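(* Let $0<p<1$, $q=1-p$, $h=-p\log p-q\log q$. Let $(X_n)$ satisfy $X_0=X_1=0$ and, for $n\ge2$, $X_n\stackrel{d}{=}X_{I'_n}+X^*_{n-I'_n}+T_n$, where $\mathbb{P}(I'_n=k)=\binom nkp^kq^{n-k}/(1-p^n-q^n)$ for $1\le k\le n-1$, $(X^*_k)$ is an independent copy of $(X_k)$, and $X,X^*,I'_n,T_n$ are independent. Let $\tilde g_1(z)=e^{-z}\sum_{n\ge2}\mathbb{E}(T_n)z^n/n!$ and $G_1(s)$ the meromorphic continuation of $\mathscr{M}[\tilde g_1(z)-e^{-qz}\tilde g_1(pz)-e^{-pz}\tilde g_1(qz);s]$. Let $0<\theta<\pi/2$, $\alpha<1$, $\beta\in\mathbb{R}$. (a) If $\tilde g_1\in\mathscr{J\!\!S}_{\alpha,\beta}$, then \[ \frac{\mathbb{E}(X_n)}{n}=\frac{G_1(-1)}{h}+\mathscr{F}[G_1](r\log_{1/p}n)+o(1). \] (b) If $\tilde g_1\in\mathscr{J\!\!S}$ and $\tilde g_1(z)=cz+O(|z|^\alpha(\log_+|z|)^\beta)$ uniformly for $|\arg z|\le\theta$, $|z|\to\infty$, then with $d=\lim_{s\to-1}(G_1(s)+c/(s+1))$, \[ \frac{\mathbb{E}(X_n)}{n}=\frac ch\log n+\frac dh+\frac{c(p\log^2p+q\log^2q)}{2h^2}+\mathscr{F}[G_1](r\log_{1/p}n)+o(1). \]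
   Context: $\log_+x=\log(1+x)$; $\mathscr{M}[\tilde g;s]=\int_0^\infty\tilde g(z)z^{s-1}dz$. An entire $\tilde f$ is in $\mathscr{J\!\!S}_{\alpha,\beta}$ if for some $0<\theta'<\pi/2$ and $|z|\ge1$: (I) $\tilde f(z)=O(|z|^\alpha(\log_+|z|)^\beta)$ uniformly for $|\arg z|\le\theta'$; (O) $e^z\tilde f(z)=O(e^{(1-\varepsilon)|z|})$ uniformly for $\theta'\le|\arg z|\le\pi$, some $\varepsilon>0$; $\mathscr{J\!\!S}=\bigcup_{\alpha,\beta}\mathscr{J\!\!S}_{\alpha,\beta}$. $\mathscr{F}[G](x)$: if $\frac{\log p}{\log q}=\frac r\ell$ with coprime positive integers $r,\ell$, $\mathscr{F}[G](x)=h^{-1}\sum_{k\ne0}G(-1+\chi_k)e^{2k\pi ix}$ with $\chi_k=\frac{2rk\pi i}{\log p}$; otherwise $\mathscr{F}[G]\equiv0$. *)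

theory Defs
  imports "HOL-Probability.Probability" "HOL-Complex_Analysis.Complex_Analysis"
begin

definition log_plus :: "real \<Rightarrow> real" where
  "log_plus x = ln (1 + x)"

definition JS :: "real \<Rightarrow> real \<Rightarrow> (complex \<Rightarrow> complex) set" where
  "JS \<alpha> \<beta> = {f. f holomorphic_on UNIV \<and>
     (\<exists>\<theta>'. 0 < \<theta>' \<and> \<theta>' < pi / 2 \<and>
       (\<exists>C. \<forall>z. 1 \<le> norm z \<and> \<bar>Arg z\<bar> \<le> \<theta>' \<longrightarrow>
          norm (f z) \<le> C * (norm z powr \<alpha> * log_plus (norm z) powr \<beta>)) \<and>
       (\<exists>\<epsilon>>0. \<exists>C. \<forall>z. 1 \<le> norm z \<and> \<theta>' \<le> \<bar>Arg z\<bar> \<and> \<bar>Arg z\<bar> \<le> pi \<longrightarrow>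
          norm (exp z * f z) \<le> C * exp ((1 - \<epsilon>) * norm z)))}"

definition JS_class :: "(complex \<Rightarrow> complex) set" where
  "JS_class = (\<Union>\<alpha> \<beta>. JS \<alpha> \<beta>)"

definition mellin_integrable :: "(complex \<Rightarrow> complex) \<Rightarrow> complex \<Rightarrow> bool" where
  "mellin_integrable f s \<longleftrightarrow>
     set_integrable lborel {0<..} (\<lambda>x::real. f (of_real x) * of_real x powr (s - 1))"

definition mellin :: "(complex \<Rightarrow> complex) \<Rightarrow> complex \<Rightarrow> complex" where
  "mellin f s = (LINT x:{0<..}|lborel. f (of_real (x::real)) * of_real x powr (s - 1))"

definition vert_strip :: "real \<Rightarrow> real \<Rightarrow> complex set" where
  "vert_strip a b = {s. a < Re s \<and> Re s < b}"

text \<open>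
  Requiring \<open>G\<close> to be \<^emph>\<open>nicely\<close> meromorphic rules out arbitrary values at removable singularities
  (at its poles \<open>G\<close> has the value 0).
\<close>

definition mellin_continuation_on ::
    "(complex \<Rightarrow> complex) \<Rightarrow> real \<Rightarrow> real \<Rightarrow> (complex \<Rightarrow> complex) \<Rightarrow> bool" where
  "mellin_continuation_on f a b G \<longleftrightarrow>
     G nicely_meromorphic_on vert_strip a b \<and>
     (\<exists>a' b'. a \<le> a' \<and> a' < b' \<and> b' \<le> b \<and>
        (\<forall>s\<in>vert_strip a' b'. mellin_integrable f s \<and> G s = mellin f s))"

text \<open>
  The value at \<open>s\<close> of the meromorphic continuation of the Mellin transform. The set where the
  Mellin integral converges absolutely is a union of vertical lines with convex set of abscissae, so
  continuations to different vertical strips containing \<open>s\<close> agree at \<open>s\<close>.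
\<close>

definition mellin_continuation :: "(complex \<Rightarrow> complex) \<Rightarrow> complex \<Rightarrow> complex" where
  "mellin_continuation f s =
     (THE w. \<exists>a b G. s \<in> vert_strip a b \<and> mellin_continuation_on f a b G \<and> G s = w)"

definition binary_entropy :: "real \<Rightarrow> real \<Rightarrow> real" where
  "binary_entropy p q = - p * ln p - q * ln q"

definition log_ratio :: "real \<Rightarrow> real \<Rightarrow> nat \<Rightarrow> nat \<Rightarrow> bool" where
  "log_ratio p q r l \<longleftrightarrow> 0 < r \<and> 0 < l \<and> coprime r l \<and> ln p / ln q = real r / real l"

text \<open>Unspecified if \<open>ln p / ln q\<close> is irrational; then \<open>fluct\<close> below vanishes identically.\<close>

definition log_ratio_num :: "real \<Rightarrow> real \<Rightarrow> nat" where
  "log_ratio_num p q = (THE r. \<exists>l. log_ratio p q r l)"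

definition chi :: "real \<Rightarrow> real \<Rightarrow> int \<Rightarrow> complex" where
  "chi p q k = 2 * of_nat (log_ratio_num p q) * of_int k * of_real pi * \<i> / of_real (ln p)"

definition fluct :: "real \<Rightarrow> real \<Rightarrow> (complex \<Rightarrow> complex) \<Rightarrow> real \<Rightarrow> complex" where
  "fluct p q G x =
     (if \<exists>r l. log_ratio p q r l
      then (\<Sum>\<^sub>\<infinity>k\<in>{k. k \<noteq> 0}. G (-1 + chi p q k) * exp (2 * of_int k * of_real pi * \<i> * of_real x))
             / of_real (binary_entropy p q)
      else 0)"

definition poisson_gf :: "(nat \<Rightarrow> real) \<Rightarrow> complex \<Rightarrow> complex" where
  "poisson_gf \<tau> z = exp (- z) * (\<Sum>n. of_real (\<tau> (n + 2)) * z ^ (n + 2) / fact (n + 2))"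

text \<open>
  The four independent objects take values in different types, so independence is stated for the
  \<open>\<sigma>\<close>-algebras they generate; \<open>X\<close> and \<open>Xs\<close> enter as whole processes.
\<close>

locale patricia_recurrence = prob_space M for M :: "'w measure" +
  fixes p q :: real
    and X Xs :: "nat \<Rightarrow> 'w \<Rightarrow> real"
    and I :: "nat \<Rightarrow> 'w \<Rightarrow> nat"
    and T :: "nat \<Rightarrow> 'w \<Rightarrow> real"
  assumes X_rv: "\<And>n. random_variable borel (X n)"
    and Xs_rv: "\<And>n. random_variable borel (Xs n)"
    and I_rv: "\<And>n. n \<ge> 2 \<Longrightarrow> random_variable (count_space UNIV) (I n)"
    and T_rv: "\<And>n. n \<ge> 2 \<Longrightarrow> random_variable borel (T n)"
    and Xs_copy: "distr M (PiM UNIV (\<lambda>_. borel)) (\<lambda>\<omega> k. Xs k \<omega>)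
                = distr M (PiM UNIV (\<lambda>_. borel)) (\<lambda>\<omega> k. X k \<omega>)"
    and indep: "\<And>n. n \<ge> 2 \<Longrightarrow> indep_sets (\<lambda>j.
          [sets (vimage_algebra (space M) (\<lambda>\<omega> k. X k \<omega>) (PiM UNIV (\<lambda>_. borel))),
           sets (vimage_algebra (space M) (\<lambda>\<omega> k. Xs k \<omega>) (PiM UNIV (\<lambda>_. borel))),
           sets (vimage_algebra (space M) (I n) (count_space UNIV)),
           sets (vimage_algebra (space M) (T n) borel)] ! j) {..<4}"
    and I_dist: "\<And>n k. n \<ge> 2 \<Longrightarrow> 1 \<le> k \<Longrightarrow> k \<le> n - 1 \<Longrightarrow>
          prob {\<omega> \<in> space M. I n \<omega> = k} = real (n choose k) * p ^ k * q ^ (n - k) / (1 - p ^ n - q ^ n)"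
    and X_init: "AE \<omega> in M. X 0 \<omega> = 0" "AE \<omega> in M. X 1 \<omega> = 0"
    and X_rec: "\<And>n. n \<ge> 2 \<Longrightarrow>
          distr M borel (X n) = distr M borel (\<lambda>\<omega>. X (I n \<omega>) \<omega> + Xs (n - I n \<omega>) \<omega> + T n \<omega>)"

end

theory Submission
  imports Defs "HOL-Real_Asymp.Real_Asymp"
begin

text \<open>
  The means satisfy a linear recurrence, which Poissonization turns into
  \<open>f z = f (p z) + f (q z) + B z\<close>, where \<open>B\<close> is the Poisson transform of
  \<open>\<tau> n (1 - p ^ n - q ^ n)\<close> and \<open>\<tau>\<close> is the mean toll. Then
  \<open>G x = f (exp x) / exp x\<close> solves a renewal equation with the two-point step distribution that
  takes the value \<open>- ln p\<close> with probability \<open>p\<close> and \<open>- ln q\<close> with probability \<open>q\<close>. A solution is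
  asymptotically invariant under both steps, so it converges if \<open>ln p / ln q\<close> is irrational;
  otherwise it approaches a periodic function, whose Fourier coefficients are values of the Mellin
  transform of \<open>B\<close> and add up to the fluctuation term. Increments of the means are small enough to
  pass back from the Poisson model to \<open>n\<close>. The growth conditions on the toll transform enter
  through Cauchy estimates for the tolls and their increments.

  A linear term \<open>c z\<close> is removed by subtracting \<open>c / h\<close> times the sequence \<open>n harm (n - 1)\<close>, which
  satisfies the same recurrence with an explicit toll; the Mellin transform of the latter is
  \<open>(1 - p powr (- s) - q powr (- s)) Gamma (s + 2) / (s + 1)\<^sup>2\<close>. It vanishes at the points of the
  Fourier series, and its expansion at \<open>- 1\<close> produces the additional constants.
\<close>

text \<open>Shifting a Mellin inversion contour across Re s = -1 would require control of the zeros
  of \<open>1 - p powr (- s) - q powr (- s)\<close>, which come arbitrarily close to that line when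
  \<open>ln p / ln q\<close> is irrational. The renewal formulation never locates these zeros: only
  an o(1) error is claimed, and for that boundedness, a Lipschitz bound and decay of the source are
  enough. The factor 1/h is the reciprocal of the mean step
  \<open>p * (- ln p) + q * (- ln q)\<close>. Three rates shape the hypotheses. The source B is
  O(x^(1-\<delta>)), so that its Mellin transform is defined on the line Re s = -1 itself. Toll
  increments are O(n^(1/2-\<delta>)), because replacing a Poisson variable by its mean n costs about
  sqrt n increments and the total must be o(n). Bounds on two derivatives of B make its Mellin
  values O(1/k^2), so that the Fourier series converges absolutely. The sequence
  \<open>n harm (n - 1)\<close> is convenient because its toll differs from h n by an exponentially
  small amount and its Poisson transform is z Ein(z), an explicit function.\<close>

section \<open>Asymptotic shift invariance of renewal solutions\<close>

text \<open>A convex combination close to an upper bound forces each of its terms close to that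
  bound. If D x >= L - C \<epsilon>, then p D(x - a) = D x - e x - q D(x - b) >= p L - (C + 2)
  \<epsilon>; division by p >= m gives the recursion for \<open>c\<close>. Iterating it over j + k
  steps transports near-maximality to lattice translates of x.\<close>

lemma renewal_deficiency:
  fixes D e :: "real \<Rightarrow> real"
  assumes pq: "0 < p" "0 < q" "p + q = 1" and ab: "0 < a" "0 < b"
    and m: "m = min p q"
    and D: "\<And>x. D x = e x + p * D (x - a) + q * D (x - b)"
    and ub: "\<And>x. x \<ge> X \<Longrightarrow> D x \<le> L + \<epsilon>" and e: "\<And>x. x \<ge> X \<Longrightarrow> e x \<le> \<epsilon>"
    and \<epsilon>: "0 < \<epsilon>"
    and c0: "c 0 = 1" and cSuc: "\<And>n. c (Suc n) = (c n + 2) / m"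
    and x: "D x \<ge> L - \<epsilon>" and xX: "x - real (j + k) * (a + b) \<ge> X"
  shows "D (x - real j * a - real k * b) \<ge> L - c (j + k) * \<epsilon>"
proof -
  have m0: "0 < m" "m \<le> p" "m \<le> q" using pq m by auto
  have cpos: "c n \<ge> 1" for n
    by (induction n) (use m0 pq in \<open>auto simp: c0 cSuc field_simps\<close>)
  have step: "D (y - a) \<ge> L - (C + 2) / m * \<epsilon> \<and> D (y - b) \<ge> L - (C + 2) / m * \<epsilon>"
    if y: "D y \<ge> L - C * \<epsilon>" "y - a \<ge> X" "y - b \<ge> X" and C: "C \<ge> 1" for y C
  proof -
    have gen: "d \<ge> L - (C + 2) / m * \<epsilon>"
      if d: "r * d \<ge> r * L - (C + 2) * \<epsilon>" and r: "m \<le> r" for d r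
    proof -
      have r0: "r > 0" using r m0 by simp
      have "d \<ge> L - (C + 2) * \<epsilon> / r" using d r0 by (simp add: field_simps)
      moreover have "(C + 2) * \<epsilon> / r \<le> (C + 2) * \<epsilon> / m"
        using r m0 C \<epsilon> by (intro divide_left_mono) auto
      ultimately show ?thesis by simp
    qed
    have yX: "y \<ge> X" using y ab by linarith
    have q1: "q * D (y - b) \<le> q * (L + \<epsilon>)" "p * D (y - a) \<le> p * (L + \<epsilon>)"
      using ub y pq by auto
    have q2: "q * \<epsilon> \<le> \<epsilon>" "p * \<epsilon> \<le> \<epsilon>" using pq \<epsilon> by auto
    have q3: "p * L + q * L = L" using pq by (metis distrib_right mult_1)
    have "p * D (y - a) \<ge> p * L - (C + 2) * \<epsilon>" "q * D (y - b) \<ge> q * L - (C + 2) * \<epsilon>"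
      using q1 q2 q3 e[OF yX] D[of y] y(1) by (auto simp: algebra_simps)
    then show ?thesis using gen m0 by blast
  qed
  define n where "n = j + k"
  have "\<forall>j k. j + k = n \<longrightarrow> x - real n * (a + b) \<ge> X \<longrightarrow>
      D (x - real j * a - real k * b) \<ge> L - c n * \<epsilon>"
  proof (induction n)
    case 0 then show ?case using x c0 by simp
  next
    case (Suc n)
    show ?case
    proof (intro allI impI)
      fix j k assume jk: "j + k = Suc n" and XX: "X \<le> x - real (Suc n) * (a + b)"
      have XX': "X \<le> x - real n * (a + b) - a - b" using XX by (simp add: algebra_simps)
      have le: "real j' * a + real k' * b \<le> real n * (a + b)" if "j' + k' = n" for j' k'
      proof -
        have "real j' * a \<le> real n * a" "real k' * b \<le> real n * b" using that ab by auto
        then show ?thesis by (simp add: algebra_simps)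
      qed
      consider j' where "j = Suc j'" | k' where "k = Suc k'" using jk
        by (metis add_eq_if old.nat.exhaust)
      then show "L - c (Suc n) * \<epsilon> \<le> D (x - real j * a - real k * b)"
      proof cases
        case 1
        have "D (x - real j' * a - real k * b) \<ge> L - c n * \<epsilon>"
          using Suc.IH XX' ab jk 1 by auto
        from step[OF this _ _ cpos] have "D (x - real j' * a - real k * b - a) \<ge> L - c (Suc n) * \<epsilon>"
          using XX' le[of j' k] 1 jk ab cSuc by auto
        then show ?thesis using 1 by (simp add: algebra_simps)
      next
        case 2
        have "D (x - real j * a - real k' * b) \<ge> L - c n * \<epsilon>"
          using Suc.IH XX' ab jk 2 by auto
        from step[OF this _ _ cpos] have "D (x - real j * a - real k' * b - b) \<ge> L - c (Suc n) * \<epsilon>"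
          using XX' le[of j k'] 2 jk ab cSuc by auto
        then show ?thesis using 2 by (simp add: algebra_simps)
      qed
    qed
  qed
  then show ?thesis using xX n_def by simp
qed

text \<open>
  If the upper limit \<open>L\<close> of the difference were positive, then by the deficiency estimate the
  difference is at least \<open>L / 2\<close> at all nearby lattice translates of a near-maximal point; summing it
  along a chain of \<open>N\<close> translates telescopes and contradicts the boundedness of \<open>Z\<close>.
\<close>

lemma renewal_shift_eventually_le:
  fixes Z \<phi> :: "real \<Rightarrow> real"
  assumes pq: "0 < p" "0 < q" "p + q = 1" and ab: "0 < a" "0 < b"
    and Z: "\<And>x. Z x = \<phi> x + p * Z (x - a) + q * Z (x - b)"
    and bdd: "\<And>x. \<bar>Z x\<bar> \<le> K" and \<phi>: "(\<phi> \<longlongrightarrow> 0) at_top"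
    and v: "v = real j1 * a + real k1 * b" and w: "w = real j2 * a + real k2 * b"
    and \<eta>: "0 < \<eta>"
  shows "eventually (\<lambda>x. Z (x - v) - Z (x - w) \<le> \<eta>) at_top"
proof (rule ccontr)
  assume neg: "\<not> ?thesis"
  define D where "D x = Z (x - v) - Z (x - w)" for x
  define e where "e x = \<phi> (x - v) - \<phi> (x - w)" for x
  define m where "m = min p q"
  define c :: "nat \<Rightarrow> real" where "c = rec_nat 1 (\<lambda>_ r. (r + 2) / m)"
  have c0: "c 0 = 1" and cSuc: "c (Suc n) = (c n + 2) / m" for n by (simp_all add: c_def)
  have m0: "0 < m" "m < 1" using pq m_def by auto
  have cpos: "c n \<ge> 1" for n
    by (induction n) (use m0 pq in \<open>auto simp: c0 cSuc field_simps\<close>)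
  have cmono: "c n \<le> c n'" if "n \<le> n'" for n n'
  proof (rule lift_Suc_mono_le[OF _ that])
    fix n have "c n * m \<le> c n * 1" using cpos[of n] m0 by (intro mult_left_mono) auto
    then show "c n \<le> c (Suc n)" using m0 by (simp add: cSuc field_simps)
  qed
  have Deq: "D x = e x + p * D (x - a) + q * D (x - b)" for x
    using Z[of "x - v"] Z[of "x - w"] unfolding D_def e_def by (simp add: algebra_simps)
  have Dbd: "D x \<le> 2 * K" "D x \<ge> - 2 * K" for x
    using bdd[of "x - v"] bdd[of "x - w"] unfolding D_def by auto
  have sh: "filterlim (\<lambda>x. x - u) at_top at_top" for u :: real
    using filterlim_tendsto_add_at_top[OF tendsto_const[of "-u"] filterlim_ident] by (simp add: add.commute)
  have elim: "(e \<longlongrightarrow> 0) at_top"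
    unfolding e_def using tendsto_diff[OF filterlim_compose[OF \<phi> sh] filterlim_compose[OF \<phi> sh]] by simp
  define s where "s X = Sup (D ` {X..})" for X :: real
  have bda: "bdd_above (D ` {X..})" for X using Dbd by (auto intro!: bdd_aboveI)
  have Ds: "D x \<le> s X" if "x \<ge> X" for x X
    unfolding s_def using that by (intro cSup_upper bda) auto
  have slow: "s X \<ge> \<eta>" for X
  proof -
    obtain x where "x \<ge> X" "D x > \<eta>"
      using neg unfolding D_def eventually_at_top_linorder by force
    then show ?thesis using Ds[of X x] by simp
  qed
  define L where "L = Inf (range s)"
  have bdb: "bdd_below (range s)" using slow by (auto intro!: bdd_belowI)
  have L0: "L \<ge> \<eta>" unfolding L_def using slow by (intro cInf_greatest) auto
  \<comment> \<open>A chain of N differences, each at least L / 2, adds up to more than 2 K, the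
    largest possible difference of two values of Z.\<close>
  obtain N :: nat where N: "real N * (L / 2) > 2 * K"
  proof -
    have "\<exists>N. 2 * K < real N * (L / 2)"
      using reals_Archimedean3[of "L/2"] L0 \<eta> by (metis half_gt_zero less_le_trans)
    then show ?thesis using that by blast
  qed
  \<comment> \<open>Each point x - i v - (N - 1 - i) w of the chain is reached from x by at most T
    steps of length a or b. The choice of \<epsilon> then keeps the accumulated deficiency at most L
    / 2, and starting beyond X + T (a + b) keeps all translates beyond X.\<close>
  define T where "T = N * (j1 + k1 + j2 + k2)"
  define \<epsilon> where "\<epsilon> = L / (2 * c T)"
  have \<epsilon>0: "\<epsilon> > 0" unfolding \<epsilon>_def using L0 \<eta> cpos[of T] by auto
  have cT: "c T * \<epsilon> = L / 2" unfolding \<epsilon>_def using cpos[of T] by simp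
  obtain X1 where "s X1 < L + \<epsilon>" using cInf_less_iff[of "range s" "L + \<epsilon>"] bdb \<epsilon>0 L_def by auto
  then have X1: "D x \<le> L + \<epsilon>" if "x \<ge> X1" for x using Ds[OF that] by linarith
  obtain X2 where X2: "\<And>x. x \<ge> X2 \<Longrightarrow> e x \<le> \<epsilon>"
    using order_tendstoD(2)[OF elim \<epsilon>0] unfolding eventually_at_top_linorder by (meson less_imp_le)
  define X where "X = max X1 X2"
  have sL: "s Y > L - \<epsilon>" for Y
    using cInf_lower[of "s Y" "range s"] bdb \<epsilon>0 L_def by auto
  obtain x where x: "x \<ge> X + real T * (a + b)" "D x > L - \<epsilon>"
    using sL[of "X + real T * (a + b)"] less_cSup_iff[OF _ bda, of "X + real T * (a + b)"] unfolding s_def by auto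
  have y: "D (x - real i * v - real (N - 1 - i) * w) \<ge> L / 2" if i: "i < N" for i
  proof -
    define j where "j = i * j1 + (N - 1 - i) * j2"
    define k where "k = i * k1 + (N - 1 - i) * k2"
    have "i * (j1 + k1) \<le> N * (j1 + k1)" "(N - 1 - i) * (j2 + k2) \<le> N * (j2 + k2)"
      using i by (auto intro!: mult_right_mono simp del: mult_le_cancel2)
    then have jk: "j + k \<le> T" unfolding j_def k_def T_def by (simp add: algebra_simps)
    then have "real (j + k) * (a + b) \<le> real T * (a + b)" using ab by (intro mult_right_mono) auto
    then have xX: "X \<le> x - real (j + k) * (a + b)" using x by linarith
    have "D (x - real j * a - real k * b) \<ge> L - c (j + k) * \<epsilon>"
      using renewal_deficiency[OF pq ab m_def Deq, where X=X and L=L and \<epsilon>=\<epsilon> and c=c and x=x and j=j and k=k]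
        X1 X2 \<epsilon>0 c0 cSuc x xX unfolding X_def by auto
    moreover have "c (j + k) * \<epsilon> \<le> c T * \<epsilon>" using cmono[OF jk] \<epsilon>0 by auto
    moreover have "x - real j * a - real k * b = x - real i * v - real (N - 1 - i) * w"
      unfolding j_def k_def v w of_nat_add of_nat_mult by algebra
    ultimately show ?thesis using cT by simp
  qed
  have "(\<Sum>i<N. D (x - real i * v - real (N - 1 - i) * w)) =
     (\<Sum>i<N. Z (x - real (Suc i) * v - real (N - Suc i) * w) - Z (x - real i * v - real (N - i) * w))"
    by (rule sum.cong) (auto simp: D_def of_nat_diff algebra_simps)
  also have "\<dots> = Z (x - real N * v) - Z (x - real N * w)"
    by (subst sum_lessThan_telescope) auto
  also have "\<dots> \<le> 2 * K" using bdd[of "x - real N * v"] bdd[of "x - real N * w"] by auto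
  finally have "(\<Sum>i<N. D (x - real i * v - real (N - 1 - i) * w)) \<le> 2 * K" .
  moreover have "(\<Sum>i<N. D (x - real i * v - real (N - 1 - i) * w)) \<ge> real N * (L / 2)"
    using sum_bounded_below[of "{..<N}" "L/2" "\<lambda>i. D (x - real i * v - real (N - 1 - i) * w)"] y by auto
  ultimately show False using N by linarith
qed

lemma renewal_shift_tendsto_real:
  fixes Z \<phi> :: "real \<Rightarrow> real"
  assumes pq: "0 < p" "0 < q" "p + q = 1" and ab: "0 < a" "0 < b"
    and Z: "\<And>x. Z x = \<phi> x + p * Z (x - a) + q * Z (x - b)"
    and bdd: "\<And>x. \<bar>Z x\<bar> \<le> K" and \<phi>: "(\<phi> \<longlongrightarrow> 0) at_top"
  shows "((\<lambda>x. Z (x - (real j1 * a + real k1 * b)) - Z (x - (real j2 * a + real k2 * b))) \<longlongrightarrow> 0) at_top"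
proof (rule tendstoI)
  fix \<eta> :: real assume "\<eta> > 0"
  then have \<eta>: "\<eta> / 2 > 0" by simp
  note * = renewal_shift_eventually_le[OF pq ab Z bdd \<phi> refl refl \<eta>]
  from *[of j1 k1 j2 k2] *[of j2 k2 j1 k1]
  show "eventually (\<lambda>x. dist (Z (x - (real j1 * a + real k1 * b)) - Z (x - (real j2 * a + real k2 * b))) 0 < \<eta>) at_top"
    by eventually_elim (use \<open>\<eta> > 0\<close> in \<open>auto simp: dist_real_def abs_if\<close>)
qed

lemma renewal_shift_tendsto:
  fixes Z \<phi> :: "real \<Rightarrow> complex"
  assumes pq: "0 < p" "0 < q" "p + q = 1" and ab: "0 < a" "0 < b"
    and Z: "\<And>x. Z x = \<phi> x + of_real p * Z (x - a) + of_real q * Z (x - b)"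
    and bdd: "\<And>x. norm (Z x) \<le> K" and \<phi>: "(\<phi> \<longlongrightarrow> 0) at_top"
  shows "((\<lambda>x. Z (x - (real j1 * a + real k1 * b)) - Z (x - (real j2 * a + real k2 * b))) \<longlongrightarrow> 0) at_top"
proof -
  have Z': "Re (Z x) = Re (\<phi> x) + p * Re (Z (x - a)) + q * Re (Z (x - b))"
     "Im (Z x) = Im (\<phi> x) + p * Im (Z (x - a)) + q * Im (Z (x - b))" for x
    using arg_cong[OF Z[of x], of Re] arg_cong[OF Z[of x], of Im] by auto
  have bdd': "\<bar>Re (Z x)\<bar> \<le> K" "\<bar>Im (Z x)\<bar> \<le> K" for x
    using bdd[of x] abs_Re_le_cmod[of "Z x"] abs_Im_le_cmod[of "Z x"] by linarith+
  have "((\<lambda>x. Re (Z (x - (real j1 * a + real k1 * b))) - Re (Z (x - (real j2 * a + real k2 * b)))) \<longlongrightarrow> 0) at_top"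
    by (rule renewal_shift_tendsto_real[OF pq ab Z'(1) bdd'(1) tendsto_Re[OF \<phi>, unfolded zero_complex.sel]])
  moreover have "((\<lambda>x. Im (Z (x - (real j1 * a + real k1 * b))) - Im (Z (x - (real j2 * a + real k2 * b)))) \<longlongrightarrow> 0) at_top"
    by (rule renewal_shift_tendsto_real[OF pq ab Z'(2) bdd'(2) tendsto_Im[OF \<phi>, unfolded zero_complex.sel]])
  ultimately show ?thesis by (subst tendsto_complex_iff) simp
qed

section \<open>Fourier inversion\<close>

lemma cesaro_mean_tendsto:
  fixes s :: "nat \<Rightarrow> complex"
  assumes "s \<longlonglongrightarrow> S"
  shows "(\<lambda>M. (\<Sum>N<M. s N) / of_nat M) \<longlonglongrightarrow> S"
proof (rule LIMSEQ_I)
  fix r :: real assume r: "r > 0"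
  obtain N0 where N0: "\<And>n. n \<ge> N0 \<Longrightarrow> norm (s n - S) < r / 2"
    using LIMSEQ_D[OF assms, of "r/2"] r by auto
  define K where "K = (\<Sum>N<N0. norm (s N - S))"
  obtain M0 :: nat where M0: "real M0 * (r / 2) > K"
    using reals_Archimedean3[of "r/2"] r by (metis half_gt_zero)
  show "\<exists>no. \<forall>n\<ge>no. norm ((\<Sum>N<n. s N) / of_nat n - S) < r"
  proof (intro exI allI impI)
    fix n assume n: "n \<ge> max (max N0 M0) 1"
    have n0: "real n > 0" using n by simp
    have "(\<Sum>N<n. s N) / of_nat n - S = (\<Sum>N<n. s N - S) / of_nat n"
      using n0 by (simp add: sum_subtractf field_simps)
    also have "norm \<dots> \<le> (\<Sum>N<n. norm (s N - S)) / real n"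
      by (simp add: norm_divide divide_right_mono norm_sum)
    also have "\<dots> < r"
    proof -
      have "{..<n} = {..<N0} \<union> {N0..<n}" using n by auto
      then have "(\<Sum>N<n. norm (s N - S)) = K + (\<Sum>N=N0..<n. norm (s N - S))"
        unfolding K_def by (simp add: sum.union_disjoint ivl_disj_int)
      moreover have "(\<Sum>N=N0..<n. norm (s N - S)) \<le> (\<Sum>N=N0..<n. r / 2)"
        using N0 by (intro sum_mono) (auto intro: less_imp_le)
      moreover have "(\<Sum>N=N0..<n. r / 2) \<le> real n * (r / 2)" using r by auto
      moreover have "real M0 * (r / 2) \<le> real n * (r / 2)"
        using n r by (intro mult_right_mono) auto
      ultimately have "(\<Sum>N<n. norm (s N - S)) < real n * r" using M0 by auto
      then show ?thesis using n0 by (simp add: field_simps)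
    qed
    finally show "norm ((\<Sum>N<n. s N) / of_nat n - S) < r" .
  qed
qed

text \<open>Chord against arc, from concavity of sine. It bounds the difference quotients in
  \<open>fourier_inversion\<close> and, squared, gives the quadratic bound for cosine that produces
  Gaussian decay on circles.\<close>

lemma norm_cis_minus_1_ge:
  assumes "\<bar>s\<bar> \<le> pi"
  shows "norm (cis s - 1) \<ge> \<bar>s\<bar> / pi"
proof -
  have "cmod (exp (\<i> * complex_of_real s) - 1) = 2 * \<bar>sin (s / 2)\<bar>"
    using dist_exp_i_1[of s] by (simp add: dist_norm)
  then have n: "norm (cis s - 1) = 2 * \<bar>sin (s / 2)\<bar>" by (simp add: cis_conv_exp)
  have *: "sin u \<ge> u / pi" if u: "0 \<le> u" "u \<le> pi / 2" for u
  proof -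
    have "concave_on {0..pi} sin"
      by (rule f''_le0_imp_concave[where f'=cos and f''="\<lambda>x. - sin x"])
        (auto intro!: derivative_eq_intros sin_ge_zero)
    then have "sin ((1 - 2 * u / pi) *\<^sub>R 0 + (2 * u / pi) *\<^sub>R (pi / 2)) \<ge> (1 - 2 * u / pi) * sin 0 + (2 * u / pi) * sin (pi / 2)"
      by (rule concave_onD) (use u pi_gt_zero in \<open>auto simp: field_simps\<close>)
    then have "sin u \<ge> 2 * u / pi" using pi_gt_zero by simp
    moreover have "2 * u / pi \<ge> u / pi" using u pi_gt_zero by (simp add: divide_right_mono)
    ultimately show ?thesis by simp
  qed
  have "\<bar>sin (s / 2)\<bar> = sin (\<bar>s\<bar> / 2)"
  proof (cases "s \<ge> 0")
    case True
    then have "sin (s / 2) \<ge> 0" using assms by (intro sin_ge_zero) auto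
    then show ?thesis using True by simp
  next
    case False
    then have "sin ((- s) / 2) \<ge> 0" using assms by (intro sin_ge_zero) auto
    then show ?thesis using False by simp
  qed
  then show ?thesis using n *[of "\<bar>s\<bar> / 2"] assms by auto
qed

lemma has_integral_cis_period:
  fixes k :: int
  shows "((\<lambda>t. cis (of_int k * (t - x))) has_integral (if k = 0 then 2 * of_real pi else 0)) {x - pi..x + pi}"
proof (cases "k = 0")
  case True
  then show ?thesis using has_integral_const_real[of "1::complex" "x - pi" "x + pi"]
    by (simp add: scaleR_conv_of_real)
next
  case False
  have "((\<lambda>t. cis (of_int k * (t - x))) has_integral
     (cis (of_int k * ((x + pi) - x)) / (\<i> * of_int k) - cis (of_int k * ((x - pi) - x)) / (\<i> * of_int k))) {x - pi..x + pi}"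
  proof (rule fundamental_theorem_of_calculus)
    fix t assume "t \<in> {x - pi..x + pi}"
    have "((\<lambda>z. exp (\<i> * of_int k * (z - of_real x)) / (\<i> * of_int k)) has_field_derivative
        exp (\<i> * of_int k * (of_real t - of_real x))) (at (of_real t))"
      using False by (auto intro!: derivative_eq_intros)
    from has_vector_derivative_real_field[OF this]
    show "((\<lambda>t. cis (of_int k * (t - x)) / (\<i> * of_int k)) has_vector_derivative cis (of_int k * (t - x)))
        (at t within {x - pi..x + pi})"
      by (simp add: cis_conv_exp mult.assoc)
  qed (use pi_gt_zero in linarith)
  moreover have "cis (of_int k * pi) = cis (- (of_int k * pi))"
  proof -
    have "sin (of_int k * pi) = 0" unfolding sin_zero_iff_int2 by blast
    then show ?thesis by (simp add: complex_eq_iff)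
  qed
  ultimately show ?thesis using False by simp
qed

text \<open>Multiplied by cis u - 1, the Dirichlet kernel collapses to two exponentials
  \<open>E N\<close>, so the error of the N-th partial sum is the integral of g times
  \<open>E N\<close>, with g bounded by the Lipschitz condition. Averaging over N makes the
  \<open>E N\<close> tend to 0 pointwise and boundedly, so dominated convergence shows Cesaro
  convergence to q x. Absolute summability gives an ordinary limit, which must agree with the Cesaro
  limit. The coefficients are assumed on every window of length 2 pi, which allows a window centred
  at x.\<close>

lemma fourier_inversion:
  fixes q :: "real \<Rightarrow> complex" and c :: "int \<Rightarrow> complex"
  assumes Lip: "\<And>x y. norm (q x - q y) \<le> L * \<bar>x - y\<bar>"
    and coef: "\<And>k y. ((\<lambda>t. q t * cis (- (of_int k * t))) has_integral 2 * of_real pi * c k) {y - pi..y + pi}"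
    and summ: "(\<lambda>k. norm (c k)) summable_on UNIV"
  shows "((\<lambda>k. c k * cis (of_int k * x)) has_sum q x) UNIV"
proof -
  let ?W = "{x - pi..x + pi}"
  define g where "g t = (if t = x then 0 else (q t - q x) / (cis (t - x) - 1))" for t
  have L0: "L \<ge> 0" using Lip[of 1 0] norm_ge_zero[of "q 1 - q 0"] by (simp del: norm_ge_zero)
  have gb: "norm (g t) \<le> L * pi" if t: "t \<in> ?W" for t
  proof (cases "t = x")
    case False
    have "norm (g t) = norm (q t - q x) / norm (cis (t - x) - 1)" using False by (simp add: g_def norm_divide)
    also have "\<dots> \<le> (L * \<bar>t - x\<bar>) / (\<bar>t - x\<bar> / pi)"
      by (rule frac_le) (use Lip L0 False norm_cis_minus_1_ge[of "t - x"] t in auto)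
    also have "\<dots> = L * pi" using False by simp
    finally show ?thesis .
  qed (use L0 in \<open>simp add: g_def\<close>)
  define E where "E N t = cis (of_nat (Suc N) * (t - x)) - cis (- (of_nat N * (t - x)))" for N :: nat and t :: real
  define s where "s N = (\<Sum>k\<in>{-int N..int N}. c k * cis (of_int k * x))" for N
  have Dk: "(\<Sum>k\<in>{-int N..int N}. cis (- (of_int k * u))) * (cis u - 1) = cis (of_nat (Suc N) * u) - cis (- (of_nat N * u))" for N u
  proof (induction N)
    case 0 show ?case by simp
  next
    case (Suc N)
    have set: "{-int (Suc N)..int (Suc N)} = insert (- int (Suc N)) (insert (int (Suc N)) {-int N..int N})" by auto
    have e1: "(\<Sum>k\<in>{-int (Suc N)..int (Suc N)}. cis (- (of_int k * u))) =
       cis (real (Suc N) * u) + (cis (- (real (Suc N) * u)) + (\<Sum>k\<in>{-int N..int N}. cis (- (of_int k * u))))"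
      unfolding set by (simp add: algebra_simps)
    have "(\<Sum>k\<in>{-int (Suc N)..int (Suc N)}. cis (- (of_int k * u))) * (cis u - 1) =
        (cis (real (Suc N) * u) * cis u - cis (real (Suc N) * u)) +
        (cis (- (real (Suc N) * u)) * cis u - cis (- (real (Suc N) * u))) +
        (cis (of_nat (Suc N) * u) - cis (- (of_nat N * u)))"
    proof -
      have "(A + (B + S)) * (z - 1) = (A * z - A) + (B * z - B) + S * (z - 1)" for A B S z :: complex
        by (simp add: algebra_simps)
      then show ?thesis using Suc.IH e1 by (simp only:)
    qed
    moreover have "real (Suc N) * u + u = real (Suc (Suc N)) * u" "- (real (Suc N) * u) + u = - (real N * u)"
      by (simp_all add: algebra_simps)
    ultimately show ?case by (simp add: cis_mult del: of_nat_Suc)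
  qed
  have sN: "((\<lambda>t. g t * E N t) has_integral 2 * of_real pi * (s N - q x)) ?W" for N
  proof -
    have "((\<lambda>t. \<Sum>k\<in>{-int N..int N}. (q t * cis (- (of_int k * t))) * cis (of_int k * x) - q x * cis (of_int (-k) * (t - x))) has_integral
       (\<Sum>k\<in>{-int N..int N}. 2 * of_real pi * c k * cis (of_int k * x) - q x * (if -k = 0 then 2 * of_real pi else 0))) ?W"
      by (intro has_integral_sum has_integral_diff has_integral_mult_left has_integral_mult_right coef has_integral_cis_period) auto
    also have "(\<Sum>k\<in>{-int N..int N}. 2 * of_real pi * c k * cis (of_int k * x) - q x * (if -k = 0 then 2 * of_real pi else 0))
       = 2 * of_real pi * (s N - q x)"
    proof -
      have "(\<Sum>k\<in>{-int N..int N}. q x * (if -k = 0 then 2 * complex_of_real pi else 0)) =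
         (\<Sum>k\<in>{-int N..int N}. if k = 0 then q x * (2 * complex_of_real pi) else 0)"
        by (rule sum.cong) auto
      also have "\<dots> = q x * (2 * of_real pi)" by (subst sum.delta) auto
      finally show ?thesis unfolding sum_subtractf s_def by (simp add: sum_distrib_left algebra_simps)
    qed
    finally show ?thesis
    proof (rule has_integral_eq[rotated])
      fix t assume t: "t \<in> ?W"
      have "(\<Sum>k\<in>{-int N..int N}. (q t * cis (- (of_int k * t))) * cis (of_int k * x) - q x * cis (of_int (-k) * (t - x)))
        = (q t - q x) * (\<Sum>k\<in>{-int N..int N}. cis (- (of_int k * (t - x))))"
        unfolding sum_distrib_left
      proof (rule sum.cong[OF refl])
        fix k :: int
        have "cis (- (of_int k * t)) * cis (of_int k * x) = cis (- (of_int k * (t - x)))"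
          "cis (of_int (-k) * (t - x)) = cis (- (of_int k * (t - x)))"
          by (simp_all add: cis_mult algebra_simps)
        then show "q t * cis (- (of_int k * t)) * cis (of_int k * x) - q x * cis (of_int (-k) * (t - x))
            = (q t - q x) * cis (- (of_int k * (t - x)))" by (simp add: mult.assoc left_diff_distrib)
      qed
      also have "\<dots> = g t * E N t"
      proof (cases "t = x")
        case False
        have "norm (cis (t - x) - 1) > 0" using norm_cis_minus_1_ge[of "t - x"] t False
          by (rule_tac less_le_trans[OF divide_pos_pos[of "\<bar>t - x\<bar>" pi]]) auto
        then have "(\<Sum>k\<in>{-int N..int N}. cis (- (of_int k * (t - x)))) = E N t / (cis (t - x) - 1)"
          using Dk[of "t - x" N] unfolding E_def by (simp add: nonzero_eq_divide_eq)
        then show ?thesis using False by (simp add: g_def)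
      qed (simp add: g_def)
      finally show "(\<Sum>k\<in>{-int N..int N}. (q t * cis (- (of_int k * t))) * cis (of_int k * x) - q x * cis (of_int (-k) * (t - x))) = g t * E N t" .
    qed
  qed
  define A where "A M t = g t * ((\<Sum>N<M. E N t) / of_nat M)" for M t
  have Aint: "((\<lambda>t. A M t) has_integral 2 * of_real pi * ((\<Sum>N<M. s N - q x) / of_nat M)) ?W" for M
  proof -
    have "((\<lambda>t. (\<Sum>N<M. g t * E N t) / of_nat M) has_integral (\<Sum>N<M. 2 * of_real pi * (s N - q x)) / of_nat M) ?W"
      by (intro has_integral_divide has_integral_sum sN) auto
    then show ?thesis unfolding A_def by (simp add: sum_distrib_left)
  qed
  have nE: "norm (E N t) \<le> 2" for N t
    unfolding E_def using norm_triangle_ineq4[of "cis (of_nat (Suc N) * (t - x))" "cis (- (of_nat N * (t - x)))"] by simp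
  \<comment> \<open>The bound is uniform in M, so the mean of the first M exponentials is O(1/M) at
    every fixed t other than x.\<close>
  have geo: "norm (\<Sum>N<M. z ^ N) \<le> 2 / norm (z - 1)" if z: "norm z = 1" "z \<noteq> 1" for z :: complex and M
  proof -
    have "(\<Sum>N<M. z ^ N) = (z ^ M - 1) / (z - 1)" using z by (simp add: geometric_sum)
    moreover have "norm (z ^ M - 1) \<le> 2" using norm_triangle_ineq4[of "z^M" 1] z by (simp add: norm_power)
    ultimately show ?thesis by (simp add: norm_divide divide_right_mono)
  qed
  have Alim: "(\<lambda>M. A M t) \<longlonglongrightarrow> 0" if t: "t \<in> ?W" for t
  proof (cases "t = x")
    case False
    let ?z = "cis (t - x)"
    have z1: "norm (?z - 1) > 0" using norm_cis_minus_1_ge[of "t - x"] t False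
      by (rule_tac less_le_trans[OF divide_pos_pos[of "\<bar>t - x\<bar>" pi]]) auto
    have z1': "norm (inverse ?z - 1) > 0" using z1 by (auto simp del: cis_inverse)
    define K where "K = 2 / norm (?z - 1) + 2 / norm (inverse ?z - 1)"
    have "norm (\<Sum>N<M. E N t) \<le> K" for M
    proof -
      have "(\<Sum>N<M. E N t) = ?z * (\<Sum>N<M. ?z ^ N) - (\<Sum>N<M. inverse ?z ^ N)"
        unfolding E_def by (simp add: sum_subtractf sum_distrib_left Complex.DeMoivre cis_mult algebra_simps del: of_nat_Suc)
           (simp add: algebra_simps)
      also have "norm \<dots> \<le> norm (?z * (\<Sum>N<M. ?z ^ N)) + norm (\<Sum>N<M. inverse ?z ^ N)" by (rule norm_triangle_ineq4)
      also have "\<dots> \<le> K" unfolding K_def norm_mult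
        using geo[of ?z M] geo[of "inverse ?z" M] z1 z1' by (intro add_mono) (auto simp del: cis_inverse simp: norm_inverse)
      finally show ?thesis .
    qed
    then have "norm (A M t) \<le> norm (g t) * K * inverse (real M)" for M
      unfolding A_def norm_mult norm_divide by (simp add: divide_inverse mult_left_mono mult_right_mono mult.assoc)
    moreover have "(\<lambda>M. norm (g t) * K * inverse (real M)) \<longlonglongrightarrow> 0"
      by real_asymp
    ultimately show ?thesis by (intro Lim_null_comparison[where f="\<lambda>M. A M t"]) auto
  qed (simp add: A_def g_def)
  have Ab: "norm (A M t) \<le> L * pi * 2" if t: "t \<in> ?W" for M t
  proof -
    have "norm (\<Sum>N<M. E N t) \<le> real M * 2" using sum_norm_bound[of "{..<M}" "\<lambda>N. E N t" 2] nE by simp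
    then have "norm ((\<Sum>N<M. E N t) / of_nat M) \<le> 2"
      by (cases "M = 0") (auto simp: norm_divide field_simps)
    then show ?thesis unfolding A_def norm_mult using gb[OF t] by (intro mult_mono) (auto simp: L0)
  qed
  have "(\<lambda>M. integral ?W (A M)) \<longlonglongrightarrow> integral ?W (\<lambda>_. 0)"
  proof (rule dominated_convergence(2)[where h="\<lambda>_. L * pi * 2"])
    show "A M integrable_on ?W" for M using Aint[of M] by (rule has_integral_integrable)
    show "(\<lambda>_. L * pi * 2) integrable_on ?W" by (rule integrable_const_ivl)
    show "norm (A M t) \<le> L * pi * 2" if "t \<in> ?W" for M t using Ab[OF that] .
    show "(\<lambda>M. A M t) \<longlonglongrightarrow> 0" if "t \<in> ?W" for t using Alim[OF that] .
  qed
  moreover have "integral ?W (A M) = 2 * of_real pi * ((\<Sum>N<M. s N - q x) / of_nat M)" for M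
    using Aint by (rule integral_unique)
  ultimately have "(\<lambda>M. 2 * of_real pi * ((\<Sum>N<M. s N - q x) / of_nat M)) \<longlonglongrightarrow> 0" by simp
  then have lim0: "(\<lambda>M. (\<Sum>N<M. s N - q x) / of_nat M) \<longlonglongrightarrow> 0"
    by (drule_tac tendsto_mult_left[where c="1 / (2 * complex_of_real pi)"]) simp
  obtain S where S: "((\<lambda>k. c k * cis (of_int k * x)) has_sum S) UNIV"
  proof -
    have "(\<lambda>k. norm (c k * cis (of_int k * x))) summable_on UNIV" using summ by (simp add: norm_mult)
    from has_sum_infsum[OF abs_summable_summable[OF this]] show ?thesis by (rule that)
  qed
  have "s \<longlonglongrightarrow> S"
  proof -
    have "filterlim (\<lambda>N. {-int N..int N}) (finite_subsets_at_top UNIV) sequentially"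
      unfolding filterlim_finite_subsets_at_top
    proof safe
      fix X :: "int set" assume X: "finite X"
      define b where "b = Max (insert 0 (abs ` X))"
      have b: "\<bar>k\<bar> \<le> b" if "k \<in> X" for k unfolding b_def using X that by (intro Max_ge) auto
      show "\<forall>\<^sub>F N in sequentially. finite {-int N..int N} \<and> X \<subseteq> {-int N..int N} \<and> {-int N..int N} \<subseteq> UNIV"
        using eventually_ge_at_top[of "nat b"] by eventually_elim (use b in force)
    qed
    then show ?thesis using S unfolding has_sum_def s_def by (rule filterlim_compose[rotated])
  qed
  then have "(\<lambda>N. s N - q x) \<longlonglongrightarrow> S - q x" by (intro tendsto_intros)
  from cesaro_mean_tendsto[OF this] lim0 have "S - q x = 0" by (rule LIMSEQ_unique)
  with S show ?thesis by simp
qed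

section \<open>Mellin transforms\<close>

lemma of_real_powr_exp: "x > 0 \<Longrightarrow> complex_of_real x powr z = exp (z * of_real (ln x))"
  by (simp add: powr_def Ln_of_real)

text \<open>An intermediate power of x is at most the sum of the two outer powers: the larger
  exponent dominates for x >= 1, the smaller one for x < 1.\<close>

lemma mellin_integrable_between:
  assumes 1: "mellin_integrable f s1" and 2: "mellin_integrable f s2"
    and re: "Re s1 \<le> Re s" "Re s \<le> Re s2"
  shows "mellin_integrable f s"
proof -
  let ?g = "\<lambda>s x. indicator {0<..} x *\<^sub>R (f (of_real x) * of_real x powr (s - 1)) :: complex"
  have i: "integrable lborel (?g s1)" "integrable lborel (?g s2)"
    using 1 2 unfolding mellin_integrable_def set_integrable_def by auto
  \<comment> \<open>Measurability of f is not among the hypotheses. The integrand at s inherits it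
    from the integrable integrand at \<open>s1\<close> through this factorization.\<close>
  have eq: "?g s = (\<lambda>x. ?g s1 x * (indicator {0<..} x *\<^sub>R exp ((s - s1) * of_real (ln x))))"
    by (auto simp: fun_eq_iff indicator_def of_real_powr_exp simp flip: exp_add)
       (simp add: algebra_simps)
  have "(\<lambda>x::real. exp ((s - s1) * complex_of_real (ln x))) \<in> borel_measurable borel" by measurable
  then have meas: "?g s \<in> borel_measurable lborel"
    unfolding eq by (intro borel_measurable_times borel_measurable_integrable[OF i(1)]) auto
  have "integrable lborel (\<lambda>x. norm (?g s1 x) + norm (?g s2 x))"
    by (intro Bochner_Integration.integrable_add integrable_norm i)
  then have "integrable lborel (?g s)"
  proof (rule Bochner_Integration.integrable_bound[OF _ meas], intro AE_I2)
    fix x :: real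
    show "norm (?g s x) \<le> norm (norm (?g s1 x) + norm (?g s2 x))"
    proof (cases "x > 0")
      case True
      have "x powr (Re s - 1) \<le> x powr (Re s1 - 1) + x powr (Re s2 - 1)"
      proof (cases "x \<ge> 1")
        case True
        then have "x powr (Re s - 1) \<le> x powr (Re s2 - 1)" using re by (intro powr_mono) auto
        then show ?thesis by (smt (verit) powr_ge_zero)
      next
        case False
        then have "x powr (Re s - 1) \<le> x powr (Re s1 - 1)" using re \<open>x > 0\<close> by (intro powr_mono') auto
        then show ?thesis by (smt (verit) powr_ge_zero)
      qed
      then have "norm (f x) * x powr (Re s - 1) \<le> norm (f x) * (x powr (Re s1 - 1) + x powr (Re s2 - 1))"
        by (intro mult_left_mono) auto
      then show ?thesis using True by (simp add: norm_mult norm_powr_real_powr distrib_left)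
    qed auto
  qed
  then show ?thesis unfolding mellin_integrable_def set_integrable_def .
qed

lemma norm_exp_minus_1_le: "norm (exp z - 1) \<le> norm z * exp (norm z)" for z :: complex
proof -
  have "norm (exp z - exp 0) \<le> exp (norm z) * norm (z - 0)"
  proof (rule field_differentiable_bound[of "closed_segment 0 z"])
    fix w assume w: "w \<in> closed_segment 0 z"
    show "(exp has_field_derivative exp w) (at w within closed_segment 0 z)" by (rule DERIV_subset[OF DERIV_exp]) auto
    have "norm w \<le> norm z" using segment_bound(1)[OF w] by simp
    then show "norm (exp w) \<le> exp (norm z)" using norm_exp[of w] by (meson exp_le_cancel_iff order_trans)
  qed auto
  then show ?thesis by (simp add: mult.commute)
qed

text \<open>Differentiation under the integral by dominated convergence; the derivative is the
  integral with an additional factor ln x.\<close>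

lemma mellin_has_field_derivative:
  assumes int: "\<And>s. s \<in> vert_strip a b \<Longrightarrow> mellin_integrable f s" and s: "s \<in> vert_strip a b"
  shows "\<exists>D. (mellin f has_field_derivative D) (at s)"
proof -
  obtain \<eta> where \<eta>: "\<eta> > 0" "a < Re s - \<eta>" "Re s + \<eta> < b"
  proof -
    have "a < Re s" "Re s < b" using s by (auto simp: vert_strip_def)
    then have "min (Re s - a) (b - Re s) / 2 > 0" "a < Re s - min (Re s - a) (b - Re s) / 2" "Re s + min (Re s - a) (b - Re s) / 2 < b"
      by (auto simp: min_def field_simps)
    then show ?thesis using that by blast
  qed
  define g where "g z x = (indicator {0<..} x *\<^sub>R (f (of_real x) * of_real x powr (z - 1)) :: complex)" for z and x :: real
  have gi: "integrable lborel (g z)" if "z \<in> vert_strip a b" for z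
    using int[OF that] unfolding mellin_integrable_def set_integrable_def g_def .
  have mg: "mellin f z = integral\<^sup>L lborel (g z)" for z
    unfolding mellin_def set_lebesgue_integral_def g_def ..
  have [measurable]: "g s \<in> borel_measurable lborel" using gi[OF s] by (rule borel_measurable_integrable)
  have gw: "g (s + w) x = g s x * exp (w * of_real (ln x))" for w x
    by (auto simp: g_def indicator_def of_real_powr_exp simp flip: exp_add) (simp add: algebra_simps)
  \<comment> \<open>With l = ln x and increments of norm at most \<eta>/2, the difference quotient
    of the power is at most |l| exp(\<eta> |l| / 2) <= (2/\<eta>) exp(\<eta> |l|) <= (2/\<eta>)
    (exp(\<eta> l) + exp(-\<eta> l)). The last two terms shift s to s + \<eta> and s - \<eta>, where
    the integral still converges.\<close>
  define W where "W x = (2 / \<eta>) * (norm (g (s + of_real \<eta>) x) + norm (g (s - of_real \<eta>) x))" for x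
  have Wi: "integrable lborel W" unfolding W_def
    using \<eta> by (intro integrable_mult_right Bochner_Integration.integrable_add integrable_norm gi)
      (auto simp: vert_strip_def)
  have "((\<lambda>w. (mellin f (s + w) - mellin f s) / w) \<longlongrightarrow> integral\<^sup>L lborel (\<lambda>x. g s x * of_real (ln x))) (at 0)"
    unfolding tendsto_at_iff_sequentially comp_def
  proof (intro allI impI)
    fix X :: "nat \<Rightarrow> complex" assume X: "\<forall>i. X i \<in> UNIV - {0}" and X0: "X \<longlonglongrightarrow> 0"
    obtain N where N: "\<And>n. n \<ge> N \<Longrightarrow> norm (X n) \<le> \<eta> / 2"
      using LIMSEQ_D[OF X0, of "\<eta>/2"] \<eta> by (auto intro: less_imp_le)
    define Y where "Y n = X (n + N)" for n
    have Y: "Y n \<noteq> 0" "norm (Y n) \<le> \<eta> / 2" for n using X N unfolding Y_def by auto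
    have Y0: "Y \<longlonglongrightarrow> 0" unfolding Y_def using X0 by (rule LIMSEQ_ignore_initial_segment)
    define q where "q n x = g s x * ((exp (Y n * of_real (ln x)) - 1) / Y n)" for n x
    have strip: "s + Y n \<in> vert_strip a b" for n
    proof -
      have "\<bar>Re (Y n)\<bar> \<le> \<eta> / 2" using Y(2)[of n] abs_Re_le_cmod order_trans by blast
      then show ?thesis using \<eta> by (auto simp: vert_strip_def abs_le_iff)
    qed
    have qeq: "(mellin f (s + Y n) - mellin f s) / Y n = integral\<^sup>L lborel (q n)" for n
    proof -
      have "mellin f (s + Y n) - mellin f s = integral\<^sup>L lborel (\<lambda>x. g (s + Y n) x - g s x)"
        unfolding mg using gi[OF strip] gi[OF s] by (simp add: Bochner_Integration.integral_diff)
      also have "\<dots> / Y n = integral\<^sup>L lborel (\<lambda>x. (g (s + Y n) x - g s x) / Y n)" by simp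
      also have "(\<lambda>x. (g (s + Y n) x - g s x) / Y n) = q n"
        unfolding q_def gw by (auto simp: fun_eq_iff algebra_simps diff_divide_distrib)
      finally show ?thesis .
    qed
    have "(\<lambda>n. integral\<^sup>L lborel (q n)) \<longlonglongrightarrow> integral\<^sup>L lborel (\<lambda>x. g s x * of_real (ln x))"
    proof (rule integral_dominated_convergence[where w=W])
      show "(\<lambda>x. g s x * of_real (ln x)) \<in> borel_measurable lborel" by measurable
      show "q n \<in> borel_measurable lborel" for n unfolding q_def by measurable
      show "integrable lborel W" by (rule Wi)
      show "AE x in lborel. (\<lambda>n. q n x) \<longlonglongrightarrow> g s x * of_real (ln x)"
      proof (intro AE_I2)
        fix x :: real
        have "((\<lambda>z. (exp (z * of_real (ln x)) - 1) / z) \<longlongrightarrow> of_real (ln x)) (at (0::complex))"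
        proof -
          have "((\<lambda>z. exp (z * of_real (ln x))) has_field_derivative of_real (ln x)) (at (0::complex))"
            by (auto intro!: derivative_eq_intros)
          then show ?thesis by (simp add: DERIV_def)
        qed
        moreover have "filterlim Y (at 0) sequentially" using Y Y0 by (simp add: filterlim_at)
        ultimately have "(\<lambda>n. (exp (Y n * of_real (ln x)) - 1) / Y n) \<longlonglongrightarrow> of_real (ln x)"
          by (rule filterlim_compose)
        then show "(\<lambda>n. q n x) \<longlonglongrightarrow> g s x * of_real (ln x)" unfolding q_def by (intro tendsto_intros)
      qed
      show "AE x in lborel. norm (q n x) \<le> W x" for n
      proof (intro AE_I2)
        fix x :: real
        define l where "l = ln x"
        have "norm ((exp (Y n * of_real l) - 1) / Y n) \<le> \<bar>l\<bar> * exp (norm (Y n) * \<bar>l\<bar>)"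
          using norm_exp_minus_1_le[of "Y n * of_real l"] Y(1)[of n]
          by (simp add: norm_divide norm_mult field_simps)
        also have "\<dots> \<le> \<bar>l\<bar> * exp (\<eta> / 2 * \<bar>l\<bar>)"
          using Y(2)[of n] by (intro mult_left_mono) (auto simp del: times_divide_eq_left intro!: mult_right_mono)
        also have "\<dots> \<le> (2 / \<eta> * exp (\<eta> / 2 * \<bar>l\<bar>)) * exp (\<eta> / 2 * \<bar>l\<bar>)"
        proof (rule mult_right_mono)
          have "\<eta> / 2 * \<bar>l\<bar> \<le> exp (\<eta> / 2 * \<bar>l\<bar>)" using exp_ge_add_one_self[of "\<eta> / 2 * \<bar>l\<bar>"] by linarith
          then show "\<bar>l\<bar> \<le> 2 / \<eta> * exp (\<eta> / 2 * \<bar>l\<bar>)" using \<eta> by (simp add: field_simps)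
        qed auto
        also have "\<dots> = 2 / \<eta> * exp (\<eta> * \<bar>l\<bar>)" by (simp flip: exp_add)
        also have "exp (\<eta> * \<bar>l\<bar>) \<le> exp (\<eta> * l) + exp (- (\<eta> * l))" by (cases "l \<ge> 0") auto
        finally have b: "norm ((exp (Y n * of_real l) - 1) / Y n) \<le> 2 / \<eta> * (exp (\<eta> * l) + exp (- (\<eta> * l)))"
          using \<eta> by (simp add: divide_right_mono)
        have "norm (q n x) \<le> norm (g s x) * (2 / \<eta> * (exp (\<eta> * l) + exp (- (\<eta> * l))))"
          unfolding q_def norm_mult l_def[symmetric] using b by (intro mult_left_mono) auto
        also have "\<dots> = W x"
          using gw[of "of_real \<eta>" x] gw[of "- of_real \<eta>" x]
          by (simp add: W_def norm_mult l_def[symmetric] algebra_simps)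
        finally show "norm (q n x) \<le> W x" .
      qed
    qed
    then have "(\<lambda>n. (mellin f (s + X (n + N)) - mellin f s) / X (n + N)) \<longlonglongrightarrow> integral\<^sup>L lborel (\<lambda>x. g s x * of_real (ln x))"
      unfolding qeq[symmetric] unfolding Y_def .
    then show "(\<lambda>n. (mellin f (s + X n) - mellin f s) / X n) \<longlonglongrightarrow> integral\<^sup>L lborel (\<lambda>x. g s x * of_real (ln x))"
      by (rule LIMSEQ_offset)
  qed
  then show ?thesis unfolding DERIV_def by blast
qed

section \<open>Uniqueness of the meromorphic continuation\<close>

lemma open_vert_strip: "open (vert_strip a b)"
proof -
  have "vert_strip a b = {s. a < Re s} \<inter> {s. Re s < b}" by (auto simp: vert_strip_def)
  then show ?thesis by (simp add: open_halfspace_Re_gt open_halfspace_Re_lt open_Int)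
qed

lemma vert_strip_Int: "vert_strip a b \<inter> vert_strip c d = vert_strip (max a c) (min b d)"
  by (auto simp: vert_strip_def)

lemma connected_vert_strip: "connected (vert_strip a b)"
proof -
  have "vert_strip a b = {s. a < Re s} \<inter> {s. Re s < b}" by (auto simp: vert_strip_def)
  then show ?thesis
    by (simp add: convex_connected convex_Int convex_halfspace_Re_gt convex_halfspace_Re_lt)
qed

lemma vert_strip_nonempty: "a < b \<Longrightarrow> vert_strip a b \<noteq> {}"
proof -
  assume "a < b"
  then have "of_real ((a + b) / 2) \<in> vert_strip a b" by (simp add: vert_strip_def field_simps)
  then show ?thesis by blast
qed

lemma mellin_holomorphic:
  assumes "\<And>s. s \<in> vert_strip a b \<Longrightarrow> mellin_integrable f s"
  shows "mellin f holomorphic_on vert_strip a b"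
  using mellin_has_field_derivative[OF assms] open_vert_strip
  by (auto simp: holomorphic_on_open)

text \<open>The identity theorem gives equality off a sparse set, hence near every point of A except
  perhaps at that point. Nice meromorphy settles the point itself: both functions have a pole there
  and the value 0, or both are analytic there and the values are the common limit.\<close>

lemma nicely_meromorphic_identity:
  assumes f: "f nicely_meromorphic_on A" and g: "g nicely_meromorphic_on A"
    and A: "open A" "connected A" and U: "open U" "U \<subseteq> A" "U \<noteq> {}"
    and eq: "\<And>z. z \<in> U \<Longrightarrow> f z = g z" and z: "z \<in> A"
  shows "f z = g z"
proof -
  have m: "(\<lambda>z. f z - g z) meromorphic_on A"
    using f g by (auto simp: nicely_meromorphic_on_def intro!: meromorphic_intros)
  have "eventually (\<lambda>z. f z - g z = 0) (cosparse A)"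
  proof (rule ccontr)
    assume "\<not> ?thesis"
    then have ne: "eventually (\<lambda>z. f z - g z \<noteq> 0) (cosparse A)"
      using meromorphic_imp_constant_or_avoid[OF m A, of 0] by auto
    obtain u where u: "u \<in> U" using U by auto
    have "eventually (\<lambda>z. f z - g z \<noteq> 0) (at u)"
      using ne u U A by (auto simp: eventually_cosparse_open_eq)
    moreover have "eventually (\<lambda>z. z \<in> U) (at u)" using U u by (intro eventually_at_in_open') auto
    ultimately have "eventually (\<lambda>z::complex. False) (at u)"
      by eventually_elim (use eq in auto)
    then show False by simp
  qed
  then have ev: "eventually (\<lambda>w. f w = g w) (at z)"
    using A z by (auto simp: eventually_cosparse_open_eq)
  then have pole: "is_pole f z \<longleftrightarrow> is_pole g z" by (intro is_pole_cong) auto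
  show ?thesis
  proof (cases "is_pole f z")
    case True
    then show ?thesis using pole f g z
      unfolding nicely_meromorphic_on_def by (metis is_pole_def not_tendsto_and_filterlim_at_infinity trivial_limit_at)
  next
    case False
    then have "f analytic_on {z}" "g analytic_on {z}"
      using pole nicely_meromorphic_on_imp_analytic_at f g z by blast+
    then have "f \<midarrow>z\<rightarrow> f z" "g \<midarrow>z\<rightarrow> g z" by (auto intro!: isContD analytic_at_imp_isCont)
    then show ?thesis using tendsto_cong[OF ev, of "f z"] LIM_unique by blast
  qed
qed

text \<open>The strips in which the two continuations equal the Mellin integral may be disjoint. By
  \<open>mellin_integrable_between\<close> the integral converges on their hull (c, d), and the
  holomorphic function it defines there links the two continuations.\<close>

lemma mellin_continuation_on_unique:
  assumes 1: "mellin_continuation_on f a1 b1 G1" and 2: "mellin_continuation_on f a2 b2 G2"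
    and s: "s \<in> vert_strip a1 b1" "s \<in> vert_strip a2 b2"
  shows "G1 s = G2 s"
proof -
  obtain c1 d1 where cd1: "a1 \<le> c1" "c1 < d1" "d1 \<le> b1"
    "\<And>s. s \<in> vert_strip c1 d1 \<Longrightarrow> mellin_integrable f s \<and> G1 s = mellin f s"
    using 1 unfolding mellin_continuation_on_def by blast
  obtain c2 d2 where cd2: "a2 \<le> c2" "c2 < d2" "d2 \<le> b2"
    "\<And>s. s \<in> vert_strip c2 d2 \<Longrightarrow> mellin_integrable f s \<and> G2 s = mellin f s"
    using 2 unfolding mellin_continuation_on_def by blast
  have G: "G1 nicely_meromorphic_on vert_strip a1 b1" "G2 nicely_meromorphic_on vert_strip a2 b2"
    using 1 2 unfolding mellin_continuation_on_def by auto
  define c d where "c = min c1 c2" and "d = max d1 d2"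
  have int: "mellin_integrable f s" if s: "s \<in> vert_strip c d" for s
  proof -
    obtain u where u: "mellin_integrable f u" "Re u \<le> Re s"
    proof (cases "c1 \<le> c2")
      case True
      define r where "r = (c1 + min (Re s) d1) / 2"
      have "c1 < min (Re s) d1" using s True cd1 by (auto simp: vert_strip_def c_def)
      then have "c1 < r" "r < min (Re s) d1" by (auto simp: r_def)
      then show ?thesis using cd1(4)[of "of_real r"] that[of "of_real r"] by (auto simp: vert_strip_def)
    next
      case False
      define r where "r = (c2 + min (Re s) d2) / 2"
      have "c2 < min (Re s) d2" using s False cd2 by (auto simp: vert_strip_def c_def)
      then have "c2 < r" "r < min (Re s) d2" by (auto simp: r_def)
      then show ?thesis using cd2(4)[of "of_real r"] that[of "of_real r"] by (auto simp: vert_strip_def)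
    qed
    obtain v where v: "mellin_integrable f v" "Re s \<le> Re v"
    proof (cases "d1 \<ge> d2")
      case True
      define r where "r = (d1 + max (Re s) c1) / 2"
      have "max (Re s) c1 < d1" using s True cd1 by (auto simp: vert_strip_def d_def)
      then have "r < d1" "r > max (Re s) c1" by (auto simp: r_def)
      then show ?thesis using cd1(4)[of "of_real r"] that[of "of_real r"] by (auto simp: vert_strip_def)
    next
      case False
      define r where "r = (d2 + max (Re s) c2) / 2"
      have "max (Re s) c2 < d2" using s False cd2 by (auto simp: vert_strip_def d_def)
      then have "r < d2" "r > max (Re s) c2" by (auto simp: r_def)
      then show ?thesis using cd2(4)[of "of_real r"] that[of "of_real r"] by (auto simp: vert_strip_def)
    qed
    show ?thesis by (rule mellin_integrable_between[OF u(1) v(1) u(2) v(2)])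
  qed
  have H: "mellin f nicely_meromorphic_on vert_strip c d"
    by (intro analytic_on_imp_nicely_meromorphic_on)
      (use mellin_holomorphic[OF int] open_vert_strip in \<open>simp add: analytic_on_open\<close>)
  have ext: "G z = mellin f z" if G: "G nicely_meromorphic_on vert_strip a b" and le: "a \<le> c'" "c' < d'" "d' \<le> b" "c \<le> c'" "d' \<le> d"
    and eq: "\<And>s. s \<in> vert_strip c' d' \<Longrightarrow> G s = mellin f s" and z: "z \<in> vert_strip a b" "z \<in> vert_strip c d" for G a b c' d' z
  proof (rule nicely_meromorphic_identity[where f=G and g="mellin f" and A="vert_strip a b \<inter> vert_strip c d" and U="vert_strip c' d'"])
    show "G nicely_meromorphic_on vert_strip a b \<inter> vert_strip c d" "mellin f nicely_meromorphic_on vert_strip a b \<inter> vert_strip c d"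
      using G H by (auto elim!: nicely_meromorphic_on_subset)
    show "open (vert_strip a b \<inter> vert_strip c d)" "connected (vert_strip a b \<inter> vert_strip c d)"
      unfolding vert_strip_Int by (rule open_vert_strip connected_vert_strip)+
  qed (use le eq z vert_strip_nonempty open_vert_strip in \<open>auto simp: vert_strip_def\<close>)
  define A where "A = vert_strip a1 b1 \<inter> vert_strip a2 b2"
  have AI: "A = vert_strip (max a1 a2) (min b1 b2)" unfolding A_def vert_strip_Int ..
  have ss: "max a1 a2 < Re s" "Re s < min b1 b2" using s by (auto simp: vert_strip_def)
  \<comment> \<open>The strip A common to both continuations need not meet either of the two given
    convergence strips, but it always meets their hull.\<close>
  define U where "U = vert_strip (max (max a1 a2) c) (min (min b1 b2) d)"
  show ?thesis
  proof (rule nicely_meromorphic_identity[where f=G1 and g=G2 and A=A and U=U])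
    show "G1 nicely_meromorphic_on A" "G2 nicely_meromorphic_on A"
      using G by (auto simp: A_def elim!: nicely_meromorphic_on_subset)
    show "open A" "connected A" "open U" unfolding AI U_def by (rule open_vert_strip connected_vert_strip)+
    show "U \<subseteq> A" unfolding U_def AI by (auto simp: vert_strip_def)
    show "U \<noteq> {}" unfolding U_def using cd1 cd2 ss by (intro vert_strip_nonempty) (auto simp: c_def d_def)
    show "s \<in> A" using s by (simp add: A_def)
    fix z assume z: "z \<in> U"
    have "G1 z = mellin f z"
      by (rule ext[OF G(1) cd1(1-3)]) (use z cd1(4) in \<open>auto simp: c_def d_def U_def vert_strip_def\<close>)
    moreover have "G2 z = mellin f z"
      by (rule ext[OF G(2) cd2(1-3)]) (use z cd2(4) in \<open>auto simp: c_def d_def U_def vert_strip_def\<close>)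
    ultimately show "G1 z = G2 z" by simp
  qed
qed

lemma mellin_continuation_eqI:
  assumes "mellin_continuation_on f a b G" "s \<in> vert_strip a b"
  shows "mellin_continuation f s = G s"
  unfolding mellin_continuation_def
  using assms mellin_continuation_on_unique by (intro the_equality) blast+

section \<open>Convergence criteria and calculus of Mellin integrals\<close>

lemma continuous_on_compose_of_real:
  fixes g :: "complex \<Rightarrow> complex"
  assumes "continuous_on UNIV g" shows "continuous_on S (\<lambda>x::real. g (of_real x))"
  by (rule continuous_on_compose2[OF assms]) (auto intro: continuous_on_of_real continuous_on_id)

lemma set_integrable_powr_0_1:
  assumes "e > (-1::real)" shows "set_integrable lborel {0<..<1} (\<lambda>x. x powr e)"
proof -
  have "set_integrable lborel (einterval 0 1) (\<lambda>x. x powr e)"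
  proof (rule interval_integral_FTC_nonneg(1)[where F="\<lambda>x. x powr (e + 1) / (e + 1)" and A=0 and B="1 / (e + 1)"])
    show "DERIV (\<lambda>x. x powr (e + 1) / (e + 1)) x :> x powr e" if "0 < ereal x" for x
      using that assms by (auto intro!: derivative_eq_intros)
    show "isCont (\<lambda>x. x powr e) x" if "0 < ereal x" for x
      using that by (auto intro!: continuous_intros)
    have "((\<lambda>x. x powr (e + 1) / (e + 1)) \<longlongrightarrow> 0) (at_right 0)" using assms by real_asymp
    then show "(((\<lambda>x. x powr (e + 1) / (e + 1)) \<circ> real_of_ereal) \<longlongrightarrow> 0) (at_right 0)"
      by (simp only: ereal_tendsto_simps1 zero_ereal_def)
    have "((\<lambda>x. x powr (e + 1) / (e + 1)) \<longlongrightarrow> 1 powr (e + 1) / (e + 1)) (at_left 1)"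
      by (intro tendsto_intros) (use assms in auto)
    then show "(((\<lambda>x. x powr (e + 1) / (e + 1)) \<circ> real_of_ereal) \<longlongrightarrow> 1 / (e + 1)) (at_left 1)"
      by (simp only: ereal_tendsto_simps1 one_ereal_def powr_one_eq_one)
  qed auto
  moreover have "einterval 0 1 = {0<..<1}" by (auto simp: einterval_iff)
  ultimately show ?thesis by simp
qed

lemma set_integrable_powr_1_inf:
  assumes "e < (-1::real)" shows "set_integrable lborel {1<..} (\<lambda>x. x powr e)"
proof -
  have "set_integrable lborel (einterval 1 \<infinity>) (\<lambda>x. x powr e)"
  proof (rule interval_integral_FTC_nonneg(1)[where F="\<lambda>x. x powr (e + 1) / (e + 1)" and A="1 / (e + 1)" and B=0])
    show "DERIV (\<lambda>x. x powr (e + 1) / (e + 1)) x :> x powr e" if "1 < ereal x" for x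
      using that assms by (auto intro!: derivative_eq_intros)
    show "isCont (\<lambda>x. x powr e) x" if "1 < ereal x" for x
      using that by (auto intro!: continuous_intros)
    have "((\<lambda>x. x powr (e + 1) / (e + 1)) \<longlongrightarrow> 0) at_top" using assms by real_asymp
    then show "(((\<lambda>x. x powr (e + 1) / (e + 1)) \<circ> real_of_ereal) \<longlongrightarrow> 0) (at_left \<infinity>)"
      by (simp only: ereal_tendsto_simps1)
    have "((\<lambda>x. x powr (e + 1) / (e + 1)) \<longlongrightarrow> 1 powr (e + 1) / (e + 1)) (at_right 1)"
      by (intro tendsto_intros) (use assms in auto)
    then show "(((\<lambda>x. x powr (e + 1) / (e + 1)) \<circ> real_of_ereal) \<longlongrightarrow> 1 / (e + 1)) (at_right 1)"
      by (simp only: ereal_tendsto_simps1 one_ereal_def powr_one_eq_one)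
  qed auto
  moreover have "einterval 1 \<infinity> = {1<..}" by (auto simp: einterval_iff)
  ultimately show ?thesis by simp
qed

lemma mellin_integrable_bound:
  fixes f :: "complex \<Rightarrow> complex"
  assumes cont: "continuous_on {0<..} (\<lambda>x::real. f (of_real x))"
    and b0: "\<And>x. 0 < x \<Longrightarrow> x \<le> 1 \<Longrightarrow> norm (f (of_real x)) \<le> C * x powr u"
    and b1: "\<And>x. x \<ge> 1 \<Longrightarrow> norm (f (of_real x)) \<le> C * x powr v"
    and s: "- u < Re s" "Re s < - v"
  shows "mellin_integrable f s"
proof -
  let ?h = "\<lambda>x. indicator {0<..<1} x *\<^sub>R (x powr (u + Re s - 1)) + indicator {1<..} x *\<^sub>R (x powr (v + Re s - 1))
       :: real"
  let ?g = "\<lambda>x. indicator {0<..} x *\<^sub>R (f (of_real x) * of_real x powr (s - 1))"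
  have h: "integrable lborel (\<lambda>x. C * ?h x)"
    using set_integrable_powr_0_1[of "u + Re s - 1"] set_integrable_powr_1_inf[of "v + Re s - 1"] s
    unfolding set_integrable_def by (intro integrable_mult_right Bochner_Integration.integrable_add) auto
  have "continuous_on {0<..} (\<lambda>x::real. f (of_real x) * of_real x powr (s - 1))"
    by (intro continuous_intros cont) (auto simp: complex_nonpos_Reals_iff)
  then have m: "?g \<in> borel_measurable borel"
    by (intro borel_measurable_continuous_on_indicator) auto
  have "integrable lborel ?g"
  proof (rule Bochner_Integration.integrable_bound[OF h])
    show "?g \<in> borel_measurable lborel" using m by simp
    show "AE x in lborel. norm (?g x) \<le> norm (C * ?h x)"
    \<comment> \<open>The point 1 lies in neither interval of the majorant and is discarded as a
      null set.\<close>
    proof (rule AE_mp[OF AE_lborel_singleton[of 1]], intro AE_I2 impI)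
      fix x :: real assume x1: "x \<noteq> 1"
      show "norm (?g x) \<le> norm (C * ?h x)"
      proof (cases "x > 0")
        case True
        have "norm (f x) * x powr (Re s - 1) \<le> C * ?h x"
        proof (cases "x < 1")
          case lt: True
          have "norm (f x) * x powr (Re s - 1) \<le> (C * x powr u) * x powr (Re s - 1)"
            using b0[of x] True lt by (intro mult_right_mono) auto
          also have "\<dots> = C * ?h x" using True lt by (simp add: powr_add[symmetric] algebra_simps)
          finally show ?thesis .
        next
          case gt: False
          have "norm (f x) * x powr (Re s - 1) \<le> (C * x powr v) * x powr (Re s - 1)"
            using b1[of x] True gt by (intro mult_right_mono) auto
          also have "\<dots> = C * ?h x" using True gt x1 by (simp add: powr_add[symmetric] algebra_simps)
          finally show ?thesis .
        qed
        then show ?thesis using True by (simp add: norm_mult norm_powr_real_powr)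
      qed auto
    qed
  qed
  then show ?thesis unfolding mellin_integrable_def set_integrable_def .
qed

text \<open>This evaluates a Mellin integral as the limit of an antiderivative. It serves
  integration by parts in \<open>mellin_deriv\<close>, and in \<open>mellin_limit\<close> it
  identifies limits of renewal quantities.\<close>

lemma mellin_FTC:
  fixes f :: "complex \<Rightarrow> complex" and A :: "real \<Rightarrow> complex"
  assumes int: "mellin_integrable f s"
    and A: "\<And>y. y > 0 \<Longrightarrow> (A has_vector_derivative f (of_real y) * of_real y powr (s - 1)) (at y)"
    and cont: "continuous_on {0<..} (\<lambda>x::real. f (of_real x))"
    and A0: "(A \<longlongrightarrow> 0) (at_right 0)"
  shows "(A \<longlongrightarrow> mellin f s) at_top"
proof -
  let ?g = "\<lambda>x::real. f (of_real x) * of_real x powr (s - 1)"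
  have gi: "set_integrable lborel {0<..} ?g" using int by (simp add: mellin_integrable_def)
  have "continuous_on {0<..} ?g"
    by (intro continuous_intros cont) (auto simp: complex_nonpos_Reals_iff)
  then have gc: "isCont ?g x" if "x > 0" for x
    using that by (simp add: continuous_on_eq_continuous_at)
  have Ay: "(LINT x:{0<..<y}|lborel. ?g x) = A y" if y: "y > 0" for y
  proof -
    have "(LBINT x=0..ereal y. ?g x) = A y - 0"
    proof (rule interval_integral_FTC_integrable)
      show "set_integrable lborel (einterval 0 (ereal y)) ?g"
        by (rule set_integrable_subset[OF gi]) (auto simp: einterval_iff)
      show "((A \<circ> real_of_ereal) \<longlongrightarrow> 0) (at_right 0)"
        using A0 by (simp only: ereal_tendsto_simps1 zero_ereal_def)
      have "isCont A y" using A[OF y] has_vector_derivative_continuous by blast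
      then show "((A \<circ> real_of_ereal) \<longlongrightarrow> A y) (at_left (ereal y))"
        by (simp add: ereal_tendsto_simps1 isCont_def filterlim_at_split)
    qed (use y A gc in auto)
    moreover have "einterval 0 (ereal y) = {0<..<y}" by (auto simp: einterval_iff)
    ultimately show ?thesis using y by (simp add: interval_lebesgue_integral_def)
  qed
  let ?G = "\<lambda>x. indicator {0<..} x *\<^sub>R ?g x"
  have "((\<lambda>y. LINT x|lborel. indicator {0<..<y} x *\<^sub>R ?g x) \<longlongrightarrow> (LINT x|lborel. ?G x)) at_top"
  proof (rule integral_dominated_convergence_at_top[where w="\<lambda>x. norm (?G x)"])
    show "?G \<in> borel_measurable lborel" using gi unfolding set_integrable_def by auto
    show "(\<lambda>x. indicator {0<..<y} x *\<^sub>R ?g x) \<in> borel_measurable lborel" for y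
      using set_integrable_subset[OF gi, of "{0<..<y}"] unfolding set_integrable_def by (auto simp: subset_eq)
    show "integrable lborel (\<lambda>x. norm (?G x))" using gi unfolding set_integrable_def by (rule integrable_norm)
    show "\<forall>\<^sub>F y in at_top. AE x in lborel. norm (indicator {0<..<y} x *\<^sub>R ?g x) \<le> norm (?G x)"
      by (intro always_eventually allI AE_I2) (auto simp: indicator_def)
    show "AE x in lborel. ((\<lambda>y. indicator {0<..<y} x *\<^sub>R ?g x) \<longlongrightarrow> ?G x) at_top"
    proof (intro AE_I2 tendsto_eventually)
      fix x :: real
      show "\<forall>\<^sub>F y in at_top. indicator {0<..<y} x *\<^sub>R ?g x = ?G x"
        using eventually_gt_at_top[of x] by eventually_elim (auto simp: indicator_def)
    qed
  qed
  moreover have "\<forall>\<^sub>F y in at_top. (LINT x|lborel. indicator {0<..<y} x *\<^sub>R ?g x) = A y"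
    using eventually_gt_at_top[of 0] by eventually_elim (use Ay in \<open>simp add: set_lebesgue_integral_def\<close>)
  ultimately show ?thesis
    unfolding mellin_def set_lebesgue_integral_def by (rule Lim_transform_eventually)
qed

text \<open>The derivative of F(z) z^s is (z F'(z) + s F(z)) z^(s-1), and the two limits make the
  boundary terms vanish.\<close>

lemma mellin_deriv:
  fixes F F' :: "complex \<Rightarrow> complex"
  assumes int: "mellin_integrable F s" "mellin_integrable (\<lambda>z. z * F' z) s"
    and F: "\<And>x::real. x > 0 \<Longrightarrow> (F has_field_derivative F' (of_real x)) (at (of_real x))"
    and cont: "continuous_on {0<..} (\<lambda>x::real. F' (of_real x))"
    and l0: "((\<lambda>x::real. F (of_real x) * of_real x powr s) \<longlongrightarrow> 0) (at_right 0)"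
    and l1: "((\<lambda>x::real. F (of_real x) * of_real x powr s) \<longlongrightarrow> 0) at_top"
  shows "mellin (\<lambda>z. z * F' z) s = - s * mellin F s"
proof -
  let ?h = "\<lambda>z. z * F' z + s * F z"
  have Fc: "continuous_on {0<..} (\<lambda>x::real. F (of_real x))"
  proof (rule continuous_at_imp_continuous_on, rule ballI)
    fix x :: real assume "x \<in> {0<..}"
    then have "isCont F (of_real x)" using F DERIV_isCont by auto
    then show "isCont (\<lambda>x. F (of_real x)) x" by (rule isCont_o2[rotated]) auto
  qed
  have i1: "set_integrable lborel {0<..} (\<lambda>x::real. (of_real x * F' (of_real x)) * of_real x powr (s - 1))"
    and i2: "set_integrable lborel {0<..} (\<lambda>x::real. s * (F (of_real x) * of_real x powr (s - 1)))"
    using int unfolding mellin_integrable_def by auto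
  have eq: "(\<lambda>x::real. ?h (of_real x) * of_real x powr (s - 1)) = (\<lambda>x. (of_real x * F' (of_real x)) * of_real x powr (s - 1) + s * (F (of_real x) * of_real x powr (s - 1)))"
    by (simp add: fun_eq_iff algebra_simps)
  have hi: "mellin_integrable ?h s" unfolding mellin_integrable_def eq by (intro set_integral_add i1 i2)
  have "((\<lambda>x::real. F (of_real x) * of_real x powr s) \<longlongrightarrow> mellin ?h s) at_top"
  proof (rule mellin_FTC[OF hi _ _ l0])
    show "continuous_on {0<..} (\<lambda>x::real. ?h (of_real x))" by (intro continuous_intros cont Fc)
    fix y :: real assume y: "y > 0"
    have "((\<lambda>z. F z * z powr s) has_field_derivative F' (of_real y) * of_real y powr s + (s * of_real y powr (s - 1)) * F (of_real y)) (at (of_real y))"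
      using y F[OF y] by (auto intro!: derivative_eq_intros simp: complex_nonpos_Reals_iff)
    moreover have "of_real y powr s = of_real y * complex_of_real y powr (s - 1)"
      using y by (simp add: powr_diff)
    ultimately have "((\<lambda>z. F z * z powr s) has_field_derivative ?h (of_real y) * of_real y powr (s - 1)) (at (of_real y))"
      by (simp add: algebra_simps)
    then show "((\<lambda>x. F (of_real x) * of_real x powr s) has_vector_derivative ?h (of_real y) * of_real y powr (s - 1)) (at y)"
      by (rule has_vector_derivative_real_field)
  qed
  with l1 have "mellin ?h s = 0" using tendsto_unique trivial_limit_at_top_linorder by blast
  moreover have "mellin ?h s = mellin (\<lambda>z. z * F' z) s + s * mellin F s"
    unfolding mellin_def eq by (subst set_integral_add(2)[OF i1 i2]) simp
  ultimately show ?thesis by (simp add: add_eq_0_iff)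
qed

lemma mellin_scale:
  assumes p: "p > 0" and int: "mellin_integrable f s"
  shows "mellin_integrable (\<lambda>z. f (of_real p * z)) s"
    and "mellin (\<lambda>z. f (of_real p * z)) s = of_real p powr (- s) * mellin f s"
proof -
  let ?g = "\<lambda>x::real. indicator {0<..} x *\<^sub>R (f (of_real x) * of_real x powr (s - 1))"
  let ?h = "\<lambda>x::real. indicator {0<..} x *\<^sub>R (f (of_real p * of_real x) * of_real x powr (s - 1))"
  have gi: "integrable lborel ?g" using int unfolding mellin_integrable_def set_integrable_def .
  have gh: "?h x = of_real p powr (1 - s) * ?g (0 + p * x)" for x
  proof (cases "x > 0")
    case True
    have "complex_of_real (p * x) powr (s - 1) = of_real p powr (s - 1) * of_real x powr (s - 1)"
      using p True by (simp add: powr_times_real)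
    moreover have "complex_of_real p powr (1 - s) * of_real p powr (s - 1) = 1"
      using p by (simp flip: powr_add)
    ultimately show ?thesis using True p by (simp add: mult.left_commute mult.assoc[symmetric])
  qed (use p in \<open>auto simp: indicator_def zero_less_mult_iff\<close>)
  have i: "integrable lborel (\<lambda>x. ?g (0 + p * x))"
    using lborel_integrable_real_affine[OF gi, of p 0] p by auto
  show "mellin_integrable (\<lambda>z. f (of_real p * z)) s"
    unfolding mellin_integrable_def set_integrable_def gh by (intro integrable_mult_right i)
  have "integral\<^sup>L lborel ?g = p *\<^sub>R integral\<^sup>L lborel (\<lambda>x. ?g (0 + p * x))"
    using lborel_integral_real_affine[of p ?g 0] p by simp
  then have "integral\<^sup>L lborel (\<lambda>x. ?g (0 + p * x)) = integral\<^sup>L lborel ?g / of_real p"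
    using p by (simp add: scaleR_conv_of_real)
  then have "mellin (\<lambda>z. f (of_real p * z)) s = of_real p powr (1 - s) * (mellin f s / of_real p)"
    unfolding mellin_def set_lebesgue_integral_def gh by (simp only: integral_mult_right_zero)
  also have "\<dots> = of_real p powr (- s) * mellin f s"
    using p by (simp add: powr_diff powr_minus field_simps)
  finally show "mellin (\<lambda>z. f (of_real p * z)) s = of_real p powr (- s) * mellin f s" .
qed

lemma mellin_diff:
  assumes "mellin_integrable f s" "mellin_integrable g s"
  shows "mellin_integrable (\<lambda>z. f z - g z) s" "mellin (\<lambda>z. f z - g z) s = mellin f s - mellin g s"
  using assms unfolding mellin_integrable_def mellin_def left_diff_distrib
  by (rule set_integral_diff)+

lemma mellin_add:
  assumes "mellin_integrable f s" "mellin_integrable g s"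
  shows "mellin_integrable (\<lambda>z. f z + g z) s" "mellin (\<lambda>z. f z + g z) s = mellin f s + mellin g s"
  using assms unfolding mellin_integrable_def mellin_def distrib_right
  by (rule set_integral_add)+

lemma mellin_cmult:
  assumes "mellin_integrable f s"
  shows "mellin_integrable (\<lambda>z. c * f z) s" "mellin (\<lambda>z. c * f z) s = c * mellin f s"
  using assms unfolding mellin_integrable_def mellin_def mult.assoc by simp_all

lemma mellin_times_id:
  assumes "mellin_integrable f (s + 1)"
  shows "mellin_integrable (\<lambda>z. z * f z) s" "mellin (\<lambda>z. z * f z) s = mellin f (s + 1)"
proof -
  have eq: "complex_of_real x * f (of_real x) * of_real x powr (s - 1) = f (of_real x) * of_real x powr ((s + 1) - 1)"
    if "x > 0" for x using that by (simp add: powr_diff)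
  have "set_integrable lborel {0<..} (\<lambda>x. complex_of_real x * f (of_real x) * of_real x powr (s - 1)) \<longleftrightarrow>
      set_integrable lborel {0<..} (\<lambda>x. f (of_real x) * of_real x powr ((s + 1) - 1))"
    by (rule set_integrable_cong) (auto simp only: greaterThan_iff eq)
  then show "mellin_integrable (\<lambda>z. z * f z) s" using assms by (simp only: mellin_integrable_def)
  show "mellin (\<lambda>z. z * f z) s = mellin f (s + 1)"
    unfolding mellin_def by (rule set_lebesgue_integral_cong) (auto simp only: greaterThan_iff eq sets_lborel borel_open open_greaterThan)
qed

section \<open>Poisson transforms\<close>

text \<open>Polymorphic, so that real sequences can serve as majorants of complex ones in
  \<open>ptrans_norm_le\<close>.\<close>

definition entire_coeffs :: "(nat \<Rightarrow> 'a::{real_normed_field,banach}) \<Rightarrow> bool" where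
  "entire_coeffs b \<longleftrightarrow> (\<forall>z. summable (\<lambda>n. b n * z ^ n / fact n))"

text \<open>For real z >= 0 this is the expected value of b at a Poisson variable with mean
  z.\<close>

definition ptrans :: "(nat \<Rightarrow> 'a) \<Rightarrow> 'a \<Rightarrow> 'a::{real_normed_field,banach}" where
  "ptrans b z = exp (- z) * (\<Sum>n. b n * z ^ n / fact n)"

lemma entire_coeffs_norm_summable:
  assumes "entire_coeffs b"
  shows "summable (\<lambda>n. norm (b n) * r ^ n / fact n)"
proof -
  have "summable (\<lambda>n. norm (b n / fact n * (of_real \<bar>r\<bar>) ^ n))"
    using assms by (intro powser_insidea[where x="of_real (\<bar>r\<bar> + 1)"]) (auto simp: entire_coeffs_def)
  then have "summable (\<lambda>n. norm (b n) * \<bar>r\<bar> ^ n / fact n)"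
    by (simp add: norm_mult norm_divide norm_power)
  then show ?thesis
    by (rule summable_comparison_test'[where N=0]) (simp add: norm_mult norm_divide power_abs abs_mult)
qed

lemma entire_coeffs_iff_norm: "entire_coeffs b \<longleftrightarrow> (\<forall>r. summable (\<lambda>n. norm (b n) * r ^ n / fact n))"
proof
  assume *: "\<forall>r. summable (\<lambda>n. norm (b n) * r ^ n / fact n)"
  show "entire_coeffs b" unfolding entire_coeffs_def
  proof
    fix z :: 'a
    have "summable (\<lambda>n. norm (b n * z ^ n / fact n))"
      using *[rule_format, of "norm z"] by (simp add: norm_mult norm_divide norm_power)
    then show "summable (\<lambda>n. b n * z ^ n / fact n)" by (rule summable_norm_cancel)
  qed
qed (use entire_coeffs_norm_summable in blast)

lemma entire_coeffs_bound:
  assumes b: "entire_coeffs \<beta>" "\<And>n. norm (b n) \<le> norm (\<beta> n)"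
  shows "entire_coeffs b"
  unfolding entire_coeffs_iff_norm
proof
  fix r :: real
  have "summable (\<lambda>n. norm (\<beta> n) * \<bar>r\<bar> ^ n / fact n)" using entire_coeffs_norm_summable[OF b(1)] .
  then show "summable (\<lambda>n. norm (b n) * r ^ n / fact n)"
    by (rule summable_comparison_test'[where N=0])
      (use b(2) in \<open>auto simp: norm_mult norm_divide power_abs abs_mult intro!: divide_right_mono mult_right_mono\<close>)
qed

lemma entire_coeffs_power: "entire_coeffs (\<lambda>n. c * r ^ n)"
  unfolding entire_coeffs_def
proof
  fix z :: 'a
  have "summable (\<lambda>n. c * ((r * z) ^ n /\<^sub>R fact n))" by (intro summable_mult summable_exp_generic)
  then show "summable (\<lambda>n. c * r ^ n * z ^ n / fact n)"
    by (simp add: power_mult_distrib scaleR_conv_of_real field_simps)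
qed

lemma entire_coeffs_const [simp]: "entire_coeffs (\<lambda>n. c)"
  using entire_coeffs_power[of c 1] by simp

lemma entire_coeffs_poly2:
  assumes "\<And>n. norm (b n) \<le> C * real n ^ 2"
  shows "entire_coeffs b"
proof (rule entire_coeffs_bound[OF entire_coeffs_power[of C 4]])
  fix n
  have "real n \<le> 2 ^ n" by (rule less_imp_le[OF of_nat_less_two_power])
  then have "real n ^ 2 \<le> (2 ^ n) ^ 2" by (rule power_mono) auto
  then have n2: "real n ^ 2 \<le> 4 ^ n" by (simp add: power_mult[symmetric] mult.commute[of n]) (simp add: power_mult)
  have C: "C \<ge> 0" using assms[of 1] norm_ge_zero[of "b 1"] by (auto simp del: norm_ge_zero)
  show "norm (b n) \<le> norm (C * 4 ^ n)"
    using assms[of n] n2 C by (smt (verit) mult_left_mono norm_mult norm_power real_norm_def abs_of_nonneg zero_le_power)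
qed

lemma entire_coeffs_add:
  "entire_coeffs b \<Longrightarrow> entire_coeffs c \<Longrightarrow> entire_coeffs (\<lambda>n. b n + c n)"
  unfolding entire_coeffs_def by (simp add: distrib_right add_divide_distrib summable_add)

lemma entire_coeffs_diff:
  "entire_coeffs b \<Longrightarrow> entire_coeffs c \<Longrightarrow> entire_coeffs (\<lambda>n. b n - c n)"
  unfolding entire_coeffs_def by (simp add: left_diff_distrib diff_divide_distrib summable_diff)

lemma entire_coeffs_cmult: "entire_coeffs b \<Longrightarrow> entire_coeffs (\<lambda>n. c * b n)"
  unfolding entire_coeffs_def
  using summable_mult[of "\<lambda>n. b n * z ^ n / fact n" c for z] by (simp add: mult.assoc)

lemma entire_coeffs_scale: "entire_coeffs b \<Longrightarrow> entire_coeffs (\<lambda>n. b n * c ^ n)"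
  unfolding entire_coeffs_def by (simp add: mult.assoc flip: power_mult_distrib)

lemma entire_coeffs_summable: "entire_coeffs b \<Longrightarrow> summable (\<lambda>n. b n * z ^ n / fact n)"
  by (simp add: entire_coeffs_def)

lemma diffs_over_fact: "diffs (\<lambda>n. b n / fact n) = (\<lambda>n. b (Suc n) / (fact n :: 'a::{real_normed_field,banach}))"
  by (auto simp: diffs_def fun_eq_iff field_simps simp del: of_nat_Suc)

lemma entire_coeffs_Suc:
  fixes b :: "nat \<Rightarrow> complex"
  assumes "entire_coeffs b" shows "entire_coeffs (\<lambda>n. b (Suc n))"
  unfolding entire_coeffs_def
proof
  fix z
  have "summable (\<lambda>n. diffs (\<lambda>n. b n / fact n) n * z ^ n)"
    by (rule termdiff_converges_all) (use assms in \<open>simp add: entire_coeffs_def\<close>)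
  then show "summable (\<lambda>n. b (Suc n) * z ^ n / fact n)" by (simp add: diffs_over_fact)
qed

lemma ptrans_add: "entire_coeffs b \<Longrightarrow> entire_coeffs c \<Longrightarrow> ptrans (\<lambda>n. b n + c n) z = ptrans b z + ptrans c z"
  unfolding ptrans_def
  by (simp add: distrib_right add_divide_distrib suminf_add[symmetric] entire_coeffs_summable distrib_left)

lemma ptrans_diff: "entire_coeffs b \<Longrightarrow> entire_coeffs c \<Longrightarrow> ptrans (\<lambda>n. b n - c n) z = ptrans b z - ptrans c z"
  unfolding ptrans_def
  by (simp add: left_diff_distrib diff_divide_distrib suminf_diff[symmetric] entire_coeffs_summable right_diff_distrib)

lemma ptrans_cmult: "entire_coeffs b \<Longrightarrow> ptrans (\<lambda>n. c * b n) z = c * ptrans b z"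
  unfolding ptrans_def
  using suminf_mult[of "\<lambda>n. b n * z ^ n / fact n" c] by (simp add: entire_coeffs_summable mult.assoc mult.left_commute)

lemma ptrans_has_field_derivative:
  fixes b :: "nat \<Rightarrow> complex"
  assumes b: "entire_coeffs b"
  shows "(ptrans b has_field_derivative ptrans (\<lambda>n. b (Suc n) - b n) z) (at z)"
proof -
  define S where "S z = (\<Sum>n. b n / fact n * z ^ n)" for z
  have "(S has_field_derivative (\<Sum>n. diffs (\<lambda>n. b n / fact n) n * z ^ n)) (at z)"
    unfolding S_def using b by (intro termdiffs_strong_converges_everywhere) (simp add: entire_coeffs_def)
  then have "((\<lambda>z. exp (- z) * S z) has_field_derivative
     (exp (- z) * (\<Sum>n. b (Suc n) * z ^ n / fact n) - exp (- z) * S z)) (at z)"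
    unfolding diffs_over_fact by (auto intro!: derivative_eq_intros)
  moreover have "(\<lambda>z. exp (- z) * S z) = ptrans b" by (simp add: fun_eq_iff ptrans_def S_def)
  ultimately show ?thesis
    using ptrans_diff[OF entire_coeffs_Suc[OF b] b, of z] by (simp add: ptrans_def S_def)
qed

lemma ptrans_holomorphic: "entire_coeffs b \<Longrightarrow> ptrans b holomorphic_on A"
  unfolding holomorphic_on_def field_differentiable_def
  by (blast intro: DERIV_subset[OF ptrans_has_field_derivative])

text \<open>The reason for the exponential factors in the function whose Mellin transform is taken:
  they turn a dilation of the argument into the weights p^n on the coefficients.\<close>

lemma ptrans_scale:
  assumes "p + q = 1"
  shows "exp (- q * z) * ptrans b (p * z) = ptrans (\<lambda>n. b n * p ^ n) z"
proof -
  have "exp (- q * z) * exp (- (p * z)) = exp (- z)"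
  proof -
    have "- q * z + - (p * z) = - ((p + q) * z)" by (simp add: algebra_simps)
    then show ?thesis using assms by (simp flip: exp_add)
  qed
  then show ?thesis unfolding ptrans_def by (simp add: power_mult_distrib mult.assoc[symmetric])
qed

text \<open>Poisson thinning: keeping each of Poisson(z) many items with probability p leaves
  Poisson(p z) many. Analytically it is the Cauchy product with exp(q z).\<close>

lemma ptrans_thinning:
  fixes b :: "nat \<Rightarrow> complex"
  assumes b: "entire_coeffs b" and pq: "p + q = 1"
  shows "ptrans b (p * z) = ptrans (\<lambda>n. \<Sum>k\<le>n. of_nat (n choose k) * p ^ k * q ^ (n - k) * b k) z"
    and "entire_coeffs (\<lambda>n. \<Sum>k\<le>n. of_nat (n choose k) * p ^ k * q ^ (n - k) * b k)"
proof -
  define c where "c n = (\<Sum>k\<le>n. of_nat (n choose k) * p ^ k * q ^ (n - k) * b k)" for n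
  have s: "(\<lambda>n. c n * z ^ n / fact n) sums ((\<Sum>n. b n * (p * z) ^ n / fact n) * exp (q * z))" for z
  proof -
    have 1: "summable (\<lambda>n. norm (b n * (p * z) ^ n / fact n))"
      using entire_coeffs_norm_summable[OF b, of "norm (p * z)"] by (simp add: norm_mult norm_divide norm_power)
    have 2: "summable (\<lambda>n. norm ((q * z) ^ n /\<^sub>R fact n))" by (rule summable_norm_exp)
    have "(\<lambda>n. \<Sum>k\<le>n. (b k * (p * z) ^ k / fact k) * ((q * z) ^ (n - k) /\<^sub>R fact (n - k))) sums
       ((\<Sum>n. b n * (p * z) ^ n / fact n) * (\<Sum>n. (q * z) ^ n /\<^sub>R fact n))"
      by (rule Cauchy_product_sums[OF 1 2])
    also have "(\<lambda>n. \<Sum>k\<le>n. (b k * (p * z) ^ k / fact k) * ((q * z) ^ (n - k) /\<^sub>R fact (n - k))) = (\<lambda>n. c n * z ^ n / fact n)"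
    proof
      fix n
      have "(b k * (p * z) ^ k / fact k) * ((q * z) ^ (n - k) /\<^sub>R fact (n - k)) =
         of_nat (n choose k) * p ^ k * q ^ (n - k) * b k * z ^ n / fact n" if "k \<le> n" for k
      proof -
        have "(of_nat (n choose k) :: complex) = fact n / (fact k * fact (n - k))" using that by (rule binomial_fact)
        moreover have "z ^ n = z ^ k * z ^ (n - k)" using that by (simp flip: power_add)
        ultimately show ?thesis by (simp add: power_mult_distrib scaleR_conv_of_real field_simps)
      qed
      then show "(\<Sum>k\<le>n. (b k * (p * z) ^ k / fact k) * ((q * z) ^ (n - k) /\<^sub>R fact (n - k))) = c n * z ^ n / fact n"
        unfolding c_def sum_distrib_right sum_divide_distrib by (intro sum.cong) auto
    qed
    finally show ?thesis by (simp add: exp_def)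
  qed
  show "entire_coeffs (\<lambda>n. \<Sum>k\<le>n. of_nat (n choose k) * p ^ k * q ^ (n - k) * b k)"
    using s unfolding entire_coeffs_def c_def by (blast intro: sums_summable)
  have "exp (- z) * exp (q * z) = exp (- (p * z))"
  proof -
    have "- ((p + q) * z) + q * z = - (p * z)" by (simp add: algebra_simps)
    then show ?thesis using pq by (simp flip: exp_add)
  qed
  then show "ptrans b (p * z) = ptrans (\<lambda>n. \<Sum>k\<le>n. of_nat (n choose k) * p ^ k * q ^ (n - k) * b k) z"
    unfolding ptrans_def sums_unique[OF s[of z], symmetric, unfolded c_def] by (simp add: mult.assoc[symmetric] mult.commute)
qed

text \<open>Moduli are taken inside the series; replacing exp(-z) by exp(-norm z) leaves the factor
  exp(norm z - Re z), which is 1 on the positive axis and mild near it.\<close>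

lemma ptrans_norm_le:
  fixes b :: "nat \<Rightarrow> complex" and \<beta> :: "nat \<Rightarrow> real"
  assumes le: "\<And>n. norm (b n) \<le> \<beta> n" and \<beta>: "entire_coeffs \<beta>"
  shows "norm (ptrans b z) \<le> exp (norm z - Re z) * ptrans \<beta> (norm z)"
proof -
  have b: "entire_coeffs b" by (rule entire_coeffs_bound[OF \<beta>]) (use order_trans[OF le abs_ge_self] in simp)
  have "norm (\<Sum>n. b n * z ^ n / fact n) \<le> (\<Sum>n. \<beta> n * norm z ^ n / fact n)"
    by (rule norm_suminf_le[OF _ entire_coeffs_summable[OF \<beta>]])
      (use le in \<open>auto simp: norm_mult norm_divide norm_power intro!: divide_right_mono mult_right_mono\<close>)
  then have "norm (ptrans b z) \<le> exp (- Re z) * (\<Sum>n. \<beta> n * norm z ^ n / fact n)"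
    unfolding ptrans_def norm_mult by (simp add: mult_left_mono)
  also have "\<dots> = exp (norm z - Re z) * ptrans \<beta> (norm z)"
    unfolding ptrans_def by (simp add: mult.assoc[symmetric] flip: exp_add)
  finally show ?thesis .
qed

lemma ptrans_mono:
  fixes b c :: "nat \<Rightarrow> real"
  assumes "entire_coeffs b" "entire_coeffs c" "\<And>n. b n \<le> c n" "x \<ge> 0"
  shows "ptrans b x \<le> ptrans c x"
  unfolding ptrans_def using assms
  by (intro mult_left_mono suminf_le entire_coeffs_summable) (auto intro!: divide_right_mono mult_right_mono)

lemma ptrans_const: "ptrans (\<lambda>_. c) z = c"
proof -
  have "(\<Sum>n. c * z ^ n / fact n) = c * exp z"
    using suminf_mult[OF summable_exp_generic[of z], of c] by (simp add: exp_def scaleR_conv_of_real field_simps)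
  then show ?thesis by (simp add: ptrans_def exp_minus field_simps)
qed

lemma entire_coeffs_of_nat: "entire_coeffs (\<lambda>n. of_nat n)"
proof (rule entire_coeffs_poly2[where C=1])
  show "norm (of_nat n :: 'a) \<le> 1 * (real n)\<^sup>2" for n
    unfolding norm_of_nat by (cases n) (simp_all add: power2_eq_square)
qed

lemma entire_coeffs_of_nat2: "entire_coeffs (\<lambda>n. of_nat n * (of_nat n - 1))"
proof (rule entire_coeffs_poly2[where C=1])
  fix n :: nat
  have "of_nat n * (of_nat n - 1) = (of_nat (n * (n - 1)) :: 'a)" by (cases n) (auto simp: algebra_simps)
  moreover have "real (n * (n - 1)) \<le> (real n)\<^sup>2"
    unfolding power2_eq_square of_nat_mult by (intro mult_left_mono) auto
  ultimately show "norm (of_nat n * (of_nat n - 1) :: 'a) \<le> 1 * (real n)\<^sup>2"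
    by (simp only: norm_of_nat mult_1)
qed

lemma ptrans_of_nat: "ptrans (\<lambda>n. of_nat n) z = z"
proof -
  have "(\<lambda>n. z ^ n /\<^sub>R fact n) sums exp z" by (rule exp_converges)
  then have "(\<lambda>n. z * (z ^ n /\<^sub>R fact n)) sums (z * exp z)" by (rule sums_mult)
  also have "(\<lambda>n. z * (z ^ n /\<^sub>R fact n)) = (\<lambda>n. of_nat (Suc n) * z ^ Suc n / fact (Suc n))"
    by (auto simp: fun_eq_iff scaleR_conv_of_real field_simps simp del: of_nat_Suc)
  finally have "(\<lambda>n. of_nat n * z ^ n / fact n) sums (z * exp z)"
    by (subst (asm) sums_Suc_iff) simp
  then show ?thesis by (simp add: ptrans_def sums_unique[symmetric] exp_minus field_simps)
qed

lemma ptrans_of_nat2: "ptrans (\<lambda>n. of_nat n * (of_nat n - 1)) z = z\<^sup>2"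
proof -
  have "(\<lambda>n. z ^ n /\<^sub>R fact n) sums exp z" by (rule exp_converges)
  then have "(\<lambda>n. z\<^sup>2 * (z ^ n /\<^sub>R fact n)) sums (z\<^sup>2 * exp z)" by (rule sums_mult)
  also have "(\<lambda>n. z\<^sup>2 * (z ^ n /\<^sub>R fact n)) = (\<lambda>n. of_nat (Suc (Suc n)) * (of_nat (Suc (Suc n)) - 1) * z ^ Suc (Suc n) / fact (Suc (Suc n)))"
  proof
    fix n
    have "(of_nat (Suc (Suc n)) :: 'a) \<noteq> 0" "(of_nat (Suc n) :: 'a) \<noteq> 0" by (simp_all del: of_nat_Suc)
    moreover have "(of_nat (Suc (Suc n)) - 1 :: 'a) = of_nat (Suc n)" by simp
    moreover have "(fact (Suc (Suc n)) :: 'a) = of_nat (Suc (Suc n)) * of_nat (Suc n) * fact n"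
      by (simp only: fact_Suc mult.assoc)
    ultimately show "z\<^sup>2 * (z ^ n /\<^sub>R fact n) = of_nat (Suc (Suc n)) * (of_nat (Suc (Suc n)) - 1) * z ^ Suc (Suc n) / fact (Suc (Suc n))"
      by (simp only:) (simp add: scaleR_conv_of_real power2_eq_square divide_simps del: of_nat_Suc)
  qed
  finally have "(\<lambda>n. of_nat n * (of_nat n - 1) * z ^ n / fact n) sums (z\<^sup>2 * exp z)"
    by (subst (asm) sums_Suc_iff, subst (asm) sums_Suc_iff) simp
  then show ?thesis by (simp add: ptrans_def sums_unique[symmetric] exp_minus field_simps)
qed

text \<open>A concave power lies below its tangent at m. Averaged against a law with mean m, the
  linear term disappears and Jensen's inequality remains; this is applied to Poisson laws in
  \<open>ptrans_powr_le\<close> and to binomial laws in \<open>binomial_powr_le\<close>.\<close>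

lemma powr_le_tangent:
  fixes s y m :: real
  assumes "0 < s" "s \<le> 1" "m > 0" "y \<ge> 0"
  shows "y powr s \<le> m powr s + s * m powr (s - 1) * (y - m)"
proof (cases "y = 0")
  case True
  have "m powr s = m powr (s - 1) * m" using assms by (simp add: powr_diff)
  then show ?thesis using True assms by (simp add: algebra_simps mult_left_le_one_le mult_right_le_one_le)
next
  case False
  define u where "u = y / m"
  have u: "u > 0" using False assms by (simp add: u_def)
  have "u powr s \<le> 1 + s * (u - 1)"
  proof -
    have "exp ((1 - s) *\<^sub>R 0 + s *\<^sub>R ln u) \<le> (1 - s) * exp 0 + s * exp (ln u)"
      by (rule convex_onD[OF exp_convex]) (use assms in auto)
    then show ?thesis using u by (simp add: powr_def algebra_simps)
  qed
  then have "m powr s * u powr s \<le> m powr s * (1 + s * (u - 1))" by (intro mult_left_mono) auto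
  moreover have "m powr s * u powr s = y powr s" using assms u by (simp add: u_def powr_divide)
  moreover have "m powr s * (u - 1) = m powr (s - 1) * (y - m)"
    using assms by (simp add: u_def powr_diff field_simps)
  moreover have "m powr s * (1 + s * (u - 1)) = m powr s + s * (m powr s * (u - 1))" by algebra
  ultimately show ?thesis by (simp only: mult.assoc)
qed

lemma entire_coeffs_powr:
  assumes "s \<le> 2" shows "entire_coeffs (\<lambda>n. real n powr s)"
proof (rule entire_coeffs_poly2[where C=1])
  fix n
  show "norm (real n powr s) \<le> 1 * (real n)\<^sup>2"
  proof (cases "n = 0")
    case False
    then have "real n powr s \<le> real n powr 2" using assms by (intro powr_mono) auto
    then show ?thesis using False by simp
  qed auto
qed

lemma ptrans_powr_le:
  assumes "0 < s" "s \<le> 1" "x > 0"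
  shows "ptrans (\<lambda>n. real n powr s) x \<le> x powr s"
proof -
  have e: "entire_coeffs (\<lambda>n. x powr s - s * x powr (s - 1) * x + s * x powr (s - 1) * real n)"
    by (intro entire_coeffs_add entire_coeffs_const entire_coeffs_cmult entire_coeffs_of_nat)
  have "ptrans (\<lambda>n. real n powr s) x \<le> ptrans (\<lambda>n. x powr s - s * x powr (s - 1) * x + s * x powr (s - 1) * real n) x"
  proof (intro ptrans_mono entire_coeffs_powr e)
    fix n
    have "real n powr s \<le> x powr s + s * x powr (s - 1) * (real n - x)"
      using powr_le_tangent[OF assms, of "real n"] by simp
    then show "real n powr s \<le> x powr s - s * x powr (s - 1) * x + s * x powr (s - 1) * real n"
      by (simp add: right_diff_distrib)
  qed (use assms in auto)
  also have "\<dots> = x powr s - s * x powr (s - 1) * x + s * x powr (s - 1) * x"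
    by (subst ptrans_add) (auto intro!: entire_coeffs_cmult entire_coeffs_of_nat simp: ptrans_const ptrans_cmult entire_coeffs_of_nat ptrans_of_nat)
  finally show ?thesis by simp
qed

lemma binomial_powr_le:
  fixes p q s :: real
  assumes s: "0 < s" "s \<le> 1" and p: "p > 0" "q > 0" "p + q = 1" and n: "n > 0"
  shows "(\<Sum>k\<le>n. real (n choose k) * p ^ k * q ^ (n - k) * real k powr s) \<le> (real n * p) powr s"
proof -
  define m where "m = real n * p"
  have m: "m > 0" using n p by (simp add: m_def)
  have sum1: "(\<Sum>k\<le>n. real (n choose k) * p ^ k * q ^ (n - k)) = 1"
    using binomial_ring[of p q n] p by simp
  have sum2: "(\<Sum>k\<le>n. real (n choose k) * p ^ k * q ^ (n - k) * real k) = m"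
  proof -
    obtain n' where n': "n = Suc n'" using n by (cases n) auto
    have "(\<Sum>k\<le>n. real (n choose k) * p ^ k * q ^ (n - k) * real k) =
       (\<Sum>k\<le>n'. real (n choose Suc k) * p ^ Suc k * q ^ (n' - k) * real (Suc k))"
      unfolding n' by (subst sum.atMost_Suc_shift) simp
    also have "\<dots> = (\<Sum>k\<le>n'. m * (real (n' choose k) * p ^ k * q ^ (n' - k)))"
    proof (rule sum.cong[OF refl])
      fix k
      have "real (Suc k) * real (Suc n' choose Suc k) = real (Suc n') * real (n' choose k)"
        using Suc_times_binomial_eq[of n' k] by (metis mult.commute of_nat_mult)
      then show "real (n choose Suc k) * p ^ Suc k * q ^ (n' - k) * real (Suc k) = m * (real (n' choose k) * p ^ k * q ^ (n' - k))"
        unfolding m_def n' by (simp del: of_nat_Suc binomial_Suc_Suc add: mult_ac)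
    qed
    also have "\<dots> = m" using binomial_ring[of p q n'] p by (simp add: sum_distrib_left[symmetric])
    finally show ?thesis .
  qed
  have "(\<Sum>k\<le>n. real (n choose k) * p ^ k * q ^ (n - k) * real k powr s) \<le>
     (\<Sum>k\<le>n. real (n choose k) * p ^ k * q ^ (n - k) * (m powr s + s * m powr (s - 1) * (real k - m)))"
    using p by (intro sum_mono mult_left_mono powr_le_tangent[OF s m]) auto
  also have "\<dots> = (m powr s - s * m powr (s - 1) * m) * (\<Sum>k\<le>n. real (n choose k) * p ^ k * q ^ (n - k)) +
      s * m powr (s - 1) * (\<Sum>k\<le>n. real (n choose k) * p ^ k * q ^ (n - k) * real k)"
    by (simp add: sum_distrib_left sum.distrib[symmetric] algebra_simps)
  also have "\<dots> = m powr s" unfolding sum1 sum2 by simp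
  finally show ?thesis unfolding m_def .
qed

section \<open>Binomial averages and depoissonization\<close>

text \<open>The average runs over all of 0..n, whereas the split index of the process avoids both
  ends. Including the ends moves the normalization 1 - p^n - q^n from the probabilities to the toll.
  Swapping p and q gives the average for the second part of the split.\<close>

definition binom_avg :: "real \<Rightarrow> real \<Rightarrow> (nat \<Rightarrow> complex) \<Rightarrow> nat \<Rightarrow> complex" where
  "binom_avg p q u n = (\<Sum>k\<le>n. of_nat (n choose k) * of_real p ^ k * of_real q ^ (n - k) * u k)"

text \<open>Conditioning on one of the n + 1 trials; in algebra, Pascal's rule.\<close>

lemma binom_avg_Suc:
  "binom_avg p q u (Suc n) = of_real p * binom_avg p q (\<lambda>k. u (Suc k)) n + of_real q * binom_avg p q u n"
proof -
  let ?P = "complex_of_real p" and ?Q = "complex_of_real q"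
  have "binom_avg p q u (Suc n) = ?Q ^ Suc n * u 0 +
      (\<Sum>k\<le>n. (of_nat (n choose k) + of_nat (n choose Suc k)) * ?P ^ Suc k * ?Q ^ (n - k) * u (Suc k))"
    unfolding binom_avg_def by (subst sum.atMost_Suc_shift) simp
  also have "\<dots> = (\<Sum>k\<le>n. of_nat (n choose k) * ?P ^ Suc k * ?Q ^ (n - k) * u (Suc k)) +
     (?Q ^ Suc n * u 0 + (\<Sum>k\<le>n. of_nat (n choose Suc k) * ?P ^ Suc k * ?Q ^ (n - k) * u (Suc k)))"
    by (simp add: distrib_right sum.distrib)
  also have "(\<Sum>k\<le>n. of_nat (n choose k) * ?P ^ Suc k * ?Q ^ (n - k) * u (Suc k)) = ?P * binom_avg p q (\<lambda>k. u (Suc k)) n"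
    unfolding binom_avg_def by (simp add: sum_distrib_left mult_ac)
  also have "?Q ^ Suc n * u 0 + (\<Sum>k\<le>n. of_nat (n choose Suc k) * ?P ^ Suc k * ?Q ^ (n - k) * u (Suc k)) =
      (\<Sum>k\<le>Suc n. of_nat (n choose k) * ?P ^ k * ?Q ^ (Suc n - k) * u k)"
    by (subst sum.atMost_Suc_shift) simp
  also have "\<dots> = (\<Sum>k\<le>n. of_nat (n choose k) * ?P ^ k * ?Q ^ (Suc n - k) * u k)" by simp
  also have "\<dots> = ?Q * binom_avg p q u n"
    unfolding binom_avg_def sum_distrib_left
    by (rule sum.cong) (auto simp: Suc_diff_le)
  finally show ?thesis .
qed

lemma binom_avg_difference:
  assumes "p + q = 1"
  shows "binom_avg p q u (Suc n) - binom_avg p q u n = of_real p * binom_avg p q (\<lambda>k. u (Suc k) - u k) n"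
proof -
  have q: "q = 1 - p" using assms by simp
  have "binom_avg p q (\<lambda>k. u (Suc k) - u k) n = binom_avg p q (\<lambda>k. u (Suc k)) n - binom_avg p q u n"
    unfolding binom_avg_def by (simp add: right_diff_distrib sum_subtractf)
  then have "of_real p * binom_avg p q (\<lambda>k. u (Suc k) - u k) n =
      of_real p * binom_avg p q (\<lambda>k. u (Suc k)) n - of_real p * binom_avg p q u n"
    by (simp only: right_diff_distrib)
  moreover have "complex_of_real q * binom_avg p q u n = binom_avg p q u n - of_real p * binom_avg p q u n"
    by (simp add: q left_diff_distrib)
  ultimately show ?thesis unfolding binom_avg_Suc by (simp only: add_diff_eq) simp
qed

text \<open>Jensen's inequality with the term k = n kept apart: in the induction of
  \<open>recurrence_difference_bound\<close> the bound for \<open>u n\<close> itself is still the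
  goal, so its share is subtracted and replaced by its actual norm.\<close>

lemma norm_binom_avg_le:
  assumes pq: "p > 0" "q > 0" "p + q = 1" and s: "0 < s" "s \<le> 1" and D: "D \<ge> 0" and n: "n > 0"
    and u: "\<And>k. k < n \<Longrightarrow> norm (u k) \<le> D * real k powr s"
  shows "norm (binom_avg p q u n) \<le> D * p powr s * real n powr s - D * p ^ n * real n powr s + p ^ n * norm (u n)"
proof -
  let ?w = "\<lambda>k. real (n choose k) * p ^ k * q ^ (n - k)"
  have "norm (binom_avg p q u n) \<le> (\<Sum>k\<le>n. ?w k * norm (u k))"
    unfolding binom_avg_def using pq by (intro sum_norm_le) (simp add: norm_mult norm_power)
  also have "\<dots> = (\<Sum>k<n. ?w k * norm (u k)) + p ^ n * norm (u n)"
    by (simp flip: lessThan_Suc_atMost)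
  also have "(\<Sum>k<n. ?w k * norm (u k)) \<le> (\<Sum>k<n. ?w k * (D * real k powr s))"
    using pq u by (intro sum_mono mult_left_mono) auto
  also have "\<dots> = (\<Sum>k\<le>n. ?w k * (D * real k powr s)) - p ^ n * (D * real n powr s)"
    by (simp flip: lessThan_Suc_atMost)
  also have "(\<Sum>k\<le>n. ?w k * (D * real k powr s)) = D * (\<Sum>k\<le>n. ?w k * real k powr s)"
    by (simp add: sum_distrib_left mult_ac)
  also have "\<dots> \<le> D * (real n * p) powr s"
    by (intro mult_left_mono binomial_powr_le s pq n D)
  finally show ?thesis using pq by (simp add: powr_mult mult_ac)
qed

lemma sum_powr_less_1:
  fixes p q s :: real
  assumes "p > 0" "q > 0" "p + q = 1" "s > 0"
  shows "p * p powr s + q * q powr s < 1"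
proof -
  have "x * x powr s < x" if "0 < x" "x < 1" for x :: real
    using that assms powr_less_mono2[of s x 1] by simp
  then show ?thesis using assms by (smt (verit))
qed

text \<open>Differencing a binomial average multiplies it by p, so the increments of mu satisfy a
  recurrence of the same kind with total weight p + q = 1. Jensen's inequality then contracts the
  scale n^s by the factor p^(1+s) + q^(1+s) < 1, and increments of mu are of no larger order than
  those of b.\<close>

lemma recurrence_difference_bound:
  fixes mu b :: "nat \<Rightarrow> complex"
  assumes pq: "p > 0" "q > 0" "p + q = 1" and s: "0 < s" "s \<le> 1"
    and mu: "\<And>n. mu n = binom_avg p q mu n + binom_avg q p mu n + b n"
    and mu01: "mu 0 = 0" "mu (Suc 0) = 0"
    and b: "\<And>n. n > 0 \<Longrightarrow> norm (b (Suc n) - b n) \<le> C * real n powr s"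
  obtains D where "D \<ge> 0" "\<And>n. norm (mu (Suc n) - mu n) \<le> D * real n powr s"
proof -
  define \<Delta> where "\<Delta> n = mu (Suc n) - mu n" for n
  have \<Delta>: "\<Delta> n = of_real p * binom_avg p q \<Delta> n + of_real q * binom_avg q p \<Delta> n + (b (Suc n) - b n)" for n
  proof -
    have "\<Delta> n = (binom_avg p q mu (Suc n) - binom_avg p q mu n) + (binom_avg q p mu (Suc n) - binom_avg q p mu n) + (b (Suc n) - b n)"
      unfolding \<Delta>_def using mu[of "Suc n"] mu[of n] by (simp add: algebra_simps)
    then show ?thesis unfolding \<Delta>_def using binom_avg_difference[of p q mu n] binom_avg_difference[of q p mu n] pq
      by (simp add: add.commute[of q p])
  qed
  define c where "c = 1 - (p * p powr s + q * q powr s)"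
  have c: "c > 0" using sum_powr_less_1[OF pq s(1)] by (simp add: c_def)
  \<comment> \<open>Large enough that the gain D c of the contraction pays for the source increment
    C.\<close>
  define D where "D = \<bar>C\<bar> / c"
  have D: "D \<ge> 0" "D * c \<ge> C" using c by (auto simp: D_def)
  have "norm (\<Delta> n) \<le> D * real n powr s" for n
  proof (induction n rule: less_induct)
    case (less n)
    show ?case
    proof (cases "n = 0")
      \<comment> \<open>As \<open>0 powr s\<close> is 0, the claim for n = 0 is the equality of the
        first two values of mu.\<close>
      case True then show ?thesis using mu01 by (simp add: \<Delta>_def)
    next
      case False
      define N where "N = real n powr s"
      have e: "1 - p ^ Suc n - q ^ Suc n > 0"
      proof -
        have "p ^ Suc n < p ^ 1" "q ^ Suc n < q ^ 1" using pq False
          by (intro power_strict_decreasing; simp)+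
        then show ?thesis using pq by (simp only: power_one_right)
      qed
      have "norm (\<Delta> n) \<le> norm (of_real p * binom_avg p q \<Delta> n) + norm (of_real q * binom_avg q p \<Delta> n) + norm (b (Suc n) - b n)"
        by (subst \<Delta>) (meson norm_triangle_ineq norm_triangle_mono order_refl)
      also have "\<dots> \<le> p * (D * p powr s * N - D * p ^ n * N + p ^ n * norm (\<Delta> n)) +
         q * (D * q powr s * N - D * q ^ n * N + q ^ n * norm (\<Delta> n)) + C * N"
        unfolding norm_mult N_def using pq less False
        by (intro add_mono mult_mono norm_binom_avg_le b s D) auto
      \<comment> \<open>The terms k = n of both averages are moved to the left; the remaining factor
        is positive for n > 0.\<close>
      finally have "norm (\<Delta> n) * (1 - p ^ Suc n - q ^ Suc n) \<le> D * N * (1 - p ^ Suc n - q ^ Suc n) - (D * c - C) * N"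
        unfolding c_def by (simp add: algebra_simps)
      also have "\<dots> \<le> D * N * (1 - p ^ Suc n - q ^ Suc n)" using D by (simp add: N_def)
      finally show ?thesis using e by (simp add: N_def)
    qed
  qed
  then show ?thesis using that D(1) unfolding \<Delta>_def by blast
qed

lemma difference_bound_imp:
  fixes mu :: "nat \<Rightarrow> complex"
  assumes D: "\<And>n. norm (mu (Suc n) - mu n) \<le> D * real n powr s" "D \<ge> 0" and s: "0 < s"
  shows "m \<le> n \<Longrightarrow> norm (mu n - mu m) \<le> D * real (n - m) * real n powr s"
proof (induction n rule: dec_induct)
  case (step n)
  have "norm (mu (Suc n) - mu m) \<le> norm (mu (Suc n) - mu n) + norm (mu n - mu m)"
    using norm_triangle_ineq[of "mu (Suc n) - mu n" "mu n - mu m"] by simp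
  also have "\<dots> \<le> D * real n powr s + D * real (n - m) * real n powr s" using D step by (intro add_mono) auto
  also have "\<dots> = D * real (Suc n - m) * real n powr s" using step by (simp add: Suc_diff_le algebra_simps)
  also have "\<dots> \<le> D * real (Suc n - m) * real (Suc n) powr s"
    using D s by (intro mult_left_mono powr_mono2) auto
  finally show ?case .
qed auto

lemma difference_bound_poly2:
  fixes mu :: "nat \<Rightarrow> complex"
  assumes D: "\<And>n. norm (mu (Suc n) - mu n) \<le> D * real n powr s" "D \<ge> 0" and s: "0 < s" "s \<le> 1"
    and mu0: "mu 0 = 0"
  shows "norm (mu n) \<le> D * (real n)\<^sup>2"
proof (cases "n = 0")
  case False
  have "norm (mu n) \<le> D * real n * real n powr s"
    using difference_bound_imp[OF D s(1), of 0 n] mu0 by simp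
  also have "\<dots> \<le> D * real n * real n powr 1" using False D s by (intro mult_left_mono powr_mono) auto
  finally show ?thesis by (simp add: power2_eq_square mult.assoc)
qed (use mu0 in simp)

lemma one_plus_powr_le: "0 < s \<Longrightarrow> s \<le> 1 \<Longrightarrow> t \<ge> 0 \<Longrightarrow> (1 + t) powr s \<le> 1 + (t::real)"
  using powr_mono[of s 1 "1 + t"] by simp

text \<open>The left side is at most the mean of |mu k - mu n| for a Poisson variable k with mean n.
  With t = |k - n| the difference is at most D t (n + t)^s, which is majorized by a quadratic in t,
  so only the variance n enters. For s < 1/2 the result is o(n).\<close>

lemma depoissonization:
  fixes mu :: "nat \<Rightarrow> complex"
  assumes D: "\<And>n. norm (mu (Suc n) - mu n) \<le> D * real n powr s" "D \<ge> 0" and s: "0 < s" "s \<le> 1"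
    and mu0: "mu 0 = 0" and n: "n > 0"
  shows "norm (ptrans mu (of_nat n) - mu n) \<le> D * real n powr s * (sqrt (real n) + 1)"
proof -
  define N where "N = real n"
  have N: "N > 0" using n by (simp add: N_def)
  \<comment> \<open>The bound t <= sqrt N / 2 + t^2 / (2 sqrt N) is the arithmetic-geometric mean
    inequality; the summand 1 / N of \<open>c1\<close> comes from (1 + t/N)^s <= 1 + t/N. Replacing
    t^2 by its mean N turns c0 + c1 t^2 into sqrt N + 1.\<close>
  define c0 where "c0 = sqrt N / 2"
  define c1 where "c1 = 1 / (2 * sqrt N) + 1 / N"
  define K where "K = D * N powr s"
  have K: "K \<ge> 0" using D by (simp add: K_def)
  define \<beta> where "\<beta> k = K * (c0 + c1 * (real k - N)\<^sup>2)" for k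
  \<comment> \<open>Rewritten in factorial moments, whose Poisson transforms are 1, z and
    z^2.\<close>
  have \<beta>': "\<beta> = (\<lambda>k. (K * (c0 + c1 * N\<^sup>2)) + (K * c1 * (real k * (real k - 1)) + K * c1 * (1 - 2 * N) * real k))"
    by (auto simp: \<beta>_def fun_eq_iff power2_eq_square algebra_simps)
  have e\<beta>: "entire_coeffs \<beta>" unfolding \<beta>'
    by (intro entire_coeffs_add entire_coeffs_const entire_coeffs_cmult entire_coeffs_of_nat entire_coeffs_of_nat2)
  have emu: "entire_coeffs mu" by (rule entire_coeffs_poly2[OF difference_bound_poly2[OF D s mu0]])
  have le: "norm (mu k - mu n) \<le> \<beta> k" for k
  proof -
    define t where "t = \<bar>real k - N\<bar>"
    have t: "t \<ge> 0" by (simp add: t_def)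
    have "norm (mu k - mu n) \<le> D * t * (N + t) powr s"
    proof (cases "n \<le> k")
      case True
      then show ?thesis using difference_bound_imp[OF D s(1) True] by (simp add: t_def N_def of_nat_diff)
    next
      case False
      then have kn: "k \<le> n" by simp
      have "norm (mu k - mu n) \<le> D * t * N powr s"
        using difference_bound_imp[OF D s(1) kn] kn by (simp add: t_def N_def of_nat_diff norm_minus_commute abs_if)
      also have "\<dots> \<le> D * t * (N + t) powr s" using D t N s by (intro mult_left_mono powr_mono2) auto
      finally show ?thesis .
    qed
    also have "(N + t) powr s = N powr s * (1 + t / N) powr s"
    proof -
      have "N + t = N * (1 + t / N)" using N by (simp add: field_simps)
      then show ?thesis using N t by (simp only: powr_mult)
    qed
    also have "D * t * (N powr s * (1 + t / N) powr s) \<le> D * t * (N powr s * (1 + t / N))"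
      using D t N s by (intro mult_left_mono one_plus_powr_le) auto
    also have "\<dots> = K * (t + t\<^sup>2 / N)" using N by (simp add: K_def power2_eq_square field_simps)
    also have "\<dots> \<le> K * (c0 + c1 * t\<^sup>2)"
    proof (rule mult_left_mono[OF _ K])
      have "0 \<le> (sqrt N - t)\<^sup>2" by simp
      then have "t * (2 * sqrt N) \<le> N + t\<^sup>2" using N by (simp add: power2_eq_square algebra_simps)
      then have "t \<le> (N + t\<^sup>2) / (2 * sqrt N)" using N by (subst pos_le_divide_eq) auto
      also have "\<dots> = sqrt N / 2 + t\<^sup>2 / (2 * sqrt N)" using N
        by (simp add: add_divide_distrib) (metis real_div_sqrt less_imp_le)
      finally show "t + t\<^sup>2 / N \<le> c0 + c1 * t\<^sup>2" unfolding c0_def c1_def by (simp add: distrib_right)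
    qed
    finally show ?thesis by (simp add: \<beta>_def t_def)
  qed
  have "ptrans mu (of_nat n) - mu n = ptrans (\<lambda>k. mu k - mu n) (of_nat n)"
    by (subst ptrans_diff[OF emu]) (simp_all add: ptrans_const)
  also have "norm \<dots> \<le> exp (norm (of_nat n :: complex) - Re (of_nat n)) * ptrans \<beta> (norm (of_nat n :: complex))"
    by (rule ptrans_norm_le[OF le e\<beta>])
  also have "\<dots> = ptrans \<beta> N" by (simp add: N_def)
  also have "\<dots> = K * (c0 + c1 * N\<^sup>2) + (K * c1 * N\<^sup>2 + K * c1 * (1 - 2 * N) * N)"
    unfolding \<beta>'
    by (simp add: ptrans_add ptrans_const ptrans_cmult ptrans_of_nat ptrans_of_nat2 entire_coeffs_add entire_coeffs_cmult
       entire_coeffs_of_nat entire_coeffs_of_nat2)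
  also have "\<dots> = K * (c0 + c1 * N)" by (simp add: power2_eq_square algebra_simps)
  also have "c0 + c1 * N = sqrt N + 1"
    using N by (simp add: c0_def c1_def field_simps)
  finally show ?thesis by (simp add: K_def N_def)
qed

section \<open>The renewal equation\<close>

text \<open>The tangent inequality for a convex power, from ln w <= w - 1. It makes the comparison
  function of \<open>comparison_bound\<close> a strict supersolution.\<close>

lemma powr_neg_ge_tangent:
  fixes u v d :: real
  assumes "u > 0" "v > 0" "d > 0"
  shows "u powr (- d) \<ge> v powr (- d) - d * v powr (- d - 1) * (u - v)"
proof -
  define w where "w = u / v"
  have w: "w > 0" using assms by (simp add: w_def)
  have "w powr (- d) \<ge> 1 - d * ln w"
    using exp_ge_add_one_self[of "- d * ln w"] w by (simp add: powr_def)
  moreover have "d * ln w \<le> d * (w - 1)" using ln_le_minus_one[OF w] assms by (intro mult_left_mono) auto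
  ultimately have "w powr (- d) \<ge> 1 - d * (w - 1)" by linarith
  then have "v powr (- d) * w powr (- d) \<ge> v powr (- d) * (1 - d * (w - 1))" by (intro mult_left_mono) auto
  moreover have "v powr (- d) * w powr (- d) = u powr (- d)" using assms w by (simp add: w_def flip: powr_mult)
  moreover have "v powr (- d - 1) = v powr (- d) / v" using assms by (simp add: powr_diff)
  moreover have "v powr (- d) * (1 - d * (w - 1)) = v powr (- d) - d * (v powr (- d) / v) * (u - v)"
    using assms by (simp add: w_def field_simps)
  ultimately show ?thesis by simp
qed

text \<open>A minimum principle started at minus infinity. If E x < 0, then E >= E x / 2 holds far
  to the left and propagates to the right in steps of length min a b; reaching x gives E x >= E x /
  2, which is impossible for a negative value.\<close>

lemma superharmonic_nonneg:
  fixes E :: "real \<Rightarrow> real"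
  assumes pq: "0 < p" "0 < q" "p + q = 1" and ab: "0 < a" "0 < b"
    and E: "\<And>x. E x \<ge> p * E (x - a) + q * E (x - b)"
    and lim: "\<And>\<epsilon>. \<epsilon> > 0 \<Longrightarrow> eventually (\<lambda>x. E x \<ge> - \<epsilon>) at_bot"
  shows "E x \<ge> 0"
proof (rule ccontr)
  assume "\<not> E x \<ge> 0"
  then have "- E x / 2 > 0" by simp
  from lim[OF this] obtain X where X: "\<And>y. y \<le> X \<Longrightarrow> E y \<ge> E x / 2"
    by (auto simp: eventually_at_bot_linorder)
  define m where "m = min a b"
  have m: "m > 0" using ab by (simp add: m_def)
  have "\<forall>y \<le> X + real n * m. E y \<ge> E x / 2" for n
  proof (induction n)
    case (Suc n)
    show ?case
    proof (intro allI impI)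
      fix y assume y: "y \<le> X + real (Suc n) * m"
      have "y - a \<le> X + real n * m" "y - b \<le> X + real n * m" using y by (auto simp: m_def algebra_simps min_def split: if_splits)
      then have "E (y - a) \<ge> E x / 2" "E (y - b) \<ge> E x / 2" using Suc by auto
      then have "p * E (y - a) + q * E (y - b) \<ge> p * (E x / 2) + q * (E x / 2)"
        using pq by (intro add_mono mult_left_mono) auto
      moreover have "p * (E x / 2) + q * (E x / 2) = E x / 2" using pq by (metis distrib_right mult_1)
      ultimately show "E y \<ge> E x / 2" using E[of y] by linarith
    qed
  qed (use X in auto)
  moreover obtain n :: nat where "real n * m > x - X" using reals_Archimedean3[OF m] by blast
  then have "x \<le> X + real n * m" by simp
  ultimately have "E x \<ge> E x / 2" by blast
  then show False using \<open>\<not> E x \<ge> 0\<close> by simp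
qed

lemma has_integral_near_const:
  fixes G :: "real \<Rightarrow> complex"
  assumes "(G has_integral I) {x - c..x}" "c \<ge> 0" "\<And>t. t \<in> {x - c..x} \<Longrightarrow> norm (G t - g) \<le> e" "e \<ge> 0"
  shows "norm (I - of_real c * g) \<le> e * c"
proof -
  have "((\<lambda>t. G t - g) has_integral I - of_real c * g) {x - c..x}"
    using has_integral_diff[OF assms(1) has_integral_const_real[of g "x - c" x]] assms(2)
    by (simp add: scaleR_conv_of_real)
  from has_integral_bound_real[OF assms(4) finite.emptyI this] assms(3) show ?thesis
    using assms(2) by simp
qed

text \<open>In the application f is the Poisson transform of the means. The weight x^2 (1 +
  x)^(-1-\<delta>) records both ends: a double zero of B at 0 and growth at most x^(1-\<delta>) at
  infinity. Each derivative costs one power of x, as Cauchy estimates on discs of radius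
  proportional to x provide.\<close>

locale renewal_equation =
  fixes p q \<delta> K :: real and f f' B B' B'' :: "complex \<Rightarrow> complex"
  assumes p: "0 < p" and q: "0 < q" and pq: "p + q = 1" and \<delta>: "0 < \<delta>" and K: "0 \<le> K"
    and f: "\<And>z. (f has_field_derivative f' z) (at z)"
    and f'_cont: "isCont f' 0"
    and f0: "f 0 = 0" "f' 0 = 0"
    and B: "\<And>z. (B has_field_derivative B' z) (at z)"
    and B': "\<And>z. (B' has_field_derivative B'' z) (at z)"
    and B''_cont: "continuous_on UNIV B''"
    and feq: "\<And>z. f z = f (of_real p * z) + f (of_real q * z) + B z"
    and B_bound: "\<And>x. x > 0 \<Longrightarrow> norm (B (of_real x)) \<le> K * x\<^sup>2 * (1 + x) powr (- 1 - \<delta>)"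
    and B'_bound: "\<And>x. x > 0 \<Longrightarrow> norm (B' (of_real x)) \<le> K * x * (1 + x) powr (- 1 - \<delta>)"
    and B''_bound: "\<And>x. x > 0 \<Longrightarrow> norm (B'' (of_real x)) \<le> K * (1 + x) powr (- 1 - \<delta>)"
begin

definition a where "a = - ln p"
definition b where "b = - ln q"
definition G where "G x = f (of_real (exp x)) / of_real (exp x)" for x :: real
definition \<phi> where "\<phi> x = B (of_real (exp x)) / of_real (exp x)" for x :: real
text \<open>This is the derivative of G. It solves the renewal equation with source \<psi>, so one
  comparison argument bounds G and makes it Lipschitz.\<close>

definition H where "H x = f' (of_real (exp x)) - G x" for x :: real
definition \<psi> where "\<psi> x = B' (of_real (exp x)) - \<phi> x" for x :: real

lemma p1: "p < 1" and q1: "q < 1" using p q pq by auto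

lemma a_pos: "a > 0" and b_pos: "b > 0"
  using p q p1 q1 by (auto simp: a_def b_def)

lemma exp_a: "exp (x - a) = p * exp x" and exp_b: "exp (x - b) = q * exp x"
  using p q by (simp_all add: a_def b_def exp_add)

lemma G_eq: "G x = \<phi> x + of_real p * G (x - a) + of_real q * G (x - b)"
proof -
  have "G x = (f (of_real p * of_real (exp x)) + f (of_real q * of_real (exp x)) + B (of_real (exp x))) / of_real (exp x)"
    unfolding G_def by (subst feq) simp
  also have "\<dots> = \<phi> x + of_real p * G (x - a) + of_real q * G (x - b)"
    unfolding G_def \<phi>_def exp_a exp_b using p q by (simp add: add_divide_distrib)
  finally show ?thesis .
qed

lemma f'_eq: "f' z = of_real p * f' (of_real p * z) + of_real q * f' (of_real q * z) + B' z"
proof -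
  have "((\<lambda>z. f (of_real p * z) + f (of_real q * z) + B z) has_field_derivative
      f' (of_real p * z) * of_real p + f' (of_real q * z) * of_real q + B' z) (at z)"
    by (intro DERIV_add B DERIV_chain2[OF f] DERIV_cmult_Id)
  moreover have "(\<lambda>z. f (of_real p * z) + f (of_real q * z) + B z) = f" by (rule ext) (rule feq[symmetric])
  ultimately have "(f has_field_derivative f' (of_real p * z) * of_real p + f' (of_real q * z) * of_real q + B' z) (at z)"
    by simp
  from DERIV_unique[OF f this] show ?thesis by (simp add: mult.commute)
qed

lemma H_eq: "H x = \<psi> x + of_real p * H (x - a) + of_real q * H (x - b)"
proof -
  have "f' (of_real (exp x)) = of_real p * f' (of_real (exp (x - a))) + of_real q * f' (of_real (exp (x - b))) + B' (of_real (exp x))"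
    unfolding exp_a exp_b using f'_eq[of "of_real (exp x)"] by simp
  then show ?thesis unfolding H_def \<psi>_def using G_eq[of x] by (simp add: algebra_simps)
qed

lemma exp_vector_derivative:
  assumes "(g has_field_derivative g') (at (of_real (exp x)))"
  shows "((\<lambda>x. g (complex_of_real (exp x))) has_vector_derivative g' * of_real (exp x)) (at x)"
proof -
  have "((\<lambda>z. g (exp z)) has_field_derivative g' * exp (of_real x)) (at (of_real x))"
    by (rule DERIV_chain2[where f=g and g=exp]) (use assms DERIV_exp[of "complex_of_real x"] in \<open>auto simp del: of_real_exp simp: exp_of_real\<close>)
  from has_vector_derivative_real_field[OF this] show ?thesis by (simp add: exp_of_real)
qed

lemma G_deriv: "(G has_vector_derivative H x) (at x)"
proof -
  have "((\<lambda>z. f z / z) has_field_derivative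
      (f' (of_real (exp x)) * of_real (exp x) - f (of_real (exp x))) / (of_real (exp x) * of_real (exp x))) (at (of_real (exp x)))"
    by (rule DERIV_cong[OF DERIV_divide[OF f DERIV_ident]]) (auto simp: power2_eq_square)
  note * = exp_vector_derivative[OF this]
  have "(u * E - v) / (E * E) * E = u - v / E" if "E \<noteq> 0" for u v E :: complex
    using that by (simp add: field_simps)
  from this[of "of_real (exp x)"] * show ?thesis unfolding G_def[abs_def] H_def by (simp only: of_real_eq_0_iff exp_not_eq_zero not_False_eq_True)
qed

lemma G_cont: "isCont G x" by (rule has_vector_derivative_continuous[OF G_deriv])

lemma B_continuous: "continuous_on A B" "continuous_on A B'"
  by (rule continuous_at_imp_continuous_on, intro ballI, rule DERIV_isCont, rule B B')+

lemma bump_bound: "norm (\<phi> x) \<le> K * (exp x * (1 + exp x) powr (- 1 - \<delta>))"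
  "norm (\<psi> x) \<le> 2 * K * (exp x * (1 + exp x) powr (- 1 - \<delta>))"
proof -
  show 1: "norm (\<phi> x) \<le> K * (exp x * (1 + exp x) powr (- 1 - \<delta>))"
    using B_bound[of "exp x"] by (simp add: \<phi>_def norm_divide power2_eq_square field_simps)
  have "norm (\<psi> x) \<le> norm (B' (of_real (exp x))) + norm (\<phi> x)" unfolding \<psi>_def by (rule norm_triangle_ineq4)
  then show "norm (\<psi> x) \<le> 2 * K * (exp x * (1 + exp x) powr (- 1 - \<delta>))"
    using 1 B'_bound[of "exp x"] by (simp add: mult.assoc)
qed

lemma \<phi>_decay: "norm (\<phi> x) \<le> K * exp (- \<delta> * x)"
proof -
  have "(1 + exp x) powr (- 1 - \<delta>) \<le> exp x powr (- 1 - \<delta>)" using \<delta> by (intro powr_mono2') auto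
  also have "exp x * exp x powr (- 1 - \<delta>) = exp (- \<delta> * x)"
    by (simp add: exp_powr_real flip: exp_add) (simp add: algebra_simps)
  finally have "exp x * (1 + exp x) powr (- 1 - \<delta>) \<le> exp (- \<delta> * x)" by simp
  then show ?thesis using bump_bound(1)[of x] K by (meson mult_left_mono order_trans)
qed

lemma \<phi>_tendsto: "(\<phi> \<longlongrightarrow> 0) at_top"
proof (rule Lim_null_comparison)
  show "\<forall>\<^sub>F x in at_top. norm (\<phi> x) \<le> K * exp (- \<delta> * x)" by (intro always_eventually allI \<phi>_decay)
  show "((\<lambda>x. K * exp (- \<delta> * x)) \<longlongrightarrow> 0) at_top" using \<delta> by real_asymp
qed

lemma exp_at_bot_at_0: "filterlim (\<lambda>x::real. complex_of_real (exp x)) (at 0) at_bot"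
proof -
  have "((\<lambda>x::real. complex_of_real (exp x)) \<longlongrightarrow> of_real 0) at_bot"
    by (intro tendsto_of_real exp_at_bot)
  then show ?thesis by (simp add: filterlim_at)
qed

lemma G_at_bot: "(G \<longlongrightarrow> 0) at_bot"
proof -
  have "((\<lambda>z. f z / z) \<longlongrightarrow> 0) (at 0)" using f[of 0] f0 by (simp add: DERIV_def)
  from filterlim_compose[OF this exp_at_bot_at_0] show ?thesis by (simp add: G_def[abs_def])
qed

lemma H_at_bot: "(H \<longlongrightarrow> 0) at_bot"
proof -
  have "(f' \<longlongrightarrow> 0) (at 0)" using f'_cont f0 by (simp add: isCont_def)
  from filterlim_compose[OF this exp_at_bot_at_0] have "((\<lambda>x. f' (of_real (exp x)) - G x) \<longlongrightarrow> 0 - 0) at_bot"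
    by (intro tendsto_diff G_at_bot)
  then show ?thesis by (simp add: H_def[abs_def])
qed

text \<open>Comparison with the bounded strict supersolution \<open>1 - (1 + e\<^sup>x) powr (-\<delta>)\<close>.\<close>

lemma comparison_bound:
  fixes Z \<zeta> :: "real \<Rightarrow> complex"
  assumes Z: "\<And>x. Z x = \<zeta> x + of_real p * Z (x - a) + of_real q * Z (x - b)"
    and \<zeta>: "\<And>x. norm (\<zeta> x) \<le> L * (exp x * (1 + exp x) powr (- 1 - \<delta>))"
    and lim: "(Z \<longlongrightarrow> 0) at_bot" and L: "L \<ge> 0"
  shows "norm (Z x) \<le> L / (2 * p * q * \<delta>)"
proof -
  define S where "S x = 1 - (1 + exp x) powr (- \<delta>)" for x :: real
  \<comment> \<open>Chosen so that c times the defect of S under the renewal step majorizes the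
    source; then \<open>c * S x - norm (Z x)\<close> is superharmonic and asymptotically nonnegative
    at minus infinity.\<close>
  define c where "c = L / (2 * p * q * \<delta>)"
  have c: "c \<ge> 0" using L p q \<delta> by (simp add: c_def)
  define e where "e x = exp x * (1 + exp x) powr (- 1 - \<delta>)" for x :: real
  have S: "S x - p * S (x - a) - q * S (x - b) \<ge> 2 * p * q * \<delta> * e x" for x
  proof -
    define y where "y = exp x"
    have y: "y > 0" by (simp add: y_def)
    \<comment> \<open>The tangent at 1 + y, evaluated at 1 + r y for r = p and r = q. The weighted
      defects p (1 - p) + q (1 - q) = 2 p q explain the constant.\<close>
    have *: "(1 + r * y) powr (- \<delta>) - (1 + y) powr (- \<delta>) \<ge> \<delta> * (1 - r) * e x" if r: "r > 0" for r
      using powr_neg_ge_tangent[of "1 + r * y" "1 + y" \<delta>] r y \<delta> add_pos_pos[of 1 "r * y"]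
      by (simp add: e_def y_def[symmetric] algebra_simps minus_diff_commute)
    have "S x - p * S (x - a) - q * S (x - b) =
       p * ((1 + p * y) powr (- \<delta>) - (1 + y) powr (- \<delta>)) + q * ((1 + q * y) powr (- \<delta>) - (1 + y) powr (- \<delta>))"
    proof -
      have q': "q = 1 - p" using pq by simp
      show ?thesis unfolding S_def exp_a exp_b y_def[symmetric] unfolding q' by (simp add: algebra_simps)
    qed
    also have "\<dots> \<ge> p * (\<delta> * (1 - p) * e x) + q * (\<delta> * (1 - q) * e x)"
      using *[OF p] *[OF q] p q by (intro add_mono mult_left_mono) auto
    also have "p * (\<delta> * (1 - p) * e x) + q * (\<delta> * (1 - q) * e x) = 2 * p * q * \<delta> * e x"
    proof -
      have "1 - p = q" "1 - q = p" using pq by auto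
      then show ?thesis by simp
    qed
    finally show ?thesis .
  qed
  have "c * S x - norm (Z x) \<ge> 0"
  proof (rule superharmonic_nonneg[OF p q pq a_pos b_pos, of "\<lambda>x. c * S x - norm (Z x)"])
    fix x
    have "norm (Z x) \<le> norm (\<zeta> x) + norm (of_real p * Z (x - a)) + norm (of_real q * Z (x - b))"
      by (subst Z) (intro order_trans[OF norm_triangle_ineq] add_mono norm_triangle_ineq order_refl)
    also have "\<dots> \<le> L * e x + p * norm (Z (x - a)) + q * norm (Z (x - b))"
      using \<zeta>[of x] p q by (simp add: norm_mult e_def)
    also have "L * e x = c * (2 * p * q * \<delta> * e x)" using p q \<delta> by (simp add: c_def)
    also have "\<dots> \<le> c * (S x - p * S (x - a) - q * S (x - b))" by (rule mult_left_mono[OF S c])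
    finally show "p * (c * S (x - a) - norm (Z (x - a))) + q * (c * S (x - b) - norm (Z (x - b))) \<le> c * S x - norm (Z x)"
      by (simp add: algebra_simps)
  next
    fix \<epsilon> :: real assume "\<epsilon> > 0"
    have S0: "S x \<ge> 0" for x
    proof -
      have "(1 + exp x) powr (- \<delta>) \<le> (1 + exp x) powr 0" using \<delta> by (intro powr_mono) auto
      then show ?thesis using exp_gt_zero[of x] by (simp add: S_def add_pos_pos split: if_splits)
    qed
    have "\<forall>\<^sub>F x in at_bot. norm (Z x) < \<epsilon>"
      using tendstoD[OF lim \<open>\<epsilon> > 0\<close>] by simp
    then show "\<forall>\<^sub>F x in at_bot. - \<epsilon> \<le> c * S x - norm (Z x)"
    proof eventually_elim
      case (elim x)
      have "c * S x \<ge> 0" using c S0 by simp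
      then show ?case using elim by linarith
    qed
  qed
  moreover have "c * S x \<le> c * 1" using c by (intro mult_left_mono) (auto simp: S_def)
  ultimately show ?thesis by (simp add: c_def)
qed

text \<open>The comparison bound for the source constant 2 K of H, which also covers the constant K
  of G.\<close>

definition M where "M = 2 * K / (2 * p * q * \<delta>)"

lemma M0: "M \<ge> 0" using K p q \<delta> by (simp add: M_def)

lemma G_bound: "norm (G x) \<le> M"
proof -
  have "norm (G x) \<le> K / (2 * p * q * \<delta>)"
    by (rule comparison_bound[OF G_eq bump_bound(1) G_at_bot K])
  also have "\<dots> \<le> M" unfolding M_def using K p q \<delta> by (intro divide_right_mono) auto
  finally show ?thesis .
qed

lemma H_bound: "norm (H x) \<le> M"
  unfolding M_def by (rule comparison_bound[OF H_eq bump_bound(2) H_at_bot]) (use K in auto)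

lemma G_lipschitz: "norm (G x - G y) \<le> M * \<bar>x - y\<bar>"
proof -
  have *: "norm (G x - G y) \<le> M * (x - y)" if "y \<le> x" for x y
  proof -
    have "(H has_integral G x - G y) {y..x}"
      by (rule fundamental_theorem_of_calculus[OF that]) (rule has_vector_derivative_at_within[OF G_deriv])
    from has_integral_bound_real[OF M0 finite.emptyI this] H_bound show ?thesis using that by simp
  qed
  show ?thesis using *[of x y] *[of y x] by (cases "y \<le> x") (auto simp: norm_minus_commute abs_if)
qed

lemma G_shift: "((\<lambda>x. G (x - (real j1 * a + real k1 * b)) - G (x - (real j2 * a + real k2 * b))) \<longlongrightarrow> 0) at_top"
  by (rule renewal_shift_tendsto[OF p q pq a_pos b_pos G_eq G_bound \<phi>_tendsto])

end

section \<open>Mellin values as limits, and convergence in the non-lattice case\<close>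

lemma antiderivative_real_line:
  fixes g :: "real \<Rightarrow> complex"
  assumes "\<And>x. isCont g x"
  obtains \<Gamma> where "\<And>x. (\<Gamma> has_vector_derivative g x) (at x)"
proof -
  have "\<exists>F. \<forall>x :: real. -\<infinity> < ereal x \<longrightarrow> ereal x < \<infinity> \<longrightarrow> (F has_vector_derivative g x) (at x)"
    by (rule einterval_antiderivative) (use assms in auto)
  then show ?thesis using that by auto
qed

lemma filterlim_minus_const_at_top: "filterlim (\<lambda>x::real. x - u) at_top at_top"
  using filterlim_tendsto_add_at_top[OF tendsto_const[of "-u"] filterlim_ident] by (simp add: add.commute)

lemma filterlim_plus_const_at_top: "filterlim (\<lambda>x::real. x + u) at_top at_top"
  using filterlim_minus_const_at_top[of "-u"] by simp

context renewal_equation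
begin

text \<open>The weight is O(x^2) at 0 and O(x^(1-\<delta>)) at infinity. The resulting strip
  contains the line Re s = -1, where all Mellin values of the limit and of its Fourier series
  lie.\<close>

lemma mellin_integrable_bump:
  assumes cont: "continuous_on {0<..} (\<lambda>x::real. F (of_real x))"
    and b: "\<And>x. x > 0 \<Longrightarrow> norm (F (of_real x)) \<le> L * x\<^sup>2 * (1 + x) powr (- 1 - \<delta>)"
    and L: "L \<ge> 0" and s: "-2 < Re s" "Re s < - 1 + \<delta>"
  shows "mellin_integrable F s"
proof (rule mellin_integrable_bound[OF cont, where C=L and u=2 and v="1 - \<delta>"])
  fix x :: real assume x: "0 < x"
  have "(1 + x) powr (- 1 - \<delta>) \<le> 1 powr (- 1 - \<delta>)" using \<delta> x by (intro powr_mono2') auto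
  then have "L * x\<^sup>2 * (1 + x) powr (- 1 - \<delta>) \<le> L * x\<^sup>2 * 1" using L by (intro mult_left_mono) auto
  then show "norm (F (of_real x)) \<le> L * x powr 2" using b[OF x] x by simp
next
  fix x :: real assume x: "1 \<le> x"
  have "(1 + x) powr (- 1 - \<delta>) \<le> x powr (- 1 - \<delta>)" using \<delta> x by (intro powr_mono2') auto
  then have "L * x\<^sup>2 * (1 + x) powr (- 1 - \<delta>) \<le> L * x\<^sup>2 * x powr (- 1 - \<delta>)" using L by (intro mult_left_mono) auto
  also have "\<dots> = L * x powr (1 - \<delta>)"
  proof -
    have "x\<^sup>2 * x powr (- 1 - \<delta>) = x powr 2 * x powr (- 1 - \<delta>)" using x by simp
    also have "\<dots> = x powr (1 - \<delta>)" unfolding powr_add[symmetric] by simp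
    finally show ?thesis by (simp only: mult.assoc)
  qed
  finally show "norm (F (of_real x)) \<le> L * x powr (1 - \<delta>)" using b[of x] x by simp
qed (use s in auto)

lemma mellin_B_integrable: "-2 < Re s \<Longrightarrow> Re s < - 1 + \<delta> \<Longrightarrow> mellin_integrable B s"
  by (rule mellin_integrable_bump[where F=B, OF continuous_on_compose_of_real[OF B_continuous(1)] B_bound K])

text \<open>The substitution y = exp x turns the integral of \<phi>(x) exp(\<omega> x) over the real
  line into the Mellin integral of B at -1 + \<omega>.\<close>

lemma mellin_limit:
  assumes A: "\<And>x. (A has_vector_derivative \<phi> x * exp (\<omega> * of_real x)) (at x)"
    and A0: "(A \<longlongrightarrow> 0) at_bot" and \<omega>: "Re \<omega> = 0"
  shows "(A \<longlongrightarrow> mellin B (- 1 + \<omega>)) at_top"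
proof -
  have "((\<lambda>y. A (ln y)) \<longlongrightarrow> mellin B (- 1 + \<omega>)) at_top"
  proof (rule mellin_FTC)
    show "mellin_integrable B (- 1 + \<omega>)" by (rule mellin_B_integrable) (use \<omega> \<delta> in auto)
    show "continuous_on {0<..} (\<lambda>x::real. B (of_real x))"
      by (rule continuous_on_compose_of_real[OF B_continuous(1)])
    show "((\<lambda>y. A (ln y)) \<longlongrightarrow> 0) (at_right 0)"
      by (rule filterlim_compose[where g=A, OF A0 ln_at_0])
    fix y :: real assume y: "y > 0"
    have "((A \<circ> ln) has_vector_derivative (1 / y) *\<^sub>R (\<phi> (ln y) * exp (\<omega> * of_real (ln y)))) (at y)"
    proof (rule vector_diff_chain_at[OF _ A])
      show "(ln has_vector_derivative 1 / y) (at y)"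
        using DERIV_ln_divide[OF y] by (simp add: has_real_derivative_iff_has_vector_derivative)
    qed
    moreover have "(1 / y) *\<^sub>R (\<phi> (ln y) * exp (\<omega> * of_real (ln y))) = B (of_real y) * of_real y powr ((- 1 + \<omega>) - 1)"
    proof -
      let ?l = "complex_of_real (ln y)"
      have "((- 1 + \<omega>) - 1) * ?l = \<omega> * ?l - ?l - ?l" by (simp add: left_diff_distrib distrib_right)
      then have "of_real y powr ((- 1 + \<omega>) - 1) = exp (\<omega> * ?l - ?l - ?l)"
        by (simp only: of_real_powr_exp[OF y])
      also have "\<dots> = exp (\<omega> * ?l) / (exp ?l * exp ?l)" by (simp only: exp_diff divide_divide_eq_left)
      also have "exp ?l = of_real y" using y by (simp only: exp_of_real exp_ln)
      finally have e: "of_real y powr ((- 1 + \<omega>) - 1) = exp (\<omega> * ?l) / (of_real y * of_real y)" .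
      have "(1 / y) *\<^sub>R (\<phi> (ln y) * exp (\<omega> * ?l)) = B (of_real y) * (exp (\<omega> * ?l) / (of_real y * of_real y))"
        unfolding \<phi>_def exp_ln[OF y] by (simp add: scaleR_conv_of_real)
      then show ?thesis by (simp only: e)
    qed
    ultimately show "((\<lambda>y. A (ln y)) has_vector_derivative B (of_real y) * of_real y powr ((- 1 + \<omega>) - 1)) (at y)"
      by (simp add: comp_def)
  qed
  then have "((\<lambda>x. A (ln (exp x))) \<longlongrightarrow> mellin B (- 1 + \<omega>)) at_top"
    by (rule filterlim_compose[where g="\<lambda>y. A (ln y)"]) (rule exp_at_top)
  then show ?thesis by simp
qed

definition h where "h = p * a + q * b"

lemma h_pos: "h > 0" unfolding h_def using p q a_pos b_pos by (simp add: add_pos_pos)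

text \<open>Density of differences of lattice steps together with the Lipschitz bound extends
  asymptotic invariance to all real shifts, uniformly on bounded windows. The value of the limit
  comes from W, which converges by \<open>mellin_limit\<close> and is asymptotic to h G.\<close>

lemma G_tendsto_nonlattice:
  assumes dense: "\<And>u \<epsilon>. \<epsilon> > 0 \<Longrightarrow> \<exists>j1 k1 j2 k2. \<bar>(real j1 * a + real k1 * b) - (real j2 * a + real k2 * b) - u\<bar> < \<epsilon>"
  shows "(G \<longlongrightarrow> mellin B (- 1) / of_real h) at_top"
proof -
  have sh: "((\<lambda>x. G (x - u) - G x) \<longlongrightarrow> 0) at_top" for u
  proof (rule tendstoI)
    fix e :: real assume e: "e > 0"
    define e' where "e' = e / (2 * (M + 1))"
    have e': "e' > 0" using e M0 by (simp add: e'_def)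
    obtain j1 k1 j2 k2 where jk: "\<bar>(real j1 * a + real k1 * b) - (real j2 * a + real k2 * b) - u\<bar> < e'"
      using dense[OF e'] by blast
    define v w where "v = real j1 * a + real k1 * b" and "w = real j2 * a + real k2 * b"
    have "((\<lambda>x. G (x + w - v) - G (x + w - w)) \<longlongrightarrow> 0) at_top"
      unfolding v_def w_def by (rule filterlim_compose[OF G_shift filterlim_plus_const_at_top])
    from tendstoD[OF this half_gt_zero[OF e]]
    show "\<forall>\<^sub>F x in at_top. dist (G (x - u) - G x) 0 < e"
    proof eventually_elim
      case (elim x)
      have "norm (G (x - u) - G (x + w - v)) \<le> M * \<bar>(x - u) - (x + w - v)\<bar>" by (rule G_lipschitz)
      also have "\<dots> \<le> M * e'" using jk M0 by (intro mult_left_mono) (auto simp: v_def w_def)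
      also have "\<dots> \<le> e / 2" using e M0 by (simp add: e'_def field_simps)
      finally have 1: "norm (G (x - u) - G (x + w - v)) \<le> e / 2" .
      have "norm (G (x - u) - G x) \<le> norm (G (x - u) - G (x + w - v)) + norm (G (x + w - v) - G x)"
        using norm_triangle_ineq[of "G (x - u) - G (x + w - v)" "G (x + w - v) - G x"] by simp
      then show ?case using 1 elim by simp
    qed
  qed
  \<comment> \<open>A net of N + 1 shifts with spacing e' covers the window of length c; between net
    points the Lipschitz bound takes over.\<close>
  have unif: "\<forall>\<^sub>F x in at_top. \<forall>t\<in>{x - c..x}. norm (G t - G x) \<le> e" if e: "e > 0" and c: "c > 0" for e c
  proof -
    define e' where "e' = e / (2 * (M + 1))"
    have e': "e' > 0" using e M0 by (simp add: e'_def)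
    obtain N :: nat where N: "real N * e' > c" using reals_Archimedean3[OF e'] by blast
    have "\<forall>\<^sub>F x in at_top. \<forall>i\<in>{..N}. norm (G (x - real i * e') - G x) < e / 2"
      by (intro eventually_ball_finite ballI) (use tendstoD[OF sh half_gt_zero[OF e]] in auto)
    then show ?thesis
    proof eventually_elim
      case (elim x)
      show ?case
      proof
        fix t assume t: "t \<in> {x - c..x}"
        define i where "i = nat \<lfloor>(x - t) / e'\<rfloor>"
        have q0: "(x - t) / e' \<ge> 0" using t e' by simp
        have ri: "real i = of_int \<lfloor>(x - t) / e'\<rfloor>" using q0 by (simp add: i_def)
        have "real i \<le> (x - t) / e'" "(x - t) / e' < real i + 1" unfolding ri by linarith+
        then have i: "real i * e' \<le> x - t" "x - t < (real i + 1) * e'" using e' by (simp_all add: field_simps)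
        have "real i * e' < real N * e'" using i(1) t N by auto
        then have iN: "i \<le> N" using e' by simp
        have "norm (G t - G (x - real i * e')) \<le> M * \<bar>t - (x - real i * e')\<bar>" by (rule G_lipschitz)
        also have "\<dots> \<le> M * e'"
        proof (rule mult_left_mono[OF _ M0])
          show "\<bar>t - (x - real i * e')\<bar> \<le> e'" using i by (simp add: distrib_right)
        qed
        also have "\<dots> \<le> e / 2" using e M0 by (simp add: e'_def field_simps)
        finally have "norm (G t - G (x - real i * e')) \<le> e / 2" .
        moreover have "norm (G (x - real i * e') - G x) < e / 2" using elim iN by auto
        ultimately show "norm (G t - G x) \<le> e"
          using norm_triangle_ineq[of "G t - G (x - real i * e')" "G (x - real i * e') - G x"] by simp
      qed
    qed
  qed
  obtain \<Gamma> where \<Gamma>: "\<And>x. (\<Gamma> has_vector_derivative G x) (at x)"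
    by (rule antiderivative_real_line[OF G_cont]) (rule that)
  have \<Gamma>i: "(G has_integral \<Gamma> x - \<Gamma> (x - c)) {x - c..x}" if "c > 0" for x c
    by (rule fundamental_theorem_of_calculus) (use that in \<open>auto intro!: has_vector_derivative_at_within[OF \<Gamma>]\<close>)
  have \<Gamma>bot: "((\<lambda>x. \<Gamma> x - \<Gamma> (x - c)) \<longlongrightarrow> 0) at_bot" if c: "c > 0" for c
  proof (rule tendstoI)
    fix e :: real assume e: "e > 0"
    have "\<forall>\<^sub>F x in at_bot. norm (G x) < e / (2 * c)" using tendstoD[OF G_at_bot, of "e / (2 * c)"] e c by simp
    then obtain X where X: "\<And>x. x \<le> X \<Longrightarrow> norm (G x) < e / (2 * c)" by (auto simp: eventually_at_bot_linorder)
    show "\<forall>\<^sub>F x in at_bot. dist (\<Gamma> x - \<Gamma> (x - c)) 0 < e"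
      unfolding eventually_at_bot_linorder
    proof (intro exI allI impI)
      fix x assume x: "x \<le> X"
      have "norm (\<Gamma> x - \<Gamma> (x - c) - of_real c * 0) \<le> e / (2 * c) * c"
        by (rule has_integral_near_const[OF \<Gamma>i[OF c]]) (use c e X x in \<open>auto intro: less_imp_le\<close>)
      then show "dist (\<Gamma> x - \<Gamma> (x - c)) 0 < e" using c e by simp
    qed
  qed
  have \<Gamma>top: "((\<lambda>x. \<Gamma> x - \<Gamma> (x - c) - of_real c * G x) \<longlongrightarrow> 0) at_top" if c: "c > 0" for c
  proof (rule tendstoI)
    fix e :: real assume e: "e > 0"
    have "\<forall>\<^sub>F x in at_top. \<forall>t\<in>{x - c..x}. norm (G t - G x) \<le> e / (2 * c)" using unif[of "e / (2 * c)" c] e c by simp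
    then show "\<forall>\<^sub>F x in at_top. dist (\<Gamma> x - \<Gamma> (x - c) - of_real c * G x) 0 < e"
    proof eventually_elim
      case (elim x)
      have "norm (\<Gamma> x - \<Gamma> (x - c) - of_real c * G x) \<le> e / (2 * c) * c"
        by (rule has_integral_near_const[OF \<Gamma>i[OF c]]) (use c e elim in auto)
      then show ?case using c e by simp
    qed
  qed
  \<comment> \<open>The expected integral of G over the last step. By the renewal equation its
    derivative is \<phi>, and near constancy of G on windows gives W x - h G x -> 0 with h the mean
    step.\<close>
  define W where "W x = of_real p * (\<Gamma> x - \<Gamma> (x - a)) + of_real q * (\<Gamma> x - \<Gamma> (x - b))" for x
  have \<Gamma>s: "((\<lambda>x. \<Gamma> (x - c)) has_vector_derivative G (x - c)) (at x)" for x c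
  proof -
    have "((\<lambda>x::real. x - c) has_vector_derivative 1) (at x)"
      by (auto intro!: derivative_eq_intros simp flip: has_real_derivative_iff_has_vector_derivative)
    from vector_diff_chain_at[OF this, of \<Gamma> "G (x - c)"] \<Gamma>[of "x - c"] show ?thesis by (simp add: comp_def)
  qed
  have "(W \<longlongrightarrow> mellin B (- 1 + 0)) at_top"
  proof (rule mellin_limit)
    fix x
    have "(W has_vector_derivative of_real p * (G x - G (x - a)) + of_real q * (G x - G (x - b))) (at x)"
      unfolding W_def by (intro has_vector_derivative_add has_vector_derivative_mult_right has_vector_derivative_diff \<Gamma> \<Gamma>s)
    moreover have "of_real p * (G x - G (x - a)) + of_real q * (G x - G (x - b)) = \<phi> x * exp (0 * of_real x)"
    proof -
      have "complex_of_real p + of_real q = 1" by (simp only: of_real_add[symmetric] pq of_real_1)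
      then have "of_real p * G x + of_real q * G x = G x" by (simp flip: distrib_right)
      then have "of_real p * (G x - G (x - a)) + of_real q * (G x - G (x - b)) =
          G x - (of_real p * G (x - a) + of_real q * G (x - b))" by (simp add: right_diff_distrib)
      also have "\<dots> = \<phi> x" by (subst G_eq) simp
      finally show ?thesis by simp
    qed
    ultimately show "(W has_vector_derivative \<phi> x * exp (0 * of_real x)) (at x)" by simp
  next
    have "(W \<longlongrightarrow> of_real p * 0 + of_real q * 0) at_bot"
      unfolding W_def[abs_def] by (intro tendsto_intros \<Gamma>bot a_pos b_pos)
    then show "(W \<longlongrightarrow> 0) at_bot" by simp
  qed simp
  then have Wlim: "(W \<longlongrightarrow> mellin B (- 1)) at_top" by simp
  have "((\<lambda>x. of_real p * (\<Gamma> x - \<Gamma> (x - a) - of_real a * G x) + of_real q * (\<Gamma> x - \<Gamma> (x - b) - of_real b * G x)) \<longlongrightarrow>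
      of_real p * 0 + of_real q * 0) at_top"
    by (intro tendsto_intros \<Gamma>top a_pos b_pos)
  moreover have "(\<lambda>x. of_real p * (\<Gamma> x - \<Gamma> (x - a) - of_real a * G x) + of_real q * (\<Gamma> x - \<Gamma> (x - b) - of_real b * G x))
      = (\<lambda>x. W x - of_real h * G x)"
  proof
    fix x
    have "P * (u - A * g) + Q * (v - C * g) = P * u + Q * v - (P * A + Q * C) * g" for P Q A C g u v :: complex
      by (simp add: algebra_simps)
    then show "of_real p * (\<Gamma> x - \<Gamma> (x - a) - of_real a * G x) + of_real q * (\<Gamma> x - \<Gamma> (x - b) - of_real b * G x)
      = W x - of_real h * G x" unfolding W_def h_def of_real_add of_real_mult .
  qed
  ultimately have "((\<lambda>x. W x - of_real h * G x) \<longlongrightarrow> 0) at_top" by simp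
  from tendsto_divide[OF tendsto_diff[OF Wlim this] tendsto_const[of "of_real h"]] h_pos
  have "((\<lambda>x. (W x - (W x - of_real h * G x)) / of_real h) \<longlongrightarrow> (mellin B (- 1) - 0) / of_real h) at_top" by simp
  moreover have "(W x - (W x - of_real h * G x)) / of_real h = G x" for x using h_pos by simp
  ultimately show ?thesis by simp
qed

end

section \<open>The lattice case and its Fourier series\<close>

lemma summable_on_inverse_square_int:
  "(\<lambda>k::int. C / (of_int k)\<^sup>2 :: real) summable_on UNIV"
proof -
  have s: "summable (\<lambda>n::nat. norm (C / (of_nat (Suc n))\<^sup>2))"
  proof -
    have "summable (\<lambda>n. \<bar>C\<bar> * (1 / (real (Suc n))\<^sup>2))"
      using inverse_squares_sums[THEN sums_summable] by (intro summable_mult) (simp add: add.commute)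
    then show ?thesis by (simp add: abs_mult)
  qed
  have n: "(\<lambda>n::nat. C / (of_nat (Suc n))\<^sup>2) summable_on UNIV"
    using norm_summable_imp_summable_on[OF s] by simp
  have i1: "inj (\<lambda>n. int (Suc n))" and i2: "inj (\<lambda>n. - int (Suc n))" by (auto simp: inj_on_def)
  have "(\<lambda>k::int. C / (of_int k)\<^sup>2) summable_on range (\<lambda>n. int (Suc n))"
    unfolding summable_on_reindex[OF i1] using n by (simp add: comp_def)
  moreover have "(\<lambda>k::int. C / (of_int k)\<^sup>2) summable_on range (\<lambda>n. - int (Suc n))"
  proof -
    have "(- 1 - x)\<^sup>2 = (1 + x)\<^sup>2" for x :: real by (simp add: power2_eq_square algebra_simps)
    then show ?thesis unfolding summable_on_reindex[OF i2] using n by (simp add: comp_def)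
  qed
  ultimately have "(\<lambda>k::int. C / (of_int k)\<^sup>2) summable_on range (\<lambda>n. int (Suc n)) \<union> range (\<lambda>n. - int (Suc n))"
    by (rule summable_on_Un_disjoint) (auto)
  then have "(\<lambda>k::int. C / (of_int k)\<^sup>2) summable_on insert 0 (range (\<lambda>n. int (Suc n)) \<union> range (\<lambda>n. - int (Suc n)))"
    by (simp add: summable_on_insert_iff)
  also have "insert 0 (range (\<lambda>n. int (Suc n)) \<union> range (\<lambda>n. - int (Suc n))) = UNIV"
  proof -
    have "k \<in> insert 0 (range (\<lambda>n. int (Suc n)) \<union> range (\<lambda>n. - int (Suc n)))" for k :: int
    proof (cases "k > 0")
      case True
      then have "k = int (Suc (nat (k - 1)))" by simp
      then show ?thesis by blast
    next
      case False
      then have "k = 0 \<or> k = - int (Suc (nat (- k - 1)))" by simp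
      then show ?thesis by blast
    qed
    then show ?thesis by blast
  qed
  finally show ?thesis .
qed

context renewal_equation
begin

lemma bump_limits:
  assumes b: "\<And>x. x > 0 \<Longrightarrow> norm (F (of_real x)) \<le> L * x\<^sup>2 * (1 + x) powr (- 1 - \<delta>)" and s: "Re s = - 1"
  shows "((\<lambda>x::real. F (of_real x) * of_real x powr s) \<longlongrightarrow> 0) (at_right 0)"
    and "((\<lambda>x::real. F (of_real x) * of_real x powr s) \<longlongrightarrow> 0) at_top"
proof -
  have le: "norm (F (of_real x) * of_real x powr s) \<le> L * x * (1 + x) powr (- 1 - \<delta>)" if x: "x > 0" for x
  proof -
    have "norm (F (of_real x) * of_real x powr s) = norm (F (of_real x)) * x powr (- 1)"
      using x s by (simp add: norm_mult norm_powr_real_powr)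
    also have "\<dots> \<le> (L * x\<^sup>2 * (1 + x) powr (- 1 - \<delta>)) * x powr (- 1)" using b[OF x] by (intro mult_right_mono) auto
    also have "\<dots> = L * x * (1 + x) powr (- 1 - \<delta>)" using x by (simp add: powr_minus power2_eq_square field_simps)
    finally show ?thesis .
  qed
  show "((\<lambda>x::real. F (of_real x) * of_real x powr s) \<longlongrightarrow> 0) (at_right 0)"
  proof (rule Lim_null_comparison)
    show "\<forall>\<^sub>F x in at_right 0. norm (F (of_real x) * of_real x powr s) \<le> L * x * (1 + x) powr (- 1 - \<delta>)"
      using eventually_at_right_less[of 0] by eventually_elim (rule le)
    show "((\<lambda>x. L * x * (1 + x) powr (- 1 - \<delta>)) \<longlongrightarrow> 0) (at_right 0)" by real_asymp
  qed
  show "((\<lambda>x::real. F (of_real x) * of_real x powr s) \<longlongrightarrow> 0) at_top"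
  proof (rule Lim_null_comparison)
    show "\<forall>\<^sub>F x in at_top. norm (F (of_real x) * of_real x powr s) \<le> L * x * (1 + x) powr (- 1 - \<delta>)"
      using eventually_gt_at_top[of 0] by eventually_elim (rule le)
    show "((\<lambda>x. L * x * (1 + x) powr (- 1 - \<delta>)) \<longlongrightarrow> 0) at_top" using \<delta> by real_asymp
  qed
qed

text \<open>Two integrations by parts with the operator z d/dz multiply the Mellin transform by s^2.
  On the line Re s = -1 the absolute integral of the resulting function does not depend on Im s.
  Below, \<open>F1\<close> and \<open>F3\<close> are the first and second image of B under this
  operator, and \<open>F2\<close> is the derivative of \<open>F1\<close>.\<close>

lemma mellin_B_decay:
  obtains C where "\<And>\<omega>. Re \<omega> = 0 \<Longrightarrow> norm (mellin B (- 1 + \<omega>)) * (norm \<omega>)\<^sup>2 \<le> C"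
proof -
  define F1 where "F1 z = z * B' z" for z
  define F2 where "F2 z = B' z + z * B'' z" for z
  define F3 where "F3 z = z * F2 z" for z
  have c1: "continuous_on UNIV F1" and c2: "continuous_on UNIV F2" and c3: "continuous_on UNIV F3"
    unfolding F1_def F2_def F3_def
    by (intro continuous_intros B_continuous B''_cont)+
  have F1b: "norm (F1 (of_real x)) \<le> K * x\<^sup>2 * (1 + x) powr (- 1 - \<delta>)" if x: "x > 0" for x
    using B'_bound[OF x] x mult_left_mono[OF B'_bound[OF x], of x]
    by (simp add: F1_def norm_mult power2_eq_square mult_ac)
  have F3b: "norm (F3 (of_real x)) \<le> (2 * K) * x\<^sup>2 * (1 + x) powr (- 1 - \<delta>)" if x: "x > 0" for x
  proof -
    have "norm (F2 (of_real x)) \<le> norm (B' (of_real x)) + x * norm (B'' (of_real x))"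
      unfolding F2_def using norm_triangle_ineq[of "B' (of_real x)" "of_real x * B'' (of_real x)"] x by (simp add: norm_mult)
    also have "\<dots> \<le> K * x * (1 + x) powr (- 1 - \<delta>) + x * (K * (1 + x) powr (- 1 - \<delta>))"
      using B'_bound[OF x] B''_bound[OF x] x by (intro add_mono mult_left_mono) auto
    finally have "x * norm (F2 (of_real x)) \<le> x * (2 * K * x * (1 + x) powr (- 1 - \<delta>))"
      using x by (intro mult_left_mono) auto
    then show ?thesis using x by (simp add: F3_def norm_mult power2_eq_square mult_ac)
  qed
  have K2: "0 \<le> 2 * K" using K by simp
  let ?I = "LINT x:{0<..}|lborel. norm (F3 (of_real x) * of_real x powr (-1 - 1))"
  have "norm (mellin B (- 1 + \<omega>)) * (norm \<omega>)\<^sup>2 \<le> ?I" if \<omega>: "Re \<omega> = 0" for \<omega>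
  proof -
    define s where "s = - 1 + \<omega>"
    have s: "Re s = - 1" "- 2 < Re s" "Re s < - 1 + \<delta>" using \<omega> \<delta> by (auto simp: s_def)
    have iB: "mellin_integrable B s" by (rule mellin_B_integrable) (use s in auto)
    have i1: "mellin_integrable F1 s"
      by (rule mellin_integrable_bump[OF continuous_on_compose_of_real[OF c1] F1b K s(2,3)])
    have i3: "mellin_integrable F3 s"
      by (rule mellin_integrable_bump[OF continuous_on_compose_of_real[OF c3] F3b K2 s(2,3)])
    have m1: "mellin F1 s = - s * mellin B s"
      unfolding F1_def[abs_def]
      by (rule mellin_deriv[OF iB i1[unfolded F1_def[abs_def]] B continuous_on_compose_of_real[OF B_continuous(2)]
            bump_limits[OF B_bound s(1)]])
    have F1d: "(F1 has_field_derivative F2 z) (at z)" for z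
      unfolding F1_def F2_def by (rule derivative_eq_intros refl B')+ simp
    have m3: "mellin F3 s = - s * mellin F1 s"
      unfolding F3_def[abs_def]
      by (rule mellin_deriv[OF i1 i3[unfolded F3_def[abs_def]] F1d continuous_on_compose_of_real[OF c2]
            bump_limits[OF F1b s(1)]])
    have "norm (mellin B s) * (norm s)\<^sup>2 = norm (mellin F3 s)"
      unfolding m3 m1 by (simp add: norm_mult power2_eq_square mult_ac)
    also have "norm (mellin F3 s) \<le> (LINT x:{0<..}|lborel. norm (F3 (of_real x) * of_real x powr (s - 1)))"
      unfolding mellin_def by (rule set_integral_norm_bound[OF i3[unfolded mellin_integrable_def]])
    also have "\<dots> = ?I"
      by (rule set_lebesgue_integral_cong) (auto simp: norm_mult norm_powr_real_powr s)
    finally have 1: "norm (mellin B s) * (norm s)\<^sup>2 \<le> ?I" .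
    have "norm \<omega> = \<bar>Im s\<bar>" using \<omega> by (simp add: s_def cmod_def)
    also have "\<dots> \<le> norm s" by (rule abs_Im_le_cmod)
    finally have "norm (mellin B s) * (norm \<omega>)\<^sup>2 \<le> norm (mellin B s) * (norm s)\<^sup>2"
      by (intro mult_left_mono power_mono) auto
    then show ?thesis using 1 unfolding s_def by linarith
  qed
  then show ?thesis by (rule that)
qed

text \<open>If both steps are multiples of \<tau>, the quantity V plays the role of an
  antiderivative: its increment over \<tau> is \<phi>, so V converges geometrically along x + n
  \<tau>, to a Lipschitz function Q. Since G is asymptotically invariant under \<tau>, V is
  asymptotic to (p r + q l) G = (h / \<tau>) G. The Fourier coefficients of Q are limits of
  integrals of V over one period, which \<open>mellin_limit\<close> evaluates.\<close>

lemma G_lattice: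
  fixes r l :: nat
  assumes lam: "a = real r * \<tau>" "b = real l * \<tau>" "\<tau> > 0" and cop: "coprime r l"
  defines "c \<equiv> \<lambda>k::int. mellin B (- 1 + (- 2 * of_real pi * of_int k / of_real \<tau>) * \<i>) / of_real \<tau>"
  obtains Q where "((\<lambda>x. (of_real h / of_real \<tau>) * G x - Q x) \<longlongrightarrow> 0) at_top"
    "\<And>x. ((\<lambda>k. c k * cis (of_int k * (2 * pi * x / \<tau>))) has_sum Q x) UNIV"
proof -
  have r0: "r > 0" using lam a_pos b_pos by (auto intro!: Nat.gr0I)
  have step: "((\<lambda>x. G (x - \<tau>) - G x) \<longlongrightarrow> 0) at_top"
  proof -
    \<comment> \<open>Bezout: u a - v b = \<tau>, so invariance under differences of lattice steps
      contains invariance under \<tau>.\<close>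
    obtain u v where uv: "u * r = v * l + 1"
      using bezout_nat[of r l] cop r0 by (auto simp: coprime_iff_gcd_eq_1 mult.commute)
    have e: "real u * real r = real v * real l + 1" using arg_cong[OF uv, of real] by simp
    have "real u * a + real 0 * b = (real 0 * a + real v * b) + \<tau>"
    proof -
      have "real u * a = (real u * real r) * \<tau>" using lam by simp
      also have "\<dots> = real v * b + \<tau>" unfolding e using lam by (simp add: distrib_right)
      finally show ?thesis by simp
    qed
    then have "((\<lambda>x. G (x - (real v * b + \<tau>)) - G (x - real v * b)) \<longlongrightarrow> 0) at_top"
      using G_shift[of u 0 0 v] by simp
    from filterlim_compose[OF this filterlim_plus_const_at_top[of "real v * b"]] show ?thesis by simp
  qed
  have steps: "((\<lambda>x. G (x - real i * \<tau>) - G x) \<longlongrightarrow> 0) at_top" for i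
  proof (induction i)
    case (Suc i)
    have "((\<lambda>x. G ((x - real i * \<tau>) - \<tau>) - G (x - real i * \<tau>)) \<longlongrightarrow> 0) at_top"
      by (rule filterlim_compose[OF step filterlim_minus_const_at_top])
    from tendsto_add[OF this Suc] show ?case by (simp add: algebra_simps)
  qed simp
  \<comment> \<open>The expected sum of G over the points x, x - \<tau>, ... of the last step, the
    discrete counterpart of the expected integral used in the non-lattice case.\<close>
  define V where "V x = of_real p * (\<Sum>i<r. G (x - real i * \<tau>)) + of_real q * (\<Sum>i<l. G (x - real i * \<tau>))" for x
  have telescope: "(\<Sum>i<n. G (x - real i * \<tau>)) - (\<Sum>i<n. G (x - \<tau> - real i * \<tau>)) = G x - G (x - real n * \<tau>)" for n x
  proof -
    have "(\<Sum>i<n. G (x - real i * \<tau>)) - (\<Sum>i<n. G (x - \<tau> - real i * \<tau>)) = (\<Sum>i<n. G (x - real i * \<tau>) - G (x - real (Suc i) * \<tau>))"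
      by (simp add: sum_subtractf algebra_simps)
    also have "\<dots> = G x - G (x - real n * \<tau>)" by (subst sum_lessThan_telescope') simp
    finally show ?thesis .
  qed
  have Vstep: "V x - V (x - \<tau>) = \<phi> x" for x
  proof -
    have "V x - V (x - \<tau>) = of_real p * ((\<Sum>i<r. G (x - real i * \<tau>)) - (\<Sum>i<r. G (x - \<tau> - real i * \<tau>))) +
        of_real q * ((\<Sum>i<l. G (x - real i * \<tau>)) - (\<Sum>i<l. G (x - \<tau> - real i * \<tau>)))"
      unfolding V_def right_diff_distrib by simp
    also have "\<dots> = of_real p * (G x - G (x - a)) + of_real q * (G x - G (x - b))" unfolding telescope lam ..
    also have "\<dots> = (of_real p + of_real q) * G x - (of_real p * G (x - a) + of_real q * G (x - b))"
      by (simp only: distrib_right right_diff_distrib) simp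
    also have "complex_of_real p + of_real q = 1" by (simp only: of_real_add[symmetric] pq of_real_1)
    also have "1 * G x - (of_real p * G (x - a) + of_real q * G (x - b)) = \<phi> x" by (subst G_eq) simp
    finally show ?thesis .
  qed
  have hl: "h / \<tau> = p * real r + q * real l" unfolding h_def lam(1,2) using lam(3) by (simp add: field_simps)
  have VG: "((\<lambda>x. V x - (of_real h / of_real \<tau>) * G x) \<longlongrightarrow> 0) at_top"
  proof -
    have "((\<lambda>x. of_real p * (\<Sum>i<r. G (x - real i * \<tau>) - G x) + of_real q * (\<Sum>i<l. G (x - real i * \<tau>) - G x)) \<longlongrightarrow>
       of_real p * (\<Sum>i<r. 0) + of_real q * (\<Sum>i<l. 0)) at_top"
      by (intro tendsto_add tendsto_mult_left tendsto_sum steps)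
    moreover have "of_real p * (\<Sum>i<r. G (x - real i * \<tau>) - G x) + of_real q * (\<Sum>i<l. G (x - real i * \<tau>) - G x)
       = V x - (of_real h / of_real \<tau>) * G x" for x
      unfolding V_def of_real_divide[symmetric] hl
      by (simp add: sum_subtractf right_diff_distrib distrib_right)
    ultimately show ?thesis by simp
  qed
  have V_bot: "(V \<longlongrightarrow> 0) at_bot"
  proof -
    have "filterlim (\<lambda>x::real. x - u) at_bot at_bot" for u
      unfolding filterlim_at_bot
    proof
      show "\<forall>\<^sub>F x in at_bot. x - u \<le> Z" for Z
        using eventually_le_at_bot[of "Z + u"] by eventually_elim simp
    qed
    then have "((\<lambda>x. G (x - u)) \<longlongrightarrow> 0) at_bot" for u by (rule filterlim_compose[OF G_at_bot])
    then have "(V \<longlongrightarrow> of_real p * (\<Sum>i<r. 0) + of_real q * (\<Sum>i<l. 0)) at_bot"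
      unfolding V_def[abs_def] by (intro tendsto_add tendsto_mult_left tendsto_sum)
    then show ?thesis by simp
  qed
  define L where "L = (p * real r + q * real l) * M"
  have V_lip: "norm (V x - V y) \<le> L * \<bar>x - y\<bar>" for x y
  proof -
    have s: "norm ((\<Sum>i<n. G (x - real i * \<tau>)) - (\<Sum>i<n. G (y - real i * \<tau>))) \<le> real n * (M * \<bar>x - y\<bar>)" for n
    proof -
      have "norm (G (x - real i * \<tau>) - G (y - real i * \<tau>)) \<le> M * \<bar>x - y\<bar>" for i
        using G_lipschitz[of "x - real i * \<tau>" "y - real i * \<tau>"] by simp
      then have "norm (\<Sum>i<n. G (x - real i * \<tau>) - G (y - real i * \<tau>)) \<le> real (card {..<n}) * (M * \<bar>x - y\<bar>)"
        by (intro sum_norm_bound)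
      then show ?thesis by (simp add: sum_subtractf)
    qed
    have "V x - V y = of_real p * ((\<Sum>i<r. G (x - real i * \<tau>)) - (\<Sum>i<r. G (y - real i * \<tau>))) +
        of_real q * ((\<Sum>i<l. G (x - real i * \<tau>)) - (\<Sum>i<l. G (y - real i * \<tau>)))"
      unfolding V_def right_diff_distrib by simp
    also have "norm \<dots> \<le> p * (real r * (M * \<bar>x - y\<bar>)) + q * (real l * (M * \<bar>x - y\<bar>))"
      using p q s by (intro order_trans[OF norm_triangle_ineq] add_mono) (auto simp: norm_mult)
    finally show ?thesis by (simp add: L_def algebra_simps)
  qed
  have V_cont: "isCont V x" for x
    unfolding V_def[abs_def] by (intro continuous_intros isCont_o2[OF _ G_cont])
  have Vn: "V (x + real n * \<tau>) = V x + (\<Sum>i<n. \<phi> (x + real (Suc i) * \<tau>))" for x n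
  proof (induction n)
    case (Suc n)
    have "V (x + real (Suc n) * \<tau>) = V (x + real (Suc n) * \<tau> - \<tau>) + \<phi> (x + real (Suc n) * \<tau>)"
      using Vstep[of "x + real (Suc n) * \<tau>"] by (simp add: algebra_simps)
    moreover have "x + real (Suc n) * \<tau> - \<tau> = x + real n * \<tau>" by (simp add: algebra_simps)
    ultimately show ?case by (simp only: Suc sum.lessThan_Suc add.assoc)
  qed simp
  define \<rho> where "\<rho> = exp (- \<delta> * \<tau>)"
  have \<rho>: "0 < \<rho>" "\<rho> < 1" using \<delta> lam by (auto simp: \<rho>_def)
  have \<phi>n: "norm (\<phi> (x + real n * \<tau>)) \<le> K * exp (- \<delta> * x) * \<rho> ^ n" for x n
  proof -
    have "exp (- \<delta> * (x + real n * \<tau>)) = exp (- \<delta> * x) * \<rho> ^ n"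
      unfolding \<rho>_def by (simp add: exp_of_nat_mult[symmetric] algebra_simps flip: exp_add)
    then show ?thesis using \<phi>_decay[of "x + real n * \<tau>"] by (simp add: mult.assoc)
  qed
  have geo: "(\<lambda>n. K * exp (- \<delta> * x) * \<rho> ^ Suc n) sums (K * exp (- \<delta> * x) * (\<rho> / (1 - \<rho>)))" for x
  proof -
    have "(\<lambda>n. K * exp (- \<delta> * x) * (\<rho> * \<rho> ^ n)) sums (K * exp (- \<delta> * x) * (\<rho> * (1 / (1 - \<rho>))))"
      by (intro sums_mult geometric_sums) (use \<rho> in auto)
    then show ?thesis by simp
  qed
  have \<phi>sum: "summable (\<lambda>i. \<phi> (x + real (Suc i) * \<tau>))" for x
    by (rule summable_comparison_test'[OF sums_summable[OF geo], where N=0]) (rule \<phi>n)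
  define Q where "Q x = V x + (\<Sum>i. \<phi> (x + real (Suc i) * \<tau>))" for x
  have QV: "norm (Q x - V x) \<le> K * (\<rho> / (1 - \<rho>)) * exp (- \<delta> * x)" for x
  proof -
    have "norm (Q x - V x) = norm (\<Sum>i. \<phi> (x + real (Suc i) * \<tau>))" by (simp add: Q_def)
    also have "\<dots> \<le> (\<Sum>i. K * exp (- \<delta> * x) * \<rho> ^ Suc i)"
      by (rule norm_suminf_le[OF \<phi>n sums_summable[OF geo]])
    also have "\<dots> = K * exp (- \<delta> * x) * (\<rho> / (1 - \<rho>))" by (rule sums_unique[OF geo, symmetric])
    finally show ?thesis by (simp add: mult_ac)
  qed
  have Qn: "(\<lambda>n. V (x + real n * \<tau>)) \<longlonglongrightarrow> Q x" for x
    unfolding Vn Q_def using summable_LIMSEQ[OF \<phi>sum] by (intro tendsto_intros)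
  have Q_lip: "norm (Q x - Q y) \<le> L * \<bar>x - y\<bar>" for x y
  proof (rule Lim_bounded)
    show "(\<lambda>n. norm (V (x + real n * \<tau>) - V (y + real n * \<tau>))) \<longlonglongrightarrow> norm (Q x - Q y)"
      by (intro tendsto_intros Qn)
    show "\<forall>n\<ge>0. norm (V (x + real n * \<tau>) - V (y + real n * \<tau>)) \<le> L * \<bar>x - y\<bar>"
    proof (intro allI impI)
      show "norm (V (x + real n * \<tau>) - V (y + real n * \<tau>)) \<le> L * \<bar>x - y\<bar>" for n
        using V_lip[of "x + real n * \<tau>" "y + real n * \<tau>"] by simp
    qed
  qed
  have QG: "((\<lambda>x. (of_real h / of_real \<tau>) * G x - Q x) \<longlongrightarrow> 0) at_top"
  proof -
    have "((\<lambda>x. Q x - V x) \<longlongrightarrow> 0) at_top"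
    proof (rule Lim_null_comparison)
      show "\<forall>\<^sub>F x in at_top. norm (Q x - V x) \<le> K * (\<rho> / (1 - \<rho>)) * exp (- \<delta> * x)"
        by (intro always_eventually allI QV)
      show "((\<lambda>x. K * (\<rho> / (1 - \<rho>)) * exp (- \<delta> * x)) \<longlongrightarrow> 0) at_top"
        by (intro tendsto_mult_right_zero) (use \<delta> in real_asymp)
    qed
    from tendsto_minus[OF tendsto_add[OF this VG]] show ?thesis by simp
  qed
  have coef: "((\<lambda>t. Q (\<tau> * t / (2 * pi)) * cis (- (of_int k * t))) has_integral 2 * of_real pi * c k) {y - pi..y + pi}" for k y
  proof -
    define \<omega> where "\<omega> = (- 2 * of_real pi * of_int k / of_real \<tau>) * \<i>"
    have \<omega>e: "exp (\<omega> * of_real x) = cis (- (of_int k * (2 * pi * x / \<tau>)))" for x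
      by (simp add: \<omega>_def cis_conv_exp mult_ac)
    have \<omega>per: "exp (\<omega> * of_real (x + real n * \<tau>)) = exp (\<omega> * of_real x)" for x n
    proof -
      have "- (of_int k * (2 * pi * (x + real n * \<tau>) / \<tau>)) = - (of_int k * (2 * pi * x / \<tau>)) + 2 * pi * of_int (- k * int n)"
        using lam by (simp add: field_simps)
      moreover have "cis (2 * pi * of_int (- k * int n)) = 1" by (rule cis_multiple_2pi) simp
      ultimately show ?thesis unfolding \<omega>e by (simp only: cis_mult[symmetric]) simp
    qed
    define U where "U x = V x * exp (\<omega> * of_real x)" for x
    have U_cont: "isCont U x" for x
      unfolding U_def[abs_def] by (intro continuous_intros V_cont)
    obtain \<Psi> where \<Psi>: "\<And>x. (\<Psi> has_vector_derivative U x) (at x)"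
      by (rule antiderivative_real_line[OF U_cont]) (rule that)
    have \<Psi>s: "((\<lambda>x. \<Psi> (x - \<tau>)) has_vector_derivative U (x - \<tau>)) (at x)" for x
    proof -
      have "((\<lambda>x::real. x - \<tau>) has_vector_derivative 1) (at x)"
        by (auto intro!: derivative_eq_intros simp flip: has_real_derivative_iff_has_vector_derivative)
      from vector_diff_chain_at[OF this, of \<Psi> "U (x - \<tau>)"] \<Psi>[of "x - \<tau>"] show ?thesis by (simp add: comp_def)
    qed
    \<comment> \<open>The integral of U over one period. Because exp(\<omega> x) has period \<tau>,
      its derivative is \<phi>(x) exp(\<omega> x), exactly what \<open>mellin_limit\<close>
      requires.\<close>
    define A where "A x = \<Psi> x - \<Psi> (x - \<tau>)" for x
    have "(A \<longlongrightarrow> mellin B (- 1 + \<omega>)) at_top"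
    proof (rule mellin_limit)
      fix x
      have "(A has_vector_derivative U x - U (x - \<tau>)) (at x)"
        unfolding A_def[abs_def] by (intro has_vector_derivative_diff \<Psi> \<Psi>s)
      moreover have "U x - U (x - \<tau>) = \<phi> x * exp (\<omega> * of_real x)"
        using \<omega>per[of "x - \<tau>" 1] Vstep[of x] by (simp add: U_def flip: left_diff_distrib)
      ultimately show "(A has_vector_derivative \<phi> x * exp (\<omega> * of_real x)) (at x)" by simp
    next
      show "(A \<longlongrightarrow> 0) at_bot"
      proof (rule tendstoI)
        fix e :: real assume e: "e > 0"
        have "\<forall>\<^sub>F x in at_bot. norm (V x) < e / (2 * \<tau>)" using tendstoD[OF V_bot, of "e / (2 * \<tau>)"] e lam by simp
        then obtain X where X: "\<And>x. x \<le> X \<Longrightarrow> norm (V x) < e / (2 * \<tau>)" by (auto simp: eventually_at_bot_linorder)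
        show "\<forall>\<^sub>F x in at_bot. dist (A x) 0 < e"
          unfolding eventually_at_bot_linorder
        proof (intro exI allI impI)
          fix x assume x: "x \<le> X"
          have "(U has_integral A x) {x - \<tau>..x}" unfolding A_def
            by (rule fundamental_theorem_of_calculus) (use lam in \<open>auto intro!: has_vector_derivative_at_within[OF \<Psi>]\<close>)
          then have "norm (A x - of_real \<tau> * 0) \<le> e / (2 * \<tau>) * \<tau>"
            by (rule has_integral_near_const)
              (use lam e X x in \<open>auto simp: U_def norm_mult \<omega>e intro: less_imp_le\<close>)
          then show "dist (A x) 0 < e" using lam e by simp
        qed
      qed
    qed (simp add: \<omega>_def)
    then have Alim: "(\<lambda>n. A (y' + real n * \<tau>)) \<longlonglongrightarrow> mellin B (- 1 + \<omega>)" for y'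
    proof (rule filterlim_compose)
      show "filterlim (\<lambda>n. y' + real n * \<tau>) at_top sequentially" using lam by real_asymp
    qed
    \<comment> \<open>The period \<tau> is rescaled to 2 pi for \<open>fourier_inversion\<close>;
      the n-th translate converges to Q times the character, with the uniform bound L.\<close>
    define v where "v n t = V (\<tau> * t / (2 * pi) + real n * \<tau>) * cis (- (of_int k * t))" for n t
    have vi: "(v n has_integral of_real (2 * pi / \<tau>) * A (\<tau> * (y + pi) / (2 * pi) + real n * \<tau>)) {y - pi..y + pi}" for n
    proof -
      define \<Theta> where "\<Theta> t = of_real (2 * pi / \<tau>) * \<Psi> (\<tau> * t / (2 * pi) + real n * \<tau>)" for t
      have "(v n has_integral \<Theta> (y + pi) - \<Theta> (y - pi)) {y - pi..y + pi}"
      proof (rule fundamental_theorem_of_calculus)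
        fix t
        have "((\<lambda>t. \<tau> * t / (2 * pi) + real n * \<tau>) has_vector_derivative \<tau> / (2 * pi)) (at t)"
          by (auto intro!: derivative_eq_intros simp flip: has_real_derivative_iff_has_vector_derivative)
        from vector_diff_chain_at[OF this \<Psi>]
        have "((\<lambda>t. \<Psi> (\<tau> * t / (2 * pi) + real n * \<tau>)) has_vector_derivative (\<tau> / (2 * pi)) *\<^sub>R U (\<tau> * t / (2 * pi) + real n * \<tau>)) (at t)"
          by (simp add: comp_def)
        from has_vector_derivative_mult_right[OF this, of "of_real (2 * pi / \<tau>)"]
        have "(\<Theta> has_vector_derivative of_real (2 * pi / \<tau>) * ((\<tau> / (2 * pi)) *\<^sub>R U (\<tau> * t / (2 * pi) + real n * \<tau>))) (at t)"
          by (simp add: \<Theta>_def[abs_def])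
        moreover have "of_real (2 * pi / \<tau>) * ((\<tau> / (2 * pi)) *\<^sub>R U (\<tau> * t / (2 * pi) + real n * \<tau>)) = U (\<tau> * t / (2 * pi) + real n * \<tau>)"
          using lam by (simp add: scaleR_conv_of_real)
        moreover have "U (\<tau> * t / (2 * pi) + real n * \<tau>) = v n t"
        proof -
          have "of_int k * (2 * pi * (\<tau> * t / (2 * pi)) / \<tau>) = of_int k * t" using lam by simp
          moreover have "exp (\<omega> * of_real (\<tau> * t / (2 * pi) + real n * \<tau>)) =
              cis (- (of_int k * (2 * pi * (\<tau> * t / (2 * pi)) / \<tau>)))"
            by (rule trans[OF \<omega>per \<omega>e])
          ultimately show ?thesis unfolding U_def v_def by (simp only:)
        qed
        ultimately show "(\<Theta> has_vector_derivative v n t) (at t within {y - pi..y + pi})"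
          by (simp add: has_vector_derivative_at_within)
      qed simp
      moreover have "\<Theta> (y + pi) - \<Theta> (y - pi) = of_real (2 * pi / \<tau>) * A (\<tau> * (y + pi) / (2 * pi) + real n * \<tau>)"
      proof -
        have "\<tau> * (y - pi) / (2 * pi) + real n * \<tau> = (\<tau> * (y + pi) / (2 * pi) + real n * \<tau>) - \<tau>"
          by (simp add: field_simps)
        then show ?thesis unfolding \<Theta>_def A_def by (simp only: right_diff_distrib)
      qed
      ultimately show ?thesis by simp
    qed
    have bnd: "norm (v n t) \<le> L" for n t
    proof -
      have g: "norm (\<Sum>i<j. G (x - real i * \<tau>)) \<le> real j * M" for j x
        using sum_norm_bound[of "{..<j}" "\<lambda>i. G (x - real i * \<tau>)" M] G_bound by simp
      have "norm (V x) \<le> p * (real r * M) + q * (real l * M)" for x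
        unfolding V_def using p q g
        by (intro order_trans[OF norm_triangle_ineq] add_mono) (auto simp: norm_mult intro!: mult_left_mono)
      then show ?thesis by (simp add: v_def norm_mult L_def algebra_simps)
    qed
    let ?S = "{y - pi..y + pi}"
    have "(\<lambda>t. Q (\<tau> * t / (2 * pi)) * cis (- (of_int k * t))) integrable_on ?S \<and>
      (\<lambda>n. integral ?S (v n)) \<longlonglongrightarrow> integral ?S (\<lambda>t. Q (\<tau> * t / (2 * pi)) * cis (- (of_int k * t)))"
    proof -
      have d1: "v n integrable_on ?S" for n using vi[of n] by (rule has_integral_integrable)
      have d2: "(\<lambda>_. L) integrable_on ?S" by (rule integrable_const_ivl)
      have d3: "norm (v n t) \<le> L" if "t \<in> ?S" for n t by (rule bnd)
      have d4: "(\<lambda>n. v n t) \<longlonglongrightarrow> Q (\<tau> * t / (2 * pi)) * cis (- (of_int k * t))" if "t \<in> ?S" for t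
        unfolding v_def by (intro tendsto_intros Qn)
      show ?thesis using dominated_convergence[OF d1 d2 d3 d4] by blast
    qed
    moreover have "(\<lambda>n. integral ?S (v n)) \<longlonglongrightarrow> of_real (2 * pi / \<tau>) * mellin B (- 1 + \<omega>)"
      unfolding integral_unique[OF vi] by (intro tendsto_intros Alim)
    ultimately have "(\<lambda>t. Q (\<tau> * t / (2 * pi)) * cis (- (of_int k * t))) integrable_on ?S"
      "integral ?S (\<lambda>t. Q (\<tau> * t / (2 * pi)) * cis (- (of_int k * t))) = of_real (2 * pi / \<tau>) * mellin B (- 1 + \<omega>)"
      by (auto intro: LIMSEQ_unique)
    then have "((\<lambda>t. Q (\<tau> * t / (2 * pi)) * cis (- (of_int k * t))) has_integral of_real (2 * pi / \<tau>) * mellin B (- 1 + \<omega>)) ?S"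
      unfolding has_integral_integrable_integral by blast
    then show ?thesis unfolding c_def \<omega>_def by simp
  qed
  have summ: "(\<lambda>k. norm (c k)) summable_on UNIV"
  proof -
    obtain C where C: "\<And>\<omega>. Re \<omega> = 0 \<Longrightarrow> norm (mellin B (- 1 + \<omega>)) * (norm \<omega>)\<^sup>2 \<le> C"
      by (rule mellin_B_decay) (rule that)
    define C' where "C' = C * \<tau> / (2 * pi)\<^sup>2"
    have le: "norm (c k) \<le> C' / (of_int k)\<^sup>2" if k: "k \<noteq> 0" for k
    proof -
      define \<omega> where "\<omega> = (- 2 * complex_of_real pi * of_int k / of_real \<tau>) * \<i>"
      have n: "(norm \<omega>)\<^sup>2 = (2 * pi * of_int k / \<tau>)\<^sup>2"
        using lam by (simp add: \<omega>_def norm_mult norm_divide power_mult_distrib power_divide)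
      have "norm (mellin B (- 1 + \<omega>)) * (2 * pi * of_int k / \<tau>)\<^sup>2 \<le> C" using C[of \<omega>] n by (simp add: \<omega>_def)
      then have "norm (mellin B (- 1 + \<omega>)) \<le> C / (2 * pi * of_int k / \<tau>)\<^sup>2"
        using k lam by (subst pos_le_divide_eq) auto
      then have "norm (mellin B (- 1 + \<omega>)) / \<tau> \<le> C / (2 * pi * of_int k / \<tau>)\<^sup>2 / \<tau>"
        using lam by (intro divide_right_mono) auto
      moreover have "norm (c k) = norm (mellin B (- 1 + \<omega>)) / \<tau>"
        unfolding c_def \<omega>_def[symmetric] norm_divide using lam by simp
      ultimately have "norm (c k) \<le> C / (2 * pi * of_int k / \<tau>)\<^sup>2 / \<tau>" by simp
      also have "\<dots> = C' / (of_int k)\<^sup>2" using lam k by (simp add: C'_def power2_eq_square field_simps)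
      finally show ?thesis .
    qed
    have "(\<lambda>k. norm (c k)) summable_on (UNIV - {0})"
    proof (rule summable_on_comparison_test)
      show "(\<lambda>k::int. C' / (of_int k)\<^sup>2) summable_on (UNIV - {0})"
        by (rule summable_on_subset[OF summable_on_inverse_square_int]) auto
    qed (use le in auto)
    then have "(\<lambda>k. norm (c k)) summable_on (insert 0 (UNIV - {0}))" by (subst summable_on_insert_iff) simp
    then show ?thesis by (simp add: insert_absorb)
  qed
  show ?thesis
  proof (rule that[OF QG])
    fix x
    have lip: "norm (Q (\<tau> * s / (2 * pi)) - Q (\<tau> * t / (2 * pi))) \<le> (L * (\<tau> / (2 * pi))) * \<bar>s - t\<bar>" for s t
    proof -
      have "\<bar>\<tau> * s / (2 * pi) - \<tau> * t / (2 * pi)\<bar> = \<tau> / (2 * pi) * \<bar>s - t\<bar>"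
        using lam by (simp add: abs_mult right_diff_distrib[symmetric] diff_divide_distrib[symmetric])
      then show ?thesis using Q_lip[of "\<tau> * s / (2 * pi)" "\<tau> * t / (2 * pi)"] by (simp add: mult.assoc)
    qed
    have "((\<lambda>k. c k * cis (of_int k * (2 * pi * x / \<tau>))) has_sum Q (\<tau> * (2 * pi * x / \<tau>) / (2 * pi))) UNIV"
      by (rule fourier_inversion[OF lip coef summ])
    then show "((\<lambda>k. c k * cis (of_int k * (2 * pi * x / \<tau>))) has_sum Q x) UNIV" using lam by simp
  qed
qed

end

section \<open>Means with an admissible toll\<close>

lemma log_ratio_num_eq:
  assumes "log_ratio p q r l" shows "log_ratio_num p q = r"
  unfolding log_ratio_num_def
proof (rule the_equality)
  fix r' assume "\<exists>l. log_ratio p q r' l"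
  then obtain l' where 1: "log_ratio p q r' l'" ..
  have "real r / real l = real r' / real l'" "0 < l" "0 < l'" using assms 1 unfolding log_ratio_def by auto
  then have "real (r * l') = real (r' * l)" by (simp add: field_simps)
  then have e: "r * l' = r' * l" by (simp only: of_nat_eq_iff)
  have "r dvd r' * l" "r' dvd r * l'" using e by (metis dvd_triv_left)+
  then have "r dvd r'" "r' dvd r"
    using assms 1 unfolding log_ratio_def by (simp_all add: coprime_dvd_mult_left_iff)
  then show "r' = r" by (simp add: dvd_antisym)
qed (use assms in blast)

lemma ptrans_0: "ptrans b 0 = b 0"
  unfolding ptrans_def using powser_zero[of "\<lambda>n. b n / fact n"] by (simp add: mult.commute)

lemma entire_coeffs_difference:
  fixes b :: "nat \<Rightarrow> complex"
  shows "entire_coeffs b \<Longrightarrow> entire_coeffs (\<lambda>n. b (Suc n) - b n)"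
  by (intro entire_coeffs_diff entire_coeffs_Suc)

lemma bump_bound_large:
  fixes \<delta> :: real
  assumes x: "x \<ge> 1" and \<delta>: "\<delta> > 0"
  shows "x powr (- 1 - \<delta>) \<le> 2 powr (1 + \<delta>) * (1 + x) powr (- 1 - \<delta>)"
proof -
  have "(2 * x) powr (- 1 - \<delta>) \<le> (1 + x) powr (- 1 - \<delta>)"
    using x \<delta> by (intro powr_mono2') auto
  then have "2 powr (1 + \<delta>) * (2 * x) powr (- 1 - \<delta>) \<le> 2 powr (1 + \<delta>) * (1 + x) powr (- 1 - \<delta>)"
    by (rule mult_left_mono) simp
  moreover have "2 powr (1 + \<delta>) * (2 * x) powr (- 1 - \<delta>) = x powr (- 1 - \<delta>)"
  proof -
    have "2 powr (1 + \<delta>) * 2 powr (- 1 - \<delta>) = (1::real)" by (simp flip: powr_add)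
    then show ?thesis using x by (simp add: powr_mult mult.assoc[symmetric])
  qed
  ultimately show ?thesis by simp
qed

text \<open>This reduces the three bounds of \<open>renewal_equation\<close> to one bound for B on
  discs. For large x, Cauchy's inequality on the disc of radius \<kappa> x costs a factor 1 /
  (\<kappa> x) per derivative. For x up to X, a bound of B'' on a compact disc is integrated twice,
  starting from the double zero at 0.\<close>

lemma entire_bump_bounds:
  fixes B B' B'' :: "complex \<Rightarrow> complex"
  assumes B: "\<And>z. (B has_field_derivative B' z) (at z)"
    and B': "\<And>z. (B' has_field_derivative B'' z) (at z)"
    and B''c: "continuous_on UNIV B''"
    and B0: "B 0 = 0" "B' 0 = 0" and \<delta>: "0 < \<delta>" and \<kappa>: "0 < \<kappa>"
    and disc: "\<And>x z. R \<le> x \<Longrightarrow> norm (z - of_real x) \<le> \<kappa> * x \<Longrightarrow> norm (B z) \<le> C * x powr (1 - \<delta>)"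
  obtains K where "0 \<le> K"
    "\<And>x. x > 0 \<Longrightarrow> norm (B (of_real x)) \<le> K * x\<^sup>2 * (1 + x) powr (- 1 - \<delta>)"
    "\<And>x. x > 0 \<Longrightarrow> norm (B' (of_real x)) \<le> K * x * (1 + x) powr (- 1 - \<delta>)"
    "\<And>x. x > 0 \<Longrightarrow> norm (B'' (of_real x)) \<le> K * (1 + x) powr (- 1 - \<delta>)"
proof -
  define X where "X = max R 1"
  have X: "X \<ge> 1" "X \<ge> R" by (auto simp: X_def)
  have Bh: "B holomorphic_on A" for A
    unfolding holomorphic_on_def field_differentiable_def by (blast intro: DERIV_subset[OF B])
  have dB: "deriv B = B'" by (rule ext) (rule DERIV_imp_deriv[OF B])
  have dB': "deriv B' = B''" by (rule ext) (rule DERIV_imp_deriv[OF B'])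
  have C0: "C \<ge> 0"
  proof -
    have "norm (B (of_real X)) \<le> C * X powr (1 - \<delta>)" using X \<kappa> by (intro disc) auto
    then have "0 \<le> C * X powr (1 - \<delta>)" by (rule order_trans[OF norm_ge_zero])
    then show ?thesis using X by (simp add: zero_le_mult_iff)
  qed
  have cauchy: "norm ((deriv ^^ n) B (of_real x)) \<le> fact n * (C * x powr (1 - \<delta>)) / (\<kappa> * x) ^ n" if x: "x \<ge> X" for x n
  proof (rule Cauchy_inequality)
    show "B holomorphic_on ball (of_real x) (\<kappa> * x)" by (rule Bh)
    show "continuous_on (cball (of_real x) (\<kappa> * x)) B" by (rule holomorphic_on_imp_continuous_on[OF Bh])
    show "0 < \<kappa> * x" using \<kappa> x X by auto
    show "norm (B z) \<le> C * x powr (1 - \<delta>)" if "norm (of_real x - z) = \<kappa> * x" for z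
      using that x X by (intro disc) (auto simp: norm_minus_commute)
  qed
  have "compact (B'' ` cball 0 X)" by (intro compact_continuous_image continuous_on_subset[OF B''c]) auto
  then have "bounded (B'' ` cball 0 X)" by (rule compact_imp_bounded)
  then obtain K0 where K0': "\<And>w. w \<in> B'' ` cball 0 X \<Longrightarrow> norm w \<le> K0" unfolding bounded_iff by blast
  have K0: "norm (B'' z) \<le> K0" if "norm z \<le> X" for z using K0' that by auto
  have K0n: "K0 \<ge> 0" using K0[of 0] X norm_ge_zero[of "B'' 0"] by (simp del: norm_ge_zero)
  have s1: "norm (B' (of_real x)) \<le> K0 * x" if x: "0 < x" "x \<le> X" for x
  proof -
    have "norm (B' (of_real x) - B' 0) \<le> K0 * norm (complex_of_real x - 0)"
    proof (rule field_differentiable_bound[of "cball 0 x"])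
      show "(B' has_field_derivative B'' z) (at z within cball 0 x)" for z by (rule DERIV_subset[OF B']) auto
      show "norm (B'' z) \<le> K0" if "z \<in> cball 0 x" for z using that x by (intro K0) auto
    qed (use x in auto)
    then show ?thesis using B0 x by simp
  qed
  have s1': "norm (B' z) \<le> K0 * X1" if z: "norm z \<le> X1" "X1 \<le> X" for z X1
  proof -
    have "norm (B' z - B' 0) \<le> K0 * norm (z - 0)"
    proof (rule field_differentiable_bound[of "cball 0 X1"])
      show "(B' has_field_derivative B'' z) (at z within cball 0 X1)" for z by (rule DERIV_subset[OF B']) auto
      show "norm (B'' z) \<le> K0" if "z \<in> cball 0 X1" for z using that z by (intro K0) auto
    qed (use z norm_ge_zero[of z] in \<open>auto simp del: norm_ge_zero\<close>)
    also have "\<dots> \<le> K0 * X1" using z K0n by (intro mult_left_mono) auto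
    finally show ?thesis using B0 by simp
  qed
  have s0: "norm (B (of_real x)) \<le> K0 * x\<^sup>2" if x: "0 < x" "x \<le> X" for x
  proof -
    have "norm (B (of_real x) - B 0) \<le> (K0 * x) * norm (complex_of_real x - 0)"
    proof (rule field_differentiable_bound[of "cball 0 x"])
      show "(B has_field_derivative B' z) (at z within cball 0 x)" for z by (rule DERIV_subset[OF B]) auto
      show "norm (B' z) \<le> K0 * x" if "z \<in> cball 0 x" for z using that x by (intro s1') auto
    qed (use x in auto)
    then show ?thesis using B0 x by (simp add: power2_eq_square mult.assoc)
  qed
  define w where "w = (1 + X) powr (- 1 - \<delta>)"
  have w: "w > 0" using X by (simp add: w_def)
  have small: "K0 \<le> K0 / w * (1 + x) powr (- 1 - \<delta>)" if x: "0 < x" "x \<le> X" for x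
  proof -
    have "w \<le> (1 + x) powr (- 1 - \<delta>)" unfolding w_def using x \<delta> by (intro powr_mono2') auto
    then have "K0 * w \<le> K0 * (1 + x) powr (- 1 - \<delta>)" using K0n by (rule mult_left_mono)
    then show ?thesis using w by (simp add: field_simps)
  qed
  \<comment> \<open>The summands are the Cauchy constants n! C / \<kappa>^n for n = 0, 1, 2; the
    power of 2 is the cost of replacing x by 1 + x in the weight.\<close>
  define K1 where "K1 = 2 powr (1 + \<delta>) * (C + C / \<kappa> + 2 * C / \<kappa>\<^sup>2)"
  define K where "K = K0 / w + K1"
  have K10: "K1 \<ge> 0" using C0 \<kappa> by (simp add: K1_def)
  have KK: "K0 / w \<ge> 0" using K0n w by simp
  have powx: "x powr (1 - \<delta>) = x\<^sup>2 * x powr (- 1 - \<delta>)" if "x > 0" for x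
  proof -
    have "x\<^sup>2 * x powr (- 1 - \<delta>) = x powr 2 * x powr (- 1 - \<delta>)" using that by simp
    also have "\<dots> = x powr (1 - \<delta>)" unfolding powr_add[symmetric] by simp
    finally show ?thesis ..
  qed
  \<comment> \<open>The two ranges are joined once for all three bounds, with y standing for x^2, x
    and 1.\<close>
  have fin: "v \<le> K * y * (1 + x) powr (- 1 - \<delta>)"
    if x: "x > 0" and y: "y \<ge> 0" and sm: "x \<le> X \<Longrightarrow> v \<le> K0 * y" and la: "x \<ge> X \<Longrightarrow> v \<le> c * y * x powr (- 1 - \<delta>)"
      and c: "0 \<le> c" "2 powr (1 + \<delta>) * c \<le> K1" for x y v c
  proof (cases "x \<le> X")
    case True
    have "v \<le> K0 * y" by (rule sm[OF True])
    also have "\<dots> \<le> (K0 / w * (1 + x) powr (- 1 - \<delta>)) * y" by (rule mult_right_mono[OF small[OF x True] y])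
    also have "\<dots> \<le> (K * (1 + x) powr (- 1 - \<delta>)) * y" using K10 y by (intro mult_right_mono) (auto simp: K_def)
    finally show ?thesis by (simp add: mult_ac)
  next
    case False
    have "v \<le> c * y * x powr (- 1 - \<delta>)" using la False by simp
    also have "\<dots> \<le> c * y * (2 powr (1 + \<delta>) * (1 + x) powr (- 1 - \<delta>))"
      using False X \<delta> c y by (intro mult_left_mono bump_bound_large) auto
    also have "\<dots> = (2 powr (1 + \<delta>) * c) * (y * (1 + x) powr (- 1 - \<delta>))" by (simp add: mult_ac)
    also have "\<dots> \<le> K * (y * (1 + x) powr (- 1 - \<delta>))" using c KK y by (intro mult_right_mono) (auto simp: K_def)
    finally show ?thesis by (simp add: mult_ac)
  qed
  show ?thesis
  proof (rule that[of K])
    show "0 \<le> K" using KK K10 by (simp add: K_def)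
    fix x :: real assume x: "x > 0"
    show "norm (B (of_real x)) \<le> K * x\<^sup>2 * (1 + x) powr (- 1 - \<delta>)"
    proof (rule fin[OF x, of _ _ C])
      show "norm (B (of_real x)) \<le> C * x\<^sup>2 * x powr (- 1 - \<delta>)" if "x \<ge> X"
        using cauchy[OF that, of 0] powx[OF x] by (simp add: mult.assoc)
      show "2 powr (1 + \<delta>) * C \<le> K1" unfolding K1_def using C0 \<kappa> by (intro mult_left_mono) auto
    qed (use s0 x C0 in auto)
    show "norm (B' (of_real x)) \<le> K * x * (1 + x) powr (- 1 - \<delta>)"
    proof (rule fin[OF x, of _ _ "C / \<kappa>"])
      show "norm (B' (of_real x)) \<le> C / \<kappa> * x * x powr (- 1 - \<delta>)" if "x \<ge> X"
        using cauchy[OF that, of 1] powx[OF x] x \<kappa> by (simp add: dB power2_eq_square field_simps)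
      show "2 powr (1 + \<delta>) * (C / \<kappa>) \<le> K1" unfolding K1_def using C0 \<kappa> by (intro mult_left_mono) auto
    qed (use s1 x C0 \<kappa> in auto)
    have "norm (B'' (of_real x)) \<le> K * 1 * (1 + x) powr (- 1 - \<delta>)"
    proof (rule fin[OF x, of _ _ "2 * C / \<kappa>\<^sup>2"])
      show "norm (B'' (of_real x)) \<le> 2 * C / \<kappa>\<^sup>2 * 1 * x powr (- 1 - \<delta>)" if "x \<ge> X"
        using cauchy[OF that, of 2] powx[OF x] x \<kappa> by (simp add: numeral_2_eq_2 dB dB' power2_eq_square field_simps)
      show "2 powr (1 + \<delta>) * (2 * C / \<kappa>\<^sup>2) \<le> K1" unfolding K1_def using C0 \<kappa> by (intro mult_left_mono) auto
      show "norm (B'' (of_real x)) \<le> K0 * 1" if "x \<le> X" using K0[of "of_real x"] x that by simp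
    qed (use C0 \<kappa> in auto)
    then show "norm (B'' (of_real x)) \<le> K * (1 + x) powr (- 1 - \<delta>)" by simp
  qed
qed

text \<open>Both arithmetic cases in the form of the theorem. In the lattice case the term k = 0 of
  the Fourier series is the constant, and the others form \<open>fluct\<close>; otherwise
  \<open>fluct\<close> vanishes and irrationality supplies the density.\<close>

lemma (in renewal_equation) G_asymptotics:
  "((\<lambda>x. G x - (mellin B (- 1) / of_real (binary_entropy p q)
      + fluct p q (mellin B) (real (log_ratio_num p q) * (x / ln (1 / p))))) \<longlongrightarrow> 0) at_top"
proof -
  have hh: "binary_entropy p q = h" by (simp add: binary_entropy_def h_def a_def b_def)
  show ?thesis
  proof (cases "\<exists>r l. log_ratio p q r l")
    case True
    then obtain r l where rl: "log_ratio p q r l" by blast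
    note rn = log_ratio_num_eq[OF rl]
    have rl': "0 < r" "0 < l" "coprime r l" "ln p / ln q = real r / real l" using rl by (auto simp: log_ratio_def)
    define \<tau> where "\<tau> = a / real r"
    have \<tau>: "\<tau> > 0" using a_pos rl' by (simp add: \<tau>_def)
    have ar: "a = real r * \<tau>" using rl' by (simp add: \<tau>_def)
    have bl: "b = real l * \<tau>"
    proof -
      have "a / b = real r / real l" using rl'(4) by (simp add: a_def b_def)
      then show ?thesis using b_pos a_pos rl' by (simp add: \<tau>_def field_simps)
    qed
    define c where "c k = mellin B (- 1 + (- 2 * of_real pi * of_int k / of_real \<tau>) * \<i>) / of_real \<tau>" for k :: int
    obtain Q where Q: "((\<lambda>x. (of_real h / of_real \<tau>) * G x - Q x) \<longlongrightarrow> 0) at_top"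
      "\<And>x. ((\<lambda>k. c k * cis (of_int k * (2 * pi * x / \<tau>))) has_sum Q x) UNIV"
      using G_lattice[OF ar bl \<tau> rl'(3)] unfolding c_def by blast
    \<comment> \<open>Since ln p = - r \<tau>, the point \<chi> is the frequency -2 pi i k / \<tau>
      of the Fourier coefficients. Likewise r x / ln(1/p) = x / \<tau>, so the arguments of the
      characters agree.\<close>
    have chi: "chi p q k = (- 2 * of_real pi * of_int k / of_real \<tau>) * \<i>" for k
    proof -
      have "ln p = - (real r * \<tau>)" using ar by (simp add: a_def)
      then have lp: "complex_of_real (ln p) = - (of_nat r * of_real \<tau>)"
        by (simp only: of_real_minus of_real_mult of_real_of_nat_eq)
      show ?thesis unfolding chi_def rn lp using rl' \<tau> by (simp add: field_simps)
    qed
    have main: "mellin B (- 1) / of_real h + fluct p q (mellin B) (real r * (x / ln (1 / p))) = (of_real \<tau> / of_real h) * Q x" for x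
    proof -
      define y where "y = real r * (x / ln (1 / p))"
      have y: "2 * pi * x / \<tau> = 2 * pi * y"
      proof -
        have "ln (1 / p) = real r * \<tau>" using ar p by (simp add: a_def ln_div)
        then show ?thesis using rl' \<tau> by (simp add: y_def)
      qed
      have e: "exp (2 * of_int k * of_real pi * \<i> * of_real y) = cis (of_int k * (2 * pi * x / \<tau>))" for k :: int
        unfolding y by (simp add: cis_conv_exp mult_ac)
      have "((\<lambda>k. c k * cis (of_int k * (2 * pi * x / \<tau>))) has_sum Q x - c 0 * cis (of_int 0 * (2 * pi * x / \<tau>))) (UNIV - {0})"
        by (rule has_sum_Diff[OF Q(2)]) (auto intro: has_sum_finiteI)
      then have "((\<lambda>k. c k * cis (of_int k * (2 * pi * x / \<tau>))) has_sum Q x - c 0) {k. k \<noteq> 0}"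
        by (simp add: Collect_neg_eq Compl_eq_Diff_UNIV)
      from has_sum_cmult_right[OF this, of "of_real \<tau>"]
      have "((\<lambda>k. mellin B (- 1 + chi p q k) * exp (2 * of_int k * of_real pi * \<i> * of_real y)) has_sum of_real \<tau> * (Q x - c 0)) {k. k \<noteq> 0}"
        unfolding e chi c_def using \<tau> by simp
      then have "fluct p q (mellin B) y = of_real \<tau> * (Q x - c 0) / of_real h"
        unfolding fluct_def hh using True by (simp add: infsumI)
      moreover have "of_real \<tau> * c 0 = mellin B (- 1)" using \<tau> by (simp add: c_def)
      ultimately show ?thesis using h_pos by (simp add: y_def right_diff_distrib diff_divide_distrib)
    qed
    have "((\<lambda>x. (of_real \<tau> / of_real h) * ((of_real h / of_real \<tau>) * G x - Q x)) \<longlongrightarrow> (of_real \<tau> / of_real h) * 0) at_top"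
      by (intro tendsto_mult_left Q(1))
    moreover have "(of_real \<tau> / of_real h) * ((of_real h / of_real \<tau>) * G x - Q x) =
       G x - (mellin B (- 1) / of_real h + fluct p q (mellin B) (real r * (x / ln (1 / p))))" for x
      unfolding main using h_pos \<tau> by (simp add: right_diff_distrib)
    ultimately show ?thesis unfolding hh rn by simp
  next
    case False
    have irr: "a / b \<notin> \<rat>"
    proof
      assume "a / b \<in> \<rat>"
      then obtain m n :: nat where mn: "n \<noteq> 0" "\<bar>a / b\<bar> = real m / real n" "coprime m n"
        by (rule Rats_abs_nat_div_natE)
      then have e: "a / b = real m / real n" using a_pos b_pos by simp
      have "m \<noteq> 0" using e a_pos b_pos mn by (intro notI) auto
      then have "log_ratio p q m n" unfolding log_ratio_def using mn e by (simp add: a_def b_def)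
      then show False using False by blast
    qed
    have dense: "\<exists>j1 k1 j2 k2. \<bar>(real j1 * a + real k1 * b) - (real j2 * a + real k2 * b) - u\<bar> < \<epsilon>" if \<epsilon>: "\<epsilon> > 0" for u \<epsilon>
    proof -
      have "0 < \<epsilon> / b" using \<epsilon> b_pos by simp
      then obtain j i where ij: "i > 0" "\<bar>of_int i * (a / b) - of_int j - u / b\<bar> < \<epsilon> / b"
        by (rule sequence_of_fractional_parts_is_dense[OF irr]) (rule that)
      have "\<bar>of_int i * a - of_int j * b - u\<bar> = b * \<bar>of_int i * (a / b) - of_int j - u / b\<bar>"
      proof -
        have "of_int i * a - of_int j * b - u = b * (of_int i * (a / b) - of_int j - u / b)" using b_pos by (simp add: field_simps)
        then show ?thesis using b_pos by (simp add: abs_mult)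
      qed
      also have "\<dots> < \<epsilon>" using ij(2) b_pos by (simp add: pos_less_divide_eq mult.commute)
      finally have 1: "\<bar>of_int i * a - of_int j * b - u\<bar> < \<epsilon>" .
      \<comment> \<open>The integer j may have either sign; its parts \<open>nat (- j)\<close> and
        \<open>nat j\<close> supply the multiplicities of b on the two sides.\<close>
      have "real (nat i) = of_int i" using ij(1) by simp
      moreover have "real (nat (- j)) - real (nat j) = - of_int j" by (cases "j \<ge> 0") auto
      ultimately have "(real (nat i) * a + real (nat (- j)) * b) - (real 0 * a + real (nat j) * b) = of_int i * a - of_int j * b"
        by (simp add: add_diff_eq[symmetric] left_diff_distrib[symmetric])
      then show ?thesis using 1 by metis
    qed
    have "((\<lambda>x. G x - mellin B (- 1) / of_real h) \<longlongrightarrow> mellin B (- 1) / of_real h - mellin B (- 1) / of_real h) at_top"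
      by (intro tendsto_diff tendsto_const G_tendsto_nonlattice dense)
    moreover have "fluct p q (mellin B) y = 0" for y using False unfolding fluct_def by (simp only: if_False)
    ultimately show ?thesis unfolding hh by simp
  qed
qed

text \<open>The increments of b control the discrete side: increments of mu, hence depoissonization
  with error n^(1/2-\<delta>) (sqrt n + 1) / n -> 0. The bound on discs controls the analytic side,
  the source of the renewal equation. The condition \<delta> < 1/2 keeps the exponent 1/2 - \<delta>
  positive, as Jensen's inequality for powers demands.\<close>

lemma mean_asymptotics:
  fixes mu b :: "nat \<Rightarrow> complex"
  assumes pq: "0 < p" "0 < q" "p + q = 1" and \<delta>: "0 < \<delta>" "\<delta> < 1 / 2" and \<kappa>: "0 < \<kappa>"
    and mu: "\<And>n. mu n = binom_avg p q mu n + binom_avg q p mu n + b n"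
    and mu01: "mu 0 = 0" "mu (Suc 0) = 0"
    and b: "\<And>n. n > 0 \<Longrightarrow> norm (b (Suc n) - b n) \<le> C * real n powr (1 / 2 - \<delta>)"
    and disc: "\<And>x z. R \<le> x \<Longrightarrow> norm (z - of_real x) \<le> \<kappa> * x \<Longrightarrow> norm (ptrans b z) \<le> C' * x powr (1 - \<delta>)"
  shows "(\<lambda>n. mu n / of_nat n - (mellin (ptrans b) (- 1) / of_real (binary_entropy p q)
      + fluct p q (mellin (ptrans b)) (real (log_ratio_num p q) * log (1 / p) (real n)))) \<longlonglongrightarrow> 0"
    and "\<And>s. -2 < Re s \<Longrightarrow> Re s < - 1 + \<delta> \<Longrightarrow> mellin_integrable (ptrans b) s"
proof -
  define s where "s = 1 / 2 - \<delta>"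
  have s: "0 < s" "s \<le> 1" using \<delta> by (auto simp: s_def)
  obtain D where D: "D \<ge> 0" "\<And>n. norm (mu (Suc n) - mu n) \<le> D * real n powr s"
    using recurrence_difference_bound[OF pq s mu mu01 b[folded s_def]] by blast
  have emu: "entire_coeffs mu" by (rule entire_coeffs_poly2[OF difference_bound_poly2[OF D(2,1) s mu01(1)]])
  have pqc: "complex_of_real p + of_real q = 1" "complex_of_real q + of_real p = 1"
    using pq(3) by (simp_all only: of_real_add[symmetric] add.commute of_real_1)
  have th1: "ptrans mu (of_real p * z) = ptrans (binom_avg p q mu) z" "entire_coeffs (binom_avg p q mu)" for z
    using ptrans_thinning[OF emu pqc(1)] unfolding binom_avg_def[abs_def] by auto
  have th2: "ptrans mu (of_real q * z) = ptrans (binom_avg q p mu) z" "entire_coeffs (binom_avg q p mu)" for z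
    using ptrans_thinning[OF emu pqc(2)] unfolding binom_avg_def[abs_def] by auto
  \<comment> \<open>Read backwards, b is the defect of mu in the recurrence, so its generating
    function is entire because mu grows at most quadratically.\<close>
  have beq: "b = (\<lambda>n. mu n - (binom_avg p q mu n + binom_avg q p mu n))"
  proof
    show "b n = mu n - (binom_avg p q mu n + binom_avg q p mu n)" for n by (subst mu) simp
  qed
  have eb: "entire_coeffs b" unfolding beq by (intro entire_coeffs_diff entire_coeffs_add emu th1 th2)
  \<comment> \<open>For n = 0 and n = 1 the averages involve only the vanishing values
    \<open>mu 0\<close> and \<open>mu 1\<close>. These two zeros of b are the double zero of B at
    0.\<close>
  have b0: "b 0 = 0" unfolding beq using mu01 by (simp add: binom_avg_def)
  have b1: "b (Suc 0) = 0" unfolding beq using mu01 by (simp add: binom_avg_def)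
  define B B' B'' where "B = ptrans b" and "B' = ptrans (\<lambda>n. b (Suc n) - b n)"
    and "B'' = ptrans (\<lambda>n. (b (Suc (Suc n)) - b (Suc n)) - (b (Suc n) - b n))"
  have dB: "(B has_field_derivative B' z) (at z)" for z
    unfolding B_def B'_def by (rule ptrans_has_field_derivative[OF eb])
  have dB': "(B' has_field_derivative B'' z) (at z)" for z
    unfolding B'_def B''_def by (rule ptrans_has_field_derivative[OF entire_coeffs_difference[OF eb]])
  have B''c: "continuous_on UNIV B''"
    unfolding B''_def
    by (rule holomorphic_on_imp_continuous_on[OF ptrans_holomorphic[OF entire_coeffs_difference[OF entire_coeffs_difference[OF eb]]]])
  have B00: "B 0 = 0" "B' 0 = 0" using b0 b1 by (simp_all add: B_def B'_def ptrans_0)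
  obtain K where K: "0 \<le> K"
    "\<And>x. x > 0 \<Longrightarrow> norm (B (of_real x)) \<le> K * x\<^sup>2 * (1 + x) powr (- 1 - \<delta>)"
    "\<And>x. x > 0 \<Longrightarrow> norm (B' (of_real x)) \<le> K * x * (1 + x) powr (- 1 - \<delta>)"
    "\<And>x. x > 0 \<Longrightarrow> norm (B'' (of_real x)) \<le> K * (1 + x) powr (- 1 - \<delta>)"
  proof (rule entire_bump_bounds[OF dB dB' B''c B00 \<delta>(1) \<kappa>, of R C'])
    show "norm (B z) \<le> C' * x powr (1 - \<delta>)" if "R \<le> x" "norm (z - of_real x) \<le> \<kappa> * x" for x z
      unfolding B_def by (rule disc[OF that])
  qed (rule that; blast)
  define f f' where "f = ptrans mu" and "f' = ptrans (\<lambda>n. mu (Suc n) - mu n)"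
  interpret R: renewal_equation p q \<delta> K f f' B B' B''
  proof
    show "(f has_field_derivative f' z) (at z)" for z
      unfolding f_def f'_def by (rule ptrans_has_field_derivative[OF emu])
    show "isCont f' 0"
      unfolding f'_def by (rule DERIV_isCont[OF ptrans_has_field_derivative[OF entire_coeffs_difference[OF emu]]])
    show "f 0 = 0" "f' 0 = 0" using mu01 by (simp_all add: f_def f'_def ptrans_0)
    show "f z = f (of_real p * z) + f (of_real q * z) + B z" for z
      unfolding f_def th1 th2 B_def beq
      by (simp add: ptrans_diff ptrans_add emu th1 th2 entire_coeffs_add)
  qed (fact pq \<delta> K dB dB' B''c)+
  show "mellin_integrable (ptrans b) z" if "-2 < Re z" "Re z < - 1 + \<delta>" for z
    using R.mellin_B_integrable[OF that] by (simp add: B_def)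
  define L where "L x = mellin B (- 1) / of_real (binary_entropy p q)
      + fluct p q (mellin B) (real (log_ratio_num p q) * (x / ln (1 / p)))" for x
  have "(\<lambda>n. R.G (ln (real n)) - L (ln (real n))) \<longlonglongrightarrow> 0"
  proof (rule filterlim_compose[where g="\<lambda>x. R.G x - L x"])
    show "((\<lambda>x. R.G x - L x) \<longlongrightarrow> 0) at_top" unfolding L_def by (rule R.G_asymptotics)
    show "filterlim (\<lambda>n. ln (real n)) at_top sequentially" by real_asymp
  qed
  moreover have "(\<lambda>n. mu n / of_nat n - R.G (ln (real n))) \<longlonglongrightarrow> 0"
  proof (rule Lim_null_comparison)
    show "\<forall>\<^sub>F n in sequentially. norm (mu n / of_nat n - R.G (ln (real n))) \<le> D * real n powr s * (sqrt (real n) + 1) / real n"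
      using eventually_gt_at_top[of 0]
    proof eventually_elim
      case (elim n)
      have "R.G (ln (real n)) = ptrans mu (of_nat n) / of_nat n" unfolding R.G_def using elim by (simp add: f_def)
      then have "mu n / of_nat n - R.G (ln (real n)) = - ((ptrans mu (of_nat n) - mu n) / of_nat n)"
        by (simp add: diff_divide_distrib)
      then have "norm (mu n / of_nat n - R.G (ln (real n))) = norm (ptrans mu (of_nat n) - mu n) / real n"
        by (simp add: norm_divide)
      also have "\<dots> \<le> D * real n powr s * (sqrt (real n) + 1) / real n"
        by (intro divide_right_mono depoissonization[OF D(2,1) s mu01(1) elim]) auto
      finally show ?case .
    qed
    show "(\<lambda>n. D * real n powr s * (sqrt (real n) + 1) / real n) \<longlonglongrightarrow> 0"
      unfolding s_def using \<delta> by real_asymp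
  qed
  ultimately have "(\<lambda>n. (mu n / of_nat n - R.G (ln (real n))) + (R.G (ln (real n)) - L (ln (real n)))) \<longlonglongrightarrow> 0 + 0"
    by (intro tendsto_add)
  then have "(\<lambda>n. mu n / of_nat n - L (ln (real n))) \<longlonglongrightarrow> 0" by simp
  moreover have "L (ln (real n)) = mellin (ptrans b) (- 1) / of_real (binary_entropy p q)
      + fluct p q (mellin (ptrans b)) (real (log_ratio_num p q) * log (1 / p) (real n))" for n
    unfolding L_def B_def log_def ..
  ultimately show "(\<lambda>n. mu n / of_nat n - (mellin (ptrans b) (- 1) / of_real (binary_entropy p q)
      + fluct p q (mellin (ptrans b)) (real (log_ratio_num p q) * log (1 / p) (real n)))) \<longlonglongrightarrow> 0" by simp
qed

section \<open>Coefficient bounds from growth in sectors\<close>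

lemma cos_le_quadratic:
  assumes "\<bar>t\<bar> \<le> pi" shows "cos t \<le> 1 - t\<^sup>2 / (2 * pi\<^sup>2)"
proof -
  have "(\<bar>t\<bar> / pi)\<^sup>2 \<le> (norm (cis t - 1))\<^sup>2"
    using norm_cis_minus_1_ge[OF assms] by (intro power_mono) auto
  also have "(norm (cis t - 1))\<^sup>2 = (cos t - 1)\<^sup>2 + (sin t)\<^sup>2" by (simp add: cmod_power2)
  also have "\<dots> = 2 - 2 * cos t" using sin_cos_squared_add[of t] by (simp add: power2_eq_square algebra_simps)
  finally show ?thesis using pi_gt_zero by (simp add: power_divide field_simps)
qed

text \<open>At x = 1/n this bound gives (n + 1/2) ln(1 + 1/n) >= 1 with no loss, which is the
  monotonicity behind \<open>fact_le_stirling\<close>.\<close>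

lemma ln_one_plus_ge:
  assumes "x \<ge> (0::real)" shows "ln (1 + x) \<ge> 2 * x / (2 + x)"
proof -
  let ?f = "\<lambda>x::real. ln (1 + x) - 2 * x / (2 + x)"
  have "?f 0 \<le> ?f x"
  proof (rule DERIV_nonneg_imp_nondecreasing[OF assms])
    fix y :: real assume y: "0 \<le> y"
    have "(?f has_real_derivative (1 / (1 + y) - (2 * (2 + y) - 2 * y) / (2 + y)\<^sup>2)) (at y)"
      using y by (auto intro!: derivative_eq_intros simp: power2_eq_square)
    moreover have "1 / (1 + y) - (2 * (2 + y) - 2 * y) / (2 + y)\<^sup>2 = y\<^sup>2 / ((1 + y) * (2 + y)\<^sup>2)"
      using y by (simp add: divide_simps) (simp add: power2_eq_square algebra_simps)
    ultimately show "\<exists>d. (?f has_real_derivative d) (at y) \<and> 0 \<le> d" using y by force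
  qed
  then show ?thesis by simp
qed

text \<open>The sequence n! e^n / (n^n sqrt n) is decreasing and equals e at n = 1.\<close>

lemma fact_le_stirling:
  assumes "n > 0" shows "fact n * exp (real n) / real n ^ n \<le> exp 1 * sqrt (real n)"
proof -
  have "fact n * exp (real n) / (real n ^ n * sqrt (real n)) \<le> exp 1"
    using assms
  proof (induction n rule: nat_induct_non_zero)
    case (Suc n)
    define s where "s m = fact m * exp (real m) / (real m ^ m * sqrt (real m))" for m :: nat
    have n: "real n > 0" using Suc by simp
    have "s (Suc n) \<le> s n"
    proof -
      have "exp 1 \<le> (1 + 1 / real n) powr (real n + 1 / 2)"
      proof -
        have "1 \<le> (real n + 1 / 2) * ln (1 + 1 / real n)"
        proof -
          have "(real n + 1 / 2) * (2 * (1 / real n) / (2 + 1 / real n)) \<le> (real n + 1 / 2) * ln (1 + 1 / real n)"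
            by (intro mult_left_mono ln_one_plus_ge) auto
          moreover have "(real n + 1 / 2) * (2 * (1 / real n) / (2 + 1 / real n)) = 1"
            using n by (simp add: divide_simps)
          ultimately show ?thesis by simp
        qed
        moreover have "1 + 1 / real n > 0" using n by (simp add: add_pos_pos)
        ultimately show ?thesis by (simp add: powr_def)
      qed
      also have "\<dots> = (1 + 1 / real n) ^ n * sqrt (1 + 1 / real n)"
      proof -
        have "1 + 1 / real n > 0" using n by (simp add: add_pos_pos)
        then show ?thesis by (simp add: powr_add powr_realpow powr_half_sqrt)
      qed
      also have "(1 + 1 / real n) = real (Suc n) / real n" using n by (simp add: field_simps)
      finally have e: "exp 1 \<le> (real (Suc n) / real n) ^ n * sqrt (real (Suc n) / real n)" .
      have "s (Suc n) = (fact n * exp (real n) / (real (Suc n) ^ n * sqrt (real (Suc n)))) * exp 1"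
        unfolding s_def by (simp add: exp_add field_simps del: of_nat_Suc) (simp add: exp_add algebra_simps)
      also have "\<dots> \<le> (fact n * exp (real n) / (real (Suc n) ^ n * sqrt (real (Suc n)))) * ((real (Suc n) / real n) ^ n * sqrt (real (Suc n) / real n))"
        by (intro mult_left_mono e) auto
      also have "\<dots> = s n"
        unfolding s_def using n by (simp add: power_divide real_sqrt_divide del: of_nat_Suc)
      finally show ?thesis .
    qed
    then show ?case using Suc unfolding s_def by simp
  qed simp
  then have "fact n * exp (real n) / real n ^ n / sqrt (real n) \<le> exp 1" by (simp add: divide_simps)
  then show ?thesis using assms by (simp add: pos_divide_le_eq mult_ac)
qed

lemma exp_neg_le_inverse: "u \<ge> 0 \<Longrightarrow> exp (- u) \<le> 1 / (1 + (u::real))"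
  using exp_ge_add_one_self[of u] by (simp add: exp_minus divide_inverse le_imp_inverse_le)

text \<open>Gaussian factors are majorized by exp(-u) <= 1 / (1 + u). The integral is then an
  arctangent and keeps the order 1 / sqrt k of the Gaussian integral.\<close>

lemma has_integral_lorentz:
  assumes k: "k > (0::real)"
  obtains I where "((\<lambda>t. 1 / (1 + k * t\<^sup>2)) has_integral I) {- pi..pi}" "I \<le> pi / sqrt k"
proof -
  let ?F = "\<lambda>t. arctan (sqrt k * t) / sqrt k"
  have "((\<lambda>t. 1 / (1 + k * t\<^sup>2)) has_integral (?F pi - ?F (- pi))) {- pi..pi}"
  proof (rule fundamental_theorem_of_calculus)
    fix t :: real
    have "(?F has_real_derivative (1 / (1 + (sqrt k * t)\<^sup>2)) * sqrt k / sqrt k) (at t)"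
      by (auto intro!: derivative_eq_intros simp: divide_inverse)
    then have "(?F has_real_derivative 1 / (1 + k * t\<^sup>2)) (at t)" using k by (simp add: power_mult_distrib)
    then show "(?F has_vector_derivative 1 / (1 + k * t\<^sup>2)) (at t within {- pi..pi})"
      by (simp add: has_real_derivative_iff_has_vector_derivative has_vector_derivative_at_within)
  qed (use pi_gt_zero in linarith)
  moreover have "?F pi - ?F (- pi) \<le> pi / sqrt k"
  proof -
    have "arctan (sqrt k * pi) \<le> pi / 2" using arctan_ubound[of "sqrt k * pi"] by simp
    then show ?thesis using k by (simp add: arctan_minus diff_divide_distrib[symmetric] divide_right_mono)
  qed
  ultimately show ?thesis by (rule that)
qed

text \<open>Cauchy's coefficient formula on a circle, with the radius absorbed into the
  coefficients.\<close>

lemma coeff_has_integral: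
  fixes a :: "nat \<Rightarrow> complex"
  assumes a: "summable (\<lambda>k. norm (a k))"
  shows "((\<lambda>\<theta>. (\<Sum>k. a k * cis (real k * \<theta>)) * cis (- (real n * \<theta>))) has_integral 2 * of_real pi * a n) {- pi..pi}"
proof -
  let ?S = "{- pi..pi}"
  define P where "P N \<theta> = (\<Sum>k<N. a k * cis (real k * \<theta>) * cis (- (real n * \<theta>)))" for N \<theta>
  have cisint: "((\<lambda>\<theta>. a k * cis (real k * \<theta>) * cis (- (real n * \<theta>))) has_integral (if k = n then 2 * of_real pi * a n else 0)) ?S" for k
  proof -
    have "((\<lambda>\<theta>. a k * cis (of_int (int k - int n) * (\<theta> - 0))) has_integral a k * (if int k - int n = 0 then 2 * of_real pi else 0)) {0 - pi..0 + pi}"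
      by (intro has_integral_mult_right has_integral_cis_period)
    moreover have "a k * cis (real k * \<theta>) * cis (- (real n * \<theta>)) = a k * cis (of_int (int k - int n) * (\<theta> - 0))" for \<theta>
      by (simp add: mult.assoc cis_mult left_diff_distrib)
    ultimately show ?thesis by (cases "k = n") (simp_all only: of_nat_eq_iff diff_eq_eq simp_thms if_True if_False mult_zero_right diff_0 add_0 diff_self add.left_neutral mult.commute[of "a n"])
  qed
  have Pint: "(P N has_integral (\<Sum>k<N. if k = n then 2 * of_real pi * a n else 0)) ?S" for N
    unfolding P_def by (intro has_integral_sum cisint) auto
  have Plim: "(\<lambda>N. P N \<theta>) \<longlonglongrightarrow> (\<Sum>k. a k * cis (real k * \<theta>)) * cis (- (real n * \<theta>))" for \<theta>
  proof -
    have "summable (\<lambda>k. a k * cis (real k * \<theta>))"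
      by (rule summable_norm_cancel) (use a in \<open>simp add: norm_mult\<close>)
    from tendsto_mult_right[OF summable_LIMSEQ[OF this], of "cis (- (real n * \<theta>))"]
    show ?thesis unfolding P_def by (simp add: sum_distrib_right)
  qed
  have Pb: "norm (P N \<theta>) \<le> (\<Sum>k. norm (a k))" for N \<theta>
  proof -
    have "norm (P N \<theta>) \<le> (\<Sum>k<N. norm (a k))" unfolding P_def by (rule sum_norm_le) (simp add: norm_mult)
    also have "\<dots> \<le> (\<Sum>k. norm (a k))" by (rule sum_le_suminf[OF a]) auto
    finally show ?thesis .
  qed
  let ?F = "\<lambda>\<theta>. (\<Sum>k. a k * cis (real k * \<theta>)) * cis (- (real n * \<theta>))"
  have d: "?F integrable_on ?S" "(\<lambda>N. integral ?S (P N)) \<longlonglongrightarrow> integral ?S ?F"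
  proof -
    have d1: "P N integrable_on ?S" for N using Pint[of N] by (rule has_integral_integrable)
    have d2: "(\<lambda>_. \<Sum>k. norm (a k)) integrable_on ?S" by (rule integrable_const_ivl)
    have d3: "norm (P N t) \<le> (\<Sum>k. norm (a k))" if "t \<in> ?S" for N t by (rule Pb)
    have d4: "(\<lambda>N. P N t) \<longlonglongrightarrow> ?F t" if "t \<in> ?S" for t by (rule Plim)
    show "?F integrable_on ?S" "(\<lambda>N. integral ?S (P N)) \<longlonglongrightarrow> integral ?S ?F"
      using dominated_convergence[OF d1 d2 d3 d4] by blast+
  qed
  have "(\<lambda>N. integral ?S (P N)) \<longlonglongrightarrow> 2 * of_real pi * a n"
  proof (rule tendsto_eventually)
    show "\<forall>\<^sub>F N in sequentially. integral ?S (P N) = 2 * of_real pi * a n"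
      using eventually_gt_at_top[of n] by eventually_elim (simp add: integral_unique[OF Pint])
  qed
  then have "integral ?S ?F = 2 * of_real pi * a n" using d(2) LIMSEQ_unique by blast
  then show ?thesis using d(1) by (simp add: has_integral_integrable_integral)
qed

lemma coeff_integral_bound:
  fixes F :: "real \<Rightarrow> complex"
  assumes int: "(F has_integral I) {- pi..pi}"
    and le: "\<And>\<theta>. \<theta> \<in> {- pi..pi} \<Longrightarrow> norm (F \<theta>) \<le> A / (1 + k * \<theta>\<^sup>2)" and k: "k > 0" and A: "A \<ge> 0"
  shows "norm I \<le> A * (pi / sqrt k)"
proof -
  obtain J where J: "((\<lambda>t. 1 / (1 + k * t\<^sup>2)) has_integral J) {- pi..pi}" "J \<le> pi / sqrt k"
    by (rule has_integral_lorentz[OF k]) (rule that)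
  from has_integral_mult_right[OF J(1), of A] have J2: "((\<lambda>t. A / (1 + k * t\<^sup>2)) has_integral A * J) {- pi..pi}" by simp
  have "norm (integral {- pi..pi} F) \<le> integral {- pi..pi} (\<lambda>t. A / (1 + k * t\<^sup>2))"
    by (rule integral_norm_bound_integral) (use int J2 le in \<open>auto intro: has_integral_integrable\<close>)
  also have "\<dots> = A * J" using J2 by (rule integral_unique)
  also have "\<dots> \<le> A * (pi / sqrt k)" using J(2) A by (intro mult_left_mono) auto
  finally show ?thesis using int by (simp add: integral_unique)
qed

text \<open>Cauchy's formula on the saddle point circle |z| = n. The factor n! e^n / n^n is O(sqrt
  n), the Gaussian in Arg has width 1 / sqrt n, and the two cancel, leaving n^(1-\<delta>). For an
  increment the integrand gains a factor of size 1/n + |Arg z|, which is of order 1 / sqrt n on the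
  effective width and accounts for n^(1/2-\<delta>).\<close>

lemma poisson_coeff_bounds:
  fixes t :: "nat \<Rightarrow> complex"
  assumes et: "entire_coeffs t" and \<kappa>: "\<kappa> > 0" and C: "C \<ge> 0"
    and bound: "\<And>z. norm z \<ge> N0 \<Longrightarrow>
        norm (exp z * ptrans t z) \<le> C * norm z powr (1 - \<delta>) * exp (norm z * (1 - \<kappa> * (Arg z)\<^sup>2))"
  obtains D where "\<And>n. n > 0 \<Longrightarrow> real n \<ge> N0 \<Longrightarrow> norm (t n) \<le> D * real n powr (1 - \<delta>)"
    "\<And>n. n > 0 \<Longrightarrow> real n \<ge> N0 \<Longrightarrow> norm (t (Suc n) - t n) \<le> D * real n powr (1 / 2 - \<delta>)"
proof -
  define E where "E = exp (1::real)"
  define D1 where "D1 = E * C / sqrt \<kappa>"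
  \<comment> \<open>Chosen so that 2 + u <= c2 exp(\<kappa> u / 2): half of the Gaussian exponent
    absorbs the factor coming from the increment, and the other half is integrated.\<close>
  define c2 where "c2 = 2 + 2 / \<kappa>"
  define D2 where "D2 = E * C * c2 / sqrt (\<kappa> / 2)"
  have main: "norm (t n) \<le> D1 * real n powr (1 - \<delta>) \<and> norm (t (Suc n) - t n) \<le> D2 * real n powr (1 / 2 - \<delta>)"
    if n: "n > 0" and N: "real n \<ge> N0" for n
  proof -
    define r where "r = real n"
    have r: "r \<ge> 1" using n by (simp add: r_def)
    define a where "a k = t k * of_real (r ^ k) / fact k" for k
    have as: "summable (\<lambda>k. norm (a k))"
      using entire_coeffs_norm_summable[OF et, of r] r by (simp add: a_def norm_mult norm_divide norm_power)
    define S where "S \<theta> = (\<Sum>k. a k * cis (real k * \<theta>))" for \<theta>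
    have S: "S \<theta> = exp (of_real r * cis \<theta>) * ptrans t (of_real r * cis \<theta>)" for \<theta>
    proof -
      have "t k * (of_real r * cis \<theta>) ^ k / fact k = a k * cis (real k * \<theta>)" for k
        by (simp add: a_def power_mult_distrib Complex.DeMoivre)
      then show ?thesis unfolding ptrans_def S_def by (simp add: exp_minus)
    qed
    have Sb: "norm (S \<theta>) \<le> C * r powr (1 - \<delta>) * exp r * exp (- \<kappa> * r * \<theta>\<^sup>2)" if \<theta>: "\<theta> \<in> {- pi..pi}" for \<theta>
    proof -
      \<comment> \<open>At \<theta> = - pi the principal argument is pi; only the squares agree on
        the whole interval.\<close>
      have "(Arg (of_real r * cis \<theta>))\<^sup>2 = \<theta>\<^sup>2"
      proof (cases "\<theta> = - pi")
        case True
        have "cis \<theta> = - 1" using True by (simp add: complex_eq_iff)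
        then have "of_real r * cis \<theta> = of_real (- r)" by simp
        moreover have "Arg (of_real (- r)) = pi" unfolding Arg_of_real using r by simp
        ultimately show ?thesis using True by simp
      next
        case False
        have "Arg (of_real r * cis \<theta>) = \<theta>"
          by (rule Arg_unique[of r]) (use r \<theta> False in \<open>auto simp: cis_conv_exp\<close>)
        then show ?thesis by simp
      qed
      moreover have "norm (of_real r * cis \<theta>) = r" using r by (simp add: norm_mult)
      ultimately have "norm (S \<theta>) \<le> C * r powr (1 - \<delta>) * exp (r * (1 - \<kappa> * \<theta>\<^sup>2))"
        unfolding S using bound[of "of_real r * cis \<theta>"] N by (simp add: r_def)
      also have "exp (r * (1 - \<kappa> * \<theta>\<^sup>2)) = exp r * exp (- \<kappa> * r * \<theta>\<^sup>2)"
        by (simp add: exp_add[symmetric] algebra_simps)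
      finally show ?thesis by (simp add: mult.assoc)
    qed
    define A where "A = C * r powr (1 - \<delta>) * exp r"
    have A0: "A \<ge> 0" using C by (simp add: A_def)
    define w where "w = fact n / r ^ n"
    have w0: "w \<ge> 0" using r by (simp add: w_def)
    have wA: "w * exp r \<le> E * sqrt r"
      using fact_le_stirling[OF n] by (simp add: w_def E_def r_def)
    have tn: "t n = of_real w * a n" using r by (simp add: w_def a_def)
    have I1: "norm (2 * of_real pi * a n) \<le> A * (pi / sqrt (\<kappa> * r))"
    proof (rule coeff_integral_bound[OF coeff_has_integral[OF as, of n]])
      fix \<theta> :: real assume \<theta>: "\<theta> \<in> {- pi..pi}"
      have "norm (S \<theta> * cis (- (real n * \<theta>))) \<le> A * exp (- (\<kappa> * r * \<theta>\<^sup>2))"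
        using Sb[OF \<theta>] by (simp add: norm_mult A_def)
      also have "\<dots> \<le> A * (1 / (1 + \<kappa> * r * \<theta>\<^sup>2))"
        using \<kappa> r A0 by (intro mult_left_mono exp_neg_le_inverse) auto
      finally show "norm ((\<Sum>k. a k * cis (real k * \<theta>)) * cis (- (real n * \<theta>))) \<le> A / (1 + \<kappa> * r * \<theta>\<^sup>2)"
        by (simp add: S_def)
    qed (use \<kappa> r A0 in auto)
    have s1: "norm (a n) \<le> A / sqrt (\<kappa> * r)"
    proof -
      have "pi * (2 * norm (a n)) \<le> pi * (A / sqrt (\<kappa> * r))" using I1 by (simp add: norm_mult mult_ac)
      then have "2 * norm (a n) \<le> A / sqrt (\<kappa> * r)" using pi_gt_zero by (simp only: mult_le_cancel_left_pos)
      then show ?thesis using norm_ge_zero[of "a n"] by linarith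
    qed
    have "norm (t n) = w * norm (a n)" unfolding tn norm_mult using w0 by simp
    also have "\<dots> \<le> w * (A / sqrt (\<kappa> * r))" by (rule mult_left_mono[OF s1 w0])
    also have "\<dots> = (w * exp r) * (C * r powr (1 - \<delta>) / sqrt (\<kappa> * r))" by (simp add: A_def)
    also have "\<dots> \<le> (E * sqrt r) * (C * r powr (1 - \<delta>) / sqrt (\<kappa> * r))"
      using C \<kappa> r by (intro mult_right_mono wA) auto
    also have "\<dots> = D1 * r powr (1 - \<delta>)" using r \<kappa> by (simp add: D1_def real_sqrt_mult)
    finally have r1: "norm (t n) \<le> D1 * r powr (1 - \<delta>)" .
    \<comment> \<open>Both coefficients are read off the same circle r = n. Normalizing t (n + 1) by
      n! / r^n, as for t n, leaves the factor (n + 1) / r = (r + 1) / r.\<close>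
    define J where "J = 2 * of_real pi * a (Suc n) * of_real ((r + 1) / r) - 2 * of_real pi * a n"
    have Jint: "((\<lambda>\<theta>. S \<theta> * cis (- (real n * \<theta>)) * (of_real ((r + 1) / r) * cis (- \<theta>) - 1)) has_integral J) {- pi..pi}"
    proof -
      have "((\<lambda>\<theta>. S \<theta> * cis (- (real (Suc n) * \<theta>)) * of_real ((r + 1) / r) - S \<theta> * cis (- (real n * \<theta>))) has_integral J) {- pi..pi}"
        unfolding J_def S_def
        by (intro has_integral_diff has_integral_mult_left coeff_has_integral[OF as])
      moreover have "S \<theta> * cis (- (real (Suc n) * \<theta>)) * of_real ((r + 1) / r) - S \<theta> * cis (- (real n * \<theta>)) =
          S \<theta> * cis (- (real n * \<theta>)) * (of_real ((r + 1) / r) * cis (- \<theta>) - 1)" for \<theta>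
      proof -
        have "cis (- (real (Suc n) * \<theta>)) = cis (- (real n * \<theta>)) * cis (- \<theta>)"
          by (simp add: cis_mult algebra_simps)
        then show ?thesis by (simp add: right_diff_distrib mult_ac)
      qed
      ultimately show ?thesis by simp
    qed
    have Jb: "norm J \<le> (A * (c2 / sqrt r)) * (pi / sqrt (\<kappa> / 2 * r))"
    proof (rule coeff_integral_bound[OF Jint])
      fix \<theta> :: real assume \<theta>: "\<theta> \<in> {- pi..pi}"
      have q: "norm (of_real ((r + 1) / r) * cis (- \<theta>) - 1) \<le> 1 / r + \<bar>\<theta>\<bar>"
      proof -
        have "of_real ((r + 1) / r) * cis (- \<theta>) - 1 = of_real (1 / r) * cis (- \<theta>) + (cis (- \<theta>) - 1)"
          using r by (simp add: add_divide_distrib distrib_right)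
        also have "norm \<dots> \<le> norm (of_real (1 / r) * cis (- \<theta>)) + norm (cis (- \<theta>) - 1)" by (rule norm_triangle_ineq)
        also have "norm (cis (- \<theta>) - 1) \<le> \<bar>\<theta>\<bar>"
        proof -
          have "norm (cis (- \<theta>) - 1) = 2 * \<bar>sin ((- \<theta>) / 2)\<bar>"
            using dist_exp_i_1[of "- \<theta>"] by (simp add: cis_conv_exp)
          also have "\<bar>sin ((- \<theta>) / 2)\<bar> \<le> \<bar>(- \<theta>) / 2\<bar>" by (rule abs_sin_x_le_abs_x)
          finally show ?thesis by simp
        qed
        finally show ?thesis using r by (simp only: norm_mult norm_cis norm_of_real mult_1_right) simp
      qed
      have q2: "1 / r + \<bar>\<theta>\<bar> \<le> (1 / sqrt r) * (2 + r * \<theta>\<^sup>2)"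
      proof -
        have sr: "sqrt r \<ge> 1" "sqrt r * sqrt r = r" using r by auto
        have "1 / r \<le> 1 / sqrt r"
          using sr by (intro divide_left_mono) (auto, metis mult_le_cancel_right1 sr(1) sr(2) order_trans zero_le_one mult.commute less_eq_real_def)
        moreover have "\<bar>\<theta>\<bar> \<le> (1 / sqrt r) * (1 + r * \<theta>\<^sup>2)"
        proof -
          have "0 \<le> (sqrt r * \<bar>\<theta>\<bar> - 1)\<^sup>2 + (sqrt r * \<bar>\<theta>\<bar>)\<^sup>2 + 1" by simp
          also have "\<dots> = 2 * (1 + r * \<theta>\<^sup>2) - 2 * (sqrt r * \<bar>\<theta>\<bar>)"
            using r by (simp add: power2_eq_square algebra_simps)
          finally have "\<bar>\<theta>\<bar> * sqrt r \<le> 1 + r * \<theta>\<^sup>2" by (simp add: mult.commute)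
          then show ?thesis using sr r by (simp add: pos_le_divide_eq)
        qed
        ultimately show ?thesis by (simp add: distrib_left)
      qed
      have q3: "(2 + r * \<theta>\<^sup>2) * exp (- \<kappa> * r * \<theta>\<^sup>2) \<le> c2 / (1 + \<kappa> / 2 * r * \<theta>\<^sup>2)"
      proof -
        define u where "u = r * \<theta>\<^sup>2"
        have u: "u \<ge> 0" using r by (simp add: u_def)
        have "(2 + u) \<le> c2 * exp (\<kappa> / 2 * u)"
        proof -
          have "c2 * exp (\<kappa> / 2 * u) \<ge> c2 * (1 + \<kappa> / 2 * u)"
            using \<kappa> exp_ge_add_one_self[of "\<kappa> / 2 * u"] by (intro mult_left_mono) (auto simp: c2_def)
          moreover have "c2 * (1 + \<kappa> / 2 * u) = 2 + u + 2 / \<kappa> + \<kappa> * u" using \<kappa> by (simp add: c2_def field_simps)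
          moreover have "\<kappa> * u \<ge> 0" "2 / \<kappa> \<ge> 0" using \<kappa> u by auto
          ultimately show ?thesis by linarith
        qed
        then have "(2 + u) * exp (- (\<kappa> * u)) \<le> (c2 * exp (\<kappa> / 2 * u)) * exp (- (\<kappa> * u))"
          by (intro mult_right_mono) auto
        also have "\<dots> = c2 * exp (- (\<kappa> / 2 * u))" by (simp add: mult.assoc flip: exp_add)
        also have "\<dots> \<le> c2 * (1 / (1 + \<kappa> / 2 * u))"
          using \<kappa> u by (intro mult_left_mono exp_neg_le_inverse) (auto simp: c2_def)
        finally show ?thesis by (simp add: u_def mult.assoc)
      qed
      have "norm (S \<theta> * cis (- (real n * \<theta>)) * (of_real ((r + 1) / r) * cis (- \<theta>) - 1)) =
         norm (S \<theta>) * norm (of_real ((r + 1) / r) * cis (- \<theta>) - 1)" by (simp only: norm_mult norm_cis mult_1_right)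
      also have "\<dots> \<le> (A * exp (- \<kappa> * r * \<theta>\<^sup>2)) * ((1 / sqrt r) * (2 + r * \<theta>\<^sup>2))"
        using Sb[OF \<theta>] q q2 A0 by (intro mult_mono) (auto simp: A_def)
      also have "\<dots> = (A / sqrt r) * ((2 + r * \<theta>\<^sup>2) * exp (- \<kappa> * r * \<theta>\<^sup>2))" by simp
      also have "\<dots> \<le> (A / sqrt r) * (c2 / (1 + \<kappa> / 2 * r * \<theta>\<^sup>2))"
        using A0 r by (intro mult_left_mono q3) auto
      finally show "norm (S \<theta> * cis (- (real n * \<theta>)) * (of_real ((r + 1) / r) * cis (- \<theta>) - 1)) \<le> (A * (c2 / sqrt r)) / (1 + \<kappa> / 2 * r * \<theta>\<^sup>2)"
        by simp
    qed (use \<kappa> r A0 in \<open>auto simp: c2_def\<close>)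
    have tJ: "t (Suc n) - t n = of_real (w / (2 * pi)) * J"
    proof -
      have "t (Suc n) = of_real w * (a (Suc n) * of_real ((r + 1) / r))"
        using r n by (simp add: w_def a_def field_simps r_def del: of_nat_Suc) (simp add: field_simps)
      then show ?thesis unfolding J_def tn by (simp add: right_diff_distrib)
    qed
    have "norm (t (Suc n) - t n) = (w / (2 * pi)) * norm J" unfolding tJ norm_mult norm_of_real using w0 by simp
    also have "\<dots> \<le> (w / (2 * pi)) * ((A * (c2 / sqrt r)) * (pi / sqrt (\<kappa> / 2 * r)))"
      using w0 by (intro mult_left_mono Jb) auto
    also have "\<dots> = (w * exp r) * (C * r powr (1 - \<delta>) * c2 / sqrt r / sqrt (\<kappa> / 2 * r) / 2)" by (simp add: A_def mult_ac)
    also have "\<dots> \<le> (E * sqrt r) * (C * r powr (1 - \<delta>) * c2 / sqrt r / sqrt (\<kappa> / 2 * r) / 2)"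
      using C \<kappa> r by (intro mult_right_mono wA) (auto simp: c2_def)
    also have "\<dots> = D2 * (r powr (1 - \<delta>) / sqrt r) / 2" using r \<kappa>
      by (simp add: D2_def real_sqrt_mult real_sqrt_divide field_simps)
    also have "r powr (1 - \<delta>) / sqrt r = r powr (1 / 2 - \<delta>)"
      using r by (simp add: powr_half_sqrt[symmetric] powr_diff[symmetric])
    also have "D2 * r powr (1 / 2 - \<delta>) / 2 \<le> D2 * r powr (1 / 2 - \<delta>)"
    proof -
      have "D2 * r powr (1 / 2 - \<delta>) \<ge> 0" using C \<kappa> by (simp add: D2_def E_def c2_def)
      then show ?thesis by simp
    qed
    finally show ?thesis using r1 by (simp add: r_def)
  qed
  define D where "D = max D1 D2"
  show ?thesis
  proof (rule that[of D])
    fix n :: nat assume n: "n > 0" "real n \<ge> N0"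
    have "D1 * real n powr (1 - \<delta>) \<le> D * real n powr (1 - \<delta>)" "D2 * real n powr (1 / 2 - \<delta>) \<le> D * real n powr (1 / 2 - \<delta>)"
      by (auto simp: D_def intro!: mult_right_mono)
    then show "norm (t n) \<le> D * real n powr (1 - \<delta>)" "norm (t (Suc n) - t n) \<le> D * real n powr (1 / 2 - \<delta>)"
      using main[OF n] by linarith+
  qed
qed

lemma extend_powr_bound:
  fixes f :: "nat \<Rightarrow> real"
  assumes "\<And>n. n > 0 \<Longrightarrow> real n \<ge> N0 \<Longrightarrow> f n \<le> D * real n powr s"
  shows "\<exists>D'\<ge>0. \<forall>n>0. f n \<le> D' * real n powr s"
proof -
  define N where "N = nat \<lceil>N0\<rceil>"
  define D' where "D' = \<bar>D\<bar> + (\<Sum>n<N. \<bar>f n\<bar> / real n powr s)"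
  have S: "(\<Sum>n<N. \<bar>f n\<bar> / real n powr s) \<ge> 0" by (intro sum_nonneg) auto
  have "f n \<le> D' * real n powr s" if n: "n > 0" for n
  proof (cases "real n \<ge> N0")
    case True
    have "f n \<le> D * real n powr s" using assms n True by blast
    also have "\<dots> \<le> D' * real n powr s" using S by (intro mult_right_mono) (auto simp: D'_def)
    finally show ?thesis .
  next
    case False
    then have "n < N" unfolding N_def by linarith
    then have "\<bar>f n\<bar> / real n powr s \<le> (\<Sum>n<N. \<bar>f n\<bar> / real n powr s)"
      by (intro member_le_sum) auto
    then have "\<bar>f n\<bar> / real n powr s \<le> D'" by (simp add: D'_def)
    then have "\<bar>f n\<bar> \<le> D' * real n powr s" using n by (simp add: pos_divide_le_eq)
    then show ?thesis by simp
  qed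
  moreover have "D' \<ge> 0" using S by (simp add: D'_def)
  ultimately show ?thesis by blast
qed

lemma Re_le_norm_quadratic: "Re z \<le> norm z * (1 - (Arg z)\<^sup>2 / (2 * pi\<^sup>2))"
proof -
  have "\<bar>Arg z\<bar> \<le> pi" using Arg_bounded[of z] by (simp add: abs_le_iff)
  then have "norm z * cos (Arg z) \<le> norm z * (1 - (Arg z)\<^sup>2 / (2 * pi\<^sup>2))"
    by (intro mult_left_mono cos_le_quadratic) auto
  moreover have "Re z = norm z * cos (Arg z)" using arg_cong[OF rcis_cmod_Arg[of z], of Re] by simp
  ultimately show ?thesis by simp
qed

lemma Re_le_norm_outside:
  assumes "\<theta> \<le> \<bar>Arg z\<bar>" "0 \<le> \<theta>"
  shows "Re z \<le> norm z * (1 - \<theta>\<^sup>2 / (2 * pi\<^sup>2))"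
proof -
  have "\<theta>\<^sup>2 \<le> (Arg z)\<^sup>2" using assms power_mono[of \<theta> "\<bar>Arg z\<bar>" 2] by simp
  then have "norm z * (1 - (Arg z)\<^sup>2 / (2 * pi\<^sup>2)) \<le> norm z * (1 - \<theta>\<^sup>2 / (2 * pi\<^sup>2))"
    by (intro mult_left_mono) (auto simp: divide_right_mono)
  then show ?thesis using Re_le_norm_quadratic[of z] by simp
qed

lemma ptrans_minus_linear:
  fixes \<tau> :: "nat \<Rightarrow> complex"
  assumes "entire_coeffs \<tau>"
  shows "entire_coeffs (\<lambda>n. \<tau> n - c * of_nat n)" "ptrans (\<lambda>n. \<tau> n - c * of_nat n) z = ptrans \<tau> z - c * z"
proof -
  have e: "entire_coeffs (\<lambda>n. of_nat n :: complex)" "entire_coeffs (\<lambda>n. c * of_nat n)"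
    by (intro entire_coeffs_cmult entire_coeffs_of_nat)+
  show "entire_coeffs (\<lambda>n. \<tau> n - c * of_nat n)" by (rule entire_coeffs_diff[OF assms e(2)])
  show "ptrans (\<lambda>n. \<tau> n - c * of_nat n) z = ptrans \<tau> z - c * z"
    by (simp only: ptrans_diff[OF assms e(2)] ptrans_cmult[OF e(1)] ptrans_of_nat)
qed

text \<open>Growth in the sector and exponential smallness outside it merge into one Gaussian bound
  in Arg z, the form required by \<open>poisson_coeff_bounds\<close>. Subtracting c z is harmless
  outside the sector, where |exp z| is already exponentially smaller than exp |z|.\<close>

lemma sector_coeff_bounds:
  fixes \<tau> :: "nat \<Rightarrow> complex"
  assumes et: "entire_coeffs \<tau>" and \<delta>: "0 < \<delta>" "\<delta> < 1" and \<theta>: "0 < \<theta>" and \<epsilon>: "0 < \<epsilon>"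
    and inner: "\<And>z. R \<le> norm z \<Longrightarrow> \<bar>Arg z\<bar> \<le> \<theta> \<Longrightarrow> norm (ptrans \<tau> z - c * z) \<le> C0 * norm z powr (1 - \<delta>)"
    and outer: "\<And>z. R \<le> norm z \<Longrightarrow> \<theta> \<le> \<bar>Arg z\<bar> \<Longrightarrow> norm (exp z * ptrans \<tau> z) \<le> C1 * exp ((1 - \<epsilon>) * norm z)"
  obtains D where "D \<ge> 0" "\<And>n. n > 0 \<Longrightarrow> norm (\<tau> n - c * of_nat n) \<le> D * real n powr (1 - \<delta>)"
    "\<And>n. n > 0 \<Longrightarrow> norm ((\<tau> (Suc n) - c * of_nat (Suc n)) - (\<tau> n - c * of_nat n)) \<le> D * real n powr (1 / 2 - \<delta>)"
proof -
  define t where "t n = \<tau> n - c * of_nat n" for n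
  have t: "entire_coeffs t" "ptrans t z = ptrans \<tau> z - c * z" for z
    using ptrans_minus_linear[OF et] unfolding t_def by auto
  define \<eta> where "\<eta> = \<theta>\<^sup>2 / (2 * pi\<^sup>2)"
  have \<eta>: "\<eta> > 0" using \<theta> by (simp add: \<eta>_def)
  \<comment> \<open>Half of the decay \<eta> is spent on absorbing the linear factor of c z.\<close>
  define \<epsilon>' where "\<epsilon>' = min \<epsilon> (\<eta> / 2)"
  have \<epsilon>': "\<epsilon>' > 0" using \<epsilon> \<eta> by (simp add: \<epsilon>'_def)
  define C2 where "C2 = \<bar>C1\<bar> + norm c * (2 / \<eta>)"
  have C2: "C2 \<ge> 0" using \<eta> by (simp add: C2_def)
  have out: "norm (exp z * ptrans t z) \<le> C2 * exp ((1 - \<epsilon>') * norm z)"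
    if z: "R \<le> norm z" "\<theta> \<le> \<bar>Arg z\<bar>" for z
  proof -
    define x where "x = norm z"
    have x: "x \<ge> 0" by (simp add: x_def)
    have "norm (exp z * ptrans t z) \<le> norm (exp z * ptrans \<tau> z) + norm (exp z * (c * z))"
      unfolding t right_diff_distrib by (rule norm_triangle_ineq4)
    also have "norm (exp z * ptrans \<tau> z) \<le> \<bar>C1\<bar> * exp ((1 - \<epsilon>') * x)"
    proof -
      have "norm (exp z * ptrans \<tau> z) \<le> C1 * exp ((1 - \<epsilon>) * x)" unfolding x_def by (rule outer[OF z])
      also have "\<dots> \<le> \<bar>C1\<bar> * exp ((1 - \<epsilon>') * x)"
        using x by (intro mult_mono) (auto simp: \<epsilon>'_def intro!: mult_right_mono)
      finally show ?thesis .
    qed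
    also have "norm (exp z * (c * z)) \<le> norm c * (2 / \<eta>) * exp ((1 - \<epsilon>') * x)"
    proof -
      have "x \<le> (2 / \<eta>) * exp (\<eta> / 2 * x)"
        using exp_ge_add_one_self[of "\<eta> / 2 * x"] \<eta> by (simp add: field_simps)
      then have "exp (Re z) * x \<le> exp (x * (1 - \<eta>)) * ((2 / \<eta>) * exp (\<eta> / 2 * x))"
        using Re_le_norm_outside[OF z(2)] \<theta> x by (intro mult_mono) (auto simp: \<eta>_def x_def)
      also have "\<dots> = (2 / \<eta>) * exp ((1 - \<eta> / 2) * x)" by (simp add: algebra_simps flip: exp_add)
      also have "\<dots> \<le> (2 / \<eta>) * exp ((1 - \<epsilon>') * x)"
        using x \<eta> by (intro mult_left_mono) (auto simp: \<epsilon>'_def intro!: mult_right_mono)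
      finally have "norm c * (exp (Re z) * x) \<le> norm c * ((2 / \<eta>) * exp ((1 - \<epsilon>') * x))" by (intro mult_left_mono) auto
      then show ?thesis by (simp add: norm_mult x_def mult_ac)
    qed
    finally show ?thesis unfolding C2_def x_def by (simp add: distrib_right)
  qed
  \<comment> \<open>The first entry serves inside the sector through the cosine bound; the second
    gives \<kappa> (Arg z)^2 <= \<epsilon>' outside it.\<close>
  define \<kappa> where "\<kappa> = min (1 / (2 * pi\<^sup>2)) (\<epsilon>' / pi\<^sup>2)"
  have \<kappa>: "\<kappa> > 0" using \<epsilon>' by (simp add: \<kappa>_def)
  define C where "C = \<bar>C0\<bar> + C2"
  define N0 where "N0 = max R 1"
  have circle: "norm (exp z * ptrans t z) \<le> C * norm z powr (1 - \<delta>) * exp (norm z * (1 - \<kappa> * (Arg z)\<^sup>2))"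
    if z: "norm z \<ge> N0" for z
  proof (cases "\<bar>Arg z\<bar> \<le> \<theta>")
    case True
    have "norm z * (1 - (Arg z)\<^sup>2 / (2 * pi\<^sup>2)) \<le> norm z * (1 - \<kappa> * (Arg z)\<^sup>2)"
    proof (rule mult_left_mono)
      have "\<kappa> * (Arg z)\<^sup>2 \<le> 1 / (2 * pi\<^sup>2) * (Arg z)\<^sup>2" by (rule mult_right_mono) (auto simp: \<kappa>_def)
      then show "1 - (Arg z)\<^sup>2 / (2 * pi\<^sup>2) \<le> 1 - \<kappa> * (Arg z)\<^sup>2" by simp
    qed simp
    then have e: "norm (exp z) \<le> exp (norm z * (1 - \<kappa> * (Arg z)\<^sup>2))" using Re_le_norm_quadratic[of z] by simp
    have "norm (ptrans t z) \<le> C0 * norm z powr (1 - \<delta>)" unfolding t using inner[of z] z True by (simp add: N0_def)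
    also have "\<dots> \<le> C * norm z powr (1 - \<delta>)" using C2 by (intro mult_right_mono) (auto simp: C_def)
    finally have "norm (exp z) * norm (ptrans t z) \<le> exp (norm z * (1 - \<kappa> * (Arg z)\<^sup>2)) * (C * norm z powr (1 - \<delta>))"
      using e by (intro mult_mono) auto
    then show ?thesis by (simp add: norm_mult mult_ac)
  next
    case False
    have Ap: "(Arg z)\<^sup>2 \<le> pi\<^sup>2"
      using Arg_bounded[of z] power_mono[of "\<bar>Arg z\<bar>" pi 2] by (simp add: abs_le_iff)
    have "\<kappa> * (Arg z)\<^sup>2 \<le> (\<epsilon>' / pi\<^sup>2) * pi\<^sup>2" using Ap \<epsilon>' \<kappa> by (intro mult_mono) (auto simp: \<kappa>_def)
    then have k: "\<kappa> * (Arg z)\<^sup>2 \<le> \<epsilon>'" by simp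
    have "1 \<le> norm z powr (1 - \<delta>)" using z \<delta> by (intro ge_one_powr_ge_zero) (auto simp: N0_def)
    have "norm (exp z * ptrans t z) \<le> C2 * exp ((1 - \<epsilon>') * norm z)" using out[of z] z False by (simp add: N0_def)
    also have "\<dots> \<le> C * exp (norm z * (1 - \<kappa> * (Arg z)\<^sup>2))"
      using k C2 by (intro mult_mono) (auto simp: C_def mult.commute[of "norm z"] intro!: mult_right_mono)
    also have "\<dots> = C * 1 * exp (norm z * (1 - \<kappa> * (Arg z)\<^sup>2))" by simp
    also have "\<dots> \<le> C * norm z powr (1 - \<delta>) * exp (norm z * (1 - \<kappa> * (Arg z)\<^sup>2))"
      using C2 \<open>1 \<le> norm z powr (1 - \<delta>)\<close> by (intro mult_right_mono mult_left_mono) (auto simp: C_def)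
    finally show ?thesis .
  qed
  have C: "C \<ge> 0" using C2 by (simp add: C_def)
  obtain D where D: "\<And>n. n > 0 \<Longrightarrow> real n \<ge> N0 \<Longrightarrow> norm (t n) \<le> D * real n powr (1 - \<delta>)"
    "\<And>n. n > 0 \<Longrightarrow> real n \<ge> N0 \<Longrightarrow> norm (t (Suc n) - t n) \<le> D * real n powr (1 / 2 - \<delta>)"
  proof (rule poisson_coeff_bounds[OF t(1) \<kappa> C, of N0 \<delta>])
    show "norm (exp z * ptrans t z) \<le> C * norm z powr (1 - \<delta>) * exp (norm z * (1 - \<kappa> * (Arg z)\<^sup>2))"
      if "N0 \<le> norm z" for z by (rule circle[OF that])
  qed (rule that; blast)
  obtain D1 where D1: "D1 \<ge> 0" "\<forall>n>0. norm (t n) \<le> D1 * real n powr (1 - \<delta>)"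
    using extend_powr_bound[OF D(1)] by blast
  obtain D2 where D2: "D2 \<ge> 0" "\<forall>n>0. norm (t (Suc n) - t n) \<le> D2 * real n powr (1 / 2 - \<delta>)"
    using extend_powr_bound[OF D(2)] by blast
  show ?thesis
  proof (rule that[of "D1 + D2"])
    fix n :: nat assume n: "n > 0"
    have "norm (t n) \<le> D1 * real n powr (1 - \<delta>)" using D1 n by blast
    also have "\<dots> \<le> (D1 + D2) * real n powr (1 - \<delta>)" using D2 by (intro mult_right_mono) auto
    finally show "norm (\<tau> n - c * of_nat n) \<le> (D1 + D2) * real n powr (1 - \<delta>)" by (simp add: t_def)
    have "norm (t (Suc n) - t n) \<le> D2 * real n powr (1 / 2 - \<delta>)" using D2 n by blast
    also have "\<dots> \<le> (D1 + D2) * real n powr (1 / 2 - \<delta>)" using D1 by (intro mult_right_mono) auto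
    finally show "norm ((\<tau> (Suc n) - c * of_nat (Suc n)) - (\<tau> n - c * of_nat n)) \<le> (D1 + D2) * real n powr (1 / 2 - \<delta>)"
      by (simp only: t_def)
  qed (use D1 D2 in auto)
qed

section \<open>Discs inside the sector, and geometric perturbations of the toll\<close>

lemma ptrans_geometric: "ptrans (\<lambda>n. C * \<rho> ^ n) x = C * exp (- (1 - \<rho>) * x)" for x :: real
  using ptrans_scale[of \<rho> "1 - \<rho>" x "\<lambda>_. C"] by (simp add: ptrans_const mult.commute)

text \<open>On the disc |Im z| <= \<kappa> x and |z| >= x / 2, so |sin (Arg z)| <= 2 \<kappa> <= sin
  \<theta>; positivity of Re z excludes the obtuse range.\<close>

lemma Arg_le_of_disc:
  assumes x: "x > 0" and \<kappa>: "0 < \<kappa>" "\<kappa> \<le> 1 / 2" "2 * \<kappa> \<le> sin \<theta>" and \<theta>: "0 < \<theta>" "\<theta> < pi / 2"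
    and z: "norm (z - of_real x) \<le> \<kappa> * x"
  shows "\<bar>Arg z\<bar> \<le> \<theta>"
proof (rule ccontr)
  assume "\<not> \<bar>Arg z\<bar> \<le> \<theta>"
  then have gt: "\<theta> < \<bar>Arg z\<bar>" by simp
  have "\<bar>Re z - x\<bar> \<le> \<kappa> * x" "\<bar>Im z\<bar> \<le> \<kappa> * x"
    using order_trans[OF abs_Re_le_cmod z] order_trans[OF abs_Im_le_cmod z] by auto
  then have re: "Re z \<ge> (1 - \<kappa>) * x" and im: "\<bar>Im z\<bar> \<le> \<kappa> * x" by (auto simp: algebra_simps)
  have "(1 - \<kappa>) * x \<ge> 1 / 2 * x" using \<kappa> x by (intro mult_right_mono) auto
  then have re': "Re z \<ge> x / 2" using re by simp
  have nz: "norm z \<ge> x / 2" using complex_Re_le_cmod[of z] re' by linarith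
  have zz: "Re z = norm z * cos (Arg z)" "Im z = norm z * sin (Arg z)"
    using arg_cong[OF rcis_cmod_Arg[of z], of Re] arg_cong[OF rcis_cmod_Arg[of z], of Im] by simp_all
  have "cos (Arg z) > 0"
  proof (rule ccontr)
    assume "\<not> cos (Arg z) > 0"
    then have "norm z * cos (Arg z) \<le> 0" by (simp add: mult_nonneg_nonpos)
    then show False using zz re' x by simp
  qed
  have lt: "\<bar>Arg z\<bar> < pi / 2"
  proof (rule ccontr)
    assume "\<not> \<bar>Arg z\<bar> < pi / 2"
    moreover have "\<bar>Arg z\<bar> \<le> pi" using Arg_bounded[of z] by (simp add: abs_le_iff)
    ultimately have "cos \<bar>Arg z\<bar> \<le> cos (pi / 2)" by (intro cos_monotone_0_pi_le) auto
    then show False using \<open>cos (Arg z) > 0\<close> by simp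
  qed
  have "sin \<theta> < sin \<bar>Arg z\<bar>" by (rule sin_monotone_2pi) (use gt lt \<theta> in auto)
  also have "sin \<bar>Arg z\<bar> \<le> \<bar>sin (Arg z)\<bar>" by (simp add: abs_if)
  finally have s: "sin \<theta> < \<bar>sin (Arg z)\<bar>" .
  have "(x / 2) * sin \<theta> < norm z * \<bar>sin (Arg z)\<bar>"
    using nz s x \<theta> sin_gt_zero[of \<theta>] by (intro mult_le_less_imp_less) auto
  also have "\<dots> = \<bar>Im z\<bar>" using zz(2) by (simp add: abs_mult)
  also have "\<dots> \<le> \<kappa> * x" by (rule im)
  also have "\<dots> \<le> (x / 2) * sin \<theta>" using \<kappa> x by (simp add: field_simps)
  finally show False by simp
qed

text \<open>The sector hypothesis yields the bound on discs that \<open>entire_bump_bounds\<close>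
  requires, even after an exponentially small change e of the coefficients: the Poisson transform of
  e is at most C exp(\<rho> |z| - Re z), which is bounded on narrow discs.\<close>

lemma sector_disc_bound:
  fixes \<tau> e :: "nat \<Rightarrow> complex"
  assumes et: "entire_coeffs \<tau>" and \<delta>: "0 < \<delta>" "\<delta> < 1" and \<theta>: "0 < \<theta>" "\<theta> < pi / 2"
    and inner: "\<And>z. R \<le> norm z \<Longrightarrow> \<bar>Arg z\<bar> \<le> \<theta> \<Longrightarrow> norm (ptrans \<tau> z - c * z) \<le> C0 * norm z powr (1 - \<delta>)"
    and e: "\<And>n. norm (e n) \<le> C * \<rho> ^ n" and \<rho>: "0 < \<rho>" "\<rho> < 1"
  obtains \<kappa> R' C' where "\<kappa> > 0"
    "\<And>x z. R' \<le> x \<Longrightarrow> norm (z - of_real x) \<le> \<kappa> * x \<Longrightarrow> norm (ptrans (\<lambda>n. \<tau> n - c * of_nat n + e n) z) \<le> C' * x powr (1 - \<delta>)"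
proof -
  \<comment> \<open>The first two entries keep the disc in the sector; the third ensures \<rho> (1 +
    \<kappa>) <= 1 - \<kappa>, so that \<rho> |z| <= Re z on the disc.\<close>
  define \<kappa> where "\<kappa> = min (min (1 / 2) (sin \<theta> / 2)) ((1 - \<rho>) / 2)"
  have sin: "sin \<theta> > 0" using \<theta> by (intro sin_gt_zero) auto
  have \<kappa>: "0 < \<kappa>" "\<kappa> \<le> 1 / 2" "2 * \<kappa> \<le> sin \<theta>" "2 * \<kappa> \<le> 1 - \<rho>" using sin \<rho> by (auto simp: \<kappa>_def min_def)
  define R' where "R' = max (2 * R) 1"
  have C: "C \<ge> 0" using e[of 0] norm_ge_zero[of "e 0"] by (simp del: norm_ge_zero)
  have ec: "entire_coeffs (\<lambda>n. C * \<rho> ^ n)" by (rule entire_coeffs_power)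
  have ee: "entire_coeffs e" by (rule entire_coeffs_bound[OF ec]) (use e C \<rho> in \<open>auto intro: order_trans\<close>)
  note t = ptrans_minus_linear[OF et, of c]
  define C' where "C' = 2 * \<bar>C0\<bar> + C"
  have "norm (ptrans (\<lambda>n. \<tau> n - c * of_nat n + e n) z) \<le> C' * x powr (1 - \<delta>)"
    if x: "R' \<le> x" and z: "norm (z - of_real x) \<le> \<kappa> * x" for x z
  proof -
    have x1: "x \<ge> 1" "x \<ge> 2 * R" using x by (auto simp: R'_def)
    have x0: "x > 0" using x1 by simp
    have A: "\<bar>Arg z\<bar> \<le> \<theta>" by (rule Arg_le_of_disc[OF x0 \<kappa>(1-3) \<theta> z])
    have "\<bar>Re z - x\<bar> \<le> \<kappa> * x" using order_trans[OF abs_Re_le_cmod z] by auto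
    then have re: "Re z \<ge> (1 - \<kappa>) * x" by (auto simp: algebra_simps)
    have nz: "norm z \<le> (1 + \<kappa>) * x"
    proof -
      have "norm z \<le> norm (z - of_real x) + norm (of_real x :: complex)"
        using norm_triangle_ineq[of "z - of_real x" "of_real x"] by simp
      then show ?thesis using z x0 by (simp add: algebra_simps)
    qed
    have nz2: "norm z \<le> 2 * x"
    proof -
      have "(1 + \<kappa>) * x \<le> 2 * x" using \<kappa> x0 by (intro mult_right_mono) auto
      then show ?thesis using nz by simp
    qed
    have "(1 - \<kappa>) * x \<ge> 1 / 2 * x" using \<kappa> x0 by (intro mult_right_mono) auto
    then have "norm z \<ge> x / 2" using re complex_Re_le_cmod[of z] by linarith
    then have Rz: "R \<le> norm z" using x1 by simp
    have "norm (ptrans \<tau> z - c * z) \<le> C0 * norm z powr (1 - \<delta>)" by (rule inner[OF Rz A])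
    also have "\<dots> \<le> \<bar>C0\<bar> * (2 * x) powr (1 - \<delta>)"
      using nz2 \<delta> by (intro mult_mono powr_mono2) auto
    also have "\<dots> \<le> \<bar>C0\<bar> * (2 * x powr (1 - \<delta>))"
    proof (rule mult_left_mono)
      have "(2::real) powr (1 - \<delta>) \<le> 2 powr 1" using \<delta> by (intro powr_mono) auto
      then show "(2 * x) powr (1 - \<delta>) \<le> 2 * x powr (1 - \<delta>)" using x0 by (simp add: powr_mult mult_right_mono)
    qed simp
    finally have 1: "norm (ptrans \<tau> z - c * z) \<le> 2 * \<bar>C0\<bar> * x powr (1 - \<delta>)" by simp
    have "norm (ptrans e z) \<le> exp (norm z - Re z) * ptrans (\<lambda>n. C * \<rho> ^ n) (norm z)"
      by (rule ptrans_norm_le[OF e ec])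
    also have "\<dots> = C * exp (\<rho> * norm z - Re z)"
      unfolding ptrans_geometric by (simp add: algebra_simps flip: exp_add)
    also have "\<dots> \<le> C * 1"
    proof (rule mult_left_mono[OF _ C])
      have "\<rho> * norm z \<le> \<rho> * ((1 + \<kappa>) * x)" using nz \<rho> by (intro mult_left_mono) auto
      also have "\<dots> = (\<rho> + \<rho> * \<kappa>) * x" by (simp add: algebra_simps)
      also have "\<dots> \<le> (1 - \<kappa>) * x"
      proof (rule mult_right_mono)
        have "\<rho> * \<kappa> \<le> 1 * \<kappa>" using \<rho> \<kappa> by (intro mult_right_mono) auto
        then show "\<rho> + \<rho> * \<kappa> \<le> 1 - \<kappa>" using \<kappa> by linarith
      qed (use x0 in simp)
      finally show "exp (\<rho> * norm z - Re z) \<le> 1" using re by simp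
    qed
    also have "\<dots> \<le> C * x powr (1 - \<delta>)" using C x1 \<delta> by (intro mult_left_mono ge_one_powr_ge_zero) auto
    finally have 2: "norm (ptrans e z) \<le> C * x powr (1 - \<delta>)" .
    have "ptrans (\<lambda>n. \<tau> n - c * of_nat n + e n) z = (ptrans \<tau> z - c * z) + ptrans e z"
      using ptrans_add[OF t(1) ee, of z] t(2)[of z] by simp
    also have "norm \<dots> \<le> norm (ptrans \<tau> z - c * z) + norm (ptrans e z)" by (rule norm_triangle_ineq)
    finally show ?thesis using 1 2 unfolding C'_def by (simp add: distrib_right)
  qed
  then show ?thesis using that[of \<kappa> R' C'] \<kappa>(1) by blast
qed

lemma geometric_dominates_linear:
  fixes m \<rho> :: real
  assumes "0 < m" "m < \<rho>"
  obtains C where "C \<ge> 0" "\<And>n. (real n + 1) * m ^ n \<le> C * \<rho> ^ n"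
proof -
  define r where "r = m / \<rho>"
  have r: "0 < r" "r < 1" using assms by (auto simp: r_def)
  have "(\<lambda>n. real n * r ^ n) \<longlonglongrightarrow> 0"
    using powser_times_n_limit_0[of r] r by simp
  then have "Bseq (\<lambda>n. real n * r ^ n)" by (intro convergent_imp_Bseq convergentI)
  then obtain K where K: "K > 0" "\<And>n. norm (real n * r ^ n) \<le> K" by (auto simp: Bseq_def)
  have "(real n + 1) * m ^ n \<le> (K + 1) * \<rho> ^ n" for n
  proof -
    have mr: "m ^ n = r ^ n * \<rho> ^ n" using assms by (simp add: r_def power_divide)
    have "real n * r ^ n \<le> K" using K(2)[of n] r by simp
    moreover have "r ^ n \<le> 1" using r by (intro power_le_one) auto
    ultimately have "(real n + 1) * r ^ n \<le> K + 1" by (simp add: distrib_right)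
    then have "((real n + 1) * r ^ n) * \<rho> ^ n \<le> (K + 1) * \<rho> ^ n" using assms by (intro mult_right_mono) auto
    then show ?thesis by (simp add: mr mult.assoc)
  qed
  then show ?thesis using that[of "K + 1"] K by simp
qed

section \<open>The comparison sequence\<close>

text \<open>The absorption identity completes the sum to a binomial expansion of length m + 1 from
  which only the term q^(m+1) is missing.\<close>

lemma binom_avg_inverse_Suc:
  assumes "p \<noteq> 0" "p + q = 1"
  shows "of_real p * binom_avg p q (\<lambda>k. 1 / of_nat (Suc k)) m = (1 - of_real q ^ Suc m) / of_nat (Suc m)"
proof -
  let ?P = "complex_of_real p" and ?Q = "complex_of_real q"
  have "of_nat (Suc m) * (?P * binom_avg p q (\<lambda>k. 1 / of_nat (Suc k)) m) = (\<Sum>k\<le>m. of_nat (Suc m choose Suc k) * ?P ^ Suc k * ?Q ^ (m - k))"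
    unfolding binom_avg_def sum_distrib_left
  proof (rule sum.cong[OF refl])
    fix k
    have "(of_nat (Suc k) :: complex) * of_nat (Suc m choose Suc k) = of_nat (Suc m) * of_nat (m choose k)"
      unfolding of_nat_mult[symmetric] Suc_times_binomial_eq by (simp only: mult.commute)
    moreover have "(of_nat (Suc k) :: complex) \<noteq> 0" by (simp del: of_nat_Suc)
    ultimately have "(of_nat (Suc m choose Suc k) :: complex) = of_nat (Suc m) * of_nat (m choose k) / of_nat (Suc k)"
      by (metis nonzero_mult_div_cancel_left)
    then show "of_nat (Suc m) * (?P * (of_nat (m choose k) * ?P ^ k * ?Q ^ (m - k) * (1 / of_nat (Suc k)))) =
       of_nat (Suc m choose Suc k) * ?P ^ Suc k * ?Q ^ (m - k)" by simp
  qed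
  also have "\<dots> = (\<Sum>k\<le>Suc m. of_nat (Suc m choose k) * ?P ^ k * ?Q ^ (Suc m - k)) - ?Q ^ Suc m"
    unfolding sum.atMost_Suc_shift[of _ m] by simp
  also have "\<dots> = (?P + ?Q) ^ Suc m - ?Q ^ Suc m" by (simp only: binomial_ring)
  also have "?P + ?Q = 1" by (simp only: of_real_add[symmetric] assms of_real_1)
  finally have *: "of_nat (Suc m) * (?P * binom_avg p q (\<lambda>k. 1 / of_nat (Suc k)) m) = 1 - ?Q ^ Suc m" by simp
  have "(of_nat (Suc m) :: complex) \<noteq> 0" by (simp del: of_nat_Suc)
  then show ?thesis using * by (metis nonzero_mult_div_cancel_left)
qed

text \<open>Summation of the difference formula: the increments of \<open>harm\<close> are 1 / (k +
  1), whose averages are known.\<close>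

lemma binom_avg_harm:
  assumes "p \<noteq> 0" "p + q = 1"
  shows "binom_avg p q harm m = (\<Sum>j<m. (1 - of_real q ^ Suc j) / of_nat (Suc j))"
proof (induction m)
  case 0 show ?case by (simp add: binom_avg_def harm_def)
next
  case (Suc m)
  have "binom_avg p q harm (Suc m) = binom_avg p q harm m + of_real p * binom_avg p q (\<lambda>k. harm (Suc k) - harm k) m"
    using binom_avg_difference[OF assms(2), of harm m] by (simp add: algebra_simps)
  also have "(\<lambda>k. harm (Suc k) - harm k :: complex) = (\<lambda>k. 1 / of_nat (Suc k))"
    by (auto simp: harm_Suc divide_inverse)
  finally show ?case unfolding Suc binom_avg_inverse_Suc[OF assms] by simp
qed

text \<open>The index n - 1 fits the absorption identity: the factor n lowers the average of
  \<open>nharm\<close> at n to an average of \<open>harm\<close> at n - 1. For n = 0 the factor n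
  gives 0.\<close>

definition nharm :: "nat \<Rightarrow> complex" where "nharm n = of_nat n * harm (n - 1)"

lemma binom_avg_nharm:
  "binom_avg p q nharm (Suc m) = of_nat (Suc m) * of_real p * binom_avg p q harm m"
proof -
  let ?P = "complex_of_real p" and ?Q = "complex_of_real q"
  have "binom_avg p q nharm (Suc m) = (\<Sum>k\<le>m. of_nat (Suc m choose Suc k) * ?P ^ Suc k * ?Q ^ (m - k) * nharm (Suc k))"
    unfolding binom_avg_def by (subst sum.atMost_Suc_shift) (simp add: nharm_def)
  also have "\<dots> = of_nat (Suc m) * ?P * binom_avg p q harm m"
    unfolding binom_avg_def sum_distrib_left
  proof (rule sum.cong[OF refl])
    fix k
    have e: "(of_nat (Suc m choose Suc k) :: complex) * of_nat (Suc k) = of_nat (Suc m) * of_nat (m choose k)"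
      unfolding of_nat_mult[symmetric] Suc_times_binomial_eq ..
    have "of_nat (Suc m choose Suc k) * ?P ^ Suc k * ?Q ^ (m - k) * nharm (Suc k) =
      (of_nat (Suc m choose Suc k) * of_nat (Suc k)) * (?P ^ Suc k * ?Q ^ (m - k) * harm k)"
      by (simp only: nharm_def diff_Suc_1 mult_ac)
    also have "\<dots> = of_nat (Suc m) * ?P * (of_nat (m choose k) * ?P ^ k * ?Q ^ (m - k) * harm k)"
      unfolding e by (simp only: power_Suc mult_ac)
    finally show "of_nat (Suc m choose Suc k) * ?P ^ Suc k * ?Q ^ (m - k) * nharm (Suc k) =
      of_nat (Suc m) * ?P * (of_nat (m choose k) * ?P ^ k * ?Q ^ (m - k) * harm k)" .
  qed
  finally show ?thesis .
qed

text \<open>The sum is a partial sum of p (- ln (1 - q)) + q (- ln (1 - p)), which is the entropy h;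
  hence this toll is close to h n. \<open>nharm_toll_tail\<close> bounds the remainder by the
  geometric tail of the logarithm series.\<close>

definition nharm_toll :: "real \<Rightarrow> real \<Rightarrow> nat \<Rightarrow> complex" where
  "nharm_toll p q n = of_nat n * of_real (\<Sum>j<n - 1. (p * q ^ Suc j + q * p ^ Suc j) / real (Suc j))"

lemma nharm_recurrence:
  assumes "p \<noteq> 0" "q \<noteq> 0" "p + q = 1"
  shows "nharm n = binom_avg p q nharm n + binom_avg q p nharm n + nharm_toll p q n"
proof (cases n)
  case 0 then show ?thesis by (simp add: binom_avg_def nharm_def nharm_toll_def)
next
  case (Suc m)
  let ?P = "complex_of_real p" and ?Q = "complex_of_real q"
  have qp: "q + p = 1" using assms by simp
  have PQ: "?P + ?Q = 1" by (simp only: of_real_add[symmetric] assms of_real_1)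
  have "(\<Sum>j<m. 1 / of_nat (Suc j)) = ?P * (\<Sum>j<m. (1 - ?Q ^ Suc j) / of_nat (Suc j)) + ?Q * (\<Sum>j<m. (1 - ?P ^ Suc j) / of_nat (Suc j)) +
      (\<Sum>j<m. (?P * ?Q ^ Suc j + ?Q * ?P ^ Suc j) / of_nat (Suc j))"
    unfolding sum_distrib_left sum.distrib[symmetric]
  proof (rule sum.cong[OF refl])
    fix j
    have "(?P * (1 - ?Q ^ Suc j) + ?Q * (1 - ?P ^ Suc j) + (?P * ?Q ^ Suc j + ?Q * ?P ^ Suc j)) = ?P + ?Q" by (simp add: algebra_simps)
    then show "1 / of_nat (Suc j) = ?P * ((1 - ?Q ^ Suc j) / of_nat (Suc j)) + ?Q * ((1 - ?P ^ Suc j) / of_nat (Suc j)) +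
        (?P * ?Q ^ Suc j + ?Q * ?P ^ Suc j) / of_nat (Suc j)"
      unfolding PQ times_divide_eq_right add_divide_distrib[symmetric] by (simp only:)
  qed
  moreover have "(harm m :: complex) = (\<Sum>j<m. 1 / of_nat (Suc j))"
    by (induction m) (simp_all add: harm_def[of 0] harm_Suc divide_inverse)
  ultimately have "of_nat (Suc m) * (harm m :: complex) = of_nat (Suc m) * ?P * binom_avg p q harm m + of_nat (Suc m) * ?Q * binom_avg q p harm m +
     of_nat (Suc m) * (\<Sum>j<m. (?P * ?Q ^ Suc j + ?Q * ?P ^ Suc j) / of_nat (Suc j))"
    unfolding binom_avg_harm[OF assms(1,3)] binom_avg_harm[OF assms(2) qp] by (simp only: distrib_left mult.assoc)
  then show ?thesis unfolding Suc binom_avg_nharm nharm_def[of "Suc m"] nharm_toll_def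
    by (simp del: of_nat_Suc power_Suc)
qed

lemma nharm_toll_tail:
  assumes pq: "0 < p" "0 < q" "p + q = 1"
  shows "norm (of_real (binary_entropy p q) * of_nat n - nharm_toll p q n) \<le> 2 / (1 - max p q) * (real n * max p q ^ n)"
proof (cases n)
  case 0 then show ?thesis by (simp add: nharm_toll_def)
next
  case (Suc m)
  define M where "M = max p q"
  have M: "0 < M" "M < 1" "p \<le> M" "q \<le> M" using pq by (auto simp: M_def)
  define d where "d j = (p * q ^ Suc j + q * p ^ Suc j) / real (Suc j)" for j
  have lnser: "(\<lambda>j. x ^ Suc j / real (Suc j)) sums (- ln (1 - x))" if x: "0 < x" "x < 1" for x :: real
  proof -
    have s: "summable (\<lambda>j. x ^ Suc j / real (Suc j))"
    proof (rule summable_comparison_test'[where N=0])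
      show "summable (\<lambda>j. x ^ j)" using x by (intro summable_geometric) auto
      show "norm (x ^ Suc j / real (Suc j)) \<le> x ^ j" for j
      proof -
        have "x ^ Suc j / real (Suc j) \<le> x ^ Suc j / 1" using x by (intro divide_left_mono) auto
        also have "\<dots> \<le> x ^ j" using x by (simp add: mult_left_le_one_le)
        finally show ?thesis using x by simp
      qed
    qed
    have "ln (1 - x) = (\<Sum>j. (- 1) ^ j * (1 / real (j + 1)) * ((1 - x) - 1) ^ Suc j)"
      by (rule ln_series) (use x in auto)
    also have "\<dots> = (\<Sum>j. - (x ^ Suc j / real (Suc j)))"
    proof (rule arg_cong[where f=suminf], rule ext)
      fix j
      have "(- 1) ^ j * (- x) ^ Suc j = - (x ^ Suc j)"
        by (subst power_minus) (simp add: power_mult_distrib[symmetric] flip: mult.assoc)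
      then show "(- 1) ^ j * (1 / real (j + 1)) * ((1 - x) - 1) ^ Suc j = - (x ^ Suc j / real (Suc j))" by simp
    qed
    also have "\<dots> = - (\<Sum>j. x ^ Suc j / real (Suc j))" by (rule suminf_minus[OF s])
    finally show ?thesis using summable_sums[OF s] by simp
  qed
  have "d sums (p * (- ln (1 - q)) + q * (- ln (1 - p)))"
    unfolding d_def add_divide_distrib times_divide_eq_right[symmetric]
    by (intro sums_add sums_mult lnser) (use pq in auto)
  moreover have "1 - q = p" "1 - p = q" using pq by auto
  ultimately have dh: "d sums binary_entropy p q" by (simp add: binary_entropy_def)
  have tail: "(\<lambda>j. d (j + m)) sums (binary_entropy p q - (\<Sum>j<m. d j))" by (rule sums_split_initial_segment[OF dh])
  have dle: "norm (d (j + m)) \<le> 2 * M ^ Suc m * M ^ j" for j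
  proof -
    have d0: "d i \<ge> 0" for i using pq by (simp add: d_def)
    have "d (j + m) \<le> (p * q ^ Suc (j + m) + q * p ^ Suc (j + m)) / 1"
      unfolding d_def using pq by (intro divide_left_mono) auto
    also have "\<dots> \<le> 1 * M ^ Suc (j + m) + 1 * M ^ Suc (j + m)"
      unfolding div_by_1 using M pq by (intro add_mono mult_mono power_mono) auto
    finally show ?thesis using d0 by (simp add: power_add mult_ac)
  qed
  have geo: "(\<lambda>j. 2 * M ^ Suc m * M ^ j) sums (2 * M ^ Suc m * (1 / (1 - M)))"
    by (intro sums_mult geometric_sums) (use M in auto)
  have "norm (binary_entropy p q - (\<Sum>j<m. d j)) \<le> 2 * M ^ Suc m * (1 / (1 - M))"
    using norm_suminf_le[OF dle sums_summable[OF geo]] sums_unique[OF tail] sums_unique[OF geo] by simp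
  then have "norm (complex_of_real (binary_entropy p q - (\<Sum>j<m. d j))) \<le> 2 * M ^ Suc m * (1 / (1 - M))"
    unfolding norm_of_real by simp
  then have "real n * norm (complex_of_real (binary_entropy p q - (\<Sum>j<m. d j))) \<le> real n * (2 * M ^ Suc m * (1 / (1 - M)))"
    by (rule mult_left_mono) simp
  moreover have "of_real (binary_entropy p q) * of_nat n - nharm_toll p q n = of_nat n * of_real (binary_entropy p q - (\<Sum>j<m. d j))"
    unfolding nharm_toll_def Suc d_def by (simp add: algebra_simps)
  ultimately show ?thesis unfolding Suc M_def by (simp add: norm_mult del: of_nat_Suc) (simp add: mult_ac)
qed

text \<open>Induction with the tangent of x^e at n + 1. An arbitrarily small exponent e is what
  allows the Mellin transform of \<open>ein\<close> up to Re u < 0.\<close>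

lemma harm_le_powr:
  assumes e: "0 < e" "e \<le> 1" shows "harm n \<le> real n powr e / e"
proof (induction n)
  case (Suc n)
  define x where "x = real (Suc n)"
  have x: "x > 0" by (simp add: x_def)
  have "real n powr e \<le> x powr e + e * x powr (e - 1) * (real n - x)"
    by (rule powr_le_tangent[OF e x]) simp
  then have 1: "real n powr e / e \<le> x powr e / e - x powr (e - 1)" using e by (simp add: x_def field_simps)
  have "x powr (e - 1) \<ge> x powr (- 1)" using e by (intro powr_mono) (auto simp: x_def)
  then have "inverse x \<le> x powr (e - 1)" using x by (simp add: powr_minus)
  then have "harm n + inverse x \<le> x powr e / e" using Suc 1 by linarith
  then show ?case by (simp add: harm_Suc x_def)
qed (simp add: harm_def)

lemma norm_harm: "norm (harm n :: complex) = harm n"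
proof -
  have "norm (harm n :: complex) = norm (complex_of_real (harm n))" by (simp only: of_real_harm)
  then show ?thesis using harm_nonneg[of n, where 'a=real] by simp
qed

lemma entire_coeffs_harm: "entire_coeffs (harm :: nat \<Rightarrow> complex)"
proof (rule entire_coeffs_bound[OF entire_coeffs_of_nat[where 'a=real]])
  fix n
  have "harm n \<le> real n powr 1 / 1" by (rule harm_le_powr) auto
  then show "norm (harm n :: complex) \<le> norm (real n)" unfolding norm_harm by simp
qed

text \<open>The entire exponential integral Ein(z), the integral of (1 - exp(-t)) / t from 0 to z:
  see \<open>times_ein'\<close>, and note that \<open>harm 0\<close> is 0.\<close>

definition ein :: "complex \<Rightarrow> complex" where "ein = ptrans harm"
definition ein' :: "complex \<Rightarrow> complex" where "ein' = ptrans (\<lambda>n. harm (Suc n) - harm n)"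

lemma ein_deriv: "(ein has_field_derivative ein' z) (at z)"
  unfolding ein_def ein'_def by (rule ptrans_has_field_derivative[OF entire_coeffs_harm])

lemma times_ein': "z * ein' z = 1 - exp (- z)"
proof -
  have "(\<lambda>n. z ^ Suc n /\<^sub>R fact (Suc n)) sums (exp z - 1)"
    using exp_converges[of z] by (subst sums_Suc_iff) simp
  also have "(\<lambda>n. z ^ Suc n /\<^sub>R fact (Suc n)) = (\<lambda>n. z * ((harm (Suc n) - harm n) * z ^ n / fact n))"
  proof
    fix n
    have "(harm (Suc n) - harm n :: complex) = 1 / of_nat (Suc n)" by (simp add: harm_Suc divide_inverse)
    moreover have "(fact (Suc n) :: real) = real (Suc n) * fact n" by (rule fact_Suc)
    ultimately show "z ^ Suc n /\<^sub>R fact (Suc n) = z * ((harm (Suc n) - harm n) * z ^ n / fact n)"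
      by (simp only:) (simp add: scaleR_conv_of_real divide_inverse del: of_nat_Suc)
  qed
  finally have 1: "(\<lambda>n. z * ((harm (Suc n) - harm n) * z ^ n / fact n)) sums (exp z - 1)" .
  have e: "entire_coeffs (\<lambda>n. harm (Suc n) - harm n :: complex)"
    by (intro entire_coeffs_diff entire_coeffs_Suc entire_coeffs_harm)
  have "z * (\<Sum>n. (harm (Suc n) - harm n) * z ^ n / fact n) = exp z - 1"
    using sums_unique2[OF sums_mult[OF summable_sums[OF entire_coeffs_summable[OF e]]] 1] .
  then have "z * ein' z = exp (- z) * (exp z - 1)" unfolding ein'_def ptrans_def by (simp add: mult.left_commute)
  then show ?thesis by (simp add: right_diff_distrib flip: exp_add)
qed

lemma ein_bound:
  assumes e: "0 < e" "e \<le> 1" and x: "x > 0"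
  shows "norm (ein (of_real x)) \<le> x powr e / e"
proof -
  have ee: "entire_coeffs (\<lambda>n. 1 / e * real n powr e)" using e by (intro entire_coeffs_cmult entire_coeffs_powr) auto
  have "norm (ein (of_real x)) \<le> exp (norm (complex_of_real x) - Re (of_real x)) * ptrans (\<lambda>n. 1 / e * real n powr e) (norm (complex_of_real x))"
    unfolding ein_def
    by (rule ptrans_norm_le[OF _ ee]) (use harm_le_powr[OF e] in \<open>simp add: norm_harm\<close>)
  also have "\<dots> = 1 / e * ptrans (\<lambda>n. real n powr e) x"
    using x e by (simp only: norm_of_real Re_complex_of_real abs_of_pos diff_self exp_zero mult_1) (rule ptrans_cmult, rule entire_coeffs_powr, simp)
  also have "\<dots> \<le> 1 / e * x powr e" using e x by (intro mult_left_mono ptrans_powr_le) auto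
  finally show ?thesis by simp
qed

lemma tendsto_powr_bounds:
  fixes F :: "complex \<Rightarrow> complex"
  assumes b: "\<And>x. x > 0 \<Longrightarrow> norm (F (of_real x)) \<le> C * x powr e"
  shows "- e < Re u \<Longrightarrow> ((\<lambda>x::real. F (of_real x) * of_real x powr u) \<longlongrightarrow> 0) (at_right 0)"
    and "Re u < - e \<Longrightarrow> ((\<lambda>x::real. F (of_real x) * of_real x powr u) \<longlongrightarrow> 0) at_top"
proof -
  have le: "norm (F (of_real x) * of_real x powr u) \<le> C * x powr (e + Re u)" if x: "x > 0" for x
    using mult_right_mono[OF b[OF x], of "x powr Re u"] x by (simp add: norm_mult norm_powr_real_powr powr_add mult.assoc)
  show "((\<lambda>x::real. F (of_real x) * of_real x powr u) \<longlongrightarrow> 0) (at_right 0)" if "- e < Re u"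
  proof (rule Lim_null_comparison)
    show "\<forall>\<^sub>F x in at_right 0. norm (F (of_real x) * of_real x powr u) \<le> C * x powr (e + Re u)"
      using eventually_at_right_less[of 0] by eventually_elim (rule le)
    have "e + Re u > 0" using that by simp
    then show "((\<lambda>x. C * x powr (e + Re u)) \<longlongrightarrow> 0) (at_right 0)" by real_asymp
  qed
  show "((\<lambda>x::real. F (of_real x) * of_real x powr u) \<longlongrightarrow> 0) at_top" if "Re u < - e"
  proof (rule Lim_null_comparison)
    show "\<forall>\<^sub>F x in at_top. norm (F (of_real x) * of_real x powr u) \<le> C * x powr (e + Re u)"
      using eventually_gt_at_top[of 0] by eventually_elim (rule le)
    have "e + Re u < 0" using that by simp
    then show "((\<lambda>x. C * x powr (e + Re u)) \<longlongrightarrow> 0) at_top" by real_asymp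
  qed
qed

text \<open>Applying z d/dz once to Ein gives 1 - exp(-z), and twice gives z exp(-z), whose Mellin
  transform is Gamma(u + 1). Each application multiplies the transform by -u.\<close>

lemma mellin_ein:
  assumes u: "- 1 < Re u" "Re u < 0"
  shows "mellin_integrable ein u" "mellin ein u = Gamma (u + 1) / u\<^sup>2"
proof -
  define F where "F z = 1 - exp (- z)" for z :: complex
  define E where "E z = z * exp (- z)" for z :: complex
  have Fr: "F (of_real x) = of_real (1 - exp (- x))" for x :: real
    by (simp only: F_def of_real_diff of_real_1 exp_of_real[symmetric] of_real_minus)
  have Er: "E (of_real x) = of_real (x * exp (- x))" for x :: real
    by (simp only: E_def of_real_mult exp_of_real[symmetric] of_real_minus)
  have F1: "norm (F (of_real x)) \<le> 1 * x powr 1" and F0: "norm (F (of_real x)) \<le> 1 * x powr 0" if x: "x > 0" for x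
    unfolding Fr norm_of_real using x exp_ge_add_one_self[of "- x"] by (auto simp: abs_of_nonneg)
  have E1: "norm (E (of_real x)) \<le> 1 * x powr 1" and E0: "norm (E (of_real x)) \<le> 1 * x powr 0" if x: "x > 0" for x
  proof -
    have "x * exp (- x) \<le> x * 1" using x by (intro mult_left_mono) auto
    then show "norm (E (of_real x)) \<le> 1 * x powr 1" unfolding Er norm_of_real using x by (simp add: abs_mult)
    have "x \<le> exp x" using exp_ge_add_one_self[of x] by linarith
    then have "x * exp (- x) \<le> exp x * exp (- x)" by (intro mult_right_mono) auto
    then show "norm (E (of_real x)) \<le> 1 * x powr 0" unfolding Er norm_of_real using x by (simp add: abs_mult flip: exp_add)
  qed
  have cE: "continuous_on {0<..} (\<lambda>x::real. E (of_real x))" and cF: "continuous_on {0<..} (\<lambda>x::real. F (of_real x))"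
    unfolding E_def F_def by (intro continuous_intros)+
  have iE: "mellin_integrable E u"
    by (rule mellin_integrable_bound[OF cE E1 E0, of u]) (use u in auto)
  have iF: "mellin_integrable F u"
    by (rule mellin_integrable_bound[OF cF F1 F0, of u]) (use u in auto)
  \<comment> \<open>A growth exponent for \<open>ein\<close> at infinity that is positive but still
    satisfies Re u < - e.\<close>
  define e where "e = - Re u / 2"
  have e: "0 < e" "e \<le> 1" "Re u < - e" using u by (auto simp: e_def)
  have X1: "norm (ein (of_real x)) \<le> 1 * x powr 1" if "x > 0" for x using ein_bound[of 1 x] that by simp
  have X0: "norm (ein (of_real x)) \<le> (1 / e) * x powr e" if "x > 0" for x using ein_bound[OF e(1,2) that] by simp
  have cX: "continuous_on {0<..} (\<lambda>x::real. ein (of_real x))" "continuous_on {0<..} (\<lambda>x::real. ein' (of_real x))"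
  proof -
    have "continuous_on UNIV ein" by (rule continuous_at_imp_continuous_on, intro ballI, rule DERIV_isCont[OF ein_deriv])
    then show "continuous_on {0<..} (\<lambda>x::real. ein (of_real x))" by (rule continuous_on_compose_of_real)
    have "continuous_on UNIV ein'"
      unfolding ein'_def
      by (rule holomorphic_on_imp_continuous_on[OF ptrans_holomorphic[OF entire_coeffs_diff[OF entire_coeffs_Suc[OF entire_coeffs_harm] entire_coeffs_harm]]])
    then show "continuous_on {0<..} (\<lambda>x::real. ein' (of_real x))" by (rule continuous_on_compose_of_real)
  qed
  have maxC: "1 \<le> max 1 (1 / e)" "1 / e \<le> max 1 (1 / e)" by auto
  show iX: "mellin_integrable ein u"
  proof (rule mellin_integrable_bound[OF cX(1), where C="max 1 (1 / e)" and u=1 and v=e])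
    show "norm (ein (of_real x)) \<le> max 1 (1 / e) * x powr 1" if "0 < x" for x
      using X1[OF that] mult_right_mono[OF maxC(1), of "x powr 1"] by auto
    show "norm (ein (of_real x)) \<le> max 1 (1 / e) * x powr e" if "1 \<le> x" for x
      using X0[of x] that mult_right_mono[OF maxC(2), of "x powr e"] by auto
  qed (use u e in auto)
  have zein: "(\<lambda>z. z * ein' z) = F" by (auto simp: F_def times_ein')
  have "mellin (\<lambda>z. z * ein' z) u = - u * mellin ein u"
    by (rule mellin_deriv[OF iX _ ein_deriv cX(2) tendsto_powr_bounds(1)[OF X1] tendsto_powr_bounds(2)[OF X0]])
      (use u e iF in \<open>auto simp: zein\<close>)
  then have m1: "mellin F u = - u * mellin ein u" by (simp only: zein)
  have m2: "mellin E u = - u * mellin F u"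
    unfolding E_def
  proof (rule mellin_deriv[OF iF _ _ _ tendsto_powr_bounds(1)[OF F1] tendsto_powr_bounds(2)[OF F0]])
    show "mellin_integrable (\<lambda>z. z * exp (- z)) u" using iE by (simp add: E_def[abs_def])
    show "(F has_field_derivative exp (- of_real x)) (at (of_real x))" for x
      unfolding F_def by (auto intro!: derivative_eq_intros)
  qed (use u in \<open>auto intro!: continuous_intros\<close>)
  have "mellin E u = integral {0<..} (\<lambda>x::real. E (of_real x) * of_real x powr (u - 1))"
    unfolding mellin_def by (rule set_borel_integral_eq_integral(2)) (use iE in \<open>simp add: mellin_integrable_def\<close>)
  also have "\<dots> = integral {0<..} (\<lambda>t. of_real t powr ((u + 1) - 1) / of_real (exp t))"
  proof (rule integral_cong)
    fix x :: real assume "x \<in> {0<..}"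
    then have x: "x > 0" by simp
    then have "of_real x powr ((u + 1) - 1) = of_real x * complex_of_real x powr (u - 1)" by (simp add: powr_diff)
    moreover have "exp (- complex_of_real x) = 1 / of_real (exp x)"
      by (simp add: exp_minus exp_of_real[symmetric] divide_inverse)
    ultimately show "E (of_real x) * of_real x powr (u - 1) = of_real x powr ((u + 1) - 1) / of_real (exp x)"
      unfolding E_def by simp
  qed
  also have "\<dots> = Gamma (u + 1)" by (rule integral_unique[OF Gamma_integral_complex']) (use u in simp)
  finally have "mellin E u = Gamma (u + 1)" .
  then have "Gamma (u + 1) = u\<^sup>2 * mellin ein u" unfolding m2 m1 by (simp add: power2_eq_square mult.assoc)
  moreover have "u \<noteq> 0" using u by auto
  ultimately show "mellin ein u = Gamma (u + 1) / u\<^sup>2" by simp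
qed

lemma ptrans_nharm: "ptrans nharm z = z * ein z" "entire_coeffs nharm"
proof -
  have s: "(\<lambda>n. nharm n * z ^ n / fact n) sums (z * (\<Sum>n. harm n * z ^ n / fact n))" for z
  proof -
    have "(\<lambda>n. z * (harm n * z ^ n / fact n)) sums (z * (\<Sum>n. harm n * z ^ n / fact n))"
      by (intro sums_mult summable_sums entire_coeffs_summable entire_coeffs_harm)
    also have "(\<lambda>n. z * (harm n * z ^ n / fact n)) = (\<lambda>n. nharm (Suc n) * z ^ Suc n / fact (Suc n))"
      by (auto simp: nharm_def fun_eq_iff field_simps simp del: of_nat_Suc)
    finally show ?thesis by (subst (asm) sums_Suc_iff) (simp add: nharm_def)
  qed
  show "entire_coeffs nharm" unfolding entire_coeffs_def by (intro allI sums_summable[OF s])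
  show "ptrans nharm z = z * ein z"
    unfolding ptrans_def ein_def using sums_unique[OF s[of z]] by (simp add: mult.left_commute)
qed

text \<open>The factor z in z Ein(z) shifts the argument of \<open>mellin_ein\<close> to u = s + 1,
  and the bracket is the effect of the two dilations. The formula continues the Mellin transform
  across Re s = -1; at s = -1 division by zero gives the value 0, although the function has a pole
  there.\<close>

definition nharm_mellin :: "real \<Rightarrow> real \<Rightarrow> complex \<Rightarrow> complex" where
  "nharm_mellin p q s = (1 - of_real p powr (- s) - of_real q powr (- s)) * Gamma (s + 2) / (s + 1)\<^sup>2"

lemma ptrans_nharm_toll:
  assumes pq: "0 < p" "0 < q" "p + q = 1"
  shows "ptrans (nharm_toll p q) z = ptrans nharm z - ptrans nharm (of_real p * z) - ptrans nharm (of_real q * z)"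
    "entire_coeffs (nharm_toll p q)"
proof -
  have pqc: "complex_of_real p + of_real q = 1" "complex_of_real q + of_real p = 1"
    using pq(3) by (simp_all only: of_real_add[symmetric] add.commute of_real_1)
  have th1: "ptrans nharm (of_real p * z) = ptrans (binom_avg p q nharm) z" "entire_coeffs (binom_avg p q nharm)" for z
    using ptrans_thinning[OF ptrans_nharm(2) pqc(1)] unfolding binom_avg_def[abs_def] by auto
  have th2: "ptrans nharm (of_real q * z) = ptrans (binom_avg q p nharm) z" "entire_coeffs (binom_avg q p nharm)" for z
    using ptrans_thinning[OF ptrans_nharm(2) pqc(2)] unfolding binom_avg_def[abs_def] by auto
  have eq: "nharm_toll p q = (\<lambda>n. nharm n - binom_avg p q nharm n - binom_avg q p nharm n)"
  proof
    show "nharm_toll p q n = nharm n - binom_avg p q nharm n - binom_avg q p nharm n" for n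
      by (subst nharm_recurrence[of p q]) (use pq in auto)
  qed
  show "entire_coeffs (nharm_toll p q)" unfolding eq by (intro entire_coeffs_diff ptrans_nharm th1 th2)
  show "ptrans (nharm_toll p q) z = ptrans nharm z - ptrans nharm (of_real p * z) - ptrans nharm (of_real q * z)"
    unfolding eq th1 th2 by (simp add: ptrans_diff entire_coeffs_diff ptrans_nharm(2) th1 th2)
qed

lemma mellin_nharm_toll:
  assumes pq: "0 < p" "0 < q" "p + q = 1" and s: "- 2 < Re s" "Re s < - 1"
  shows "mellin_integrable (ptrans (nharm_toll p q)) s" "mellin (ptrans (nharm_toll p q)) s = nharm_mellin p q s"
proof -
  define f where "f z = z * ein z" for z
  have u: "- 1 < Re (s + 1)" "Re (s + 1) < 0" using s by auto
  have f: "mellin_integrable f s" "mellin f s = Gamma (s + 2) / (s + 1)\<^sup>2"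
    using mellin_times_id[OF mellin_ein(1)[OF u]] mellin_ein(2)[OF u] by (simp_all add: f_def[abs_def] add.assoc)
  note 1 = mellin_scale[OF pq(1) f(1)] and 2 = mellin_scale[OF pq(2) f(1)]
  have eq: "ptrans (nharm_toll p q) = (\<lambda>z. f z - f (of_real p * z) - f (of_real q * z))"
    by (rule ext) (simp only: ptrans_nharm_toll(1)[OF pq] ptrans_nharm(1) f_def)
  note d1 = mellin_diff[OF f(1) 1(1)]
  note d2 = mellin_diff[OF d1(1) 2(1)]
  show "mellin_integrable (ptrans (nharm_toll p q)) s" unfolding eq by (rule d2(1))
  show "mellin (ptrans (nharm_toll p q)) s = nharm_mellin p q s"
    unfolding eq d2(2) d1(2) 1(2) 2(2) f(2) nharm_mellin_def by (simp add: left_diff_distrib diff_divide_distrib)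
qed

section \<open>The mean recurrence\<close>

lemma binom_avg_flip:
  "binom_avg q p u n = (\<Sum>k\<le>n. of_nat (n choose k) * of_real p ^ k * of_real q ^ (n - k) * u (n - k))"
proof -
  have "binom_avg q p u n = (\<Sum>k\<le>n. of_nat (n choose (n - k)) * of_real q ^ (n - k) * of_real p ^ (n - (n - k)) * u (n - k))"
    unfolding binom_avg_def by (rule sum.nat_diff_reindex[symmetric, of _ "Suc n", simplified lessThan_Suc_atMost diff_Suc_Suc])
  also have "\<dots> = (\<Sum>k\<le>n. of_nat (n choose k) * of_real p ^ k * of_real q ^ (n - k) * u (n - k))"
    by (rule sum.cong) (auto simp: binomial_symmetric[symmetric])
  finally show ?thesis .
qed

lemma binom_interior_sum:
  fixes p q :: real
  assumes "p + q = 1" "n \<ge> 2"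
  shows "(\<Sum>k\<in>{1..n - 1}. real (n choose k) * p ^ k * q ^ (n - k)) = 1 - p ^ n - q ^ n"
proof -
  have "{..n} = insert 0 (insert n {1..n - 1})" using assms by auto
  then have "(\<Sum>k\<le>n. real (n choose k) * p ^ k * q ^ (n - k)) = q ^ n + (p ^ n + (\<Sum>k\<in>{1..n - 1}. real (n choose k) * p ^ k * q ^ (n - k)))"
    using assms by simp
  moreover have "(\<Sum>k\<le>n. real (n choose k) * p ^ k * q ^ (n - k)) = 1"
    using binomial_ring[of p q n] assms by simp
  ultimately show ?thesis by simp
qed

lemma one_minus_powers_pos:
  fixes p q :: real
  assumes "0 < p" "0 < q" "p + q = 1" "n \<ge> 2"
  shows "1 - p ^ n - q ^ n > 0"
proof -
  have "p ^ n < p ^ 1" "q ^ n < q ^ 1" using assms by (intro power_strict_decreasing; simp)+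
  then show ?thesis using assms by simp
qed

context patricia_recurrence
begin

lemma X_process_measurable: "(\<lambda>\<omega> k. X k \<omega>) \<in> measurable M (PiM UNIV (\<lambda>_. borel))"
  and Xs_process_measurable: "(\<lambda>\<omega> k. Xs k \<omega>) \<in> measurable M (PiM UNIV (\<lambda>_. borel))"
  by (rule measurable_PiM_single'; use X_rv Xs_rv in simp)+

lemma distr_Xs: "distr M borel (Xs k) = distr M borel (X k)"
proof -
  have c: "(\<lambda>f. f k) \<in> measurable (PiM UNIV (\<lambda>_. borel :: real measure)) borel" by simp
  have "distr M borel (Xs k) = distr (distr M (PiM UNIV (\<lambda>_. borel)) (\<lambda>\<omega> k. Xs k \<omega>)) borel (\<lambda>f. f k)"
    by (subst distr_distr[OF c Xs_process_measurable]) (simp add: comp_def)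
  also have "\<dots> = distr M borel (X k)"
    unfolding Xs_copy by (subst distr_distr[OF c X_process_measurable]) (simp add: comp_def)
  finally show ?thesis .
qed

lemma Xs_integrable: "integrable M (X k) \<Longrightarrow> integrable M (Xs k)"
proof -
  assume "integrable M (X k)"
  then have "integrable (distr M borel (X k)) (\<lambda>x. x)" using X_rv by (simp add: integrable_distr_eq)
  then show ?thesis unfolding distr_Xs[symmetric] using Xs_rv by (simp add: integrable_distr_eq)
qed

lemma Xs_expectation: "expectation (Xs k) = expectation (X k)"
proof -
  have "expectation (Xs k) = integral\<^sup>L (distr M borel (Xs k)) (\<lambda>x. x)" using Xs_rv by (simp add: integral_distr)
  also have "\<dots> = expectation (X k)" unfolding distr_Xs using X_rv by (simp add: integral_distr)
  finally show ?thesis .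
qed

text \<open>From independence of the generated \<sigma>-algebras to independence of two real
  variables. The index j selects the process X (j = 0) or its copy (j = 1); the split index is
  member 2 of the family.\<close>

lemma indep_process_index:
  assumes n: "n \<ge> 2" and j: "j < (2::nat)"
    and Z: "random_variable borel (Z :: 'w \<Rightarrow> real)"
    and ZV: "Z \<in> measurable (vimage_algebra (space M) (if j = 0 then (\<lambda>\<omega> k. X k \<omega>) else (\<lambda>\<omega> k. Xs k \<omega>)) (PiM UNIV (\<lambda>_. borel))) borel"
  shows "indep_var borel Z borel (\<lambda>\<omega>. if I n \<omega> = k then 1 else 0 :: real)"
proof -
  let ?V = "vimage_algebra (space M) (if j = 0 then (\<lambda>\<omega> k. X k \<omega>) else (\<lambda>\<omega> k. Xs k \<omega>)) (PiM UNIV (\<lambda>_. borel))"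
  let ?U = "vimage_algebra (space M) (I n) (count_space UNIV)"
  define F where "F j = [sets (vimage_algebra (space M) (\<lambda>\<omega> k. X k \<omega>) (PiM UNIV (\<lambda>_. borel))),
           sets (vimage_algebra (space M) (\<lambda>\<omega> k. Xs k \<omega>) (PiM UNIV (\<lambda>_. borel))),
           sets (vimage_algebra (space M) (I n) (count_space UNIV)),
           sets (vimage_algebra (space M) (T n) borel)] ! j" for j :: nat
  have ind: "indep_sets F {..<4}" unfolding F_def using indep[OF n] .
  have Fj: "F j = sets ?V" using j by (cases "j = 0") (auto simp: F_def less_2_cases_iff)
  have F2: "F 2 = sets ?U" by (simp add: F_def numeral_2_eq_2)
  let ?Y = "\<lambda>\<omega>. if I n \<omega> = k then 1 else 0 :: real"
  have YU: "?Y \<in> measurable ?U borel"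
    by (rule measurable_compose[OF measurable_vimage_algebra1]) auto
  have Y: "random_variable borel ?Y"
    by (rule measurable_compose[OF I_rv[OF n]]) auto
  have sub: "sigma_sets (space M) {W -` A \<inter> space M |A. A \<in> sets borel} \<subseteq> sets (vimage_algebra (space M) g N)"
    if "W \<in> measurable (vimage_algebra (space M) g N) (borel :: real measure)" for W and g :: "'w \<Rightarrow> 'c" and N
  proof -
    have "{W -` A \<inter> space M |A. A \<in> sets borel} \<subseteq> sets (vimage_algebra (space M) g N)"
      using measurable_sets[OF that] by auto
    then have "sigma_sets (space (vimage_algebra (space M) g N)) {W -` A \<inter> space M |A. A \<in> sets borel} \<subseteq> sets (vimage_algebra (space M) g N)"
      by (rule sets.sigma_sets_subset)
    then show ?thesis by simp
  qed
  have "indep_set (sigma_sets (space M) {Z -` A \<inter> space M |A. A \<in> sets borel}) (sigma_sets (space M) {?Y -` A \<inter> space M |A. A \<in> sets borel})"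
  proof (rule indep_setI)
    show "sigma_sets (space M) {Z -` A \<inter> space M |A. A \<in> sets borel} \<subseteq> events"
      using measurable_sets[OF Z] by (intro sets.sigma_sets_subset) auto
    show "sigma_sets (space M) {?Y -` A \<inter> space M |A. A \<in> sets borel} \<subseteq> events"
      using measurable_sets[OF Y] by (intro sets.sigma_sets_subset) auto
    fix a b assume a: "a \<in> sigma_sets (space M) {Z -` A \<inter> space M |A. A \<in> sets borel}"
      and b: "b \<in> sigma_sets (space M) {?Y -` A \<inter> space M |A. A \<in> sets borel}"
    have aV: "a \<in> F j" and bU: "b \<in> F 2" unfolding Fj F2 using a b sub[OF ZV] sub[OF YU] by auto
    define S where "S i = (if i = j then a else b)" for i
    have "prob (\<Inter>i\<in>{j, 2}. S i) = (\<Prod>i\<in>{j, 2}. prob (S i))"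
      by (rule indep_setsD[OF ind]) (use j aV bU in \<open>auto simp: S_def\<close>)
    then show "prob (a \<inter> b) = prob a * prob b" using j by (simp add: S_def Int_commute)
  qed
  then show ?thesis using Z Y by (simp add: indep_var_eq)
qed

text \<open>The index i of the process is unrelated to the event I n = k, so the same statement
  serves X k and Xs (n - k).\<close>

lemma expectation_at_index:
  assumes n: "n \<ge> 2" and k: "1 \<le> k" "k \<le> n - 1"
  defines "w \<equiv> real (n choose k) * p ^ k * q ^ (n - k) / (1 - p ^ n - q ^ n)"
  shows "integrable M (X i) \<Longrightarrow> integrable M (\<lambda>\<omega>. X i \<omega> * (if I n \<omega> = k then 1 else 0))"
    "integrable M (X i) \<Longrightarrow> expectation (\<lambda>\<omega>. X i \<omega> * (if I n \<omega> = k then 1 else 0)) = expectation (X i) * w"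
    "integrable M (X i) \<Longrightarrow> integrable M (\<lambda>\<omega>. Xs i \<omega> * (if I n \<omega> = k then 1 else 0))"
    "integrable M (X i) \<Longrightarrow> expectation (\<lambda>\<omega>. Xs i \<omega> * (if I n \<omega> = k then 1 else 0)) = expectation (X i) * w"
proof -
  let ?Y = "\<lambda>\<omega>. if I n \<omega> = k then 1 else 0 :: real"
  have B: "{\<omega> \<in> space M. I n \<omega> = k} \<in> events"
    using measurable_sets[OF I_rv[OF n], of "{k}"] by (simp add: vimage_def Int_def conj_commute)
  have Yi: "integrable M ?Y" "expectation ?Y = w"
  proof -
    have "integrable M (indicator {\<omega> \<in> space M. I n \<omega> = k} :: 'w \<Rightarrow> real)"
      by (rule integrable_real_indicator[OF B]) (simp add: emeasure_eq_measure)
    moreover have eq: "?Y \<omega> = indicator {\<omega> \<in> space M. I n \<omega> = k} \<omega>" if "\<omega> \<in> space M" for \<omega>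
      using that by (simp add: indicator_def)
    ultimately show "integrable M ?Y" by (simp cong: Bochner_Integration.integrable_cong)
    have "expectation ?Y = expectation (indicator {\<omega> \<in> space M. I n \<omega> = k})"
      by (rule Bochner_Integration.integral_cong) (use eq in auto)
    also have "\<dots> = prob {\<omega> \<in> space M. I n \<omega> = k}" using B by simp
    also have "\<dots> = w" unfolding w_def by (rule I_dist[OF n k])
    finally show "expectation ?Y = w" .
  qed
  have c: "(\<lambda>f. f i) \<in> measurable (PiM UNIV (\<lambda>_. borel :: real measure)) borel" by simp
  have iX: "indep_var borel (X i) borel ?Y"
  proof (rule indep_process_index[OF n, where j=0])
    show "X i \<in> measurable (vimage_algebra (space M) (if (0::nat) = 0 then (\<lambda>\<omega> k. X k \<omega>) else (\<lambda>\<omega> k. Xs k \<omega>)) (PiM UNIV (\<lambda>_. borel))) borel"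
      using measurable_compose[OF measurable_vimage_algebra1 c, of "\<lambda>\<omega> k. X k \<omega>" "space M"] by (simp add: space_PiM)
  qed (use X_rv in auto)
  have iXs: "indep_var borel (Xs i) borel ?Y"
  proof (rule indep_process_index[OF n, where j=1])
    show "Xs i \<in> measurable (vimage_algebra (space M) (if (1::nat) = 0 then (\<lambda>\<omega> k. X k \<omega>) else (\<lambda>\<omega> k. Xs k \<omega>)) (PiM UNIV (\<lambda>_. borel))) borel"
      using measurable_compose[OF measurable_vimage_algebra1 c, of "\<lambda>\<omega> k. Xs k \<omega>" "space M"] by (simp add: space_PiM)
  qed (use Xs_rv in auto)
  assume Xi: "integrable M (X i)"
  note Xsi = Xs_integrable[OF Xi]
  show "integrable M (\<lambda>\<omega>. X i \<omega> * ?Y \<omega>)" by (rule indep_var_integrable[OF iX Xi Yi(1)])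
  show "expectation (\<lambda>\<omega>. X i \<omega> * ?Y \<omega>) = expectation (X i) * w"
    using indep_var_lebesgue_integral[OF iX Xi Yi(1)] Yi(2) by simp
  show "integrable M (\<lambda>\<omega>. Xs i \<omega> * ?Y \<omega>)" by (rule indep_var_integrable[OF iXs Xsi Yi(1)])
  show "expectation (\<lambda>\<omega>. Xs i \<omega> * ?Y \<omega>) = expectation (X i) * w"
    using indep_var_lebesgue_integral[OF iXs Xsi Yi(1)] Yi(2) Xs_expectation by simp
qed

text \<open>The locale prescribes the law of \<open>I n\<close> only on 1..n - 1; these
  probabilities already sum to 1, so other values form a null set.\<close>

lemma index_range:
  assumes pq: "0 < p" "0 < q" "p + q = 1" and n: "n \<ge> 2"
  shows "AE \<omega> in M. I n \<omega> \<in> {1..n - 1}"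
proof -
  let ?B = "\<lambda>k. {\<omega> \<in> space M. I n \<omega> = k}"
  have B: "?B k \<in> events" for k
    using measurable_sets[OF I_rv[OF n], of "{k}"] by (simp add: vimage_def Int_def conj_commute)
  have "prob (\<Union>k\<in>{1..n - 1}. ?B k) = (\<Sum>k\<in>{1..n - 1}. prob (?B k))"
    by (rule finite_measure_finite_Union) (use B in \<open>auto simp: disjoint_family_on_def\<close>)
  also have "\<dots> = (\<Sum>k\<in>{1..n - 1}. real (n choose k) * p ^ k * q ^ (n - k) / (1 - p ^ n - q ^ n))"
    by (rule sum.cong[OF refl]) (rule I_dist[OF n], auto)
  also have "\<dots> = 1"
    unfolding sum_divide_distrib[symmetric] binom_interior_sum[OF pq(3) n] using one_minus_powers_pos[OF pq n] by simp
  finally have "AE \<omega> in M. \<omega> \<in> (\<Union>k\<in>{1..n - 1}. ?B k)" by (rule AE_prob_1)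
  then show ?thesis by (rule AE_mp) (auto intro!: AE_I2)
qed

text \<open>The randomly indexed right-hand side agrees almost surely with the finite sum S over
  fixed indices, whose terms factor by independence. As X n is given only in law, both integrability
  and the mean pass through its distribution.\<close>

lemma mean_step:
  assumes pq: "0 < p" "0 < q" "p + q = 1" and n: "n \<ge> 2" and Ti: "integrable M (T n)"
    and X: "\<And>k. k < n \<Longrightarrow> integrable M (X k)"
  shows "integrable M (X n)"
    "expectation (X n) = (\<Sum>k\<in>{1..n - 1}. (expectation (X k) + expectation (X (n - k))) * (real (n choose k) * p ^ k * q ^ (n - k) / (1 - p ^ n - q ^ n))) + expectation (T n)"
proof -
  let ?w = "\<lambda>k. real (n choose k) * p ^ k * q ^ (n - k) / (1 - p ^ n - q ^ n)"
  define Z where "Z \<omega> = X (I n \<omega>) \<omega> + Xs (n - I n \<omega>) \<omega> + T n \<omega>" for \<omega>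
  define Y where "Y k \<omega> = (if I n \<omega> = k then 1 else 0 :: real)" for k \<omega>
  define S where "S \<omega> = (\<Sum>k\<in>{1..n - 1}. X k \<omega> * Y k \<omega> + Xs (n - k) \<omega> * Y k \<omega>) + T n \<omega>" for \<omega>
  have i: "integrable M (\<lambda>\<omega>. X k \<omega> * Y k \<omega>)" "expectation (\<lambda>\<omega>. X k \<omega> * Y k \<omega>) = expectation (X k) * ?w k"
    "integrable M (\<lambda>\<omega>. Xs (n - k) \<omega> * Y k \<omega>)" "expectation (\<lambda>\<omega>. Xs (n - k) \<omega> * Y k \<omega>) = expectation (X (n - k)) * ?w k"
    if k: "k \<in> {1..n - 1}" for k
  proof -
    have k': "1 \<le> k" "k \<le> n - 1" using k by auto
    have a: "integrable M (X k)" "integrable M (X (n - k))" by (rule X; use k n in auto)+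
    note e = expectation_at_index[OF n k']
    show "integrable M (\<lambda>\<omega>. X k \<omega> * Y k \<omega>)" unfolding Y_def by (rule e(1)[OF a(1)])
    show "expectation (\<lambda>\<omega>. X k \<omega> * Y k \<omega>) = expectation (X k) * ?w k" unfolding Y_def by (rule e(2)[OF a(1)])
    show "integrable M (\<lambda>\<omega>. Xs (n - k) \<omega> * Y k \<omega>)" unfolding Y_def by (rule e(3)[OF a(2)])
    show "expectation (\<lambda>\<omega>. Xs (n - k) \<omega> * Y k \<omega>) = expectation (X (n - k)) * ?w k" unfolding Y_def by (rule e(4)[OF a(2)])
  qed
  have Si: "integrable M S" unfolding S_def
    by (intro Bochner_Integration.integrable_add Bochner_Integration.integrable_sum i Ti)
  have SE: "expectation S = (\<Sum>k\<in>{1..n - 1}. (expectation (X k) + expectation (X (n - k))) * ?w k) + expectation (T n)"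
  proof -
    have "expectation S = expectation (\<lambda>\<omega>. \<Sum>k\<in>{1..n - 1}. X k \<omega> * Y k \<omega> + Xs (n - k) \<omega> * Y k \<omega>) + expectation (T n)"
      unfolding S_def by (intro Bochner_Integration.integral_add Bochner_Integration.integrable_sum Bochner_Integration.integrable_add i Ti)
    also have "expectation (\<lambda>\<omega>. \<Sum>k\<in>{1..n - 1}. X k \<omega> * Y k \<omega> + Xs (n - k) \<omega> * Y k \<omega>)
       = (\<Sum>k\<in>{1..n - 1}. expectation (\<lambda>\<omega>. X k \<omega> * Y k \<omega> + Xs (n - k) \<omega> * Y k \<omega>))"
      by (intro Bochner_Integration.integral_sum Bochner_Integration.integrable_add i)
    also have "\<dots> = (\<Sum>k\<in>{1..n - 1}. (expectation (X k) + expectation (X (n - k))) * ?w k)"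
    proof (rule sum.cong[OF refl])
      fix k assume k: "k \<in> {1..n - 1}"
      have "expectation (\<lambda>\<omega>. X k \<omega> * Y k \<omega> + Xs (n - k) \<omega> * Y k \<omega>) = expectation (X k) * ?w k + expectation (X (n - k)) * ?w k"
        by (subst Bochner_Integration.integral_add[OF i(1)[OF k] i(3)[OF k]]) (simp only: i(2)[OF k] i(4)[OF k])
      then show "expectation (\<lambda>\<omega>. X k \<omega> * Y k \<omega> + Xs (n - k) \<omega> * Y k \<omega>) = (expectation (X k) + expectation (X (n - k))) * ?w k"
        by (simp only: distrib_right)
    qed
    finally show ?thesis .
  qed
  have ZS: "AE \<omega> in M. S \<omega> = Z \<omega>"
    using index_range[OF pq n]
  proof (rule AE_mp, intro AE_I2 impI)
    fix \<omega> assume I: "I n \<omega> \<in> {1..n - 1}"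
    have "(\<Sum>k\<in>{1..n - 1}. X k \<omega> * Y k \<omega> + Xs (n - k) \<omega> * Y k \<omega>) = (\<Sum>k\<in>{1..n - 1}. if k = I n \<omega> then X k \<omega> + Xs (n - k) \<omega> else 0)"
      by (rule sum.cong) (auto simp: Y_def)
    also have "\<dots> = X (I n \<omega>) \<omega> + Xs (n - I n \<omega>) \<omega>" using I by (subst sum.delta) auto
    finally show "S \<omega> = Z \<omega>" by (simp add: S_def Z_def)
  qed
  have Zm: "Z \<in> borel_measurable M"
  proof -
    have "(\<lambda>\<omega>. X (I n \<omega>) \<omega>) \<in> borel_measurable M" by (rule measurable_compose_countable[OF X_rv I_rv[OF n]])
    moreover have "(\<lambda>\<omega>. (\<lambda>k \<omega>. Xs (n - k) \<omega>) (I n \<omega>) \<omega>) \<in> borel_measurable M"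
      by (rule measurable_compose_countable[OF Xs_rv I_rv[OF n]])
    ultimately show ?thesis unfolding Z_def[abs_def] using T_rv[OF n] by measurable
  qed
  have Sm: "S \<in> borel_measurable M" using Si by (rule borel_measurable_integrable)
  have Zi: "integrable M Z" using Si integrable_cong_AE[OF Sm Zm ZS] by simp
  have ZE: "expectation Z = expectation S" using integral_cong_AE[OF Sm Zm ZS] by simp
  have d: "distr M borel (X n) = distr M borel Z" using X_rec[OF n] unfolding Z_def[abs_def] .
  have "integrable (distr M borel (X n)) (\<lambda>x. x)" unfolding d using Zm Zi by (simp add: integrable_distr_eq)
  then show "integrable M (X n)" using X_rv by (simp add: integrable_distr_eq)
  have "expectation (X n) = integral\<^sup>L (distr M borel (X n)) (\<lambda>x. x)" using X_rv by (simp add: integral_distr)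
  also have "\<dots> = expectation Z" unfolding d using Zm by (simp add: integral_distr)
  finally show "expectation (X n) = (\<Sum>k\<in>{1..n - 1}. (expectation (X k) + expectation (X (n - k))) * ?w k) + expectation (T n)"
    using ZE SE by simp
qed

lemma mean_recurrence:
  assumes pq: "0 < p" "0 < q" "p + q = 1" and Ti: "\<And>n. n \<ge> 2 \<Longrightarrow> integrable M (T n)"
  defines "mu \<equiv> \<lambda>n. complex_of_real (expectation (X n))"
  defines "\<tau> \<equiv> \<lambda>n. if n < 2 then 0 else complex_of_real (expectation (T n))"
  shows "mu 0 = 0" "mu (Suc 0) = 0"
    "mu n = binom_avg p q mu n + binom_avg q p mu n + \<tau> n * (1 - of_real p ^ n - of_real q ^ n)"
proof -
  have X0: "integrable M (X 0)" "expectation (X 0) = 0"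
    using X_init(1) X_rv[of 0] integrable_cong_AE[of "X 0" M "\<lambda>_. 0"] integral_cong_AE[of "X 0" M "\<lambda>_. 0"] by auto
  have X1: "integrable M (X 1)" "expectation (X 1) = 0"
    using X_init(2) X_rv[of 1] integrable_cong_AE[of "X 1" M "\<lambda>_. 0"] integral_cong_AE[of "X 1" M "\<lambda>_. 0"] by auto
  show mu0: "mu 0 = 0" and mu1: "mu (Suc 0) = 0" using X0 X1 by (simp_all add: mu_def)
  have int: "integrable M (X n)" for n
  proof (induction n rule: less_induct)
    case (less n)
    show ?case
    proof (cases "n < 2")
      case True then show ?thesis using X0 X1 by (auto simp: less_2_cases_iff)
    next
      case False then show ?thesis using less mean_step(1)[OF pq _ Ti] by simp
    qed
  qed
  show "mu n = binom_avg p q mu n + binom_avg q p mu n + \<tau> n * (1 - of_real p ^ n - of_real q ^ n)"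
  proof (cases "n < 2")
    case True
    then consider "n = 0" | "n = 1" by (auto simp: less_2_cases_iff)
    then show ?thesis by cases (simp_all add: binom_avg_def mu0 mu1 \<tau>_def)
  next
    case False
    then have n: "n \<ge> 2" by simp
    define c where "c = 1 - p ^ n - q ^ n"
    have c: "c > 0" unfolding c_def by (rule one_minus_powers_pos[OF pq n])
    let ?v = "\<lambda>k. real (n choose k) * p ^ k * q ^ (n - k)"
    define E where "E k = expectation (X k)" for k
    have "E n = (\<Sum>k\<in>{1..n - 1}. (E k + E (n - k)) * (?v k / c)) + expectation (T n)"
      unfolding E_def c_def by (rule mean_step(2)[OF pq n Ti[OF n] int])
    then have "E n * c = (\<Sum>k\<in>{1..n - 1}. (E k + E (n - k)) * (?v k / c)) * c + expectation (T n) * c" by (simp add: distrib_right)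
    also have "(\<Sum>k\<in>{1..n - 1}. (E k + E (n - k)) * (?v k / c)) * c = (\<Sum>k\<in>{1..n - 1}. ?v k * (E k + E (n - k)))"
      unfolding sum_distrib_right using c by (intro sum.cong) auto
    finally have r: "E n * c = (\<Sum>k\<in>{1..n - 1}. ?v k * (E k + E (n - k))) + expectation (T n) * c" .
    have E0: "E 0 = 0" using X0 by (simp add: E_def)
    have set: "{..n} = insert 0 (insert n {1..n - 1})" using n by auto
    have "(\<Sum>k\<le>n. ?v k * (E k + E (n - k))) = q ^ n * E n + (p ^ n * E n + (\<Sum>k\<in>{1..n - 1}. ?v k * (E k + E (n - k))))"
      unfolding set using n E0 by simp
    \<comment> \<open>The restored terms k = 0 and k = n contribute (p^n + q^n) E n because E 0 = 0;
      this absorbs the factor c on the left and leaves it on the toll alone.\<close>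
    then have "E n = (\<Sum>k\<le>n. ?v k * (E k + E (n - k))) + expectation (T n) * c"
      using r by (simp add: c_def algebra_simps)
    then have "mu n = of_real ((\<Sum>k\<le>n. ?v k * (E k + E (n - k))) + expectation (T n) * c)" by (simp add: mu_def E_def)
    also have "\<dots> = (\<Sum>k\<le>n. of_nat (n choose k) * of_real p ^ k * of_real q ^ (n - k) * (mu k + mu (n - k))) + \<tau> n * (1 - of_real p ^ n - of_real q ^ n)"
      using False by (simp add: mu_def E_def \<tau>_def c_def)
    also have "(\<Sum>k\<le>n. of_nat (n choose k) * of_real p ^ k * of_real q ^ (n - k) * (mu k + mu (n - k))) = binom_avg p q mu n + binom_avg q p mu n"
      unfolding binom_avg_flip[of q p] unfolding binom_avg_def by (simp add: distrib_left sum.distrib)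
    finally show ?thesis .
  qed
qed

end

section \<open>Asymptotics under growth conditions in a sector\<close>

lemma exp_second_order: "((\<lambda>u. (exp (a * u) - 1 - a * u) / u\<^sup>2) \<longlongrightarrow> a\<^sup>2 / 2) (at (0::complex))"
proof (rule Lim_transform_eventually[where f="\<lambda>u. a\<^sup>2 / 2 + (exp (a * u) - (1 + a * u + (a * u)\<^sup>2 / 2)) / u\<^sup>2"])
  have "((\<lambda>u. (exp (a * u) - (1 + a * u + (a * u)\<^sup>2 / 2)) / u\<^sup>2) \<longlongrightarrow> 0) (at 0)"
  proof (rule Lim_null_comparison)
    show "\<forall>\<^sub>F u in at 0. norm ((exp (a * u) - (1 + a * u + (a * u)\<^sup>2 / 2)) / u\<^sup>2) \<le> exp (norm (a * u)) * (norm a ^ 3 * norm u)"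
      unfolding eventually_at_filter
    proof (intro always_eventually allI impI)
      fix u :: complex assume u: "u \<noteq> 0"
      let ?z = "a * u"
      have "norm (exp ?z - (\<Sum>k\<le>2. ?z ^ k / fact k)) \<le> exp (norm ?z) * norm ?z ^ Suc 2 / fact 2" by (rule Taylor_exp_field)
      also have "(\<Sum>k\<le>2. ?z ^ k / fact k) = 1 + ?z + ?z\<^sup>2 / 2" by (simp add: numeral_2_eq_2)
      also have "exp (norm ?z) * norm ?z ^ Suc 2 / fact 2 \<le> exp (norm ?z) * norm ?z ^ 3"
      proof -
        have "exp (norm ?z) * norm ?z ^ 3 \<ge> 0" by simp
        moreover have "Suc 2 = 3" "(fact 2 :: real) = 2" by (simp_all add: fact_numeral)
        ultimately show ?thesis by simp
      qed
      finally have "norm (exp ?z - (1 + ?z + ?z\<^sup>2 / 2)) / norm u ^ 2 \<le> exp (norm ?z) * norm ?z ^ 3 / norm u ^ 2"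
        by (rule divide_right_mono) simp
      also have "\<dots> = exp (norm ?z) * (norm a ^ 3 * norm u)" using u
        by (simp add: norm_mult power_mult_distrib power2_eq_square power3_eq_cube)
      finally show "norm ((exp ?z - (1 + ?z + ?z\<^sup>2 / 2)) / u\<^sup>2) \<le> exp (norm ?z) * (norm a ^ 3 * norm u)"
        by (simp only: norm_divide norm_power)
    qed
    have "((\<lambda>u. exp (norm (a * u)) * (norm a ^ 3 * norm u)) \<longlongrightarrow> exp (norm (a * 0)) * (norm a ^ 3 * norm (0::complex))) (at 0)"
      by (intro tendsto_intros)
    then show "((\<lambda>u. exp (norm (a * u)) * (norm a ^ 3 * norm u)) \<longlongrightarrow> 0) (at 0)" by simp
  qed
  from tendsto_add[OF tendsto_const this] show "((\<lambda>u. a\<^sup>2 / 2 + (exp (a * u) - (1 + a * u + (a * u)\<^sup>2 / 2)) / u\<^sup>2) \<longlongrightarrow> a\<^sup>2 / 2) (at 0)"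
    by simp
  show "\<forall>\<^sub>F u in at 0. a\<^sup>2 / 2 + (exp (a * u) - (1 + a * u + (a * u)\<^sup>2 / 2)) / u\<^sup>2 = (exp (a * u) - 1 - a * u) / u\<^sup>2"
    unfolding eventually_at_filter by (intro always_eventually allI impI) (simp add: divide_simps power_mult_distrib)
qed

text \<open>With s = -1 + u, x^(-s) is x exp(- u ln x) for x = p, q. In the bracket the constant
  term vanishes by p + q = 1, the linear term is - h u, and the quadratic terms give p ln^2 p + q
  ln^2 q. Euler's constant enters through Gamma(1 + u). Hence the simple pole of
  \<open>nharm_mellin\<close> at -1 has residue - h.\<close>

lemma nharm_mellin_expansion:
  assumes pq: "0 < p" "0 < q" "p + q = 1"
  defines "h \<equiv> binary_entropy p q"
  assumes h: "h > 0"
  shows "((\<lambda>s. nharm_mellin p q s / of_real h + 1 / (s + 1)) \<longlongrightarrow>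
      euler_mascheroni - of_real (p * (ln p)\<^sup>2 + q * (ln q)\<^sup>2) / (2 * of_real h)) (at (- 1))"
proof (rule LIM_offset_zero_cancel)
  define P Q where "P = - complex_of_real (ln p)" and "Q = - complex_of_real (ln q)"
  define \<phi> where "\<phi> a u = (exp (a * u) - 1 - a * u) / u\<^sup>2" for a u :: complex
  define H where "H = complex_of_real h"
  have H: "H \<noteq> 0" using h by (simp add: H_def)
  have "((\<lambda>u::complex. (Gamma (1 + u) - 1) / u) \<longlongrightarrow> - euler_mascheroni) (at 0)"
  proof -
    have "(Gamma has_field_derivative Gamma 1 * Digamma 1) (at (1::complex))"
      by (rule has_field_derivative_Gamma) auto
    then show ?thesis by (simp add: DERIV_def)
  qed
  moreover have "isCont Gamma (1::complex)" by (rule isCont_Gamma) auto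
  then have "((\<lambda>u::complex. Gamma (1 + u)) \<longlongrightarrow> 1) (at 0)" by (simp add: isCont_iff)
  moreover have "((\<lambda>u. - of_real p * \<phi> P u - of_real q * \<phi> Q u) \<longlongrightarrow> - of_real p * (P\<^sup>2 / 2) - of_real q * (Q\<^sup>2 / 2)) (at 0)"
    unfolding \<phi>_def by (intro tendsto_intros exp_second_order)
  ultimately have "((\<lambda>u. (- of_real p * \<phi> P u - of_real q * \<phi> Q u) * Gamma (1 + u) / H - (Gamma (1 + u) - 1) / u) \<longlongrightarrow>
     (- of_real p * (P\<^sup>2 / 2) - of_real q * (Q\<^sup>2 / 2)) * 1 / H - (- euler_mascheroni)) (at 0)"
    using H by (intro tendsto_diff[of "\<lambda>u. (- of_real p * \<phi> P u - of_real q * \<phi> Q u) * Gamma (1 + u) / H"] tendsto_divide tendsto_mult tendsto_const)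
  moreover have "(- of_real p * (P\<^sup>2 / 2) - of_real q * (Q\<^sup>2 / 2)) * 1 / H - (- euler_mascheroni) =
     euler_mascheroni - of_real (p * (ln p)\<^sup>2 + q * (ln q)\<^sup>2) / (2 * H)"
    using H by (simp add: P_def Q_def field_simps)
  moreover have "\<forall>\<^sub>F u in at 0. (- of_real p * \<phi> P u - of_real q * \<phi> Q u) * Gamma (1 + u) / H - (Gamma (1 + u) - 1) / u =
      nharm_mellin p q (- 1 + u) / H + 1 / (- 1 + u + 1)"
    unfolding eventually_at_filter
  proof (intro always_eventually allI impI)
    fix u :: complex assume u: "u \<noteq> 0"
    have pw: "of_real x powr (- (- 1 + u)) = of_real x * exp (- complex_of_real (ln x) * u)" if "x > 0" for x
    proof -
      have "of_real x powr (- (- 1 + u)) = exp (complex_of_real (ln x) + - complex_of_real (ln x) * u)"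
        unfolding of_real_powr_exp[OF that] by (simp add: algebra_simps)
      also have "\<dots> = exp (complex_of_real (ln x)) * exp (- complex_of_real (ln x) * u)" by (rule exp_add)
      also have "exp (complex_of_real (ln x)) = of_real x" using that by (simp only: exp_of_real exp_ln)
      finally show ?thesis .
    qed
    \<comment> \<open>The second-order remainder of the bracket: the bracket equals X u^2 - H
      u.\<close>
    define X where "X = - of_real p * \<phi> P u - of_real q * \<phi> Q u"
    have PQ: "complex_of_real p + of_real q = 1" by (simp only: of_real_add[symmetric] pq of_real_1)
    have Hpq: "H = of_real p * P + of_real q * Q" unfolding H_def h_def binary_entropy_def P_def Q_def by simp
    have "X * u\<^sup>2 = - of_real p * (exp (P * u) - 1 - P * u) - of_real q * (exp (Q * u) - 1 - Q * u)"
      using u by (simp add: X_def \<phi>_def left_diff_distrib)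
    also have "\<dots> = (of_real p + of_real q) - of_real p * exp (P * u) - of_real q * exp (Q * u) + H * u"
      unfolding Hpq by (simp add: algebra_simps)
    finally have Xu: "X * u\<^sup>2 = 1 - of_real p * exp (P * u) - of_real q * exp (Q * u) + H * u" unfolding PQ .
    have "nharm_mellin p q (- 1 + u) = (X * u\<^sup>2 - H * u) * Gamma (1 + u) / u\<^sup>2"
      unfolding nharm_mellin_def pw[OF pq(1)] pw[OF pq(2)] Xu by (simp add: P_def Q_def add.commute)
    also have "\<dots> = X * Gamma (1 + u) - H * Gamma (1 + u) / u"
      using u by (simp add: left_diff_distrib diff_divide_distrib power2_eq_square)
    finally have "nharm_mellin p q (- 1 + u) / H = X * Gamma (1 + u) / H - Gamma (1 + u) / u"
      using H by (simp add: diff_divide_distrib)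
    then show "X * Gamma (1 + u) / H - (Gamma (1 + u) - 1) / u = nharm_mellin p q (- 1 + u) / H + 1 / (- 1 + u + 1)"
      by (simp add: diff_divide_distrib)
  qed
  ultimately show "((\<lambda>u. nharm_mellin p q (- 1 + u) / of_real h + 1 / (- 1 + u + 1)) \<longlongrightarrow>
      euler_mascheroni - of_real (p * (ln p)\<^sup>2 + q * (ln q)\<^sup>2) / (2 * of_real h)) (at 0)"
    unfolding H_def by (simp add: Lim_transform_eventually)
qed

lemma chi_eq:
  assumes "log_ratio p q r l" "0 < p" "p < 1" "0 < q" "q < 1"
  shows "chi p q k * of_real (ln p) = 2 * of_real pi * of_int (int r * k) * \<i>"
    and "chi p q k * of_real (ln q) = 2 * of_real pi * of_int (int l * k) * \<i>"
proof -
  have lp: "ln p \<noteq> 0" "ln q \<noteq> 0" using assms by auto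
  have rl: "r > 0" "l > 0" "ln p / ln q = real r / real l" using assms by (auto simp: log_ratio_def)
  show 1: "chi p q k * of_real (ln p) = 2 * of_real pi * of_int (int r * k) * \<i>"
    unfolding chi_def log_ratio_num_eq[OF assms(1)] using lp by simp
  have "ln q = ln p * (real l / real r)" using rl lp by (simp add: field_simps)
  then have "chi p q k * of_real (ln q) = (chi p q k * of_real (ln p)) * (of_nat l / of_nat r)" by simp
  also have "\<dots> = 2 * of_real pi * of_int (int l * k) * \<i>" unfolding 1 using rl by simp
  finally show "chi p q k * of_real (ln q) = 2 * of_real pi * of_int (int l * k) * \<i>" .
qed

text \<open>Since ln q / ln p = l / r, both \<chi> ln p and \<chi> ln q are integer multiples of 2
  pi i (\<open>chi_eq\<close>). The powers in the bracket thus reduce to p and q, and 1 - p - q =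
  0.\<close>

lemma nharm_mellin_chi:
  assumes lr: "log_ratio p q r l" and pq: "0 < p" "0 < q" "p + q = 1"
  shows "nharm_mellin p q (- 1 + chi p q k) = 0"
proof -
  have p1: "p < 1" "q < 1" using pq by auto
  have pw: "of_real x powr (- (- 1 + chi p q k)) = of_real x"
    if x: "x > 0" and e: "chi p q k * of_real (ln x) = 2 * of_real pi * of_int m * \<i>" for x m
  proof -
    have "of_real x powr (- (- 1 + chi p q k)) = exp (complex_of_real (ln x) - chi p q k * of_real (ln x))"
      unfolding of_real_powr_exp[OF x] by (simp add: algebra_simps)
    also have "\<dots> = exp (complex_of_real (ln x)) / exp (2 * of_real pi * of_int m * \<i>)" unfolding e by (rule exp_diff)
    also have "exp (2 * of_real pi * of_int m * \<i>) = 1"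
      using exp_integer_2pi[of "of_int m"] by (simp add: mult_ac)
    also have "exp (complex_of_real (ln x)) / 1 = of_real x" using x by (simp only: exp_of_real exp_ln div_by_1)
    finally show ?thesis .
  qed
  have "complex_of_real p + of_real q = 1" by (simp only: of_real_add[symmetric] pq of_real_1)
  then have "1 - complex_of_real p - of_real q = 0" by (simp add: algebra_simps)
  then show ?thesis
    unfolding nharm_mellin_def pw[OF pq(1) chi_eq(1)[OF lr pq(1) p1(1) pq(2) p1(2)]] pw[OF pq(2) chi_eq(2)[OF lr pq(1) p1(1) pq(2) p1(2)]] by simp
qed

lemma chi_nonzero:
  assumes lr: "log_ratio p q r l" and "0 < p" "p < 1" "k \<noteq> 0"
  shows "chi p q k \<noteq> 0" "Re (chi p q k) = 0"
proof -
  show "chi p q k \<noteq> 0" unfolding chi_def log_ratio_num_eq[OF lr] using assms by (auto simp: log_ratio_def)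
  have "chi p q k = of_real (2 * real (log_ratio_num p q) * of_int k * pi / ln p) * \<i>" by (simp add: chi_def)
  moreover have "Re (of_real x * \<i>) = 0" for x by simp
  ultimately show "Re (chi p q k) = 0" by (simp only:)
qed

lemma fluct_cong:
  assumes "\<And>r l k. log_ratio p q r l \<Longrightarrow> k \<noteq> 0 \<Longrightarrow> F (- 1 + chi p q k) = G (- 1 + chi p q k)"
  shows "fluct p q F x = fluct p q G x"
proof (cases "\<exists>r l. log_ratio p q r l")
  case True
  then obtain r l where "log_ratio p q r l" by blast
  then have "F (- 1 + chi p q k) = G (- 1 + chi p q k)" if "k \<noteq> 0" for k using assms that by blast
  then show ?thesis unfolding fluct_def by (intro if_cong refl arg_cong2[where f="(/)"] infsum_cong) auto
qed (simp add: fluct_def)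

lemma nharm_mellin_analytic:
  assumes "0 < p" "0 < q" "-2 < Re s"
  shows "s \<noteq> - 1 \<Longrightarrow> nharm_mellin p q analytic_on {s}" "nharm_mellin p q meromorphic_on {s}"
proof -
  have "s + 2 \<notin> \<int>\<^sub>\<le>\<^sub>0"
  proof
    assume "s + 2 \<in> \<int>\<^sub>\<le>\<^sub>0"
    then obtain n where "s + 2 = of_int n" "n \<le> 0" by (elim nonpos_Ints_cases)
    then have "Re (s + 2) \<le> 0" by (simp only: complex_Re_of_int of_int_le_0_iff)
    then have "Re s + 2 \<le> 0" by simp
    then show False using assms by simp
  qed
  then have 1: "(\<lambda>s. (1 - of_real p powr (- s) - of_real q powr (- s)) * Gamma (s + 2)) analytic_on {s}"
    using assms by (intro analytic_intros) (auto simp: complex_nonpos_Reals_iff)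
  show "nharm_mellin p q analytic_on {s}" if "s \<noteq> - 1"
  proof -
    have "s + 1 \<noteq> 0" using that by (metis add_eq_0_iff add.commute)
    then show ?thesis unfolding nharm_mellin_def[abs_def] by (intro analytic_on_divide[OF 1] analytic_intros) auto
  qed
  show "nharm_mellin p q meromorphic_on {s}"
    unfolding nharm_mellin_def[abs_def]
    by (intro meromorphic_on_divide analytic_on_imp_meromorphic_on[OF 1] meromorphic_intros)
qed

text \<open>Here N is the Mellin transform of the toll that remains after subtracting (c / h)
  \<open>nharm_toll\<close>. It is holomorphic across -1, so the continuation of the Mellin
  transform of g is N plus an explicit function, which carries the pole for c other than 0. The
  value at -1 is therefore claimed only for c = 0.\<close>

lemma recurrence_asymptotics:
  fixes mu \<tau> :: "nat \<Rightarrow> complex" and c :: complex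
  assumes pq: "0 < p" "0 < q" "p + q = 1" and \<delta>: "0 < \<delta>" "\<delta> < 1 / 2" and \<theta>: "0 < \<theta>" "\<theta> < pi / 2" and \<epsilon>: "0 < \<epsilon>"
    and et: "entire_coeffs \<tau>" and \<tau>0: "\<tau> 0 = 0"
    and mu01: "mu 0 = 0" "mu (Suc 0) = 0"
    and mu: "\<And>n. mu n = binom_avg p q mu n + binom_avg q p mu n + \<tau> n * (1 - of_real p ^ n - of_real q ^ n)"
    and inner: "\<And>z. R \<le> norm z \<Longrightarrow> \<bar>Arg z\<bar> \<le> \<theta> \<Longrightarrow> norm (ptrans \<tau> z - c * z) \<le> C0 * norm z powr (1 - \<delta>)"
    and outer: "\<And>z. R \<le> norm z \<Longrightarrow> \<theta> \<le> \<bar>Arg z\<bar> \<Longrightarrow> norm (exp z * ptrans \<tau> z) \<le> C1 * exp ((1 - \<epsilon>) * norm z)"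
    and g: "\<And>z. g z = ptrans (\<lambda>n. \<tau> n * (1 - of_real p ^ n - of_real q ^ n)) z"
  defines "h \<equiv> binary_entropy p q"
  shows "\<exists>N. N holomorphic_on vert_strip (- 2) (- 1 + \<delta>) \<and>
    (\<forall>s. s \<in> vert_strip (- 2) (- 1 + \<delta>) \<longrightarrow> s \<noteq> - 1 \<longrightarrow>
        mellin_continuation g s = N s + c / of_real h * nharm_mellin p q s) \<and>
    (c = 0 \<longrightarrow> mellin_continuation g (- 1) = N (- 1)) \<and>
    (\<lambda>n. mu n / of_nat n - (c / of_real h * harm (n - 1) + N (- 1) / of_real h
        + fluct p q N (real (log_ratio_num p q) * log (1 / p) (real n)))) \<longlonglongrightarrow> 0"
proof -
  have \<delta>1: "\<delta> < 1" using \<delta> by simp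
  have p1: "p < 1" "q < 1" using pq by auto
  have h: "h > 0"
  proof -
    have "- p * ln p > 0" "- q * ln q > 0" using pq p1 by (auto simp: mult_pos_neg)
    then show ?thesis by (simp add: h_def binary_entropy_def)
  qed
  obtain D where D: "D \<ge> 0" "\<And>n. n > 0 \<Longrightarrow> norm (\<tau> n - c * of_nat n) \<le> D * real n powr (1 - \<delta>)"
    "\<And>n. n > 0 \<Longrightarrow> norm ((\<tau> (Suc n) - c * of_nat (Suc n)) - (\<tau> n - c * of_nat n)) \<le> D * real n powr (1 / 2 - \<delta>)"
  proof (rule sector_coeff_bounds[OF et \<delta>(1) \<delta>1 \<theta>(1) \<epsilon>, of R c C0 C1])
    show "norm (ptrans \<tau> z - c * z) \<le> C0 * norm z powr (1 - \<delta>)" if "R \<le> norm z" "\<bar>Arg z\<bar> \<le> \<theta>" for z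
      by (rule inner[OF that])
    show "norm (exp z * ptrans \<tau> z) \<le> C1 * exp ((1 - \<epsilon>) * norm z)" if "R \<le> norm z" "\<theta> \<le> \<bar>Arg z\<bar>" for z
      by (rule outer[OF that])
  qed (rule that; blast)
  define m where "m = max p q"
  have m: "0 < m" "m < 1" "p \<le> m" "q \<le> m" using pq p1 by (auto simp: m_def)
  \<comment> \<open>Any ratio strictly between m and 1 would do; the gap absorbs the factor n +
    1.\<close>
  define \<rho> where "\<rho> = (1 + m) / 2"
  have \<rho>: "0 < \<rho>" "\<rho> < 1" "m < \<rho>" using m by (auto simp: \<rho>_def)
  obtain Cg where Cg: "Cg \<ge> 0" "\<And>n. (real n + 1) * m ^ n \<le> Cg * \<rho> ^ n"
    by (rule geometric_dominates_linear[OF m(1) \<rho>(3)]) (rule that; blast)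
  define k where "k = c / of_real h"
  have kh: "k * of_real h = c" using h by (simp add: k_def)
  define b where "b n = \<tau> n * (1 - of_real p ^ n - of_real q ^ n) - k * nharm_toll p q n" for n
  \<comment> \<open>As k h = c, the linear parts combine to b n = \<tau> n - c n + e n, where e
    collects the terms with p^n, q^n and the tail of \<open>nharm_toll\<close>, all exponentially
    small.\<close>
  define e where "e n = - \<tau> n * (of_real p ^ n + of_real q ^ n) + k * (of_real h * of_nat n - nharm_toll p q n)" for n
  have be: "b = (\<lambda>n. \<tau> n - c * of_nat n + e n)"
    by (auto simp: b_def e_def fun_eq_iff kh[symmetric] algebra_simps)
  define K where "K = (D + norm c) * 2 + norm k * (2 / (1 - m))"
  have K0: "K \<ge> 0" using D(1) m by (simp add: K_def)
  have e_le: "norm (e n) \<le> (K * Cg) * \<rho> ^ n" for n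
  proof -
    have t: "norm (\<tau> n) \<le> (D + norm c) * (real n + 1)"
    proof (cases "n = 0")
      case True then show ?thesis using D(1) \<tau>0 by simp
    next
      case False
      have "real n powr (1 - \<delta>) \<le> real n powr 1" using False \<delta> by (intro powr_mono) auto
      then have "D * real n powr (1 - \<delta>) \<le> D * real n" using D(1) False by (intro mult_left_mono) auto
      then have "norm (\<tau> n - c * of_nat n) \<le> D * real n" using D(2)[of n] False by simp
      moreover have "norm (\<tau> n) \<le> norm (\<tau> n - c * of_nat n) + norm (c * of_nat n)"
        using norm_triangle_ineq[of "\<tau> n - c * of_nat n" "c * of_nat n"] by simp
      moreover have "norm (c * of_nat n) = norm c * real n" by (simp add: norm_mult)
      ultimately have "norm (\<tau> n) \<le> (D + norm c) * real n" by (simp add: distrib_right)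
      also have "\<dots> \<le> (D + norm c) * (real n + 1)" using D(1) by (intro mult_left_mono) auto
      finally show ?thesis .
    qed
    have "norm (of_real p ^ n + of_real q ^ n :: complex) \<le> norm (of_real p ^ n :: complex) + norm (of_real q ^ n :: complex)" by (rule norm_triangle_ineq)
    also have "\<dots> = p ^ n + q ^ n" using pq by (simp add: norm_power)
    also have "\<dots> \<le> m ^ n + m ^ n" using m pq by (intro add_mono power_mono) auto
    finally have w: "norm (of_real p ^ n + of_real q ^ n :: complex) \<le> 2 * m ^ n" by simp
    have "norm (- \<tau> n * (of_real p ^ n + of_real q ^ n)) \<le> ((D + norm c) * (real n + 1)) * (2 * m ^ n)"
      unfolding norm_mult norm_minus_cancel by (intro mult_mono t w) (use D(1) in auto)
    moreover have "norm (k * (of_real h * of_nat n - nharm_toll p q n)) \<le> norm k * (2 / (1 - m) * (real n * m ^ n))"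
      unfolding norm_mult h_def m_def by (intro mult_left_mono nharm_toll_tail pq) auto
    moreover have "norm k * (2 / (1 - m) * (real n * m ^ n)) \<le> norm k * (2 / (1 - m) * ((real n + 1) * m ^ n))"
      using m by (intro mult_left_mono mult_right_mono) auto
    ultimately have "norm (e n) \<le> ((D + norm c) * (real n + 1)) * (2 * m ^ n) + norm k * (2 / (1 - m) * ((real n + 1) * m ^ n))"
      unfolding e_def using norm_triangle_ineq[of "- \<tau> n * (of_real p ^ n + of_real q ^ n)" "k * (of_real h * of_nat n - nharm_toll p q n)"] by linarith
    also have "\<dots> = K * ((real n + 1) * m ^ n)" unfolding K_def distrib_right[of "(D + norm c) * 2"] by (simp only: mult_ac)
    also have "\<dots> \<le> K * (Cg * \<rho> ^ n)" by (rule mult_left_mono[OF Cg(2) K0])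
    finally show ?thesis by (simp add: mult.assoc)
  qed
  obtain \<kappa> R' C' where disc: "\<kappa> > 0"
    "\<And>x z. R' \<le> x \<Longrightarrow> norm (z - of_real x) \<le> \<kappa> * x \<Longrightarrow> norm (ptrans (\<lambda>n. \<tau> n - c * of_nat n + e n) z) \<le> C' * x powr (1 - \<delta>)"
  proof (rule sector_disc_bound[OF et \<delta>(1) \<delta>1 \<theta>, of R c C0 e "K * Cg" \<rho>])
    show "norm (ptrans \<tau> z - c * z) \<le> C0 * norm z powr (1 - \<delta>)" if "R \<le> norm z" "\<bar>Arg z\<bar> \<le> \<theta>" for z
      by (rule inner[OF that])
    show "norm (e n) \<le> K * Cg * \<rho> ^ n" for n by (rule e_le)
    show "0 < \<rho>" "\<rho> < 1" by (rule \<rho>)+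
  qed (rule that; blast)
  have bdiff: "norm (b (Suc n) - b n) \<le> (D + 2 * (K * Cg)) * real n powr (1 / 2 - \<delta>)" if n: "n > 0" for n
  proof -
    have KC: "K * Cg \<ge> 0" using K0 Cg by simp
    have le1: "norm (e i) \<le> K * Cg" for i
    proof -
      have "(K * Cg) * \<rho> ^ i \<le> (K * Cg) * 1" using \<rho> KC by (intro mult_left_mono power_le_one) auto
      then show ?thesis using e_le[of i] by simp
    qed
    have eq: "b (Suc n) - b n = ((\<tau> (Suc n) - c * of_nat (Suc n)) - (\<tau> n - c * of_nat n)) + (e (Suc n) - e n)"
      unfolding be by (simp add: algebra_simps)
    have "norm (b (Suc n) - b n) \<le> D * real n powr (1 / 2 - \<delta>) + (norm (e (Suc n)) + norm (e n))"
      unfolding eq using D(3)[OF n] by (intro order_trans[OF norm_triangle_ineq] add_mono norm_triangle_ineq4)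
    also have "norm (e (Suc n)) + norm (e n) \<le> 2 * (K * Cg) * 1" using le1[of n] le1[of "Suc n"] by simp
    also have "2 * (K * Cg) * 1 \<le> 2 * (K * Cg) * real n powr (1 / 2 - \<delta>)"
      using KC n \<delta> by (intro mult_left_mono ge_one_powr_ge_zero) auto
    finally show ?thesis by (simp add: distrib_right)
  qed
  define mu' where "mu' n = mu n - k * nharm n" for n
  have mu': "mu' n = binom_avg p q mu' n + binom_avg q p mu' n + b n" for n
  proof -
    have lin: "binom_avg x y mu' n = binom_avg x y mu n - k * binom_avg x y nharm n" for x y
      unfolding binom_avg_def mu'_def by (simp add: right_diff_distrib sum_subtractf sum_distrib_left mult_ac)
    have "nharm n = binom_avg p q nharm n + binom_avg q p nharm n + nharm_toll p q n"
      by (rule nharm_recurrence) (use pq in auto)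
    then have "k * nharm n = k * binom_avg p q nharm n + k * binom_avg q p nharm n + k * nharm_toll p q n"
      by (simp only: distrib_left)
    then show ?thesis unfolding lin b_def using mu[of n] unfolding mu'_def by (simp only: diff_conv_add_uminus minus_add_distrib) simp
  qed
  have mu'01: "mu' 0 = 0" "mu' (Suc 0) = 0" using mu01 by (simp_all add: mu'_def nharm_def harm_def)
  have b_bound: "norm (b (Suc n) - b n) \<le> (D + 2 * (K * Cg)) * real n powr (1 / 2 - \<delta>)" if "0 < n" for n
    by (rule bdiff[OF that])
  have B_bound: "norm (ptrans b z) \<le> C' * x powr (1 - \<delta>)" if "R' \<le> x" "norm (z - of_real x) \<le> \<kappa> * x" for x z
    unfolding be by (rule disc(2)[OF that])
  note core = mean_asymptotics[of p q \<delta> \<kappa> mu' b "D + 2 * (K * Cg)" R' C', OF pq \<delta> disc(1) mu' mu'01 b_bound B_bound]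
  define N where "N = mellin (ptrans b)"
  have Nint: "mellin_integrable (ptrans b) s" if "s \<in> vert_strip (- 2) (- 1 + \<delta>)" for s
    by (rule core(2)) (use that in \<open>auto simp: vert_strip_def\<close>)
  have Nh: "N holomorphic_on vert_strip (- 2) (- 1 + \<delta>)" unfolding N_def by (rule mellin_holomorphic[OF Nint])
  define F where "F s = N s + k * nharm_mellin p q s" for s
  have Na: "N analytic_on {s}" if "s \<in> vert_strip (- 2) (- 1 + \<delta>)" for s
    using Nh that open_vert_strip analytic_at by blast
  have Fa: "F analytic_on {s}" if "s \<in> vert_strip (- 2) (- 1 + \<delta>)" "s \<noteq> - 1 \<or> k = 0" for s
  proof (cases "k = 0")
    case True then show ?thesis using Na[OF that(1)] unfolding F_def[abs_def] by simp
  next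
    case False
    then show ?thesis unfolding F_def[abs_def]
      using that by (intro analytic_intros Na nharm_mellin_analytic(1) pq) (auto simp: vert_strip_def)
  qed
  have Fm: "F meromorphic_on vert_strip (- 2) (- 1 + \<delta>)"
    unfolding F_def[abs_def]
  proof (intro meromorphic_intros)
    show "N meromorphic_on vert_strip (- 2) (- 1 + \<delta>)"
      using Nh by (intro analytic_on_imp_meromorphic_on) (simp only: analytic_on_open open_vert_strip)
    have "nharm_mellin p q meromorphic_on {s}" if "s \<in> vert_strip (- 2) (- 1 + \<delta>)" for s
      using that by (intro nharm_mellin_analytic(2) pq) (auto simp: vert_strip_def)
    then show "nharm_mellin p q meromorphic_on vert_strip (- 2) (- 1 + \<delta>)"
      unfolding meromorphic_on_def by auto
  qed
  have gsplit: "g = (\<lambda>z. ptrans b z + k * ptrans (nharm_toll p q) z)"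
  proof
    fix z
    have e1: "entire_coeffs (\<lambda>n. \<tau> n * (1 - of_real p ^ n - of_real q ^ n))"
    proof -
      have "entire_coeffs (\<lambda>n. \<tau> n - \<tau> n * of_real p ^ n - \<tau> n * of_real q ^ n)"
        by (intro entire_coeffs_diff entire_coeffs_scale et)
      then show ?thesis by (simp add: right_diff_distrib)
    qed
    have e2: "entire_coeffs (nharm_toll p q)" by (rule ptrans_nharm_toll(2)[OF pq])
    show "g z = ptrans b z + k * ptrans (nharm_toll p q) z"
      unfolding g b_def by (simp add: ptrans_diff[OF e1 entire_coeffs_cmult[OF e2]] ptrans_cmult[OF e2])
  qed
  \<comment> \<open>At its pole a nicely meromorphic function has the value 0, whereas
    \<open>F (- 1)\<close> evaluates to \<open>N (- 1)\<close>. Passing to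
    \<open>remove_sings F\<close> gives the representative that the definition requires.\<close>
  have cont: "mellin_continuation_on g (- 2) (- 1 + \<delta>) (remove_sings F)"
  proof -
    have "mellin_integrable g s \<and> remove_sings F s = mellin g s" if s: "s \<in> vert_strip (- 2) (- 1)" for s
    proof -
      have s': "- 2 < Re s" "Re s < - 1" and sv: "s \<in> vert_strip (- 2) (- 1 + \<delta>)" and sne: "s \<noteq> - 1"
        using \<delta> s by (auto simp: vert_strip_def)
      note t = mellin_nharm_toll[OF pq s']
      note a = mellin_add[OF Nint[OF sv] mellin_cmult(1)[OF t(1), of k]]
      have "mellin_integrable g s" unfolding gsplit by (rule a(1))
      moreover have "mellin g s = F s" unfolding gsplit a(2) mellin_cmult(2)[OF t(1)] t(2) F_def N_def ..
      moreover have "remove_sings F s = F s" by (rule remove_sings_at_analytic[OF Fa]) (use sv sne in auto)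
      ultimately show ?thesis by simp
    qed
    then have "\<exists>a' b'. - 2 \<le> a' \<and> a' < b' \<and> b' \<le> - 1 + \<delta> \<and>
        (\<forall>s\<in>vert_strip a' b'. mellin_integrable g s \<and> remove_sings F s = mellin g s)"
      using \<delta> by (intro exI[of _ "- 2"] exI[of _ "- 1"]) simp
    then show ?thesis unfolding mellin_continuation_on_def
      using remove_sings_nicely_meromorphic[OF Fm] by blast
  qed
  have G: "mellin_continuation g s = F s" if "s \<in> vert_strip (- 2) (- 1 + \<delta>)" "s \<noteq> - 1 \<or> k = 0" for s
    using mellin_continuation_eqI[OF cont that(1)] remove_sings_at_analytic[OF Fa[OF that]] by simp
  show ?thesis
  proof (intro exI[of _ N] conjI allI impI)
    show "N holomorphic_on vert_strip (- 2) (- 1 + \<delta>)" by (rule Nh)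
    show "mellin_continuation g s = N s + c / of_real h * nharm_mellin p q s" if "s \<in> vert_strip (- 2) (- 1 + \<delta>)" "s \<noteq> - 1" for s
      using G[of s] that by (simp add: F_def k_def)
    show "mellin_continuation g (- 1) = N (- 1)" if "c = 0"
      using G[of "- 1"] that \<delta> by (simp add: F_def k_def vert_strip_def)
    have "mu' n / of_nat n = mu n / of_nat n - c / of_real h * harm (n - 1)" if "n > 0" for n
      using that by (simp add: mu'_def nharm_def k_def diff_divide_distrib)
    then have "\<forall>\<^sub>F n in sequentially. mu' n / of_nat n - (N (- 1) / of_real h + fluct p q N (real (log_ratio_num p q) * log (1 / p) (real n))) =
        mu n / of_nat n - (c / of_real h * harm (n - 1) + N (- 1) / of_real h + fluct p q N (real (log_ratio_num p q) * log (1 / p) (real n)))"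
      by (intro eventually_mono[OF eventually_gt_at_top[of 0]]) simp
    with core(1) show "(\<lambda>n. mu n / of_nat n - (c / of_real h * harm (n - 1) + N (- 1) / of_real h
        + fluct p q N (real (log_ratio_num p q) * log (1 / p) (real n)))) \<longlonglongrightarrow> 0"
      unfolding N_def h_def by (rule Lim_transform_eventually)
  qed
qed

section \<open>Growth conditions of the theorem\<close>

lemma powr_log_plus_le_powr:
  assumes "\<alpha> < \<gamma>"
  shows "\<forall>\<^sub>F x in at_top. x powr \<alpha> * log_plus x powr \<beta> \<le> x powr \<gamma>"
proof -
  define e where "e = \<gamma> - \<alpha>"
  have e: "e > 0" using assms by (simp add: e_def)
  have "((\<lambda>x. ln (1 + x) powr \<bar>\<beta>\<bar> / x powr e) \<longlongrightarrow> 0) at_top" using e by real_asymp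
  then have "\<forall>\<^sub>F x in at_top. ln (1 + x) powr \<bar>\<beta>\<bar> / x powr e < 1" by (rule order_tendstoD) simp
  moreover have "\<forall>\<^sub>F x in at_top. ln (1 + x) \<ge> (1::real)" by real_asymp
  ultimately show ?thesis using eventually_ge_at_top[of 1]
  proof eventually_elim
    case (elim x)
    have "log_plus x powr \<beta> \<le> ln (1 + x) powr \<bar>\<beta>\<bar>" unfolding log_plus_def using elim by (intro powr_mono) auto
    also have "\<dots> \<le> x powr e" using elim by (simp add: pos_divide_less_eq)
    finally have "x powr \<alpha> * log_plus x powr \<beta> \<le> x powr \<alpha> * x powr e" by (intro mult_left_mono) auto
    also have "\<dots> = x powr \<gamma>" by (simp add: e_def flip: powr_add)
    finally show ?case .
  qed
qed

lemma powr_log_plus_le_exp: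
  assumes "\<eta> > 0"
  shows "\<forall>\<^sub>F x in at_top. x powr \<alpha> * log_plus x powr \<beta> \<le> exp (\<eta> * x)"
proof -
  have "((\<lambda>x. x powr (\<bar>\<alpha>\<bar> + 1) / exp (\<eta> * x)) \<longlongrightarrow> 0) at_top" using assms by real_asymp
  then have "\<forall>\<^sub>F x in at_top. x powr (\<bar>\<alpha>\<bar> + 1) / exp (\<eta> * x) < 1" by (rule order_tendstoD) simp
  moreover have "\<forall>\<^sub>F x in at_top. x powr \<alpha> * log_plus x powr \<beta> \<le> x powr (\<bar>\<alpha>\<bar> + 1)"
    by (rule powr_log_plus_le_powr) linarith
  ultimately show ?thesis by eventually_elim (simp add: pos_divide_less_eq)
qed

text \<open>The class supplies some angle \<theta>', but the argument uses a prescribed \<theta>.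
  For \<theta> <= |Arg z| <= \<theta>' the exponential gains exp(- \<eta> |z|) over exp |z|, and
  half of this absorbs the polynomial and logarithmic growth.\<close>

lemma JS_outer:
  assumes "f \<in> JS_class" and \<theta>: "0 < \<theta>"
  shows "\<exists>R C \<epsilon>. \<epsilon> > 0 \<and> (\<forall>z. R \<le> norm z \<longrightarrow> \<theta> \<le> \<bar>Arg z\<bar> \<longrightarrow> norm (exp z * f z) \<le> C * exp ((1 - \<epsilon>) * norm z))"
proof -
  obtain \<alpha> \<beta> where "f \<in> JS \<alpha> \<beta>" using assms(1) unfolding JS_class_def by blast
  then obtain \<theta>' C0 \<epsilon> C1 where js: "0 < \<theta>'"
    "\<And>z. 1 \<le> norm z \<Longrightarrow> \<bar>Arg z\<bar> \<le> \<theta>' \<Longrightarrow> norm (f z) \<le> C0 * (norm z powr \<alpha> * log_plus (norm z) powr \<beta>)"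
    "\<epsilon> > 0" "\<And>z. 1 \<le> norm z \<Longrightarrow> \<theta>' \<le> \<bar>Arg z\<bar> \<Longrightarrow> \<bar>Arg z\<bar> \<le> pi \<Longrightarrow> norm (exp z * f z) \<le> C1 * exp ((1 - \<epsilon>) * norm z)"
    unfolding JS_def by blast
  define \<eta> where "\<eta> = \<theta>\<^sup>2 / (2 * pi\<^sup>2)"
  have \<eta>: "\<eta> > 0" using \<theta> by (simp add: \<eta>_def)
  obtain R1 where R1: "\<And>x. x \<ge> R1 \<Longrightarrow> x powr \<alpha> * log_plus x powr \<beta> \<le> exp (\<eta> / 2 * x)"
    using powr_log_plus_le_exp[of "\<eta> / 2" \<alpha> \<beta>] \<eta> unfolding eventually_at_top_linorder by auto
  define \<epsilon>' where "\<epsilon>' = min \<epsilon> (\<eta> / 2)"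
  have \<epsilon>': "\<epsilon>' > 0" using js \<eta> by (simp add: \<epsilon>'_def)
  have "norm (exp z * f z) \<le> (\<bar>C0\<bar> + \<bar>C1\<bar>) * exp ((1 - \<epsilon>') * norm z)"
    if z: "max R1 1 \<le> norm z" "\<theta> \<le> \<bar>Arg z\<bar>" for z
  proof (cases "\<bar>Arg z\<bar> \<le> \<theta>'")
    case True
    have "norm (f z) \<le> C0 * (norm z powr \<alpha> * log_plus (norm z) powr \<beta>)" using js(2)[of z] z True by simp
    also have "\<dots> \<le> \<bar>C0\<bar> * exp (\<eta> / 2 * norm z)" using R1[of "norm z"] z by (intro mult_mono) auto
    finally have "norm (exp z) * norm (f z) \<le> exp (norm z * (1 - \<eta>)) * (\<bar>C0\<bar> * exp (\<eta> / 2 * norm z))"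
      using Re_le_norm_outside[OF z(2)] \<theta> by (intro mult_mono) (auto simp: \<eta>_def)
    also have "\<dots> = \<bar>C0\<bar> * exp ((1 - \<eta> / 2) * norm z)" by (simp add: algebra_simps flip: exp_add)
    also have "\<dots> \<le> (\<bar>C0\<bar> + \<bar>C1\<bar>) * exp ((1 - \<epsilon>') * norm z)"
      by (intro mult_mono) (auto simp: \<epsilon>'_def intro!: mult_right_mono)
    finally show ?thesis by (simp add: norm_mult)
  next
    case False
    have "\<bar>Arg z\<bar> \<le> pi" using Arg_bounded[of z] by (simp add: abs_le_iff)
    then have "norm (exp z * f z) \<le> C1 * exp ((1 - \<epsilon>) * norm z)" using js(4)[of z] z False by simp
    also have "\<dots> \<le> (\<bar>C0\<bar> + \<bar>C1\<bar>) * exp ((1 - \<epsilon>') * norm z)"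
      by (intro mult_mono) (auto simp: \<epsilon>'_def intro!: mult_right_mono)
    finally show ?thesis .
  qed
  then show ?thesis using \<epsilon>' by blast
qed

theorem theorem7p1:
  fixes M :: "'w measure" and p q h \<theta> \<alpha> \<beta> :: real and c :: complex
    and X Xs T :: "nat \<Rightarrow> 'w \<Rightarrow> real" and I :: "nat \<Rightarrow> 'w \<Rightarrow> nat"
    and g1 G1 :: "complex \<Rightarrow> complex"
  assumes "0 < p" "p < 1" and "q = 1 - p" and "h = binary_entropy p q"
    and "patricia_recurrence M p q X Xs I T"
    and "\<And>n. n \<ge> 2 \<Longrightarrow> integrable M (T n)"
    and "\<And>z::complex. summable (\<lambda>n. of_real (integral\<^sup>L M (T n)) * z ^ n / fact n)"
    and "g1 = poisson_gf (\<lambda>n. integral\<^sup>L M (T n))"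
    and "G1 = mellin_continuation (\<lambda>z. g1 z - exp (- of_real q * z) * g1 (of_real p * z)
                                          - exp (- of_real p * z) * g1 (of_real q * z))"
    and "0 < \<theta>" "\<theta> < pi / 2" and "\<alpha> < 1"
  shows "(g1 \<in> JS \<alpha> \<beta> \<longrightarrow>
            (\<lambda>n. of_real (integral\<^sup>L M (X n)) / of_nat n
                 - (G1 (-1) / of_real h
                    + fluct p q G1 (real (log_ratio_num p q) * log (1 / p) (real n))))
            \<longlonglongrightarrow> 0)
       \<and> (g1 \<in> JS_class
          \<and> (\<exists>C R. \<forall>z. R \<le> norm z \<and> \<bar>Arg z\<bar> \<le> \<theta> \<longrightarrow>
                norm (g1 z - c * z) \<le> C * (norm z powr \<alpha> * log_plus (norm z) powr \<beta>)) \<longrightarrow>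
            (let d = Lim (at (-1)) (\<lambda>s. G1 s + c / (s + 1)) in
              (\<lambda>n. of_real (integral\<^sup>L M (X n)) / of_nat n
                   - (c / of_real h * of_real (ln (real n)) + d / of_real h
                      + c * of_real (p * (ln p)\<^sup>2 + q * (ln q)\<^sup>2) / (2 * (of_real h)\<^sup>2)
                      + fluct p q G1 (real (log_ratio_num p q) * log (1 / p) (real n))))
              \<longlonglongrightarrow> 0))"
proof -
  note p = assms(1) and p1 = assms(2) and q_def = assms(3) and h_def = assms(4) and Ti = assms(6)
    and summ = assms(7) and g1_def = assms(8) and G1_def = assms(9) and \<theta> = assms(10,11) and \<alpha> = assms(12)
  interpret patricia_recurrence M p q X Xs I T by (rule assms(5))
  have pq: "0 < p" "0 < q" "p + q = 1" using p p1 q_def by auto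
  have h: "h > 0"
  proof -
    have "- p * ln p > 0" "- q * ln q > 0" using pq p1 by (auto simp: mult_pos_neg)
    then show ?thesis by (simp add: h_def binary_entropy_def)
  qed
  define \<tau> where "\<tau> n = (if n < 2 then 0 else complex_of_real (expectation (T n)))" for n
  define mu where "mu n = complex_of_real (expectation (X n))" for n
  have et: "entire_coeffs \<tau>"
  proof (rule entire_coeffs_bound)
    show "entire_coeffs (\<lambda>n. complex_of_real (expectation (T n)))" unfolding entire_coeffs_def using summ by blast
  qed (auto simp: \<tau>_def)
  have mu: "mu 0 = 0" "mu (Suc 0) = 0"
    "mu n = binom_avg p q mu n + binom_avg q p mu n + \<tau> n * (1 - of_real p ^ n - of_real q ^ n)" for n
    unfolding mu_def \<tau>_def
    by (rule mean_recurrence(1)[OF pq Ti], assumption, rule mean_recurrence(2)[OF pq Ti], assumption,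
        rule mean_recurrence(3)[OF pq Ti], assumption)
  have g1: "g1 = ptrans \<tau>"
  proof
    fix z
    have "(\<Sum>n. \<tau> n * z ^ n / fact n) = (\<Sum>n. \<tau> (n + 2) * z ^ (n + 2) / fact (n + 2)) + (\<Sum>n<2. \<tau> n * z ^ n / fact n)"
      by (rule suminf_split_initial_segment[OF entire_coeffs_summable[OF et]])
    then show "g1 z = ptrans \<tau> z" unfolding g1_def poisson_gf_def ptrans_def by (simp add: \<tau>_def numeral_2_eq_2)
  qed
  define g where "g z = g1 z - exp (- of_real q * z) * g1 (of_real p * z) - exp (- of_real p * z) * g1 (of_real q * z)" for z
  have G1: "G1 = mellin_continuation g" unfolding G1_def g_def[abs_def] ..
  have g: "g z = ptrans (\<lambda>n. \<tau> n * (1 - of_real p ^ n - of_real q ^ n)) z" for z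
  proof -
    have pqc: "complex_of_real p + of_real q = 1" "complex_of_real q + of_real p = 1"
      using pq(3) by (simp_all only: of_real_add[symmetric] add.commute of_real_1)
    have "g z = ptrans \<tau> z - ptrans (\<lambda>n. \<tau> n * of_real p ^ n) z - ptrans (\<lambda>n. \<tau> n * of_real q ^ n) z"
      unfolding g_def g1 ptrans_scale[OF pqc(1)] ptrans_scale[OF pqc(2)] ..
    also have "\<dots> = ptrans (\<lambda>n. \<tau> n - \<tau> n * of_real p ^ n - \<tau> n * of_real q ^ n) z"
      by (simp add: ptrans_diff entire_coeffs_diff entire_coeffs_scale et)
    finally show ?thesis by (simp add: right_diff_distrib)
  qed
  \<comment> \<open>Half of the gap 1 - \<alpha> is left to absorb the logarithmic factor; the cap 1
    / 4 ensures \<delta> < 1 / 2.\<close>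
  define \<delta> where "\<delta> = min ((1 - \<alpha>) / 2) (1 / 4)"
  have \<delta>: "0 < \<delta>" "\<delta> < 1 / 2" "\<alpha> < 1 - \<delta>" using \<alpha> by (auto simp: \<delta>_def min_def field_simps)
  obtain R1 where R1: "\<And>x. x \<ge> R1 \<Longrightarrow> x powr \<alpha> * log_plus x powr \<beta> \<le> x powr (1 - \<delta>)"
    using powr_log_plus_le_powr[OF \<delta>(3), of \<beta>] unfolding eventually_at_top_linorder by auto
  have \<tau>0: "\<tau> 0 = 0" by (simp add: \<tau>_def)
  \<comment> \<open>Stated for an arbitrary slope c and angle t: part (a) uses c = 0 with the angle
    provided by \<open>JS\<close>, part (b) the given c and \<theta>.\<close>
  have core: "\<exists>N. N holomorphic_on vert_strip (- 2) (- 1 + \<delta>) \<and>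
      (\<forall>s. s \<in> vert_strip (- 2) (- 1 + \<delta>) \<longrightarrow> s \<noteq> - 1 \<longrightarrow> G1 s = N s + c / of_real h * nharm_mellin p q s) \<and>
      (c = 0 \<longrightarrow> G1 (- 1) = N (- 1)) \<and>
      (\<lambda>n. mu n / of_nat n - (c / of_real h * harm (n - 1) + N (- 1) / of_real h
        + fluct p q G1 (real (log_ratio_num p q) * log (1 / p) (real n)))) \<longlonglongrightarrow> 0"
    if js: "g1 \<in> JS_class" and t: "0 < t" "t < pi / 2"
      and inner: "\<forall>z. R \<le> norm z \<and> \<bar>Arg z\<bar> \<le> t \<longrightarrow> norm (g1 z - c * z) \<le> C * (norm z powr \<alpha> * log_plus (norm z) powr \<beta>)"
    for c t C R
  proof -
    obtain R2 C2 \<epsilon> where out: "\<epsilon> > 0"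
      "\<forall>z. R2 \<le> norm z \<longrightarrow> t \<le> \<bar>Arg z\<bar> \<longrightarrow> norm (exp z * g1 z) \<le> C2 * exp ((1 - \<epsilon>) * norm z)"
      using JS_outer[OF js t(1)] by blast
    define R3 where "R3 = max R (max R1 R2)"
    have "\<exists>N. N holomorphic_on vert_strip (- 2) (- 1 + \<delta>) \<and>
      (\<forall>s. s \<in> vert_strip (- 2) (- 1 + \<delta>) \<longrightarrow> s \<noteq> - 1 \<longrightarrow>
        mellin_continuation g s = N s + c / of_real (binary_entropy p q) * nharm_mellin p q s) \<and>
      (c = 0 \<longrightarrow> mellin_continuation g (- 1) = N (- 1)) \<and>
      (\<lambda>n. mu n / of_nat n - (c / of_real (binary_entropy p q) * harm (n - 1) + N (- 1) / of_real (binary_entropy p q)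
        + fluct p q N (real (log_ratio_num p q) * log (1 / p) (real n)))) \<longlonglongrightarrow> 0"
    proof (rule recurrence_asymptotics[OF pq \<delta>(1,2) t out(1) et \<tau>0 mu(1,2) mu(3), of R3 c "\<bar>C\<bar>" C2 g])
      show "norm (ptrans \<tau> z - c * z) \<le> \<bar>C\<bar> * norm z powr (1 - \<delta>)" if z: "R3 \<le> norm z" and "\<bar>Arg z\<bar> \<le> t" for z
      proof -
        have "norm (g1 z - c * z) \<le> C * (norm z powr \<alpha> * log_plus (norm z) powr \<beta>)"
          using inner that by (simp add: R3_def)
        also have "\<dots> \<le> \<bar>C\<bar> * norm z powr (1 - \<delta>)"
          using R1[of "norm z"] z by (intro mult_mono) (auto simp: R3_def)
        finally show ?thesis by (simp add: g1)
      qed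
      show "norm (exp z * ptrans \<tau> z) \<le> C2 * exp ((1 - \<epsilon>) * norm z)" if "R3 \<le> norm z" "t \<le> \<bar>Arg z\<bar>" for z
        using out(2) that by (simp add: R3_def g1)
      show "g z = ptrans (\<lambda>n. \<tau> n * (1 - of_real p ^ n - of_real q ^ n)) z" for z by (rule g)
    qed
    then obtain N where N: "N holomorphic_on vert_strip (- 2) (- 1 + \<delta>)"
      "\<And>s. s \<in> vert_strip (- 2) (- 1 + \<delta>) \<Longrightarrow> s \<noteq> - 1 \<Longrightarrow> G1 s = N s + c / of_real h * nharm_mellin p q s"
      "c = 0 \<Longrightarrow> G1 (- 1) = N (- 1)"
      "(\<lambda>n. mu n / of_nat n - (c / of_real h * harm (n - 1) + N (- 1) / of_real h
        + fluct p q N (real (log_ratio_num p q) * log (1 / p) (real n)))) \<longlonglongrightarrow> 0"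
      unfolding G1[symmetric] h_def[symmetric] by blast
    \<comment> \<open>\<open>nharm_mellin\<close> vanishes at all points -1 + \<chi> with k not 0,
      so \<open>G1\<close> and N give the same fluctuation.\<close>
    have "fluct p q G1 x = fluct p q N x" for x
    proof (rule fluct_cong)
      fix r l and k :: int assume lr: "log_ratio p q r l" and k: "k \<noteq> 0"
      note ch = chi_nonzero[OF lr p p1 k]
      have "- 1 + chi p q k \<in> vert_strip (- 2) (- 1 + \<delta>)" using ch \<delta> by (simp add: vert_strip_def)
      moreover have "- 1 + chi p q k \<noteq> - 1" using ch by simp
      ultimately show "G1 (- 1 + chi p q k) = N (- 1 + chi p q k)"
        using N(2)[of "- 1 + chi p q k"] nharm_mellin_chi[OF lr pq, of k] by simp
    qed
    then show ?thesis using N by (intro exI[of _ N]) simp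
  qed
  show ?thesis
  proof (intro conjI impI)
    assume js: "g1 \<in> JS \<alpha> \<beta>"
    then obtain t C where t: "0 < t" "t < pi / 2"
      "\<And>z. 1 \<le> norm z \<Longrightarrow> \<bar>Arg z\<bar> \<le> t \<Longrightarrow> norm (g1 z) \<le> C * (norm z powr \<alpha> * log_plus (norm z) powr \<beta>)"
      unfolding JS_def by blast
    have jc: "g1 \<in> JS_class" using js unfolding JS_class_def by blast
    have "\<forall>z. 1 \<le> norm z \<and> \<bar>Arg z\<bar> \<le> t \<longrightarrow> norm (g1 z - 0 * z) \<le> C * (norm z powr \<alpha> * log_plus (norm z) powr \<beta>)"
      using t(3) by simp
    from core[OF jc t(1,2) this] obtain N where N: "(0::complex) = 0 \<longrightarrow> G1 (- 1) = N (- 1)"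
      "(\<lambda>n. mu n / of_nat n - (0 / of_real h * harm (n - 1) + N (- 1) / of_real h
        + fluct p q G1 (real (log_ratio_num p q) * log (1 / p) (real n)))) \<longlonglongrightarrow> 0" by (elim exE conjE) (rule that)
    have "G1 (- 1) = N (- 1)" using N(1) by blast
    then show "(\<lambda>n. of_real (integral\<^sup>L M (X n)) / of_nat n
                 - (G1 (-1) / of_real h
                    + fluct p q G1 (real (log_ratio_num p q) * log (1 / p) (real n))))
            \<longlonglongrightarrow> 0" using N(2) by (simp add: mu_def)
  next
    assume as: "g1 \<in> JS_class
          \<and> (\<exists>C R. \<forall>z. R \<le> norm z \<and> \<bar>Arg z\<bar> \<le> \<theta> \<longrightarrow>
                norm (g1 z - c * z) \<le> C * (norm z powr \<alpha> * log_plus (norm z) powr \<beta>))"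
    then obtain C R where CR: "\<forall>z. R \<le> norm z \<and> \<bar>Arg z\<bar> \<le> \<theta> \<longrightarrow>
                norm (g1 z - c * z) \<le> C * (norm z powr \<alpha> * log_plus (norm z) powr \<beta>)" by blast
    define fl where "fl n = fluct p q G1 (real (log_ratio_num p q) * log (1 / p) (real n))" for n :: nat
    have jc: "g1 \<in> JS_class" using as by blast
    from core[OF jc \<theta> CR] obtain N where N: "N holomorphic_on vert_strip (- 2) (- 1 + \<delta>)"
      "\<forall>s. s \<in> vert_strip (- 2) (- 1 + \<delta>) \<longrightarrow> s \<noteq> - 1 \<longrightarrow> G1 s = N s + c / of_real h * nharm_mellin p q s"
      "(\<lambda>n. mu n / of_nat n - (c / of_real h * harm (n - 1) + N (- 1) / of_real h + fl n)) \<longlonglongrightarrow> 0"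
      unfolding fl_def by blast
    define H where "H = complex_of_real h"
    have H: "H \<noteq> 0" using h by (simp add: H_def)
    define h2 where "h2 = complex_of_real (p * (ln p)\<^sup>2 + q * (ln q)\<^sup>2)"
    define d where "d = Lim (at (-1)) (\<lambda>s. G1 s + c / (s + 1))"
    have m1: "- 1 \<in> vert_strip (- 2) (- 1 + \<delta>)" using \<delta> by (simp add: vert_strip_def)
    \<comment> \<open>Adding c / (s + 1) cancels the pole of (c / h) \<open>nharm_mellin\<close>.
      The Euler constant left in d is the one produced by harm (n - 1), and the h2 term is
      compensated by the quadratic term of the claim.\<close>
    have d: "d = N (- 1) + c * (euler_mascheroni - h2 / (2 * H))"
      unfolding d_def
    proof (rule tendsto_Lim)
      have "isCont N (- 1)"
        using holomorphic_on_imp_continuous_on[OF N(1)] open_vert_strip m1 by (simp add: continuous_on_eq_continuous_at)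
      then have "((\<lambda>s. N s + c * (nharm_mellin p q s / H + 1 / (s + 1))) \<longlongrightarrow> N (- 1) + c * (euler_mascheroni - h2 / (2 * H))) (at (- 1))"
        unfolding H_def h2_def h_def
        by (intro tendsto_add tendsto_mult_left nharm_mellin_expansion pq) (use h in \<open>auto simp: isCont_def h_def\<close>)
      moreover have "\<forall>\<^sub>F s in at (- 1). N s + c * (nharm_mellin p q s / H + 1 / (s + 1)) = G1 s + c / (s + 1)"
        using eventually_at_in_open[OF open_vert_strip m1]
      proof eventually_elim
        case (elim s)
        then have "G1 s = N s + c / of_real h * nharm_mellin p q s" using N(2) by blast
        then show ?case by (simp add: H_def distrib_left)
      qed
      ultimately show "((\<lambda>s. G1 s + c / (s + 1)) \<longlongrightarrow> N (- 1) + c * (euler_mascheroni - h2 / (2 * H))) (at (- 1))"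
        by (rule Lim_transform_eventually)
    qed simp
    \<comment> \<open>The shift from harm n to harm (n - 1) costs 1 / n, which does not affect the
      limit.\<close>
    have harm: "(\<lambda>n. harm (n - 1) - complex_of_real (ln (real n))) \<longlonglongrightarrow> euler_mascheroni"
    proof -
      have "(\<lambda>n. complex_of_real (harm n - ln (real n)) - of_real (1 / real n)) \<longlonglongrightarrow> of_real euler_mascheroni - of_real 0"
        by (intro tendsto_diff tendsto_of_real euler_mascheroni_LIMSEQ lim_1_over_n)
      moreover have "\<forall>\<^sub>F n in sequentially. complex_of_real (harm n - ln (real n)) - of_real (1 / real n) = harm (n - 1) - complex_of_real (ln (real n))"
        using eventually_gt_at_top[of 0]
      proof eventually_elim
        case (elim n)
        then obtain k where n: "n = Suc k" by (cases n) auto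
        have "complex_of_real (harm n) = harm k + of_real (1 / real n)"
          unfolding n by (simp add: of_real_harm harm_Suc divide_inverse)
        then show ?case by (simp add: n)
      qed
      ultimately show ?thesis by (simp add: of_real_euler_mascheroni Lim_transform_eventually)
    qed
    have "(\<lambda>n. (mu n / of_nat n - (c / of_real h * harm (n - 1) + N (- 1) / of_real h + fl n))
        + c / H * ((harm (n - 1) - complex_of_real (ln (real n))) - euler_mascheroni)) \<longlonglongrightarrow> 0 + c / H * (euler_mascheroni - euler_mascheroni)"
      by (intro tendsto_add N(3) tendsto_mult_left tendsto_diff harm tendsto_const)
    then have lim: "(\<lambda>n. (mu n / of_nat n - (c / of_real h * harm (n - 1) + N (- 1) / of_real h + fl n))
        + c / H * ((harm (n - 1) - complex_of_real (ln (real n))) - euler_mascheroni)) \<longlonglongrightarrow> 0"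
      by (simp only: diff_self mult_zero_right add_0)
    have eq: "(mu n / of_nat n - (c / of_real h * harm (n - 1) + N (- 1) / of_real h + fl n))
        + c / H * ((harm (n - 1) - complex_of_real (ln (real n))) - euler_mascheroni)
        = mu n / of_nat n - (c / H * of_real (ln (real n)) + d / H + c * h2 / (2 * H\<^sup>2) + fl n)" for n
    proof -
      have "d / H + c * h2 / (2 * H\<^sup>2) = N (- 1) / H + c / H * euler_mascheroni"
        unfolding d using H by (simp add: field_simps power2_eq_square)
      then have "c / H * of_real (ln (real n)) + d / H + c * h2 / (2 * H\<^sup>2) + fl n =
          c / H * of_real (ln (real n)) + (N (- 1) / H + c / H * euler_mascheroni) + fl n" by (simp only: add.assoc)
      moreover have "(m - (k * x + y + f)) + k * ((x - l) - e) = m - (k * l + (y + k * e) + f)" for m k x y f l e :: complex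
        by (simp add: algebra_simps)
      ultimately show ?thesis unfolding H_def[symmetric] by (simp only:)
    qed
    have "(\<lambda>n. mu n / of_nat n - (c / H * of_real (ln (real n)) + d / H + c * h2 / (2 * H\<^sup>2) + fl n)) \<longlonglongrightarrow> 0"
      using lim unfolding eq .
    then show "let d = Lim (at (-1)) (\<lambda>s. G1 s + c / (s + 1)) in
              (\<lambda>n. of_real (integral\<^sup>L M (X n)) / of_nat n
                   - (c / of_real h * of_real (ln (real n)) + d / of_real h
                      + c * of_real (p * (ln p)\<^sup>2 + q * (ln q)\<^sup>2) / (2 * (of_real h)\<^sup>2)
                      + fluct p q G1 (real (log_ratio_num p q) * log (1 / p) (real n))))
              \<longlonglongrightarrow> 0"
      unfolding Let_def d_def[symmetric] mu_def H_def h2_def fl_def .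
  qed
qed

end
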